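(* Let $X$ be a complete metric space and let $T\in\mathbf I_1(X)$. Then there is a sequence $T_1,T_2,\dots$ in $\mathbf I_1(X)$ such that $$T=\sum_{i=1}^\infty T_i,\qquad \mathbf M(T)=\sum_{i=1}^\infty\mathbf M(T_i),\qquad \mathbf M(\partial T)=\sum_{i=1}^\infty\mathbf M(\partial T_i),$$ and for every $i=1,2,\dots$ there is a Lipschitz function $\sigma_i:[0,L_i]\to X$ with $\mathrm{Lip}(\sigma_i)\le1$ such that $$(\sigma_i)_\#\llbracket\chi_{[0,L_i]}\rrbracket=T_i.$$
   Context: Metric currents (Ambrosio--Kirchheim). Let $Z$ be a complete metric space. $\mathcal D^k(Z)$ is the set of tuples $(f,\pi_1,\dots,\pi_k)$ with $f:Z\to\mathbb R$ bounded Lipschitz and $\pi_i:Z\to\mathbb R$ Lipschitz. A $k$-current is a map $T:\mathcal D^k(Z)\to\mathbb R$ that is multilinear, satisfies $T(f,\pi^i_1,\dots,\pi^i_k)\to T(f,\pi_1,\dots,\pi_k)$ whenever $\pi^i_j\to\pi_j$ pointwise with uniformly bounded Lipschitz constants, and vanishes on $(f,\pi_1,\dots,\pi_k)$ if some $\pi_i$ is constant on a neighborhood of $\{f\ne0\}$. It has finite mass if there is a finite Borel measure $\mu$ with $|T(f,\pi)|\le\prod_i\mathrm{Lip}(\pi_i)\int|f|\,d\mu$; the minimal such $\mu$ is $\|T\|$, and $\mathbf M(T)=\|T\|(Z)$. Such $T$ extends to bounded Borel $f$, and $(T\llcorner A)(f,\pi)=T(f\chi_A,\pi)$. $\partial T(f,\pi_1,\dots,\pi_{k-1})=T(1,f,\pi_1,\dots,\pi_{k-1})$;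 $\phi_\#T(f,\pi)=T(f\circ\phi,\pi\circ\phi)$. For $g\in L^1(\mathbb R^k)$, $\llbracket g\rrbracket(f,\pi)=\int g f\det(\nabla\pi)\,dx$ (in particular $\llbracket\chi_{[0,L]}\rrbracket(f,\pi)=\int_0^Lf\pi'\,dt$). $T$ is integer rectifiable if $\|T\|$ is concentrated on a countably $\mathcal H^k$-rectifiable set, vanishes on $\mathcal H^k$-negligible Borel sets, and for every Lipschitz $\phi:Z\to\mathbb R^k$ and open $O$, $\phi_\#(T\llcorner O)=\llbracket g\rrbracket$ with $g\in L^1(\mathbb R^k,\mathbb Z)$; it is integral ($T\in\mathbf I_k(Z)$) if also $\partial T$ has finite mass. *)

theory Defs
  imports "HOL-Analysis.Analysis"
begin

section \<open>Metric functionals and currents\<close>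

text \<open>
  A \<open>k\<close>-tuple of functions is a list of length \<open>k\<close>. Functionals are total functions, whose values
  outside \<open>forms k\<close> carry no meaning; accordingly two \<open>k\<close>-dimensional functionals are the same
  current if they agree on \<open>forms k\<close> (\<open>same_current\<close> below).
\<close>

type_synonym 'a functional = "('a \<Rightarrow> real) \<Rightarrow> ('a \<Rightarrow> real) list \<Rightarrow> real"

definition lipschitz :: "('a::metric_space \<Rightarrow> 'b::metric_space) \<Rightarrow> bool" where
  "lipschitz p \<longleftrightarrow> (\<exists>C. C-lipschitz_on UNIV p)"

definition Lip :: "('a::metric_space \<Rightarrow> 'b::metric_space) \<Rightarrow> real" where
  "Lip p = Inf {C. C-lipschitz_on UNIV p}"

definition bounded_lipschitz :: "('a::metric_space \<Rightarrow> real) \<Rightarrow> bool" where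
  "bounded_lipschitz f \<longleftrightarrow> lipschitz f \<and> bounded (range f)"

definition forms :: "nat \<Rightarrow> (('a::metric_space \<Rightarrow> real) \<times> ('a \<Rightarrow> real) list) set" where
  "forms k = {(f, \<pi>). bounded_lipschitz f \<and> length \<pi> = k \<and> (\<forall>p\<in>set \<pi>. lipschitz p)}"

definition same_current :: "nat \<Rightarrow> 'a::metric_space functional \<Rightarrow> 'a functional \<Rightarrow> bool" where
  "same_current k S T \<longleftrightarrow> (\<forall>(f, \<pi>)\<in>forms k. S f \<pi> = T f \<pi>)"

definition multilinear_functional :: "nat \<Rightarrow> 'a::metric_space functional \<Rightarrow> bool" where
  "multilinear_functional k T \<longleftrightarrow>
     (\<forall>f g \<pi> a b. (f, \<pi>) \<in> forms k \<longrightarrow> (g, \<pi>) \<in> forms k \<longrightarrow>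
        T (\<lambda>x. a * f x + b * g x) \<pi> = a * T f \<pi> + b * T g \<pi>) \<and>
     (\<forall>f \<pi> j p q a b. (f, \<pi>) \<in> forms k \<longrightarrow> j < k \<longrightarrow> lipschitz p \<longrightarrow> lipschitz q \<longrightarrow>
        T f (\<pi>[j := (\<lambda>x. a * p x + b * q x)]) = a * T f (\<pi>[j := p]) + b * T f (\<pi>[j := q]))"

definition continuous_functional :: "nat \<Rightarrow> 'a::metric_space functional \<Rightarrow> bool" where
  "continuous_functional k T \<longleftrightarrow>
     (\<forall>f \<pi> (\<rho> :: nat \<Rightarrow> ('a \<Rightarrow> real) list) C.
        (f, \<pi>) \<in> forms k \<longrightarrow>
        (\<forall>n. length (\<rho> n) = k) \<longrightarrow>
        (\<forall>n. \<forall>j<k. C-lipschitz_on UNIV (\<rho> n ! j)) \<longrightarrow>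
        (\<forall>j<k. \<forall>x. (\<lambda>n. (\<rho> n ! j) x) \<longlonglongrightarrow> (\<pi> ! j) x) \<longrightarrow>
        (\<lambda>n. T f (\<rho> n)) \<longlonglongrightarrow> T f \<pi>)"

definition local_functional :: "nat \<Rightarrow> 'a::metric_space functional \<Rightarrow> bool" where
  "local_functional k T \<longleftrightarrow>
     (\<forall>f \<pi>. (f, \<pi>) \<in> forms k \<longrightarrow>
        (\<exists>j<k. \<exists>U c. open U \<and> {x. f x \<noteq> 0} \<subseteq> U \<and> (\<forall>x\<in>U. (\<pi> ! j) x = c)) \<longrightarrow>
        T f \<pi> = 0)"

definition current :: "nat \<Rightarrow> 'a::metric_space functional \<Rightarrow> bool" where
  "current k T \<longleftrightarrow>
     multilinear_functional k T \<and> continuous_functional k T \<and> local_functional k T"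


section \<open>Mass\<close>

definition mass_bound :: "nat \<Rightarrow> 'a::metric_space functional \<Rightarrow> 'a measure \<Rightarrow> bool" where
  "mass_bound k T \<mu> \<longleftrightarrow>
     sets \<mu> = sets borel \<and> finite_measure \<mu> \<and>
     (\<forall>(f, \<pi>)\<in>forms k. \<bar>T f \<pi>\<bar> \<le> (\<Prod>j<k. Lip (\<pi> ! j)) * (LINT x|\<mu>. \<bar>f x\<bar>))"

definition finite_mass :: "nat \<Rightarrow> 'a::metric_space functional \<Rightarrow> bool" where
  "finite_mass k T \<longleftrightarrow> (\<exists>\<mu>. mass_bound k T \<mu>)"

text \<open>
  The least measure satisfying \<open>mass_bound\<close>. This and the total mass are only meaningful for
  currents of finite mass.
\<close>

definition mass_measure :: "nat \<Rightarrow> 'a::metric_space functional \<Rightarrow> 'a measure" where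
  "mass_measure k T =
     (THE \<mu>. mass_bound k T \<mu> \<and>
        (\<forall>\<nu>. mass_bound k T \<nu> \<longrightarrow> (\<forall>A\<in>sets borel. emeasure \<mu> A \<le> emeasure \<nu> A)))"

definition mass :: "nat \<Rightarrow> 'a::metric_space functional \<Rightarrow> real" where
  "mass k T = measure (mass_measure k T) UNIV"


section \<open>Restriction, boundary, push-forward\<close>

text \<open>
  The extension of a current \<open>T\<close> of finite mass to bounded Borel \<open>f\<close>: bounded Lipschitz functions
  are dense in the \<open>L\<^sup>1\<close> space of the mass measure, and \<open>T g \<pi>\<close> depends on \<open>g\<close> continuously for the
  \<open>L\<^sup>1\<close> distance.
\<close>

definition extend :: "nat \<Rightarrow> 'a::metric_space functional \<Rightarrow> 'a functional" where
  "extend k T f \<pi> =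
     (THE v. \<forall>g :: nat \<Rightarrow> 'a \<Rightarrow> real.
        (\<forall>n. bounded_lipschitz (g n)) \<longrightarrow>
        (\<lambda>n. LINT x|mass_measure k T. \<bar>g n x - f x\<bar>) \<longlonglongrightarrow> 0 \<longrightarrow>
        (\<lambda>n. T (g n) \<pi>) \<longlonglongrightarrow> v)"

definition restrict_current :: "nat \<Rightarrow> 'a::metric_space functional \<Rightarrow> 'a set \<Rightarrow> 'a functional" where
  "restrict_current k T A f \<pi> = extend k T (\<lambda>x. f x * indicator A x) \<pi>"

definition boundary :: "'a functional \<Rightarrow> 'a functional" where
  "boundary T f \<pi> = T (\<lambda>_. 1) (f # \<pi>)"

definition pushforward :: "('a \<Rightarrow> 'b) \<Rightarrow> 'a functional \<Rightarrow> 'b functional" where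
  "pushforward \<phi> T f \<pi> = T (f \<circ> \<phi>) (map (\<lambda>p. p \<circ> \<phi>) \<pi>)"


section \<open>Currents in Euclidean space given by integrable functions\<close>

text \<open>
  Here \<open>'e\<close> plays the role of \<open>k\<close>-dimensional Euclidean space, \<open>k = DIM('e)\<close>. The order of the
  coordinates is a fixed but unspecified enumeration of \<open>Basis\<close>; a different choice changes
  \<open>jacobian_det\<close> at most by a global sign, which does not affect integer rectifiability. For
  \<open>'e = real\<close> the enumeration is \<open>[1]\<close> and there is no choice.
\<close>

definition basis_list :: "'e::euclidean_space list" where
  "basis_list = (SOME bs. distinct bs \<and> set bs = Basis)"

definition jacobian_det :: "('e::euclidean_space \<Rightarrow> real) list \<Rightarrow> 'e \<Rightarrow> real" where
  "jacobian_det \<pi> x =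
     (\<Sum>s | s permutes {..<DIM('e)}.
        of_int (sign s) *
        (\<Prod>i<DIM('e). frechet_derivative (\<pi> ! i) (at x) ((basis_list :: 'e list) ! s i)))"

text \<open>
  By Rademacher's theorem the points where \<open>frechet_derivative\<close> is a junk value form a null set
  as soon as the entries of \<open>\<pi>\<close> are Lipschitz near almost every point where \<open>g\<close> does not vanish.
\<close>

definition euclidean_current :: "('e::euclidean_space \<Rightarrow> real) \<Rightarrow> 'e functional" where
  "euclidean_current g f \<pi> = (LINT x|lebesgue. g x * f x * jacobian_det \<pi> x)"

lemma basis_list_real: "(basis_list :: real list) = [1]"
proof -
  have *: "(distinct bs \<and> set bs = (Basis :: real set)) \<longleftrightarrow> bs = [1]" for bs
  proof
    assume bs: "distinct bs \<and> set bs = (Basis :: real set)"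
    then have "length bs = card (Basis :: real set)"
      using distinct_card[of bs] by simp
    then have "length bs = 1"
      by simp
    then obtain b where "bs = [b]"
      by (cases bs) simp_all
    with bs show "bs = [1]"
      by simp
  qed simp
  show ?thesis
    unfolding basis_list_def * by (rule some_eq_trivial)
qed

lemma jacobian_det_real:
  fixes p :: "real \<Rightarrow> real"
  assumes "p differentiable (at x)"
  shows "jacobian_det [p] x = deriv p x"
proof -
  have "{..<Suc 0} = {0}"
    by (simp add: lessThan_Suc)
  then have perms: "{s. s permutes {..<Suc 0}} = {id}"
    by (simp add: permutes_sing)
  obtain D where D: "(p has_real_derivative D) (at x)"
    using assms real_differentiable_def by blast
  then have "deriv p x = D"
    by (rule DERIV_imp_deriv)
  moreover have "(*) D = frechet_derivative p (at x)"
    using D unfolding has_field_derivative_def by (rule frechet_derivative_at)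
  then have "frechet_derivative p (at x) 1 = D"
    by (metis mult.right_neutral)
  ultimately show ?thesis
    by (simp add: jacobian_det_def basis_list_real perms)
qed


section \<open>Rectifiable sets\<close>

text \<open>The value of a covering set in dimension \<open>k = 0\<close> is \<open>1\<close>, or \<open>0\<close> if the set is empty.\<close>

definition hausdorff_pre :: "nat \<Rightarrow> real \<Rightarrow> 'a::metric_space set \<Rightarrow> ennreal" where
  "hausdorff_pre k \<delta> S =
     (INF C\<in>{C :: nat \<Rightarrow> 'a set. S \<subseteq> (\<Union>i. C i) \<and> (\<forall>i. bounded (C i) \<and> diameter (C i) \<le> \<delta>)}.
        \<Sum>i. if C i = {} then 0 else ennreal (unit_ball_vol (real k) * (diameter (C i) / 2) ^ k))"

definition hausdorff_measure :: "nat \<Rightarrow> 'a::metric_space set \<Rightarrow> ennreal" where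
  "hausdorff_measure k S = (SUP \<delta>\<in>{0<..}. hausdorff_pre k \<delta> S)"

definition countably_rectifiable ::
    "'e::euclidean_space itself \<Rightarrow> 'a::metric_space set \<Rightarrow> bool" where
  "countably_rectifiable _ S \<longleftrightarrow>
     (\<exists>(A :: nat \<Rightarrow> 'e set) F. (\<forall>i. \<exists>C. C-lipschitz_on (A i) (F i)) \<and>
        hausdorff_measure DIM('e) (S - (\<Union>i. F i ` A i)) = 0)"


section \<open>Integral currents\<close>

text \<open>
  The argument of type \<open>'e itself\<close> determines the dimension \<open>k = DIM('e)\<close> of the current, so
  \<open>integral_currents TYPE(real)\<close> is the set of integral \<open>1\<close>-currents.
\<close>

definition integer_rectifiable ::
    "'e::euclidean_space itself \<Rightarrow> 'a::metric_space functional \<Rightarrow> bool" where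
  "integer_rectifiable E T \<longleftrightarrow>
     current DIM('e) T \<and> finite_mass DIM('e) T \<and>
     (\<exists>S. countably_rectifiable E S \<and> (AE x in mass_measure DIM('e) T. x \<in> S)) \<and>
     (\<forall>B\<in>sets borel. hausdorff_measure DIM('e) B = 0 \<longrightarrow> emeasure (mass_measure DIM('e) T) B = 0) \<and>
     (\<forall>(\<phi> :: 'a \<Rightarrow> 'e) U. lipschitz \<phi> \<longrightarrow> open U \<longrightarrow>
        (\<exists>g :: 'e \<Rightarrow> real. integrable lebesgue g \<and> range g \<subseteq> \<int> \<and>
           same_current DIM('e) (pushforward \<phi> (restrict_current DIM('e) T U)) (euclidean_current g)))"

definition integral_currents ::
    "'e::euclidean_space itself \<Rightarrow> 'a::metric_space functional set" where
  "integral_currents E =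
     {T. integer_rectifiable E T \<and> finite_mass (DIM('e) - 1) (boundary T)}"

end

theory Submission
  imports Defs "HOL-Combinatorics.Cycles" "HOL-Library.Multiset" "HOL-Library.Diagonal_Subsequence"
begin

text \<open>
  Up to a small error, \<open>T\<close> is carried by finitely many disjoint compact sets on each of which some
  distance function is almost isometric. Pushing forward under that function describes \<open>T\<close> there by
  an integer valued function on the line; hence \<open>T\<close> is approximated by finitely many short edges
  \<open>(x, y)\<close>, that is by \<open>\<Sum> f x * (p y - p x)\<close>, whose total length hardly exceeds the mass of \<open>T\<close>.
  Kantorovich duality, tested on the boundary of \<open>T\<close>, matches all but at most \<open>mass 0 (boundary T) / 2\<close>
  of the heads of these edges with nearby tails; after adding the corresponding short edges, the edges
  split into closed chains and at most that many open ones.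

  Order the chains by length and let the error tend to zero. Tightness of the mass measure yields
  1-Lipschitz limit curves, and chains that shrink contribute only quadratically in their length, so
  \<open>T\<close> is the sum of the currents \<open>T\<^sub>i\<close> of these curves and their lengths \<open>L\<^sub>i\<close> satisfy
  \<open>\<Sum> L\<^sub>i \<le> mass 1 T\<close>. Since \<open>mass 1 T \<le> \<Sum> mass 1 T\<^sub>i \<le> \<Sum> L\<^sub>i\<close>, equality holds throughout. Therefore
  the mass measure of \<open>T\<^sub>i\<close> is the image of Lebesgue measure on \<open>{0..L\<^sub>i}\<close> and is dominated by that of
  \<open>T\<close>, which gives the rectifiability of \<open>T\<^sub>i\<close>. The masses of the boundaries add up by the same
  comparison, as only the limits of open chains have a boundary, of mass at most 2.
\<close>

section \<open>Sums of measures\<close>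

text \<open>The obstacle is the count of open chains: it must not exceed half of
  \<open>mass 0 (boundary T)\<close>, since any weaker bound would leave an inequality between the
  boundary masses. The cost of a matching is therefore truncated at \<open>2 * l\<close>. The dual
  potential then oscillates by at most \<open>2 * l\<close>, so after centring it is bounded by
  \<open>l\<close> and pairs with the boundary of \<open>T\<close> to at most
  \<open>mass 0 (boundary T) * l\<close>, while every unmatched head costs exactly
  \<open>2 * l\<close>. The error is made smaller than the gap to the next integer, so rounding
  gives the sharp count.

  The second obstacle is that the number of chains is unbounded. In a closed chain the linear term
  of its action on \<open>(f, p)\<close> cancels, and the j-th longest closed chain has length at
  most a constant over j; hence the actions are dominated by a multiple of 1/j^2 and limit and sum
  may be exchanged.

  Integer rectifiability of the pieces comes last, because restriction is defined through the mass
  measure, which for a piece is known only after the masses have been seen to add up.\<close>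

definition sum_measure :: "(nat \<Rightarrow> 'a::topological_space measure) \<Rightarrow> 'a measure" where
  "sum_measure M = measure_of UNIV (sets borel) (\<lambda>A. \<Sum>i. emeasure (M i) A)"

lemma sets_sum_measure [simp, measurable_cong]: "sets (sum_measure M) = sets borel"
  by (simp add: sum_measure_def) (metis sets.sigma_sets_eq space_borel)

lemma space_sum_measure [simp]: "space (sum_measure M) = UNIV"
  by (simp add: sum_measure_def)

lemma emeasure_sum_measure:
  assumes M: "\<And>i. sets (M i) = sets borel" and A: "A \<in> sets borel"
  shows "emeasure (sum_measure M) A = (\<Sum>i. emeasure (M i) A)"
proof (rule emeasure_measure_of[OF sum_measure_def])
  show "countably_additive (sets (sum_measure M)) (\<lambda>A. \<Sum>i. emeasure (M i) A)"
  proof (rule countably_additiveI)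
    fix X :: "nat \<Rightarrow> 'a set"
    assume "range X \<subseteq> sets (sum_measure M)"
      and X: "disjoint_family X"
    then have "range X \<subseteq> sets (M i)" for i
      using M by simp
    then have "(\<Sum>j. emeasure (M i) (X j)) = emeasure (M i) (\<Union>j. X j)" for i
      using X by (intro suminf_emeasure) auto
    moreover have "(\<Sum>j. \<Sum>i. emeasure (M i) (X j)) = (\<Sum>i. \<Sum>j. emeasure (M i) (X j))"
      by (subst (1 2) nn_integral_count_space_nat[symmetric])
         (simp add: nn_integral_suminf)
    ultimately show "(\<Sum>j. \<Sum>i. emeasure (M i) (X j)) = (\<Sum>i. emeasure (M i) (\<Union> (range X)))"
      by simp
  qed
qed (use A in \<open>auto simp: positive_def\<close>)

lemma nn_integral_sum_measure:
  assumes M: "\<And>i. sets (M i) = sets borel" and f: "f \<in> borel_measurable borel"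
  shows "(\<integral>\<^sup>+x. f x \<partial>sum_measure M) = (\<Sum>i. \<integral>\<^sup>+x. f x \<partial>M i)"
  using f
proof (induction rule: borel_measurable_induct)
  case (cong f g)
  then have "f = g" by auto
  with cong show ?case by simp
next
  case (set A)
  then show ?case
    using M by (simp add: emeasure_sum_measure nn_integral_indicator)
next
  case (mult u c)
  have [measurable]: "u \<in> borel_measurable (M i)" "u \<in> borel_measurable (sum_measure M)" for i
    using mult M by (simp_all cong: measurable_cong_sets)
  show ?case
    using mult by (simp add: nn_integral_cmult)
next
  case (add u v)
  have [measurable]: "u \<in> borel_measurable (M i)" "u \<in> borel_measurable (sum_measure M)"
    "v \<in> borel_measurable (M i)" "v \<in> borel_measurable (sum_measure M)" for i
    using add M by (simp_all cong: measurable_cong_sets)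
  show ?case
    using add by (simp add: nn_integral_add suminf_add[symmetric])
next
  case (seq U)
  have [measurable]: "U j \<in> borel_measurable (M i)" "U j \<in> borel_measurable (sum_measure M)" for i j
    using seq M by (simp_all cong: measurable_cong_sets)
  have "(\<integral>\<^sup>+x. (SUP i. U i) x \<partial>sum_measure M) = (\<integral>\<^sup>+x. (SUP i. U i x) \<partial>sum_measure M)"
    by (simp add: image_comp)
  also have "\<dots> = (SUP j. \<integral>\<^sup>+x. U j x \<partial>sum_measure M)"
    using seq by (intro nn_integral_monotone_convergence_SUP) auto
  also have "\<dots> = (SUP j. \<Sum>i. \<integral>\<^sup>+x. U j x \<partial>M i)"
    using seq by simp
  also have "\<dots> = (\<Sum>i. SUP j. \<integral>\<^sup>+x. U j x \<partial>M i)"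
    using seq by (intro ennreal_suminf_SUP_eq[symmetric] )
      (auto intro!: incseq_SucI nn_integral_mono simp: incseq_Suc_iff le_fun_def)
  also have "\<dots> = (\<Sum>i. \<integral>\<^sup>+x. (SUP j. U j x) \<partial>M i)"
    using seq by (subst nn_integral_monotone_convergence_SUP) auto
  finally show ?case
    by (simp add: image_comp)
qed

lemma emeasure_le_sum_measure:
  assumes "\<And>i. sets (M i) = sets borel" and "A \<in> sets borel"
  shows "emeasure (M i) A \<le> emeasure (sum_measure M) A"
  using assms sum_le_suminf[of "\<lambda>i. emeasure (M i) A" "{i}"]
  by (simp add: emeasure_sum_measure)

section \<open>Lipschitz functions of a real variable\<close>

lemma emeasure_interval_measure_Ioo:
  assumes "a \<le> b"
    and mono: "\<And>x y. x \<le> y \<Longrightarrow> F x \<le> F y" and cont: "continuous_on UNIV F"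
  shows "emeasure (interval_measure F) {a<..<b} = ennreal (F b - F a)"
proof (cases "a = b")
  case False
  have "emeasure (interval_measure F) {a<..b} = emeasure (interval_measure F) {a<..<b} + emeasure (interval_measure F) {b..b}"
    using assms False by (subst plus_emeasure) (auto intro!: arg_cong[where f="emeasure _"])
  moreover have "emeasure (interval_measure F) {b..b} = 0"
    using mono cont by (subst emeasure_interval_measure_Icc) (auto intro: continuous_on_subset)
  moreover have "emeasure (interval_measure F) {a<..b} = F b - F a"
    using assms by (intro emeasure_interval_measure_Ioc)
      (auto simp: continuous_on_eq_continuous_within intro: continuous_within_subset)
  ultimately show ?thesis by simp
qed simp

lemma set_integrable_bounded_interval:
  fixes m :: "real \<Rightarrow> real"
  assumes "m \<in> borel_measurable borel" "\<And>x. \<bar>m x\<bar> \<le> B"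
  shows "set_integrable lborel {a..b} m"
  unfolding set_integrable_def
proof (rule Bochner_Integration.integrable_bound)
  show "integrable lborel (\<lambda>x. B * indicator {a..b} x)" by (simp add: emeasure_lborel_Icc_eq)
  show "AE x in lborel. norm (indicator {a..b} x *\<^sub>R m x) \<le> norm (B * indicator {a..b} x)"
    using assms(2) order_trans[OF abs_ge_zero assms(2)] by (auto simp: indicator_def)
qed (use assms(1) in measurable)

lemma set_integral_interval_le:
  fixes m :: "real \<Rightarrow> real"
  assumes m: "m \<in> borel_measurable borel" "\<And>x. \<bar>m x\<bar> \<le> B" and "a \<le> b" and K: "\<And>x. a \<le> x \<Longrightarrow> x \<le> b \<Longrightarrow> \<bar>m x\<bar> \<le> K"
  shows "\<bar>LINT x:{a..b}|lborel. m x\<bar> \<le> K * (b - a)"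
proof -
  have "\<bar>LINT x:{a..b}|lborel. m x\<bar> \<le> (LINT x|lborel. \<bar>indicator {a..b} x *\<^sub>R m x\<bar>)"
    unfolding set_lebesgue_integral_def by (rule integral_abs_bound)
  also have "\<dots> \<le> (LINT x|lborel. K * indicator {a..b} x)"
  proof (rule integral_mono)
    show "integrable lborel (\<lambda>x. \<bar>indicator {a..b} x *\<^sub>R m x\<bar>)"
      using set_integrable_bounded_interval[OF m] by (auto simp: set_integrable_def)
    show "\<bar>indicator {a..b} x *\<^sub>R m x\<bar> \<le> K * indicator {a..b} x" for x using K by (auto simp: indicator_def)
  qed (simp add: emeasure_lborel_Icc_eq)
  also have "\<dots> = K * (b - a)" using \<open>a \<le> b\<close> by simp
  finally show ?thesis .
qed

text \<open>The functions \<open>F\<close> and \<open>G\<close> below are nondecreasing, because the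
  slopes of \<open>v\<close> lie between \<open>- C\<close> and \<open>C\<close>, and they add up to
  the identity; so their Stieltjes measures add up to Lebesgue measure. Hence that of
  \<open>F\<close> has a density \<open>k\<close> with values in [0, 1], and as
  \<open>v x = 2 * C * F x - C * x\<close>, the density of \<open>v\<close> is
  \<open>2 * C * k - C\<close>.\<close>

lemma lipschitz_real_has_density:
  fixes v :: "real \<Rightarrow> real"
  assumes v: "C-lipschitz_on UNIV v"
  obtains g where "g \<in> borel_measurable borel" "\<And>x. \<bar>g x\<bar> \<le> C"
    "\<And>a b. a \<le> b \<Longrightarrow> v b - v a = (LINT x:{a..b}|lborel. g x)"
proof (cases "C = 0")
  case True
  then have "v x = v y" for x y
    using lipschitz_onD[OF v, of x y] by simp
  then show thesis
    using True by (intro that[of "\<lambda>_. 0"]) auto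
next
  case False
  then have D: "0 < C" using lipschitz_on_nonneg[OF v] by simp
  have vC: "\<bar>v y - v x\<bar> \<le> C * (y - x)" if "x \<le> y" for x y
    using lipschitz_onD[OF v, of y x] that by (simp add: dist_real_def abs_if split: if_splits)
  define F where "F x = v x / (2 * C) + x / 2" for x
  define G where "G x = x / 2 - v x / (2 * C)" for x
  have cont_v: "continuous_on UNIV v" using v by (rule lipschitz_on_continuous_on)
  have F: "F x \<le> F y" and G: "G x \<le> G y" if "x \<le> y" for x y
  proof -
    have "\<bar>v y - v x\<bar> / (2 * C) \<le> (y - x) / 2"
      using vC[OF that] D by (simp add: field_simps)
    then have "\<bar>v y / (2 * C) - v x / (2 * C)\<bar> \<le> (y - x) / 2"
      using D by (simp add: diff_divide_distrib[symmetric] abs_divide)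
    then show "F x \<le> F y" "G x \<le> G y"
      unfolding F_def G_def abs_le_iff diff_divide_distrib by linarith+
  qed
  have cF: "continuous_on UNIV F" and cG: "continuous_on UNIV G"
    unfolding F_def G_def using cont_v D by (auto intro!: continuous_intros)
  define M where "M i = (if i = 0 then interval_measure F else if i = Suc 0 then interval_measure G else null_measure borel)" for i :: nat
  have sM: "sets (M i) = sets borel" for i by (simp add: M_def)
  have SM: "emeasure (sum_measure M) A = emeasure (interval_measure F) A + emeasure (interval_measure G) A"
    if "A \<in> sets borel" for A
    using that sM by (subst emeasure_sum_measure, simp_all)
      (subst suminf_finite[of "{0,1}"], auto simp: M_def)
  have "lborel = sum_measure M"
  proof (rule lborel_eqI)
    fix l u :: real assume "\<And>b. b \<in> Basis \<Longrightarrow> l \<bullet> b \<le> u \<bullet> b"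
    then have "l \<le> u" by simp
    then show "emeasure (sum_measure M) (box l u) = (\<Prod>b\<in>Basis. (u - l) \<bullet> b)"
      using F G cF cG
      by (simp add: SM emeasure_interval_measure_Ioo ennreal_plus[symmetric] box_real del: ennreal_plus)
         (simp add: F_def G_def)
  qed simp
  then have le: "emeasure (interval_measure F) A \<le> emeasure lborel A"
    "emeasure (interval_measure G) A \<le> emeasure lborel A" if "A \<in> sets borel" for A
    using SM[OF that] by auto
  have "absolutely_continuous lborel (interval_measure F)" "absolutely_continuous lborel (interval_measure G)"
    using le by (auto simp: absolutely_continuous_def null_sets_def) (metis le_zero_eq)+
  then obtain f h where f: "f \<in> borel_measurable lborel" "density lborel f = interval_measure F"
    and h: "h \<in> borel_measurable lborel" "density lborel h = interval_measure G"
    using sigma_finite_measure.Radon_Nikodym[OF sigma_finite_lborel] by (metis sets_interval_measure sets_lborel)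
  have "density lborel (\<lambda>x. f x + h x) = density lborel (\<lambda>x. 1)"
  proof (rule measure_eqI)
    fix A assume "A \<in> sets (density lborel (\<lambda>x. f x + h x))"
    then have A: "A \<in> sets borel" by simp
    have "emeasure (density lborel (\<lambda>x. f x + h x)) A = emeasure (density lborel f) A + emeasure (density lborel h) A"
      using A f(1) h(1) by (simp add: emeasure_density nn_integral_add[symmetric] distrib_right)
    also have "\<dots> = emeasure lborel A"
      using A f h SM \<open>lborel = _\<close> by simp
    finally show "emeasure (density lborel (\<lambda>x. f x + h x)) A = emeasure (density lborel (\<lambda>x. 1)) A"
      by (simp add: density_1)
  qed simp
  then have "AE x in lborel. f x + h x = 1"
    using f h by (subst (asm) sigma_finite_measure.density_unique_iff[OF sigma_finite_lborel]) auto
  then have f1: "AE x in lborel. f x \<le> 1"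
    by eventually_elim (metis le_iff_add)
  \<comment> \<open>The bound by 1 holds only almost everywhere for \<open>f\<close>; the truncation
    makes it hold at every point.\<close>
  define k where "k x = enn2real (min 1 (f x))" for x
  have k: "k \<in> borel_measurable borel" "\<And>x. 0 \<le> k x" "\<And>x. k x \<le> 1"
    using f(1) unfolding k_def by (measurable, simp_all add: enn2real_leI)
  have kint: "F b - F a = (LINT x:{a..b}|lborel. k x)" if "a \<le> b" for a b
  proof -
    have "ennreal (F b - F a) = emeasure (interval_measure F) {a..b}"
      using F cF that by (subst emeasure_interval_measure_Icc) (auto intro: continuous_on_subset)
    also have "\<dots> = (\<integral>\<^sup>+x. f x * indicator {a..b} x \<partial>lborel)"
      using f by (simp add: f(2)[symmetric] emeasure_density)
    also have "\<dots> = (\<integral>\<^sup>+x. ennreal (indicator {a..b} x * k x) \<partial>lborel)"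
      using f1 by (intro nn_integral_cong_AE, eventually_elim)
        (auto simp: k_def min_def indicator_def intro: ennreal_enn2real[symmetric] le_less_trans[OF _ ennreal_one_less_top] split: if_splits)
    finally have *: "(\<integral>\<^sup>+x. ennreal (indicator {a..b} x * k x) \<partial>lborel) = ennreal (F b - F a)" ..
    have "(LINT x|lborel. indicator {a..b} x * k x) = F b - F a"
      using k * F[OF that] by (intro integral_eq_nn_integral[THEN trans]) auto
    then show ?thesis
      by (simp add: set_lebesgue_integral_def)
  qed
  define g0 where "g0 x = 2 * C * k x - C" for x
  have set: "set_integrable lborel {a..b} k" "set_integrable lborel {a..b} (\<lambda>_. C)" for a b :: real
    using set_integrable_bounded_interval[of k 1] set_integrable_bounded_interval[of "\<lambda>_. C" C] k D by auto
  have g0: "v b - v a = (LINT x:{a..b}|lborel. g0 x)" if "a \<le> b" for a b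
  proof -
    have "(LINT x:{a..b}|lborel. g0 x) = 2 * C * (LINT x:{a..b}|lborel. k x) - (LINT x:{a..b}|lborel. C)"
      unfolding g0_def using set by (subst set_integral_diff) simp_all
    also have "\<dots> = 2 * C * (F b - F a) - C * (b - a)"
      using kint[OF that] that by (simp add: set_lebesgue_integral_def)
    also have "\<dots> = v b - v a"
      unfolding F_def using D by (simp add: field_simps)
    finally show ?thesis ..
  qed
  have "\<bar>g0 x\<bar> \<le> C" for x
    using mult_left_mono[OF k(3)[of x], of "2 * C"] D k(2)[of x] unfolding g0_def by (auto simp: abs_le_iff)
  moreover have "g0 \<in> borel_measurable borel"
    unfolding g0_def using k(1) by measurable
  ultimately show thesis
    using that g0 by blast
qed

lemma negligible_UN_countable:
  assumes "countable I" "\<And>i. i \<in> I \<Longrightarrow> negligible (A i)"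
  shows "negligible (\<Union>i\<in>I. A i)"
  using assms by (intro negligible_countable_Union) auto

text \<open>One half of Lebesgue differentiation, by Vitali covering: disjoint intervals steeper
  than \<open>\<beta>\<close> cover almost all of the set and lie in an open set that barely exceeds
  the part where \<open>g\<close> is below \<open>\<alpha>\<close>. The integral of \<open>g\<close>
  over their union is thus at most \<open>\<alpha>\<close> times its length plus a small error and
  at least \<open>\<beta>\<close> times its length, so the length is small.\<close>

lemma negligible_steep_intervals:
  fixes v g :: "real \<Rightarrow> real"
  assumes g [measurable]: "g \<in> borel_measurable borel" and bd: "\<And>x. \<bar>g x\<bar> \<le> C"
    and v: "\<And>a b. a \<le> b \<Longrightarrow> v b - v a = (LINT x:{a..b}|lborel. g x)"
    and "\<alpha> < \<beta>"
  shows "negligible {x. g x < \<alpha> \<and>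
    (\<forall>d>0. \<exists>a b. a < b \<and> a \<le> x \<and> x \<le> b \<and> b - a < d \<and> \<beta> * (b - a) < v b - v a)}"
    (is "negligible ?E")
proof -
  have C: "0 \<le> C" using bd[of 0] by simp
  have "negligible (?E \<inter> {-real n..real n})" for n
    unfolding negligible_outer_le
  proof (intro allI impI)
    fix e :: real assume e: "0 < e"
    \<comment> \<open>Chosen so that \<open>(C + \<bar>\<alpha>\<bar>) * \<delta> \<le> (\<beta> -
      \<alpha>) * e\<close>, as the estimate of the finite unions below requires.\<close>
    define \<delta> where "\<delta> = e * (\<beta> - \<alpha>) / (C + \<bar>\<alpha>\<bar> + 1)"
    have \<delta>: "0 < \<delta>" using e C \<open>\<alpha> < \<beta>\<close> by (simp add: \<delta>_def)
    define G where "G = {x. g x < \<alpha>} \<inter> {-real n..real n}"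
    have G [measurable]: "G \<in> sets borel" unfolding G_def by measurable
    obtain W where W: "open W" "G \<subseteq> W" "W - G \<in> lmeasurable" "emeasure lebesgue (W - G) < ennreal \<delta>"
      using sets_lebesgue_outer_open[of G \<delta>] \<delta> G by (metis sets_completionI_sets sets_lborel)
    have mG: "G \<in> lmeasurable"
      unfolding G_def using G by (intro bounded_set_imp_lmeasurable) (auto simp: G_def intro: bounded_subset[of "{-real n..real n}"])
    have "W = G \<union> (W - G)" using W by auto
    then have mO: "W \<in> lmeasurable" using W(3) mG fmeasurable.Un by metis
    have mOG: "measure lebesgue (W - G) < \<delta>"
      using W(3,4) \<delta> by (simp add: emeasure_eq_measure2 ennreal_less_iff)
    define K where "K = {(a, b). a < b \<and> {a..b} \<subseteq> W \<and> \<beta> * (b - a) < v b - v a}"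
    let ?I = "\<lambda>i. {fst i..snd i}"
    \<comment> \<open>The covering theorem speaks of closed balls; an interval is the ball around
      its midpoint.\<close>
    have cb: "cball ((fst i + snd i) / 2) ((snd i - fst i) / 2) = ?I i" for i :: "real \<times> real"
      by (auto simp: cball_eq_atLeastAtMost field_simps)
    have Kr: "0 < (snd i - fst i) / 2" if "i \<in> K" for i
      using that by (auto simp: K_def)
    have KS: "\<exists>i. i \<in> K \<and> x \<in> cball ((fst i + snd i) / 2) ((snd i - fst i) / 2) \<and> (snd i - fst i) / 2 < d"
      if x: "x \<in> ?E \<inter> {-real n..real n}" and "0 < d" for x d
    proof -
      have "x \<in> W" using x W by (auto simp: G_def)
      then obtain \<epsilon> where \<epsilon>: "0 < \<epsilon>" "ball x \<epsilon> \<subseteq> W"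
        using W openE by blast
      then obtain a b where ab: "a < b" "a \<le> x" "x \<le> b" "b - a < min d \<epsilon>" "\<beta> * (b - a) < v b - v a"
      proof -
        have "0 < min d \<epsilon>" using \<epsilon> \<open>0 < d\<close> by simp
        then have "\<exists>a b. a < b \<and> a \<le> x \<and> x \<le> b \<and> b - a < min d \<epsilon> \<and> \<beta> * (b - a) < v b - v a"
          using x by blast
        then show thesis using that by blast
      qed
      then have "{a..b} \<subseteq> ball x \<epsilon>" by (auto simp: dist_real_def)
      then have "(a, b) \<in> K" using ab \<epsilon> by (auto simp: K_def)
      then show ?thesis
        using ab unfolding cb by (intro exI[of _ "(a, b)"]) auto
    qed
    obtain F where F: "countable F" "F \<subseteq> K"
      and disj: "pairwise (\<lambda>i j. disjnt (?I i) (?I j)) F"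
      and neg: "negligible (?E \<inter> {-real n..real n} - (\<Union>i\<in>F. ?I i))"
      by (rule Vitali_covering_theorem_cballs[of K "\<lambda>i. (snd i - fst i) / 2"
            "?E \<inter> {-real n..real n}" "\<lambda>i. (fst i + snd i) / 2", OF Kr KS])
        (simp_all add: cb)
    have fin: "measure lebesgue (\<Union>i\<in>H. ?I i) \<le> e" if H: "H \<subseteq> F" "finite H" for H
    proof -
      let ?U = "\<Union>i\<in>H. ?I i"
      have U [measurable]: "?U \<in> sets borel" using H by (intro sets.finite_UN) auto
      have HK: "fst i < snd i \<and> ?I i \<subseteq> W \<and> \<beta> * (snd i - fst i) < v (snd i) - v (fst i)" if "i \<in> H" for i
        using that H F unfolding K_def by (cases i) auto
      have UO: "?U \<subseteq> W" using HK by blast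
      have dH: "disjoint_family_on ?I H"
        using disj H unfolding disjoint_family_on_def pairwise_def disjnt_def by blast
      have int: "set_integrable lborel A g" if "A \<in> sets borel" "bounded A" for A
        unfolding set_integrable_def
        using that bd emeasure_bounded_finite[OF that(2)]
        by (intro integrableI_bounded_set_indicator[where B=C]) auto
      have bU: "bounded ?U" using H by (intro bounded_UN) auto
      have fU: "emeasure lborel ?U < \<infinity>" by (rule emeasure_bounded_finite[OF bU])
      have intR: "integrable lborel (indicator A :: real \<Rightarrow> real)" if "A \<in> sets borel" "A \<subseteq> ?U" for A
      proof (rule integrable_real_indicator)
        show "emeasure lborel A < \<infinity>"
          using U by (intro le_less_trans[OF emeasure_mono[OF that(2)] fU]) simp
      qed (use that in simp)
      have "\<beta> * measure lborel ?U = (\<Sum>i\<in>H. \<beta> * (snd i - fst i))"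
      proof -
        have "measure lborel ?U = (\<Sum>i\<in>H. measure lborel (?I i))"
          by (rule measure_finite_Union[OF H(2) _ dH]) (auto simp: emeasure_lborel_Icc_eq)
        also have "\<dots> = (\<Sum>i\<in>H. snd i - fst i)"
          using HK by (intro sum.cong measure_lborel_Icc) (auto intro: less_imp_le)
        finally show ?thesis by (simp only: sum_distrib_left)
      qed
      also have "\<dots> \<le> (\<Sum>i\<in>H. v (snd i) - v (fst i))"
        using HK by (intro sum_mono) (auto intro: less_imp_le)
      also have "\<dots> = (\<Sum>i\<in>H. LINT x:?I i|lborel. g x)"
        using HK by (intro sum.cong v) (auto intro: less_imp_le)
      also have "\<dots> = (LINT x:?U|lborel. g x)"
        using H dH by (intro set_integral_finite_Union[symmetric] int) auto
      \<comment> \<open>On \<open>G\<close> the integrand is below \<open>\<alpha>\<close>;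
        elsewhere it is at most \<open>C\<close>, hence at most
        \<open>\<alpha> + C + \<bar>\<alpha>\<bar>\<close>.\<close>
      also have "\<dots> \<le> (LINT x|lborel. \<alpha> * indicator ?U x + (C + \<bar>\<alpha>\<bar>) * indicator (?U - G) x)"
        unfolding set_lebesgue_integral_def
      proof (rule integral_mono)
        show "integrable lborel (\<lambda>x. \<alpha> * indicator ?U x + (C + \<bar>\<alpha>\<bar>) * indicator (?U - G) x)"
          by (intro Bochner_Integration.integrable_add integrable_mult_right intR) auto
        show "integrable lborel (\<lambda>x. indicator ?U x *\<^sub>R g x)"
          using int[OF U bU] by (simp add: set_integrable_def)
        fix x
        have "g x \<le> C" using bd[of x] by simp
        moreover have "g x < \<alpha>" if "x \<in> G" using that by (auto simp: G_def)
        ultimately show "indicator ?U x *\<^sub>R g x \<le> \<alpha> * indicator ?U x + (C + \<bar>\<alpha>\<bar>) * indicator (?U - G) x"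
          by (auto simp: indicator_def)
      qed
      also have "\<dots> = \<alpha> * measure lborel ?U + (C + \<bar>\<alpha>\<bar>) * measure lborel (?U - G)"
        by (subst Bochner_Integration.integral_add) (auto intro!: integrable_mult_right intR)
      also have "measure lborel (?U - G) = measure lebesgue (?U - G)"
        by simp
      also have "(C + \<bar>\<alpha>\<bar>) * \<dots> \<le> (C + \<bar>\<alpha>\<bar>) * \<delta>"
      proof (intro mult_left_mono)
        have "measure lebesgue (?U - G) \<le> measure lebesgue (W - G)"
          using UO W(3) by (intro measure_mono_fmeasurable) auto
        then show "measure lebesgue (?U - G) \<le> \<delta>" using mOG by simp
      qed (use C in simp)
      finally have "(\<beta> - \<alpha>) * measure lborel ?U \<le> (C + \<bar>\<alpha>\<bar>) * \<delta>"
        by (simp add: algebra_simps)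
      also have "\<dots> \<le> (\<beta> - \<alpha>) * e"
        using C e \<open>\<alpha> < \<beta>\<close> by (simp add: \<delta>_def field_simps)
      finally show ?thesis
        using \<open>\<alpha> < \<beta>\<close> by simp
    qed
    have mI: "?I i \<in> lmeasurable" for i :: "real \<times> real"
      using lmeasurable_cbox[of "fst i" "snd i"] by (simp add: cbox_interval)
    have "(\<Union>i\<in>F. ?I i) \<in> lmeasurable" "measure lebesgue (\<Union>i\<in>F. ?I i) \<le> e"
      using fmeasurable_UN_bound[OF F(1) mI fin] measure_UN_bound[OF F(1) mI fin] by auto
    moreover have "?E \<inter> {-real n..real n} - (\<Union>i\<in>F. ?I i) \<in> null_sets lebesgue"
      using neg by (simp add: negligible_iff_null_sets)
    moreover have "?E \<inter> {-real n..real n} \<subseteq> (\<Union>i\<in>F. ?I i) \<union> (?E \<inter> {-real n..real n} - (\<Union>i\<in>F. ?I i))"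
      by blast
    ultimately show "\<exists>T. ?E \<inter> {-real n..real n} \<subseteq> T \<and> T \<in> lmeasurable \<and> measure lebesgue T \<le> e"
      by (metis (no_types, lifting) measure_Un_null_set fmeasurable.Un fmeasurableD negligible_imp_measurable negligible_iff_null_sets)
  qed
  then have "negligible (\<Union>n. ?E \<inter> {-real n..real n})"
    by (intro negligible_countable_Union) auto
  moreover have "?E \<subseteq> (\<Union>n. ?E \<inter> {-real n..real n})"
  proof
    fix x assume "x \<in> ?E"
    moreover obtain n where "\<bar>x\<bar> \<le> real n" using real_arch_simple by blast
    ultimately show "x \<in> (\<Union>n. ?E \<inter> {-real n..real n})" by (auto intro!: exI[of _ n])
  qed
  ultimately show ?thesis by (rule negligible_subset)
qed

text \<open>If \<open>g x\<close> is not the derivative, a pair of rationals separates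
  \<open>g x\<close> from the slopes of arbitrarily short intervals around \<open>x\<close>, from
  above or from below. The case from below is the case from above for \<open>- g\<close> and
  \<open>- v\<close>, so the exceptional set is a countable union of null sets.\<close>

lemma AE_has_derivative_integral:
  fixes v g :: "real \<Rightarrow> real"
  assumes g: "g \<in> borel_measurable borel" and bd: "\<And>x. \<bar>g x\<bar> \<le> C"
    and v: "\<And>a b. a \<le> b \<Longrightarrow> v b - v a = (LINT x:{a..b}|lborel. g x)"
  shows "AE x in lebesgue. (v has_real_derivative g x) (at x)"
proof -
  define E where "E g v \<alpha> \<beta> = {x. g x < \<alpha> \<and>
    (\<forall>d>0. \<exists>a b. a < b \<and> a \<le> x \<and> x \<le> b \<and> b - a < d \<and> \<beta> * (b - a) < v b - v a)}"
    for g v :: "real \<Rightarrow> real" and \<alpha> \<beta> :: real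
  define N where "N = (\<Union>\<alpha>\<in>\<rat>. \<Union>\<beta>\<in>{x\<in>\<rat>. \<alpha> < x}. E g v \<alpha> \<beta> \<union> E (\<lambda>x. - g x) (\<lambda>x. - v x) \<alpha> \<beta>)"
  have "negligible (E g v \<alpha> \<beta>)" if "\<alpha> < \<beta>" for \<alpha> \<beta>
    unfolding E_def using g bd v that by (rule negligible_steep_intervals)
  moreover have "negligible (E (\<lambda>x. - g x) (\<lambda>x. - v x) \<alpha> \<beta>)" if "\<alpha> < \<beta>" for \<alpha> \<beta>
    unfolding E_def
  proof (rule negligible_steep_intervals[where C=C])
    show "- v b - - v a = (LINT x:{a..b}|lborel. - g x)" if "a \<le> b" for a b
      using v[OF that] by (simp add: set_lebesgue_integral_def)
  qed (use g bd that in auto)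
  ultimately have "negligible N"
    unfolding N_def
    by (intro negligible_UN_countable countable_rat countable_subset[OF _ countable_rat] negligible_Un) auto
  then have "AE x in lebesgue. x \<notin> N"
    by (simp add: negligible_iff_null_sets AE_not_in)
  then show ?thesis
  proof eventually_elim
    fix x assume xN: "x \<notin> N"
    \<comment> \<open>Stated for \<open>v\<close> and \<open>- v\<close> together, since both the
      upper and the lower estimate of the slopes are needed at the same point.\<close>
    have up: "\<exists>d>0. \<forall>a b. a < b \<longrightarrow> a \<le> x \<longrightarrow> x \<le> b \<longrightarrow> b - a < d \<longrightarrow> w b - w a \<le> (h x + e) * (b - a)"
      if "0 < e" and h: "(h = g \<and> w = v) \<or> (h = (\<lambda>x. - g x) \<and> w = (\<lambda>x. - v x))" for h w e
    proof -
      obtain \<alpha> where \<alpha>: "\<alpha> \<in> \<rat>" "h x < \<alpha>" "\<alpha> < h x + e"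
        using Rats_dense_in_real[of "h x" "h x + e"] \<open>0 < e\<close> by auto
      obtain \<beta> where \<beta>: "\<beta> \<in> \<rat>" "\<alpha> < \<beta>" "\<beta> < h x + e"
        using Rats_dense_in_real[OF \<alpha>(3)] by auto
      have "x \<notin> E h w \<alpha> \<beta>" using xN \<alpha> \<beta> h by (auto simp: N_def)
      then have "\<exists>d>0. \<forall>a b. a < b \<longrightarrow> a \<le> x \<longrightarrow> x \<le> b \<longrightarrow> b - a < d \<longrightarrow> w b - w a \<le> \<beta> * (b - a)"
        using \<alpha>(2) unfolding E_def mem_Collect_eq not_less[symmetric] by blast
      then obtain d where d: "d > 0" "\<And>a b. a < b \<Longrightarrow> a \<le> x \<Longrightarrow> x \<le> b \<Longrightarrow> b - a < d \<Longrightarrow> w b - w a \<le> \<beta> * (b - a)"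
        by blast
      have "w b - w a \<le> (h x + e) * (b - a)" if "a < b" "a \<le> x" "x \<le> b" "b - a < d" for a b
      proof -
        have "\<beta> * (b - a) \<le> (h x + e) * (b - a)"
          using that \<beta> by (intro mult_right_mono) auto
        then show ?thesis using d(2)[OF that] by linarith
      qed
      with d show ?thesis by blast
    qed
    show "(v has_real_derivative g x) (at x)"
      unfolding has_field_derivative_iff LIM_eq
    proof (intro allI impI)
      fix e :: real assume e: "0 < e"
      obtain d1 where d1: "d1 > 0" "\<And>a b. a < b \<Longrightarrow> a \<le> x \<Longrightarrow> x \<le> b \<Longrightarrow> b - a < d1 \<Longrightarrow> v b - v a \<le> (g x + e/2) * (b - a)"
        using up[of "e/2" g v] e by auto
      obtain d2 where d2: "d2 > 0" "\<And>a b. a < b \<Longrightarrow> a \<le> x \<Longrightarrow> x \<le> b \<Longrightarrow> b - a < d2 \<Longrightarrow> - v b - - v a \<le> (- g x + e/2) * (b - a)"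
        using up[of "e/2" "\<lambda>x. - g x" "\<lambda>x. - v x"] e by auto
      have "\<bar>(v b - v a) / (b - a) - g x\<bar> < e" if "a < b" "a \<le> x" "x \<le> b" "b - a < min d1 d2" for a b
      proof -
        have "\<bar>(v b - v a) - g x * (b - a)\<bar> \<le> e/2 * (b - a)"
          using d1(2)[of a b] d2(2)[of a b] that unfolding distrib_right by (intro abs_leI) auto
        moreover have "(v b - v a) / (b - a) - g x = ((v b - v a) - g x * (b - a)) / (b - a)"
          using that by (simp add: field_simps)
        ultimately have "\<bar>(v b - v a) / (b - a) - g x\<bar> \<le> e/2"
          using that by (simp add: abs_divide pos_divide_le_eq)
        then show ?thesis using e by simp
      qed
      note key = this
      have "\<bar>(v y - v x) / (y - x) - g x\<bar> < e" if "y \<noteq> x" "\<bar>y - x\<bar> < min d1 d2" for y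
      proof (cases "x < y")
        case True
        then show ?thesis using key[of x y] that by simp
      next
        case False
        then have "y < x" using that by simp
        moreover have "(v y - v x) / (y - x) = (v x - v y) / (x - y)"
          by (metis minus_diff_eq minus_divide_divide)
        ultimately show ?thesis using key[of y x] that by simp
      qed
      then show "\<exists>s>0. \<forall>y. y \<noteq> x \<and> norm (y - x) < s \<longrightarrow> norm ((v y - v x) / (y - x) - g x) < e"
        using d1 d2 by (intro exI[of _ "min d1 d2"]) auto
    qed
  qed
qed

lemma lipschitz_real_AE_derivative:
  fixes v :: "real \<Rightarrow> real"
  assumes v: "C-lipschitz_on UNIV v"
  obtains g where "g \<in> borel_measurable borel" "\<And>x. \<bar>g x\<bar> \<le> C"
    "\<And>a b. a \<le> b \<Longrightarrow> v b - v a = (LINT x:{a..b}|lborel. g x)"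
    "AE x in lebesgue. (v has_real_derivative g x) (at x)"
proof -
  obtain g where g: "g \<in> borel_measurable borel" "\<And>x. \<bar>g x\<bar> \<le> C"
    "\<And>a b. a \<le> b \<Longrightarrow> v b - v a = (LINT x:{a..b}|lborel. g x)"
    using lipschitz_real_has_density[OF v] by blast
  show thesis
    by (rule that[OF g AE_has_derivative_integral[OF g]])
qed

section \<open>Lipschitz constants and bounded Lipschitz functions\<close>

text \<open>The infimum of the Lipschitz constants is itself one, because each of them bounds every
  difference quotient.\<close>

lemma lipschitz_on_Lip:
  assumes "lipschitz p"
  shows "(Lip p)-lipschitz_on UNIV p"
proof -
  let ?S = "{C. C-lipschitz_on UNIV p}"
  have ne: "?S \<noteq> {}" using assms by (auto simp: lipschitz_def)
  have nn: "C \<ge> 0" if "C \<in> ?S" for C using that lipschitz_on_nonneg by auto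
  show ?thesis
  proof (rule lipschitz_onI)
    show "0 \<le> Lip p" unfolding Lip_def using ne nn by (rule cInf_greatest)
    fix x y
    show "dist (p x) (p y) \<le> Lip p * dist x y"
    proof (cases "x = y")
      case False
      have "dist (p x) (p y) / dist x y \<le> Lip p"
        unfolding Lip_def using ne False
        by (intro cInf_greatest) (auto simp: divide_le_eq dest!: lipschitz_onD)
      then show ?thesis using False by (simp add: divide_le_eq)
    qed simp
  qed
qed

lemma Lip_le: "C-lipschitz_on UNIV p \<Longrightarrow> Lip p \<le> C"
  unfolding Lip_def by (rule cInf_lower) (auto intro!: bdd_belowI[of _ 0] lipschitz_on_nonneg)

lemma Lip_nonneg: "lipschitz p \<Longrightarrow> 0 \<le> Lip p"
  using lipschitz_on_Lip lipschitz_on_nonneg by blast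

lemma lipschitzI: "C-lipschitz_on UNIV p \<Longrightarrow> lipschitz p"
  by (auto simp: lipschitz_def)

lemma lipschitz_realI:
  fixes f :: "'a::metric_space \<Rightarrow> real"
  assumes "0 \<le> C" "\<And>x y. f x - f y \<le> C * dist x y"
  shows "C-lipschitz_on UNIV f"
proof (rule lipschitz_onI)
  show "dist (f x) (f y) \<le> C * dist x y" for x y
    using assms(2)[of x y] assms(2)[of y x] by (auto simp: dist_real_def abs_le_iff dist_commute)
qed (use assms in simp)

lemma lipschitz_realD:
  fixes f :: "'a::metric_space \<Rightarrow> real"
  assumes "C-lipschitz_on S f" "x \<in> S" "y \<in> S"
  shows "\<bar>f x - f y\<bar> \<le> C * dist x y"
  using lipschitz_onD[OF assms] by (simp add: dist_real_def)

lemma lipschitz_on_max: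
  fixes f g :: "'a::metric_space \<Rightarrow> real"
  assumes "C-lipschitz_on UNIV f" "D-lipschitz_on UNIV g"
  shows "(max C D)-lipschitz_on UNIV (\<lambda>x. max (f x) (g x))"
proof (rule lipschitz_realI)
  show "0 \<le> max C D" using lipschitz_on_nonneg[OF assms(1)] by simp
  fix x y
  have "f x - f y \<le> C * dist x y" "g x - g y \<le> D * dist x y"
    using lipschitz_realD[OF assms(1), of x y] lipschitz_realD[OF assms(2), of x y] by auto
  moreover have "C * dist x y \<le> max C D * dist x y" "D * dist x y \<le> max C D * dist x y"
    by (auto intro: mult_right_mono)
  ultimately show "max (f x) (g x) - max (f y) (g y) \<le> max C D * dist x y"
    by (auto simp: max_def split: if_splits)
qed

lemma lipschitz_on_min:
  fixes f g :: "'a::metric_space \<Rightarrow> real"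
  assumes "C-lipschitz_on UNIV f" "D-lipschitz_on UNIV g"
  shows "(max C D)-lipschitz_on UNIV (\<lambda>x. min (f x) (g x))"
proof -
  have "(max C D)-lipschitz_on UNIV (\<lambda>x. - max (- f x) (- g x))"
    using assms by (intro lipschitz_on_minus lipschitz_on_max)
  moreover have "- max (- f x) (- g x) = min (f x) (g x)" for x by (simp add: min_def max_def)
  ultimately show ?thesis by simp
qed

lemma lipschitz_on_dist: "1-lipschitz_on UNIV (\<lambda>x. dist z x)"
  by (rule lipschitz_realI) (metis dist_triangle2 diff_le_eq mult_1 add.commute dist_commute zero_le_one)+

lemma lipschitz_on_infdist: "1-lipschitz_on UNIV (\<lambda>x. infdist x A)"
  by (rule lipschitz_realI) (use infdist_triangle in \<open>auto simp: diff_le_eq add.commute\<close>)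

lemma lipschitz_add: "lipschitz f \<Longrightarrow> lipschitz g \<Longrightarrow> lipschitz (\<lambda>x. f x + g x :: real)"
  unfolding lipschitz_def using lipschitz_on_add by blast

lemma lipschitz_cmult: "lipschitz f \<Longrightarrow> lipschitz (\<lambda>x. a * f x :: real)"
  unfolding lipschitz_def using lipschitz_on_cmult_real by blast

lemma lipschitz_linear: "lipschitz f \<Longrightarrow> lipschitz g \<Longrightarrow> lipschitz (\<lambda>x. a * f x + b * g x :: real)"
  by (intro lipschitz_add lipschitz_cmult)

lemma lipschitz_const [simp]: "lipschitz (\<lambda>_. c)"
  using lipschitzI[OF lipschitz_on_constant] .

lemma lipschitz_compose: "lipschitz f \<Longrightarrow> lipschitz g \<Longrightarrow> lipschitz (f \<circ> g)"
  unfolding lipschitz_def by (meson lipschitz_on_compose lipschitz_on_subset subset_UNIV)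

lemma lipschitz_continuous: "lipschitz f \<Longrightarrow> continuous_on S f"
  unfolding lipschitz_def by (meson lipschitz_on_continuous_on continuous_on_subset subset_UNIV)

lemma borel_measurable_lipschitz: "lipschitz (f :: 'a::metric_space \<Rightarrow> 'b::metric_space) \<Longrightarrow> f \<in> borel_measurable borel"
  by (intro borel_measurable_continuous_onI lipschitz_continuous)

lemma bounded_lipschitzI:
  assumes "C-lipschitz_on UNIV f" "\<And>x. \<bar>f x\<bar> \<le> A"
  shows "bounded_lipschitz f"
  using assms unfolding bounded_lipschitz_def by (auto intro: lipschitzI simp: bounded_iff)

lemma bounded_lipschitzE:
  assumes "bounded_lipschitz f"
  obtains A where "0 \<le> A" "A-lipschitz_on UNIV f" "\<And>x. \<bar>f x\<bar> \<le> A"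
proof -
  obtain C where C: "C-lipschitz_on UNIV f" using assms by (auto simp: bounded_lipschitz_def lipschitz_def)
  obtain B where B: "\<And>x. \<bar>f x\<bar> \<le> B" using assms by (auto simp: bounded_lipschitz_def bounded_iff)
  show thesis
    using C B lipschitz_on_nonneg[OF C]
    by (intro that[of "max C B"]) (auto intro: lipschitz_on_mono max.coboundedI2)
qed

lemma bounded_lipschitz_linear:
  assumes "bounded_lipschitz f" "bounded_lipschitz g"
  shows "bounded_lipschitz (\<lambda>x. a * f x + b * g x)"
proof -
  obtain A where A: "A-lipschitz_on UNIV f" "\<And>x. \<bar>f x\<bar> \<le> A"
    using bounded_lipschitzE[OF assms(1)] by blast
  obtain B where B: "B-lipschitz_on UNIV g" "\<And>x. \<bar>g x\<bar> \<le> B"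
    using bounded_lipschitzE[OF assms(2)] by blast
  have "\<bar>a * f x + b * g x\<bar> \<le> \<bar>a\<bar> * A + \<bar>b\<bar> * B" for x
    using A(2)[of x] B(2)[of x]
    by (intro order_trans[OF abs_triangle_ineq] add_mono) (simp_all add: abs_mult mult_left_mono)
  then show ?thesis
    by (intro bounded_lipschitzI[OF lipschitz_on_add[OF lipschitz_on_cmult_real[OF A(1)] lipschitz_on_cmult_real[OF B(1)]]])
qed

lemma bounded_lipschitz_diff:
  "bounded_lipschitz f \<Longrightarrow> bounded_lipschitz g \<Longrightarrow> bounded_lipschitz (\<lambda>x. f x - g x)"
  using bounded_lipschitz_linear[of f g 1 "-1"] by simp

lemma bounded_lipschitz_const [simp]: "bounded_lipschitz (\<lambda>_. c)"
  by (auto intro!: bounded_lipschitzI[OF lipschitz_on_constant, of _ "\<bar>c\<bar>"])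

lemma bounded_lipschitz_mult:
  assumes "bounded_lipschitz f" "bounded_lipschitz g"
  shows "bounded_lipschitz (\<lambda>x. f x * g x)"
proof -
  obtain A where A: "0 \<le> A" "A-lipschitz_on UNIV f" "\<And>x. \<bar>f x\<bar> \<le> A"
    using bounded_lipschitzE[OF assms(1)] by blast
  obtain B where B: "0 \<le> B" "B-lipschitz_on UNIV g" "\<And>x. \<bar>g x\<bar> \<le> B"
    using bounded_lipschitzE[OF assms(2)] by blast
  have "(2 * A * B)-lipschitz_on UNIV (\<lambda>x. f x * g x)"
  proof (rule lipschitz_realI)
    fix x y
    have "f x * g x - f y * g y = f x * (g x - g y) + (f x - f y) * g y"
      by (simp add: algebra_simps)
    also have "\<dots> \<le> \<bar>f x\<bar> * \<bar>g x - g y\<bar> + \<bar>f x - f y\<bar> * \<bar>g y\<bar>"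
      by (metis abs_ge_self abs_mult add_mono)
    also have "\<dots> \<le> A * (B * dist x y) + (A * dist x y) * B"
      using A B lipschitz_realD[OF A(2)] lipschitz_realD[OF B(2)] by (intro add_mono mult_mono) auto
    finally show "f x * g x - f y * g y \<le> 2 * A * B * dist x y" by (simp add: algebra_simps)
  qed (use A B in simp)
  moreover have "\<bar>f x * g x\<bar> \<le> A * B" for x
    using A B by (auto simp: abs_mult intro: mult_mono)
  ultimately show ?thesis by (rule bounded_lipschitzI)
qed

lemma bounded_lipschitz_lipschitz: "bounded_lipschitz f \<Longrightarrow> lipschitz f"
  by (simp add: bounded_lipschitz_def)

lemma lipschitz_on_borel: "C-lipschitz_on UNIV f \<Longrightarrow> f \<in> borel_measurable borel"
  by (rule borel_measurable_lipschitz[OF lipschitzI])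

lemma bounded_lipschitz_borel: "bounded_lipschitz f \<Longrightarrow> f \<in> borel_measurable borel"
  by (rule borel_measurable_lipschitz[OF bounded_lipschitz_lipschitz])

lemma bounded_lipschitz_compose:
  "bounded_lipschitz f \<Longrightarrow> lipschitz g \<Longrightarrow> bounded_lipschitz (f \<circ> g)"
  unfolding bounded_lipschitz_def by (auto intro: lipschitz_compose bounded_subset simp: image_comp[symmetric])

text \<open>Lipschitz functions decreasing to the indicator of a closed set. For empty
  \<open>F\<close> the value of \<open>infdist\<close> is 0 and the cutoff is constantly 1, which is
  why convergence to the indicator is stated for nonempty sets.\<close>

definition cutoff :: "'a::metric_space set \<Rightarrow> nat \<Rightarrow> 'a \<Rightarrow> real" where
  "cutoff F n x = max 0 (1 - real n * infdist x F)"

lemma cutoff_bounds: "0 \<le> cutoff F n x" "cutoff F n x \<le> 1"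
  by (auto simp: cutoff_def infdist_nonneg)

lemma cutoff_eq_1: "x \<in> F \<Longrightarrow> cutoff F n x = 1"
  by (simp add: cutoff_def)

lemma cutoff_nonzeroD: "cutoff F n x \<noteq> 0 \<Longrightarrow> real n * infdist x F < 1"
  by (auto simp: cutoff_def split: if_splits)

lemma lipschitz_on_cutoff: "(real n)-lipschitz_on UNIV (cutoff F n)"
proof -
  have "(max 0 (0 + real n * 1))-lipschitz_on UNIV (\<lambda>x. max 0 (1 - real n * infdist x F))"
    unfolding diff_conv_add_uminus
    by (intro lipschitz_on_max lipschitz_on_constant lipschitz_on_add lipschitz_on_minus
          lipschitz_on_cmult_real_nonneg lipschitz_on_infdist) auto
  then show ?thesis by (simp add: cutoff_def[abs_def])
qed

lemma bounded_lipschitz_cutoff: "bounded_lipschitz (cutoff F n)"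
  using lipschitz_on_cutoff
  by (rule bounded_lipschitzI[where A=1]) (simp add: cutoff_bounds)

lemma cutoff_tendsto:
  assumes "closed F" "F \<noteq> {}"
  shows "(\<lambda>n. cutoff F n x) \<longlonglongrightarrow> indicator F x"
proof (cases "x \<in> F")
  case False
  then have d: "0 < infdist x F"
    using assms infdist_pos_not_in_closed by blast
  obtain N where N: "1 < real N * infdist x F"
    using d reals_Archimedean3 by blast
  have "cutoff F n x = 0" if "N \<le> n" for n
  proof -
    have "real N * infdist x F \<le> real n * infdist x F"
      using that d by (intro mult_right_mono) auto
    then show ?thesis using N by (simp add: cutoff_def)
  qed
  then have "eventually (\<lambda>n. cutoff F n x = 0) sequentially"
    by (auto simp: eventually_sequentially)
  then show ?thesis using False by (simp add: tendsto_eventually)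
qed (simp add: cutoff_eq_1)

section \<open>Density of bounded Lipschitz functions\<close>

locale finite_borel_measure = finite_measure M for M :: "'a::metric_space measure" +
  assumes sets_borel [measurable_cong]: "sets M = sets borel"
begin

lemma space_UNIV: "space M = UNIV"
  using sets_eq_imp_space_eq[OF sets_borel] by simp

lemma borel_measurable_iff: "f \<in> borel_measurable M \<longleftrightarrow> f \<in> borel_measurable borel"
  using sets_borel measurable_cong_sets by blast

lemma integrable_bounded:
  assumes "f \<in> borel_measurable borel" "\<And>x. \<bar>f x :: real\<bar> \<le> B"
  shows "integrable M f"
  using assms by (intro integrable_const_bound[of _ B]) (auto simp: borel_measurable_iff)

lemma integrable_bounded_lipschitz: "bounded_lipschitz f \<Longrightarrow> integrable M f"
  by (metis bounded_lipschitzE bounded_lipschitz_lipschitz borel_measurable_lipschitz integrable_bounded)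

lemma closed_outer_open:
  assumes F: "closed F" and e: "0 < e"
  obtains U where "open U" "F \<subseteq> U" "measure M (U - F) < e"
proof (cases "F = {}")
  case False
  define U where "U n = {x. infdist x F < inverse (real (Suc n))}" for n
  have U: "open (U n)" "F \<subseteq> U n" for n
    unfolding U_def by (auto intro!: open_Collect_less continuous_intros)
  have "(\<lambda>n. measure M (U n - F)) \<longlonglongrightarrow> measure M (\<Inter>n. U n - F)"
  proof (rule finite_Lim_measure_decseq)
    show "range (\<lambda>n. U n - F) \<subseteq> sets M" using U F by (auto simp: sets_borel)
    have "inverse (real (Suc (Suc n))) \<le> inverse (real (Suc n))" for n by (intro le_imp_inverse_le) auto
    then show "decseq (\<lambda>n. U n - F)" by (intro decseq_SucI) (auto simp: U_def elim: less_le_trans)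
  qed
  also have "(\<Inter>n. U n - F) = {}"
  proof (intro equals0I)
    fix x assume x: "x \<in> (\<Inter>n. U n - F)"
    then have "0 < infdist x F" using F False by (intro infdist_pos_not_in_closed) auto
    then obtain n where "inverse (real (Suc n)) < infdist x F" using reals_Archimedean by blast
    then show False using x by (auto simp: U_def dest: spec[of _ n])
  qed
  finally have "eventually (\<lambda>n. measure M (U n - F) < e) sequentially"
    using e by (intro order_tendstoD(2)[of _ 0]) simp_all
  then obtain n where "measure M (U n - F) < e" by (auto simp: eventually_sequentially)
  then show thesis using that[of "U n"] U by blast
qed (use that[of "{}"] e in simp)

lemma integrable_indicator: "A \<in> sets borel \<Longrightarrow> integrable M (indicator A :: 'a \<Rightarrow> real)"
  by (intro integrable_real_indicator) (auto simp: sets_borel less_top[symmetric])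

lemma cutoff_L1_tendsto:
  assumes F: "closed F" "F \<noteq> {}"
  shows "(\<lambda>n. LINT x|M. \<bar>cutoff F n x - indicator F x\<bar>) \<longlonglongrightarrow> 0"
proof -
  have "(\<lambda>n. LINT x|M. \<bar>cutoff F n x - indicator F x\<bar>) \<longlonglongrightarrow> (LINT x|M. 0)"
  proof (rule integral_dominated_convergence[where w="\<lambda>_. 1"])
    show "AE x in M. (\<lambda>n. \<bar>cutoff F n x - indicator F x\<bar>) \<longlonglongrightarrow> 0"
      using cutoff_tendsto[OF F] by (intro AE_I2 tendsto_rabs_zero) (simp add: LIM_zero)
    show "(\<lambda>x. \<bar>cutoff F n x - indicator F x\<bar>) \<in> borel_measurable M" for n
      using F bounded_lipschitz_borel[OF bounded_lipschitz_cutoff[of F n]]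
      by (auto simp: borel_measurable_iff)
    show "AE x in M. norm \<bar>cutoff F n x - indicator F x\<bar> \<le> 1" for n
    proof (intro AE_I2)
      show "norm \<bar>cutoff F n x - indicator F x\<bar> \<le> 1" for x
        using cutoff_bounds[of F n x] by (auto simp: indicator_def abs_le_iff)
    qed
  qed auto
  then show ?thesis by simp
qed

lemma integrable_times_bounded:
  fixes f h :: "'a \<Rightarrow> real"
  assumes h: "h \<in> borel_measurable borel" "\<And>x. \<bar>h x\<bar> \<le> B" and f: "integrable M f"
  shows "integrable M (\<lambda>x. f x * h x)"
proof (rule Bochner_Integration.integrable_bound[of M "\<lambda>x. B * f x"])
  show "(\<lambda>x. f x * h x) \<in> borel_measurable M" using h(1) f borel_measurable_iff[of h] by auto
  show "AE x in M. norm (f x * h x) \<le> norm (B * f x)"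
    using h(2) order_trans[OF abs_ge_zero h(2)] by (intro AE_I2) (simp add: abs_mult mult.commute[of B] mult_left_mono)
qed (use f in simp)

lemma integral_times_le:
  fixes f h :: "'a \<Rightarrow> real"
  assumes h: "h \<in> borel_measurable borel" "\<And>x. \<bar>h x\<bar> \<le> B" and f: "integrable M f"
  shows "\<bar>LINT x|M. f x * h x\<bar> \<le> B * (LINT x|M. \<bar>f x\<bar>)"
proof -
  have "\<bar>LINT x|M. f x * h x\<bar> \<le> (LINT x|M. \<bar>f x * h x\<bar>)" by (rule integral_abs_bound)
  also have "\<dots> \<le> (LINT x|M. B * \<bar>f x\<bar>)"
  proof (rule integral_mono)
    show "\<bar>f x * h x\<bar> \<le> B * \<bar>f x\<bar>" for x using h(2)[of x] by (simp add: abs_mult mult.commute[of B] mult_left_mono)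
  qed (use integrable_times_bounded[OF h f] f in \<open>auto intro: integrable_abs\<close>)
  finally show ?thesis by simp
qed

lemma integral_times_tendsto:
  fixes f h :: "'a \<Rightarrow> real"
  assumes h: "h \<in> borel_measurable borel" "\<And>x. \<bar>h x\<bar> \<le> B"
    and i: "\<And>n. integrable M (s n)" "integrable M f" and s: "(\<lambda>n. LINT x|M. \<bar>s n x - f x\<bar>) \<longlonglongrightarrow> 0"
  shows "(\<lambda>n. LINT x|M. s n x * h x) \<longlonglongrightarrow> (LINT x|M. f x * h x)"
proof (rule LIM_zero_cancel, rule Lim_null_comparison)
  show "(\<lambda>n. B * (LINT x|M. \<bar>s n x - f x\<bar>)) \<longlonglongrightarrow> 0" by (rule tendsto_mult_right_zero[OF s])
  have "norm ((LINT x|M. s n x * h x) - (LINT x|M. f x * h x)) \<le> B * (LINT x|M. \<bar>s n x - f x\<bar>)" for n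
    using integral_times_le[OF h, of "\<lambda>x. s n x - f x"] i integrable_times_bounded[OF h i(1)] integrable_times_bounded[OF h i(2)]
    by (simp add: left_diff_distrib)
  then show "\<forall>\<^sub>F n in sequentially. norm ((LINT x|M. s n x * h x) - (LINT x|M. f x * h x)) \<le> B * (LINT x|M. \<bar>s n x - f x\<bar>)"
    by simp
qed

lemma L1_tendsto_linear:
  fixes f g :: "'a \<Rightarrow> real"
  assumes i: "\<And>n. integrable M (s n)" "\<And>n. integrable M (t n)" "integrable M f" "integrable M g"
    and s: "(\<lambda>n. LINT x|M. \<bar>s n x - f x\<bar>) \<longlonglongrightarrow> 0" and t: "(\<lambda>n. LINT x|M. \<bar>t n x - g x\<bar>) \<longlonglongrightarrow> 0"
  shows "(\<lambda>n. LINT x|M. \<bar>a * s n x + b * t n x - (a * f x + b * g x)\<bar>) \<longlonglongrightarrow> 0"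
proof (rule Lim_null_comparison)
  show "\<forall>\<^sub>F n in sequentially. norm (LINT x|M. \<bar>a * s n x + b * t n x - (a * f x + b * g x)\<bar>)
    \<le> \<bar>a\<bar> * (LINT x|M. \<bar>s n x - f x\<bar>) + \<bar>b\<bar> * (LINT x|M. \<bar>t n x - g x\<bar>)"
  proof (intro always_eventually allI)
    fix n
    have "(LINT x|M. \<bar>a * s n x + b * t n x - (a * f x + b * g x)\<bar>)
      \<le> (LINT x|M. \<bar>a\<bar> * \<bar>s n x - f x\<bar> + \<bar>b\<bar> * \<bar>t n x - g x\<bar>)"
    proof (rule integral_mono)
      fix x
      have "a * s n x + b * t n x - (a * f x + b * g x) = a * (s n x - f x) + b * (t n x - g x)"
        by (simp add: algebra_simps)
      then show "\<bar>a * s n x + b * t n x - (a * f x + b * g x)\<bar> \<le> \<bar>a\<bar> * \<bar>s n x - f x\<bar> + \<bar>b\<bar> * \<bar>t n x - g x\<bar>"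
        by (metis abs_mult abs_triangle_ineq)
    qed (use i in auto)
    also have "\<dots> = \<bar>a\<bar> * (LINT x|M. \<bar>s n x - f x\<bar>) + \<bar>b\<bar> * (LINT x|M. \<bar>t n x - g x\<bar>)"
      using i by (subst Bochner_Integration.integral_add) auto
    finally show "norm (LINT x|M. \<bar>a * s n x + b * t n x - (a * f x + b * g x)\<bar>)
      \<le> \<bar>a\<bar> * (LINT x|M. \<bar>s n x - f x\<bar>) + \<bar>b\<bar> * (LINT x|M. \<bar>t n x - g x\<bar>)" by simp
  qed
  show "(\<lambda>n. \<bar>a\<bar> * (LINT x|M. \<bar>s n x - f x\<bar>) + \<bar>b\<bar> * (LINT x|M. \<bar>t n x - g x\<bar>)) \<longlonglongrightarrow> 0"
    using tendsto_add[OF tendsto_mult[OF tendsto_const s] tendsto_mult[OF tendsto_const t]] by simp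
qed

lemma indicator_UN_L1_tendsto:
  assumes A: "\<And>i::nat. A i \<in> sets borel" "disjoint_family A"
  shows "(\<lambda>n. LINT x|M. \<bar>(\<Sum>i<n. indicator (A i) x) - indicator (\<Union>i. A i) x :: real\<bar>) \<longlonglongrightarrow> 0"
proof -
  have sums: "(\<lambda>i. indicator (A i) x :: real) sums indicator (\<Union>i. A i) x" for x
    using A(2) by (intro indicator_sums) (auto simp: disjoint_family_on_def)
  have le: "\<bar>(\<Sum>i<n. indicator (A i) x) - indicator (\<Union>i. A i) x :: real\<bar> \<le> 1" for n x
  proof -
    have "(\<Sum>i<n. indicator (A i) x :: real) \<le> indicator (\<Union>i. A i) x"
      using sum_le_suminf[OF sums_summable[OF sums[of x]], of "{..<n}"] sums_unique[OF sums[of x]] by simp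
    moreover have "0 \<le> (\<Sum>i<n. indicator (A i) x :: real)" "indicator (\<Union>i. A i) x \<le> (1 :: real)"
      by (auto intro: sum_nonneg simp: indicator_def)
    ultimately show ?thesis by linarith
  qed
  have U: "(\<Union>i. A i) \<in> sets borel" using A(1) by auto
  have "(\<lambda>n. LINT x|M. \<bar>(\<Sum>i<n. indicator (A i) x) - indicator (\<Union>i. A i) x :: real\<bar>) \<longlonglongrightarrow> (LINT x|M. 0)"
  proof (rule integral_dominated_convergence[where w="\<lambda>_. 1"])
    show "AE x in M. (\<lambda>n. \<bar>(\<Sum>i<n. indicator (A i) x) - indicator (\<Union>i. A i) x :: real\<bar>) \<longlonglongrightarrow> 0"
      using sums by (intro AE_I2 tendsto_rabs_zero) (simp add: LIM_zero sums_def)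
    show "(\<lambda>x. \<bar>(\<Sum>i<n. indicator (A i) x) - indicator (\<Union>i. A i) x :: real\<bar>) \<in> borel_measurable M" for n
      using A(1) U by (simp add: sets_borel)
  qed (use le in auto)
  then show ?thesis by simp
qed

text \<open>Induction over integrable functions with convergence in L1 as the limit case, in place
  of pointwise convergence under a dominating function. It suits properties that are linear and
  continuous in L1.\<close>

lemma integrable_L1_induct [consumes 1, case_names indicator linear limit]:
  fixes f :: "'a \<Rightarrow> real"
  assumes "integrable M f" and ind: "\<And>A. A \<in> sets borel \<Longrightarrow> P (indicator A)"
    and lin: "\<And>f g a b. integrable M f \<Longrightarrow> integrable M g \<Longrightarrow> P f \<Longrightarrow> P g \<Longrightarrow> P (\<lambda>x. a * f x + b * g x)"
    and lim: "\<And>f s. integrable M f \<Longrightarrow> (\<And>n::nat. integrable M (s n)) \<Longrightarrow> (\<And>n. P (s n)) \<Longrightarrow> (\<lambda>n. LINT x|M. \<bar>s n x - f x\<bar>) \<longlonglongrightarrow> 0 \<Longrightarrow> P f"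
  shows "P f"
  using assms(1)
proof (induction rule: integrable_induct)
  case (base A c)
  then have A: "A \<in> sets borel" by (simp add: sets_borel)
  show ?case
    using lin[OF integrable_indicator[OF A] integrable_indicator[OF A] ind[OF A] ind[OF A], of c 0] by (simp add: mult.commute)
next
  case (add f g)
  then show ?case using lin[of f g 1 1] by simp
next
  case (lim f s)
  have "(\<lambda>i. LINT x|M. \<bar>s i x - f x\<bar>) \<longlonglongrightarrow> (LINT x|M. 0)"
  proof (rule integral_dominated_convergence[where w="\<lambda>x. 3 * \<bar>f x\<bar>"])
    show "AE x in M. (\<lambda>i. \<bar>s i x - f x\<bar>) \<longlonglongrightarrow> 0"
      using lim by (intro AE_I2 tendsto_rabs_zero) (simp add: LIM_zero)
    show "AE x in M. norm \<bar>s i x - f x\<bar> \<le> 3 * \<bar>f x\<bar>" for i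
    proof (intro AE_I2)
      fix x assume "x \<in> space M"
      then have "\<bar>s i x\<bar> \<le> 2 * \<bar>f x\<bar>" using lim by simp
      then show "norm \<bar>s i x - f x\<bar> \<le> 3 * \<bar>f x\<bar>" by simp
    qed
  qed (use lim in auto)
  then show ?case using lim by (intro assms(4)[of f s]) auto
qed

text \<open>The approximable functions form a linear space closed in L1. It contains the indicators
  of closed sets, through their cutoffs, and then all Borel indicators: closed sets are an
  intersection-stable generator, complements are linear combinations and disjoint unions are limits
  in L1.\<close>

lemma bounded_lipschitz_dense_seq:
  fixes f :: "'a \<Rightarrow> real"
  assumes "integrable M f"
  obtains g :: "nat \<Rightarrow> 'a \<Rightarrow> real" where "\<And>n. bounded_lipschitz (g n)" "(\<lambda>n. LINT x|M. \<bar>g n x - f x\<bar>) \<longlonglongrightarrow> 0"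
proof -
  define P where "P f \<longleftrightarrow> (\<exists>g :: nat \<Rightarrow> 'a \<Rightarrow> real. (\<forall>n. bounded_lipschitz (g n)) \<and> (\<lambda>n. LINT x|M. \<bar>g n x - f x\<bar>) \<longlonglongrightarrow> 0)" for f
  have P_lip: "P f" if "bounded_lipschitz f" for f unfolding P_def by (rule exI[of _ "\<lambda>_. f"]) (simp add: that)
  have lin: "P (\<lambda>x. a * f x + b * g x)" if fg: "integrable M f" "integrable M g" "P f" "P g" for f g a b
  proof -
    obtain s t where s: "\<And>n::nat. bounded_lipschitz (s n)" "(\<lambda>n. LINT x|M. \<bar>s n x - f x\<bar>) \<longlonglongrightarrow> 0"
      and t: "\<And>n::nat. bounded_lipschitz (t n)" "(\<lambda>n. LINT x|M. \<bar>t n x - g x\<bar>) \<longlonglongrightarrow> 0"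
      using fg(3,4) unfolding P_def by blast
    show ?thesis
      unfolding P_def
      by (rule exI[of _ "\<lambda>n x. a * s n x + b * t n x"])
        (intro conjI allI bounded_lipschitz_linear s(1) t(1) L1_tendsto_linear fg(1,2) s(2) t(2) integrable_bounded_lipschitz)
  qed
  have lim: "P f" if f: "integrable M f" and s: "\<And>n::nat. integrable M (s n)" "\<And>n. P (s n)" "(\<lambda>n. LINT x|M. \<bar>s n x - f x\<bar>) \<longlonglongrightarrow> 0" for f s
  proof -
    \<comment> \<open>Diagonal choice: an approximation of \<open>s n\<close> with error
      \<open>1 / (n + 1)\<close> for each \<open>n\<close>.\<close>
    have "\<exists>g. bounded_lipschitz g \<and> (LINT x|M. \<bar>g x - s n x\<bar>) < inverse (real (Suc n))" for n
    proof -
      obtain g where g: "\<And>m::nat. bounded_lipschitz (g m)" "(\<lambda>m. LINT x|M. \<bar>g m x - s n x\<bar>) \<longlonglongrightarrow> 0"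
        using s(2)[of n] unfolding P_def by blast
      have "eventually (\<lambda>m. (LINT x|M. \<bar>g m x - s n x\<bar>) < inverse (real (Suc n))) sequentially"
        by (rule order_tendstoD(2)[OF g(2)]) simp
      then show ?thesis using g(1) by (auto simp: eventually_sequentially)
    qed
    then obtain g where g: "\<And>n. bounded_lipschitz (g n)" "\<And>n. (LINT x|M. \<bar>g n x - s n x\<bar>) < inverse (real (Suc n))"
      by metis
    have "(\<lambda>n. LINT x|M. \<bar>g n x - f x\<bar>) \<longlonglongrightarrow> 0"
    proof (rule Lim_null_comparison)
      show "\<forall>\<^sub>F n in sequentially. norm (LINT x|M. \<bar>g n x - f x\<bar>) \<le> inverse (real (Suc n)) + (LINT x|M. \<bar>s n x - f x\<bar>)"
      proof (intro always_eventually allI)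
        fix n
        note i = integrable_bounded_lipschitz[OF g(1)[of n]] s(1)[of n] f
        have "(LINT x|M. \<bar>g n x - f x\<bar>) \<le> (LINT x|M. \<bar>g n x - s n x\<bar> + \<bar>s n x - f x\<bar>)"
          using i by (intro integral_mono) auto
        also have "\<dots> = (LINT x|M. \<bar>g n x - s n x\<bar>) + (LINT x|M. \<bar>s n x - f x\<bar>)"
          using i by (intro Bochner_Integration.integral_add) auto
        finally show "norm (LINT x|M. \<bar>g n x - f x\<bar>) \<le> inverse (real (Suc n)) + (LINT x|M. \<bar>s n x - f x\<bar>)"
          using g(2)[of n] by simp
      qed
      show "(\<lambda>n. inverse (real (Suc n)) + (LINT x|M. \<bar>s n x - f x\<bar>)) \<longlonglongrightarrow> 0"
        using tendsto_add[OF LIMSEQ_inverse_real_of_nat s(3)] by simp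
    qed
    then show ?thesis unfolding P_def using g(1) by blast
  qed
  have closed: "P (indicator F)" if F: "closed F" for F
  proof (cases "F = {}")
    case False
    show ?thesis
      unfolding P_def by (intro exI[of _ "cutoff F"] conjI allI bounded_lipschitz_cutoff cutoff_L1_tendsto[OF F False])
  qed (use P_lip[of "\<lambda>_. 0"] in \<open>simp add: indicator_def[abs_def]\<close>)
  have ind: "P (indicator A)" if "A \<in> sets borel" for A
  proof -
    have "A \<in> sigma_sets UNIV (Collect closed)" using that by (simp add: borel_eq_closed)
    then show ?thesis
    proof (induction rule: sigma_sets_induct_disjoint[rotated 2, consumes 1, case_names basic empty compl union])
      case (compl A)
      then have A: "A \<in> sets borel" by (simp add: borel_eq_closed)
      have "(indicator (UNIV - A) :: 'a \<Rightarrow> real) = (\<lambda>x. 1 * 1 + (-1) * indicator A x)" by (auto simp: indicator_def)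
      then show ?case using lin[OF _ integrable_indicator[OF A] P_lip[of "\<lambda>_. 1"] compl(2), of 1 "-1"] by simp
    next
      case (union A)
      then have A: "A i \<in> sets borel" for i by (auto simp: borel_eq_closed)
      have s: "integrable M (\<lambda>x. \<Sum>i<n. indicator (A i) x :: real)" "P (\<lambda>x. \<Sum>i<n. indicator (A i) x)" for n
      proof (induction n)
        case (Suc n)
        case 2
        show ?case using lin[OF Suc(1) integrable_indicator[OF A] Suc(2) union(3), of 1 1] by (simp add: add.commute)
      qed (use integrable_indicator[OF A] P_lip[OF bounded_lipschitz_const[of 0]] in auto)
      show ?case
        using A union(1) by (intro lim[OF _ s indicator_UN_L1_tendsto] integrable_indicator) auto
    qed (use P_lip[OF bounded_lipschitz_const[of 0]] in \<open>auto intro: closed simp: Int_stable_def\<close>)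
  qed
  have "P f" using assms by (induction rule: integrable_L1_induct) (auto intro: ind lin lim)
  then show thesis unfolding P_def using that by blast
qed

end

section \<open>Comparison and addition of finite Borel measures\<close>

lemma finite_borel_measureI:
  assumes "sets M = sets borel" "emeasure M UNIV < \<infinity>"
  shows "finite_borel_measure M"
  using assms
  by (simp add: finite_borel_measure_def finite_borel_measure_axioms_def finite_measureI
      sets_eq_imp_space_eq[OF assms(1)])

lemma integral_ennreal:
  assumes "finite_borel_measure M" "f \<in> borel_measurable borel" "\<And>x. 0 \<le> f x" "\<And>x. f x \<le> (B::real)"
  shows "ennreal (LINT x|M. f x) = (\<integral>\<^sup>+x. f x \<partial>M)"
proof -
  interpret finite_borel_measure M by fact
  have "integrable M f"
    using assms by (intro integrable_bounded[of f B]) auto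
  then show ?thesis
    using assms by (intro nn_integral_eq_integral[symmetric]) auto
qed

lemma integral_mono_finite_borel:
  assumes M: "finite_borel_measure M" and N: "finite_borel_measure N"
    and le: "\<And>A. A \<in> sets borel \<Longrightarrow> emeasure M A \<le> emeasure N A"
    and f: "f \<in> borel_measurable borel" "\<And>x. 0 \<le> f x" "\<And>x. f x \<le> (B::real)"
  shows "(LINT x|M. f x) \<le> (LINT x|N. f x)"
proof -
  interpret M: finite_borel_measure M by fact
  interpret N: finite_borel_measure N by fact
  have "M \<le> N" using le by (subst le_measure) (simp_all add: M.sets_borel N.sets_borel)
  have "ennreal (LINT x|M. f x) \<le> ennreal (LINT x|N. f x)"
    unfolding integral_ennreal[OF M f] integral_ennreal[OF N f]
    using \<open>M \<le> N\<close> by (intro nn_integral_mono_measure) (simp_all add: M.sets_borel N.sets_borel f M.borel_measurable_iff)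
  then show ?thesis using f by (simp add: ennreal_le_iff)
qed

definition plus_measure :: "'a::topological_space measure \<Rightarrow> 'a measure \<Rightarrow> 'a measure" where
  "plus_measure M N = sum_measure (\<lambda>i. if i = 0 then M else if i = 1 then N else null_measure borel)"

lemma sets_plus_measure [simp, measurable_cong]: "sets (plus_measure M N) = sets borel"
  by (simp add: plus_measure_def)

lemma emeasure_plus_measure:
  assumes "sets M = sets borel" "sets N = sets borel" "A \<in> sets borel"
  shows "emeasure (plus_measure M N) A = emeasure M A + emeasure N A"
  unfolding plus_measure_def using assms
  by (subst emeasure_sum_measure, simp, simp) (subst suminf_finite[of "{0,1}"], auto)

lemma finite_borel_plus_measure:
  assumes "finite_borel_measure M" "finite_borel_measure N"
  shows "finite_borel_measure (plus_measure M N)"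
proof -
  interpret M: finite_borel_measure M by fact
  interpret N: finite_borel_measure N by fact
  have "emeasure (plus_measure M N) UNIV < \<infinity>"
    by (simp add: emeasure_plus_measure M.sets_borel N.sets_borel less_top[symmetric])
  then show ?thesis
    by (intro finite_borel_measureI) simp_all
qed

text \<open>Density in L1 of the sum of the two measures yields a single sequence that is good for
  both.\<close>

lemma common_approximation:
  fixes s :: "'a::metric_space \<Rightarrow> real"
  assumes M: "finite_borel_measure M" and N: "finite_borel_measure N" and s: "s \<in> borel_measurable borel" "\<And>x. \<bar>s x\<bar> \<le> B"
  obtains g :: "nat \<Rightarrow> 'a \<Rightarrow> real" where "\<And>n. bounded_lipschitz (g n)"
    "(\<lambda>n. LINT x|M. \<bar>g n x - s x\<bar>) \<longlonglongrightarrow> 0" "(\<lambda>n. LINT x|N. \<bar>g n x - s x\<bar>) \<longlonglongrightarrow> 0"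
proof -
  interpret M: finite_borel_measure M by fact
  interpret N: finite_borel_measure N by fact
  define R where "R = plus_measure M N"
  have R: "finite_borel_measure R" unfolding R_def by (rule finite_borel_plus_measure[OF M N])
  then interpret R: finite_borel_measure R .
  obtain g :: "nat \<Rightarrow> 'a \<Rightarrow> real" where g: "\<And>n. bounded_lipschitz (g n)" "(\<lambda>n. LINT x|R. \<bar>g n x - s x\<bar>) \<longlonglongrightarrow> 0"
    by (rule R.bounded_lipschitz_dense_seq[OF R.integrable_bounded[OF s]]) blast
  have le: "(LINT x|M. \<bar>g n x - s x\<bar>) \<le> (LINT x|R. \<bar>g n x - s x\<bar>)" "(LINT x|N. \<bar>g n x - s x\<bar>) \<le> (LINT x|R. \<bar>g n x - s x\<bar>)" for n
  proof -
    obtain C where C: "\<And>x. \<bar>g n x\<bar> \<le> C" using bounded_lipschitzE[OF g(1)[of n]] by blast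
    have m: "(\<lambda>x. \<bar>g n x - s x\<bar>) \<in> borel_measurable borel"
      using s(1) bounded_lipschitz_borel[OF g(1)[of n]] by measurable
    have "\<bar>g n x - s x\<bar> \<le> C + B" for x using C[of x] s(2)[of x] by (simp add: abs_le_iff)
    then show "(LINT x|M. \<bar>g n x - s x\<bar>) \<le> (LINT x|R. \<bar>g n x - s x\<bar>)" "(LINT x|N. \<bar>g n x - s x\<bar>) \<le> (LINT x|R. \<bar>g n x - s x\<bar>)"
      using m by (auto intro!: integral_mono_finite_borel[where B="C+B"] M N R[unfolded R_def]
          simp: R_def emeasure_plus_measure M.sets_borel N.sets_borel)
  qed
  show thesis
    by (rule that[OF g(1)]; rule tendsto_sandwich[OF _ _ tendsto_const g(2)]) (use le in \<open>auto intro!: always_eventually\<close>)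
qed

section \<open>Linear functionals on bounded Lipschitz functions that are bounded by an
  integral\<close>

locale lipschitz_functional = finite_borel_measure M
  for M :: "'a::metric_space measure" and \<Lambda> :: "('a \<Rightarrow> real) \<Rightarrow> real" and C :: real +
  assumes linear: "bounded_lipschitz f \<Longrightarrow> bounded_lipschitz g \<Longrightarrow>
      \<Lambda> (\<lambda>x. a * f x + b * g x) = a * \<Lambda> f + b * \<Lambda> g"
    and bound: "bounded_lipschitz f \<Longrightarrow> \<bar>\<Lambda> f\<bar> \<le> C * (LINT x|M. \<bar>f x\<bar>)"
    and C_nonneg: "0 \<le> C"
begin

lemma diff: "bounded_lipschitz f \<Longrightarrow> bounded_lipschitz g \<Longrightarrow> \<Lambda> (\<lambda>x. f x - g x) = \<Lambda> f - \<Lambda> g"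
  using linear[of f g 1 "-1"] by simp

lemma dist_bound:
  assumes "bounded_lipschitz f" "bounded_lipschitz g" "integrable M h"
  shows "\<bar>\<Lambda> f - \<Lambda> g\<bar> \<le> C * ((LINT x|M. \<bar>f x - h x\<bar>) + (LINT x|M. \<bar>g x - h x\<bar>))"
proof -
  have i: "integrable M f" "integrable M g" using assms integrable_bounded_lipschitz by auto
  have "\<bar>\<Lambda> f - \<Lambda> g\<bar> \<le> C * (LINT x|M. \<bar>f x - g x\<bar>)"
    using bound[OF bounded_lipschitz_diff[OF assms(1,2)]] diff[OF assms(1,2)] by simp
  also have "(LINT x|M. \<bar>f x - g x\<bar>) \<le> (LINT x|M. \<bar>f x - h x\<bar> + \<bar>g x - h x\<bar>)"
    using i assms by (intro integral_mono) auto
  also have "\<dots> = (LINT x|M. \<bar>f x - h x\<bar>) + (LINT x|M. \<bar>g x - h x\<bar>)"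
    using i assms by (intro Bochner_Integration.integral_add) auto
  finally show ?thesis using C_nonneg by (simp add: mult_left_mono)
qed

lemma extension_exists:
  assumes f: "integrable M f"
  obtains v where "\<And>g. bounded_lipschitz g \<Longrightarrow> \<bar>\<Lambda> g - v\<bar> \<le> C * (LINT x|M. \<bar>g x - f x\<bar>)"
proof -
  obtain s :: "nat \<Rightarrow> 'a \<Rightarrow> real" where s: "\<And>n. bounded_lipschitz (s n)"
    "(\<lambda>n. LINT x|M. \<bar>s n x - f x\<bar>) \<longlonglongrightarrow> 0"
    by (rule bounded_lipschitz_dense_seq[OF f]) blast
  let ?d = "\<lambda>n. LINT x|M. \<bar>s n x - f x\<bar>"
  have "Cauchy (\<lambda>n. \<Lambda> (s n))"
  proof (rule metric_CauchyI)
    fix e :: real assume e: "0 < e"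
    have "(\<lambda>n. C * ?d n) \<longlonglongrightarrow> C * 0" by (intro tendsto_intros s)
    then have "eventually (\<lambda>n. C * ?d n < e/2) sequentially"
      using e order_tendstoD(2)[of _ 0 _ "e/2"] by simp
    then obtain N where N: "\<And>n. n \<ge> N \<Longrightarrow> C * ?d n < e/2" by (auto simp: eventually_sequentially)
    show "\<exists>N. \<forall>m\<ge>N. \<forall>n\<ge>N. dist (\<Lambda> (s m)) (\<Lambda> (s n)) < e"
    proof (intro exI allI impI)
      fix m n assume "m \<ge> N" "n \<ge> N"
      then show "dist (\<Lambda> (s m)) (\<Lambda> (s n)) < e"
        using dist_bound[OF s(1)[of m] s(1)[of n] f] N[of m] N[of n]
        by (simp add: dist_real_def distrib_left)
    qed
  qed
  then obtain v where v: "(\<lambda>n. \<Lambda> (s n)) \<longlonglongrightarrow> v" using Cauchy_convergent convergent_def by blast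
  have "\<bar>\<Lambda> g - v\<bar> \<le> C * (LINT x|M. \<bar>g x - f x\<bar>)" if g: "bounded_lipschitz g" for g
  proof (rule LIMSEQ_le)
    show "(\<lambda>n. \<bar>\<Lambda> g - \<Lambda> (s n)\<bar>) \<longlonglongrightarrow> \<bar>\<Lambda> g - v\<bar>"
      using v by (intro tendsto_intros)
    show "(\<lambda>n. C * ((LINT x|M. \<bar>g x - f x\<bar>) + ?d n)) \<longlonglongrightarrow> C * (LINT x|M. \<bar>g x - f x\<bar>)"
      using s(2) by (auto intro!: tendsto_eq_intros)
    show "\<exists>N. \<forall>n\<ge>N. \<bar>\<Lambda> g - \<Lambda> (s n)\<bar> \<le> C * ((LINT x|M. \<bar>g x - f x\<bar>) + ?d n)"
      using dist_bound[OF g s(1) f] by blast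
  qed
  then show thesis by (rule that)
qed

text \<open>The value is singled out by an estimate against all bounded Lipschitz \<open>g\<close>,
  so that it does not refer to a chosen approximating sequence; density makes it unique for
  integrable \<open>f\<close>.\<close>

definition ext :: "('a \<Rightarrow> real) \<Rightarrow> real" where
  "ext f = (SOME v. \<forall>g. bounded_lipschitz g \<longrightarrow> \<bar>\<Lambda> g - v\<bar> \<le> C * (LINT x|M. \<bar>g x - f x\<bar>))"

lemma ext_bound:
  assumes "integrable M f" "bounded_lipschitz g"
  shows "\<bar>\<Lambda> g - ext f\<bar> \<le> C * (LINT x|M. \<bar>g x - f x\<bar>)"
proof -
  have "\<exists>v. \<forall>g. bounded_lipschitz g \<longrightarrow> \<bar>\<Lambda> g - v\<bar> \<le> C * (LINT x|M. \<bar>g x - f x\<bar>)"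
    using extension_exists[OF assms(1)] by metis
  from someI_ex[OF this] assms(2) show ?thesis unfolding ext_def by blast
qed

lemma ext_tendsto:
  assumes f: "integrable M f" and s: "\<And>n::nat. bounded_lipschitz (s n)"
    "(\<lambda>n. LINT x|M. \<bar>s n x - f x\<bar>) \<longlonglongrightarrow> 0"
  shows "(\<lambda>n. \<Lambda> (s n)) \<longlonglongrightarrow> ext f"
proof -
  have "(\<lambda>n. \<Lambda> (s n) - ext f) \<longlonglongrightarrow> 0"
  proof (rule Lim_null_comparison)
    show "\<forall>\<^sub>F n in sequentially. norm (\<Lambda> (s n) - ext f) \<le> C * (LINT x|M. \<bar>s n x - f x\<bar>)"
      using ext_bound[OF f s(1)] by (intro always_eventually) simp
    show "(\<lambda>n. C * (LINT x|M. \<bar>s n x - f x\<bar>)) \<longlonglongrightarrow> 0"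
      using tendsto_mult[OF tendsto_const s(2), of C] by simp
  qed
  then show ?thesis by (simp add: LIM_zero_iff)
qed

lemma ext_linear:
  assumes f: "integrable M f" and g: "integrable M g"
  shows "ext (\<lambda>x. a * f x + b * g x) = a * ext f + b * ext g"
proof -
  obtain s :: "nat \<Rightarrow> 'a \<Rightarrow> real" where s: "\<And>n. bounded_lipschitz (s n)" "(\<lambda>n. LINT x|M. \<bar>s n x - f x\<bar>) \<longlonglongrightarrow> 0"
    by (rule bounded_lipschitz_dense_seq[OF f]) blast
  obtain t :: "nat \<Rightarrow> 'a \<Rightarrow> real" where t: "\<And>n. bounded_lipschitz (t n)" "(\<lambda>n. LINT x|M. \<bar>t n x - g x\<bar>) \<longlonglongrightarrow> 0"
    by (rule bounded_lipschitz_dense_seq[OF g]) blast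
  have i: "integrable M (s n)" "integrable M (t n)" for n
    using s t integrable_bounded_lipschitz by auto
  have "(\<lambda>n. \<Lambda> (\<lambda>x. a * s n x + b * t n x)) \<longlonglongrightarrow> ext (\<lambda>x. a * f x + b * g x)"
  proof (rule ext_tendsto)
    show "integrable M (\<lambda>x. a * f x + b * g x)" using f g by simp
    show "bounded_lipschitz (\<lambda>x. a * s n x + b * t n x)" for n
      using s t by (intro bounded_lipschitz_linear)
    show "(\<lambda>n. LINT x|M. \<bar>a * s n x + b * t n x - (a * f x + b * g x)\<bar>) \<longlonglongrightarrow> 0"
      by (rule L1_tendsto_linear[OF i f g s(2) t(2)])
  qed
  moreover have "(\<lambda>n. \<Lambda> (\<lambda>x. a * s n x + b * t n x)) \<longlonglongrightarrow> a * ext f + b * ext g"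
    unfolding linear[OF s(1) t(1)] by (intro tendsto_intros ext_tendsto f g s t)
  ultimately show ?thesis by (rule LIMSEQ_unique)
qed

lemma ext_le:
  assumes f: "integrable M f"
  shows "\<bar>ext f\<bar> \<le> C * (LINT x|M. \<bar>f x\<bar>)"
proof -
  have "\<Lambda> (\<lambda>_. 0) = 0" using bound[of "\<lambda>_. 0"] by simp
  then show ?thesis using ext_bound[OF f, of "\<lambda>_. 0"] by simp
qed

lemma ext_bounded_lipschitz: "bounded_lipschitz f \<Longrightarrow> ext f = \<Lambda> f"
  using ext_bound[of f f] integrable_bounded_lipschitz[of f] by simp

lemma ext_L1_tendsto:
  assumes i: "\<And>n. integrable M (s n)" "integrable M f" and s: "(\<lambda>n. LINT x|M. \<bar>s n x - f x\<bar>) \<longlonglongrightarrow> 0"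
  shows "(\<lambda>n. ext (s n)) \<longlonglongrightarrow> ext f"
proof (rule LIM_zero_cancel, rule Lim_null_comparison)
  show "(\<lambda>n. C * (LINT x|M. \<bar>s n x - f x\<bar>)) \<longlonglongrightarrow> 0" by (rule tendsto_mult_right_zero[OF s])
  have "norm (ext (s n) - ext f) \<le> C * (LINT x|M. \<bar>s n x - f x\<bar>)" for n
    using ext_linear[OF i(1) i(2), of 1 n "-1"] ext_le[of "\<lambda>x. s n x - f x"] i by simp
  then show "\<forall>\<^sub>F n in sequentially. norm (ext (s n) - ext f) \<le> C * (LINT x|M. \<bar>s n x - f x\<bar>)" by simp
qed

text \<open>The set function sending \<open>A\<close> to \<open>ext (indicator A)\<close> is signed;
  adding \<open>C\<close> times \<open>M\<close> makes it a measure between 0 and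
  \<open>2 * C\<close> times \<open>M\<close>. Its Radon-Nikodym density lies in
  \<open>[0, 2 * C]\<close> almost everywhere, and subtracting \<open>C\<close> again gives
  \<open>h\<close>.\<close>

lemma has_density:
  obtains h where "h \<in> borel_measurable borel" "\<And>x. \<bar>h x\<bar> \<le> C" "\<And>f. integrable M f \<Longrightarrow> ext f = (LINT x|M. f x * h x)"
proof -
  define m where "m A = ext (indicator A) + C * measure M A" for A
  have ext_ind: "\<bar>ext (indicator B)\<bar> \<le> C * measure M B" if "B \<in> sets borel" for B
    using ext_le[OF integrable_indicator[OF that]] that by (simp add: space_UNIV)
  have m_nn: "0 \<le> m B" and m_le: "m B \<le> 2 * C * measure M B" if "B \<in> sets borel" for B
    using ext_ind[OF that] by (auto simp: m_def abs_le_iff)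
  define N where "N = measure_of UNIV (sets borel) (\<lambda>A. ennreal (m A))"
  have sN: "sets N = sets borel" unfolding N_def by simp (metis sets.sigma_sets_eq space_borel)
  have N: "emeasure N A = m A" if "A \<in> sets borel" for A
  proof (rule emeasure_measure_of[OF N_def])
    show "countably_additive (sets N) (\<lambda>A. ennreal (m A))"
    proof (rule countably_additiveI)
      fix A :: "nat \<Rightarrow> 'a set" assume A: "range A \<subseteq> sets N" "disjoint_family A" "\<Union> (range A) \<in> sets N"
      have bA: "A i \<in> sets borel" for i using A sN by auto
      have s: "integrable M (\<lambda>x. \<Sum>i<n. indicator (A i) x :: real)"
        "ext (\<lambda>x. \<Sum>i<n. indicator (A i) x) = (\<Sum>i<n. ext (indicator (A i)))" for n
      proof (induction n)
        case (Suc n)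
        case 2
        show ?case using ext_linear[OF Suc(1) integrable_indicator[OF bA], of 1 1] Suc(2) by simp
      qed (use integrable_indicator[OF bA] ext_le[of "\<lambda>_. 0"] in auto)
      have "(\<Union>i. A i) \<in> sets borel" using bA by auto
      from ext_L1_tendsto[OF s(1) integrable_indicator[OF this] indicator_UN_L1_tendsto[OF bA A(2)]]
      have "(\<lambda>i. ext (indicator (A i))) sums ext (indicator (\<Union>i. A i))" by (simp add: sums_def s(2))
      moreover have "(\<lambda>i. measure M (A i)) sums measure M (\<Union>i. A i)"
        using bA A(2) by (intro finite_measure_UNION) (auto simp: sets_borel)
      ultimately have "(\<lambda>i. m (A i)) sums m (\<Union>i. A i)" unfolding m_def by (intro sums_add sums_mult)
      then show "(\<Sum>i. ennreal (m (A i))) = ennreal (m (\<Union>i. A i))"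
        using m_nn[OF bA] by (intro suminf_ennreal_eq) auto
    qed
    show "positive (sets N) (\<lambda>A. ennreal (m A))"
      using ext_ind[of "{}"] by (simp add: positive_def m_def)
  qed (use that sN in auto)
  have "absolutely_continuous M N"
  proof -
    have "A \<in> null_sets N" if "A \<in> null_sets M" for A
    proof -
      have A: "A \<in> sets borel" "measure M A = 0" using that by (auto simp: sets_borel measure_def)
      then show ?thesis using N[OF A(1)] m_le[OF A(1)] sN by (auto simp: ennreal_neg)
    qed
    then show ?thesis unfolding absolutely_continuous_def by blast
  qed
  then obtain k where k: "k \<in> borel_measurable M" "density M k = N"
    using Radon_Nikodym sN sets_borel by metis
  have bk [measurable]: "k \<in> borel_measurable borel" using k(1) by (simp only: borel_measurable_iff)
  \<comment> \<open>Truncated so that the bound holds at every point and not only almost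
    everywhere.\<close>
  define k' where "k' x = enn2real (min (ennreal (2 * C)) (k x))" for x
  have AEk: "AE x in M. k x \<le> ennreal (2 * C)"
  proof -
    define A where "A = {x. ennreal (2 * C) < k x}"
    have A: "A \<in> sets borel" unfolding A_def by measurable
    have "emeasure N A = (\<integral>\<^sup>+x. k x * indicator A x \<partial>M)"
      using k A by (subst k(2)[symmetric], subst emeasure_density) (auto simp: sets_borel)
    moreover have "emeasure N A \<le> (\<integral>\<^sup>+x. ennreal (2 * C) * indicator A x \<partial>M)"
    proof -
      have "emeasure N A \<le> ennreal (2 * C * measure M A)"
        using N[OF A] m_le[OF A] by (simp add: ennreal_leI)
      also have "\<dots> = ennreal (2 * C) * emeasure M A"
        using C_nonneg by (simp add: ennreal_mult emeasure_eq_measure)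
      finally show ?thesis using A by (simp add: nn_integral_cmult_indicator sets_borel)
    qed
    ultimately have le: "(\<integral>\<^sup>+x. k x * indicator A x \<partial>M) \<le> (\<integral>\<^sup>+x. ennreal (2 * C) * indicator A x \<partial>M)"
      by simp
    have fin: "(\<integral>\<^sup>+x. ennreal (2 * C) * indicator A x \<partial>M) \<noteq> \<infinity>"
      using A by (simp add: nn_integral_cmult_indicator sets_borel ennreal_mult_eq_top_iff)
    have "(\<integral>\<^sup>+x. k x * indicator A x - ennreal (2 * C) * indicator A x \<partial>M) = 0"
    proof (subst nn_integral_diff)
      show "AE x in M. ennreal (2 * C) * indicator A x \<le> k x * indicator A x"
        by (intro AE_I2) (auto simp: A_def indicator_def)
    qed (use le fin k A in \<open>auto simp: sets_borel diff_eq_0_iff_ennreal less_top intro: le_less_trans\<close>)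
    then have "AE x in M. k x * indicator A x - ennreal (2 * C) * indicator A x = 0"
      using A k by (subst (asm) nn_integral_0_iff_AE) (auto simp: sets_borel)
    then show ?thesis
    proof eventually_elim
      fix x assume *: "k x * indicator A x - ennreal (2 * C) * indicator A x = 0"
      show "k x \<le> ennreal (2 * C)"
      proof (cases "x \<in> A")
        case True
        with * show ?thesis by (auto simp: diff_eq_0_iff_ennreal)
      qed (simp add: A_def not_less)
    qed
  qed
  have k': "k' \<in> borel_measurable borel" unfolding k'_def by measurable
  have k'0: "0 \<le> k' x" and k'2: "k' x \<le> 2 * C" for x
    using C_nonneg by (auto simp: k'_def intro!: enn2real_leI)
  have AEk': "AE x in M. k x = ennreal (k' x)"
    using AEk by eventually_elim (auto simp: k'_def min_def intro!: ennreal_enn2real[symmetric] elim: le_less_trans[OF _ ennreal_less_top])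
  define h where "h x = k' x - C" for x
  have h: "h \<in> borel_measurable borel" unfolding h_def using k' by measurable
  have hC: "\<bar>h x\<bar> \<le> C" for x using k'0[of x] k'2[of x] by (auto simp: h_def abs_le_iff)
  have ext_h: "ext (indicator A) = (LINT x|M. indicator A x * h x)" if A: "A \<in> sets borel" for A
  proof -
    have ik': "integrable M (\<lambda>x. indicator A x * k' x)"
      using A k' k'0 k'2 C_nonneg
      by (intro integrable_bounded[of _ "2 * C"] borel_measurable_times) (auto simp: indicator_def)
    have "ennreal (m A) = (\<integral>\<^sup>+x. k x * indicator A x \<partial>M)"
      using k A N[OF A] by (subst (asm) k(2)[symmetric], subst (asm) emeasure_density) (auto simp: sets_borel)
    also have "\<dots> = (\<integral>\<^sup>+x. ennreal (indicator A x * k' x) \<partial>M)"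
      using AEk' by (intro nn_integral_cong_AE, eventually_elim) (auto simp: indicator_def)
    also have "\<dots> = ennreal (LINT x|M. indicator A x * k' x)"
      using ik' k'0 by (intro nn_integral_eq_integral) auto
    finally have "m A = (LINT x|M. indicator A x * k' x)"
      using m_nn[OF A] k'0 by (subst (asm) ennreal_inj) (auto intro!: Bochner_Integration.integral_nonneg)
    moreover have "(LINT x|M. indicator A x * h x) = (LINT x|M. indicator A x * k' x) - (LINT x|M. C * indicator A x)"
      using ik' integrable_indicator[OF A] by (subst Bochner_Integration.integral_diff[symmetric]) (auto simp: h_def algebra_simps)
    ultimately show ?thesis by (simp add: m_def space_UNIV)
  qed
  have "ext f = (LINT x|M. f x * h x)" if "integrable M f" for f
    using that
  proof (induction rule: integrable_L1_induct)
    case (linear f g a b)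
    have "(LINT x|M. (a * f x + b * g x) * h x) = (LINT x|M. a * (f x * h x) + b * (g x * h x))" by (simp add: algebra_simps)
    then show ?case
      using linear integrable_times_bounded[OF h hC linear(1)] integrable_times_bounded[OF h hC linear(2)] by (simp add: ext_linear)
  next
    case (limit f s)
    show ?case
      using LIMSEQ_unique[OF ext_L1_tendsto[OF limit(2,1,3)]] integral_times_tendsto[OF h hC limit(2,1,3)] by (simp add: limit(4))
  qed (rule ext_h)
  with h hC that show thesis by blast
qed

text \<open>The density is only unique up to null sets, but the total variation measure it defines is the
  least measure dominating the functional.\<close>

lemma minimal_measure:
  obtains N where "finite_borel_measure N"
    "\<And>f. bounded_lipschitz f \<Longrightarrow> \<bar>\<Lambda> f\<bar> \<le> (LINT x|N. \<bar>f x\<bar>)"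
    "\<And>P A. finite_borel_measure P \<Longrightarrow> (\<And>f. bounded_lipschitz f \<Longrightarrow> \<bar>\<Lambda> f\<bar> \<le> (LINT x|P. \<bar>f x\<bar>)) \<Longrightarrow>
       A \<in> sets borel \<Longrightarrow> emeasure N A \<le> emeasure P A"
proof -
  obtain h where h: "h \<in> borel_measurable borel" "\<And>x. \<bar>h x\<bar> \<le> C"
    "\<And>f. integrable M f \<Longrightarrow> ext f = (LINT x|M. f x * h x)"
    using has_density by blast
  have hM [measurable]: "h \<in> borel_measurable M" using h borel_measurable_iff by simp
  define N where "N = density M (\<lambda>x. ennreal \<bar>h x\<bar>)"
  have sN: "sets N = sets borel" by (simp add: N_def sets_borel)
  have eN: "emeasure N A = ennreal (LINT x|M. \<bar>h x\<bar> * indicator A x)" if A: "A \<in> sets borel" for A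
  proof -
    have "emeasure N A = (\<integral>\<^sup>+x. ennreal (\<bar>h x\<bar> * indicator A x) \<partial>M)"
      using A unfolding N_def by (subst emeasure_density) (auto simp: sets_borel indicator_def intro!: nn_integral_cong)
    also have "\<dots> = ennreal (LINT x|M. \<bar>h x\<bar> * indicator A x)"
      using A h C_nonneg by (intro nn_integral_eq_integral integrable_bounded[of _ C] borel_measurable_times) (auto simp: indicator_def)
    finally show ?thesis .
  qed
  have "finite_borel_measure N"
    using eN[of UNIV] sN by (intro finite_borel_measureI) auto
  then interpret N: finite_borel_measure N .
  have Nb: "\<bar>\<Lambda> f\<bar> \<le> (LINT x|N. \<bar>f x\<bar>)" if f: "bounded_lipschitz f" for f
  proof -
    have fM [measurable]: "f \<in> borel_measurable M"
      using integrable_bounded_lipschitz[OF f] by auto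
    have "\<bar>\<Lambda> f\<bar> = \<bar>LINT x|M. f x * h x\<bar>"
      using h(3) ext_bounded_lipschitz[OF f] integrable_bounded_lipschitz[OF f] by simp
    also have "\<dots> \<le> (LINT x|M. \<bar>f x * h x\<bar>)" by (rule integral_abs_bound)
    also have "\<dots> = (LINT x|N. \<bar>f x\<bar>)"
      unfolding N_def by (subst integral_density) (auto simp: abs_mult mult.commute)
    finally show ?thesis .
  qed
  have "emeasure N A \<le> emeasure P A"
    if P: "finite_borel_measure P" and Pb: "\<And>f. bounded_lipschitz f \<Longrightarrow> \<bar>\<Lambda> f\<bar> \<le> (LINT x|P. \<bar>f x\<bar>)"
      and A: "A \<in> sets borel" for P A
  proof -
    interpret P: finite_borel_measure P by fact
    \<comment> \<open>Testing with the sign of \<open>h\<close> on \<open>A\<close> recovers the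
      full variation there. The functional and its bound by \<open>P\<close> are available on
      bounded Lipschitz functions only, so \<open>s\<close> is approximated by one sequence in L1 of
      \<open>M\<close> and of \<open>P\<close>.\<close>
    define s where "s x = sgn (h x) * indicator A x" for x
    have s: "s \<in> borel_measurable borel" "\<And>x. \<bar>s x\<bar> \<le> 1"
      unfolding s_def using h A by (auto simp: indicator_def abs_sgn_eq sgn_if)
    obtain g :: "nat \<Rightarrow> 'a \<Rightarrow> real" where g: "\<And>n. bounded_lipschitz (g n)"
      and limM: "(\<lambda>n. LINT x|M. \<bar>g n x - s x\<bar>) \<longlonglongrightarrow> 0" and limP: "(\<lambda>n. LINT x|P. \<bar>g n x - s x\<bar>) \<longlonglongrightarrow> 0"
      by (rule common_approximation[OF finite_borel_measure_axioms P s]) blast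
    have "(\<lambda>n. \<Lambda> (g n)) \<longlonglongrightarrow> ext s"
      by (rule ext_tendsto[OF integrable_bounded[OF s] g limM])
    moreover have "ext s = (LINT x|M. \<bar>h x\<bar> * indicator A x)"
    proof -
      have "s x * h x = \<bar>h x\<bar> * indicator A x" for x
        by (auto simp: s_def sgn_if indicator_def)
      then show ?thesis using h(3)[OF integrable_bounded[OF s]] by simp
    qed
    ultimately have l1: "(\<lambda>n. \<bar>\<Lambda> (g n)\<bar>) \<longlonglongrightarrow> \<bar>LINT x|M. \<bar>h x\<bar> * indicator A x\<bar>"
      by (intro tendsto_rabs) simp
    have "\<bar>\<Lambda> (g n)\<bar> \<le> measure P A + (LINT x|P. \<bar>g n x - s x\<bar>)" for n
    proof -
      have i: "integrable P (g n)" "integrable P s" "integrable P (indicator A :: 'a \<Rightarrow> real)"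
        using P.integrable_bounded_lipschitz[OF g] P.integrable_bounded[OF s] A
        by (auto simp: P.sets_borel less_top[symmetric])
      have "\<bar>\<Lambda> (g n)\<bar> \<le> (LINT x|P. \<bar>g n x\<bar>)" by (rule Pb[OF g])
      also have "\<dots> \<le> (LINT x|P. indicator A x + \<bar>g n x - s x\<bar>)"
      proof (rule integral_mono)
        show "\<bar>g n x\<bar> \<le> indicator A x + \<bar>g n x - s x\<bar>" for x
          by (auto simp: s_def indicator_def sgn_if)
      qed (use i in auto)
      also have "\<dots> = measure P A + (LINT x|P. \<bar>g n x - s x\<bar>)"
        using i A by (subst Bochner_Integration.integral_add) (auto simp: P.space_UNIV)
      finally show ?thesis .
    qed
    then have "\<bar>LINT x|M. \<bar>h x\<bar> * indicator A x\<bar> \<le> measure P A + 0"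
      by (intro LIMSEQ_le[OF l1 tendsto_add[OF tendsto_const limP]]) auto
    then show ?thesis
      using eN[OF A] by (simp add: P.emeasure_eq_measure ennreal_leI)
  qed
  with \<open>finite_borel_measure N\<close> Nb that show thesis by blast
qed

end

lemma (in finite_borel_measure) integrable_times_indicator:
  assumes "f \<in> borel_measurable borel" "\<And>x. \<bar>f x\<bar> \<le> B" "A \<in> sets borel"
  shows "integrable M (\<lambda>x. f x * indicator A x :: real)"
proof (rule integrable_bounded[of _ B])
  show "(\<lambda>x. f x * indicator A x) \<in> borel_measurable borel"
    using assms by (intro borel_measurable_times borel_measurable_indicator) auto
  show "\<bar>f x * indicator A x\<bar> \<le> B" for x
    using assms(2)[of x] by (auto simp: indicator_def)
qed

declare One_nat_def [simp del]

section \<open>The mass measure\<close>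

lemma mass_bound_finite_borel: "mass_bound k T \<mu> \<Longrightarrow> finite_borel_measure \<mu>"
  by (simp add: mass_bound_def finite_borel_measure_def finite_borel_measure_axioms_def)

lemma forms_iff:
  "(f, \<pi>) \<in> forms k \<longleftrightarrow> bounded_lipschitz f \<and> length \<pi> = k \<and> (\<forall>p\<in>set \<pi>. lipschitz p)"
  by (simp add: forms_def)

lemma prod_Lip_nonneg: "(f, \<pi>) \<in> forms k \<Longrightarrow> 0 \<le> (\<Prod>j<k. Lip (\<pi> ! j))"
  by (intro prod_nonneg) (auto simp: forms_iff intro: Lip_nonneg)

text \<open>The candidate is the infimum, in the complete lattice of measures, of all measures that
  bound \<open>T\<close>. It still bounds \<open>T\<close>: for fixed \<open>\<pi>\<close> the
  variation measure of the normalised functional lies below every bounding measure, hence below the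
  infimum. Thus one measure serves all \<open>\<pi>\<close>.\<close>

lemma mass_measure_exists:
  assumes lin: "multilinear_functional k T" and fin: "finite_mass k T"
  shows "\<exists>\<mu>. mass_bound k T \<mu> \<and> (\<forall>\<nu>. mass_bound k T \<nu> \<longrightarrow> (\<forall>A\<in>sets borel. emeasure \<mu> A \<le> emeasure \<nu> A))"
proof -
  define S where "S = {\<mu>. mass_bound k T \<mu>}"
  obtain \<mu>0 where \<mu>0: "\<mu>0 \<in> S" using fin by (auto simp: finite_mass_def S_def)
  have S: "finite_borel_measure \<nu>" "sets \<nu> = sets borel" if "\<nu> \<in> S" for \<nu>
    using that mass_bound_finite_borel by (auto simp: S_def mass_bound_def)
  have lower: "m \<le> Inf S" if "sets m = sets borel" "\<And>\<nu> A. \<nu> \<in> S \<Longrightarrow> A \<in> sets borel \<Longrightarrow> emeasure m A \<le> emeasure \<nu> A" for m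
    using that S by (intro Inf_greatest) (simp add: le_measure)
  \<comment> \<open>The order on measures compares first the spaces, then the sigma-algebras, then
    the values. The infimum lies between the null measure and \<open>\<mu>0\<close>, both on the
    Borel sets, so it lives on the Borel sets too.\<close>
  have "null_measure borel \<le> Inf S" by (rule lower) auto
  moreover have "Inf S \<le> \<mu>0" using \<mu>0 by (rule Inf_lower)
  moreover have sp: "space \<mu>0 = UNIV" using sets_eq_imp_space_eq[OF S(2)[OF \<mu>0]] by simp
  ultimately have "space (Inf S) = UNIV"
    using le_measureD1 by (metis UNIV_I space_borel space_null_measure subset_antisym subset_UNIV)
  then have sI: "sets (Inf S) = sets borel"
    using le_measureD2[OF \<open>null_measure borel \<le> Inf S\<close>] le_measureD2[OF \<open>Inf S \<le> \<mu>0\<close>] sp S(2)[OF \<mu>0] by auto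
  have min: "emeasure (Inf S) A \<le> emeasure \<nu> A" if "\<nu> \<in> S" for \<nu> A
    using le_measureD3[OF Inf_lower[OF that]] sI S(2)[OF that] by simp
  have "emeasure \<mu>0 UNIV < \<infinity>"
    using S(1)[OF \<mu>0] unfolding finite_borel_measure_def
    using finite_measure.emeasure_finite less_top by (metis infinity_ennreal_def)
  then have fI: "finite_borel_measure (Inf S)"
    using sI min[OF \<mu>0, of UNIV] by (intro finite_borel_measureI) auto
  have "mass_bound k T (Inf S)"
    unfolding mass_bound_def
  proof (intro conjI ballI)
    show "finite_measure (Inf S)" using fI by (simp add: finite_borel_measure_def)
    fix z :: "('a \<Rightarrow> real) \<times> ('a \<Rightarrow> real) list" assume z: "z \<in> forms k"
    obtain f \<pi> where f\<pi>: "z = (f, \<pi>)" by (cases z)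
    define c where "c = (\<Prod>j<k. Lip (\<pi> ! j))"
    have c: "0 \<le> c" using prod_Lip_nonneg z f\<pi> by (auto simp: c_def)
    have forms: "(g, \<pi>) \<in> forms k" if "bounded_lipschitz g" for g
      using that z f\<pi> by (simp add: forms_iff)
    have bd: "\<bar>T g \<pi>\<bar> \<le> c * (LINT x|\<nu>. \<bar>g x\<bar>)" if "\<nu> \<in> S" "bounded_lipschitz g" for \<nu> g
      using that(1) forms[OF that(2)] by (auto simp: S_def mass_bound_def c_def)
    have "\<bar>T f \<pi>\<bar> \<le> c * (LINT x|Inf S. \<bar>f x\<bar>)"
    proof (cases "c = 0")
      case True
      then show ?thesis using bd[OF \<mu>0, of f] z f\<pi> by (simp add: forms_iff)
    next
      case False
      \<comment> \<open>Division by the product of the Lipschitz constants turns every bounding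
        measure of \<open>T\<close> into one that dominates \<open>L\<close> with constant
        1.\<close>
      define L where "L g = T g \<pi> / c" for g
      have Lb: "\<bar>L g\<bar> \<le> (LINT x|\<nu>. \<bar>g x\<bar>)" if "\<nu> \<in> S" "bounded_lipschitz g" for \<nu> g
        using bd[OF that] False c by (simp add: L_def abs_divide pos_divide_le_eq mult.commute)
      interpret M0: finite_borel_measure \<mu>0 by (rule S(1)[OF \<mu>0])
      interpret lipschitz_functional \<mu>0 L 1
      proof
        fix g h :: "'a \<Rightarrow> real" and a b assume "bounded_lipschitz g" "bounded_lipschitz h"
        then have "T (\<lambda>x. a * g x + b * h x) \<pi> = a * T g \<pi> + b * T h \<pi>"
          using lin forms unfolding multilinear_functional_def by blast
        then show "L (\<lambda>x. a * g x + b * h x) = a * L g + b * L h"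
          by (simp add: L_def add_divide_distrib)
      qed (use Lb[OF \<mu>0] in auto)
      obtain N where N: "finite_borel_measure N"
        "\<And>f. bounded_lipschitz f \<Longrightarrow> \<bar>L f\<bar> \<le> (LINT x|N. \<bar>f x\<bar>)"
        "\<And>P A. finite_borel_measure P \<Longrightarrow> (\<And>f. bounded_lipschitz f \<Longrightarrow> \<bar>L f\<bar> \<le> (LINT x|P. \<bar>f x\<bar>)) \<Longrightarrow>
          A \<in> sets borel \<Longrightarrow> emeasure N A \<le> emeasure P A"
        using minimal_measure by blast
      have sN: "sets N = sets borel" using N(1) finite_borel_measure.sets_borel by blast
      have "N \<le> Inf S" using N(3)[OF S(1) Lb] sN by (intro lower) auto
      then have le: "emeasure N A \<le> emeasure (Inf S) A" for A
        using le_measureD3 sN sI by blast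
      have f: "bounded_lipschitz f" using z f\<pi> by (simp add: forms_iff)
      obtain B where B: "\<And>x. \<bar>f x\<bar> \<le> B" using bounded_lipschitzE[OF f] by blast
      have "(\<lambda>x. \<bar>f x\<bar>) \<in> borel_measurable borel"
        using bounded_lipschitz_borel[OF f] by measurable
      then have "(LINT x|N. \<bar>f x\<bar>) \<le> (LINT x|Inf S. \<bar>f x\<bar>)"
        by (intro integral_mono_finite_borel[OF N(1) fI le _ _ B]) auto
      with N(2)[OF f] have "\<bar>L f\<bar> \<le> (LINT x|Inf S. \<bar>f x\<bar>)" by simp
      then show ?thesis using False c by (simp add: L_def abs_divide pos_divide_le_eq mult.commute)
    qed
    then show "case z of (f, \<pi>) \<Rightarrow> \<bar>T f \<pi>\<bar> \<le> (\<Prod>j<k. Lip (\<pi> ! j)) * (LINT x|Inf S. \<bar>f x\<bar>)"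
      by (simp add: f\<pi> c_def)
  qed (rule sI)
  with min show ?thesis by (auto simp: S_def)
qed

lemma
  assumes "multilinear_functional k T" and "finite_mass k T"
  shows mass_bound_mass_measure: "mass_bound k T (mass_measure k T)"
    and mass_measure_least: "\<And>\<nu> A. mass_bound k T \<nu> \<Longrightarrow> A \<in> sets borel \<Longrightarrow> emeasure (mass_measure k T) A \<le> emeasure \<nu> A"
proof -
  let ?P = "\<lambda>\<mu>. mass_bound k T \<mu> \<and> (\<forall>\<nu>. mass_bound k T \<nu> \<longrightarrow> (\<forall>A\<in>sets borel. emeasure \<mu> A \<le> emeasure \<nu> A))"
  have "\<exists>!\<mu>. ?P \<mu>"
  proof (rule ex_ex1I)
    fix \<mu> \<nu> assume "?P \<mu>" "?P \<nu>"
    then show "\<mu> = \<nu>"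
      by (intro measure_eqI antisym) (auto simp: mass_bound_def)
  qed (rule mass_measure_exists[OF assms])
  then have "?P (mass_measure k T)" unfolding mass_measure_def by (rule theI')
  then show "mass_bound k T (mass_measure k T)"
    "\<And>\<nu> A. mass_bound k T \<nu> \<Longrightarrow> A \<in> sets borel \<Longrightarrow> emeasure (mass_measure k T) A \<le> emeasure \<nu> A"
    by blast+
qed

lemma finite_borel_mass_measure:
  "multilinear_functional k T \<Longrightarrow> finite_mass k T \<Longrightarrow> finite_borel_measure (mass_measure k T)"
  using mass_bound_mass_measure mass_bound_finite_borel by blast

lemma mass_nonneg: "0 \<le> mass k T"
  by (simp add: mass_def)

lemma mass_le:
  assumes "multilinear_functional k T" "mass_bound k T \<nu>"
  shows "mass k T \<le> measure \<nu> UNIV"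
proof -
  have fin: "finite_mass k T" using assms by (auto simp: finite_mass_def)
  interpret finite_borel_measure \<nu> by (rule mass_bound_finite_borel[OF assms(2)])
  interpret M: finite_borel_measure "mass_measure k T" by (rule finite_borel_mass_measure[OF assms(1) fin])
  show ?thesis
    using mass_measure_least[OF assms(1) fin assms(2), of UNIV]
    by (simp add: mass_def emeasure_eq_measure M.emeasure_eq_measure)
qed

text \<open>Minimality gives one inequality on every Borel set; applied to the complement and
  combined with the comparison of total masses it gives the other.\<close>

lemma mass_measure_eqI:
  assumes lin: "multilinear_functional k T" and \<nu>: "mass_bound k T \<nu>" and eq: "measure \<nu> UNIV \<le> mass k T"
  shows "mass_measure k T = \<nu>"
proof -
  have fin: "finite_mass k T" using \<nu> by (auto simp: finite_mass_def)
  interpret N: finite_borel_measure \<nu> by (rule mass_bound_finite_borel[OF \<nu>])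
  interpret M: finite_borel_measure "mass_measure k T" by (rule finite_borel_mass_measure[OF lin fin])
  have le: "measure (mass_measure k T) A \<le> measure \<nu> A" if "A \<in> sets borel" for A
    using mass_measure_least[OF lin fin \<nu> that]
    by (simp add: N.emeasure_eq_measure M.emeasure_eq_measure)
  show ?thesis
  proof (rule measure_eqI)
    fix A assume "A \<in> sets (mass_measure k T)"
    then have A: "A \<in> sets borel" by (simp add: M.sets_borel)
    have "measure (mass_measure k T) (-A) = measure (mass_measure k T) UNIV - measure (mass_measure k T) A"
      "measure \<nu> (-A) = measure \<nu> UNIV - measure \<nu> A"
      using A M.finite_measure_compl[of A] N.finite_measure_compl[of A]
      by (simp_all add: M.sets_borel N.sets_borel M.space_UNIV N.space_UNIV Compl_eq_Diff_UNIV)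
    then have "measure \<nu> A \<le> measure (mass_measure k T) A"
      using le[of "- A"] A eq by (simp add: mass_def)
    then show "emeasure (mass_measure k T) A = emeasure \<nu> A"
      using le[OF A] by (simp add: N.emeasure_eq_measure M.emeasure_eq_measure)
  qed (simp add: M.sets_borel N.sets_borel)
qed

text \<open>The way to compute \<open>extend\<close>: the estimate makes \<open>v\<close> the limit
  along every admissible sequence, and density provides such a sequence, so the description in the
  definition is met by \<open>v\<close> alone.\<close>

lemma extend_eqI:
  assumes M: "finite_borel_measure (mass_measure k T)" and f: "integrable (mass_measure k T) f"
    and v: "\<And>g. bounded_lipschitz g \<Longrightarrow> \<bar>T g \<pi> - v\<bar> \<le> C * (LINT x|mass_measure k T. \<bar>g x - f x\<bar>)"
  shows "extend k T f \<pi> = v"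
  unfolding extend_def
proof (rule the_equality)
  let ?M = "mass_measure k T"
  interpret finite_borel_measure ?M by fact
  show 1: "\<forall>g. (\<forall>n. bounded_lipschitz (g n)) \<longrightarrow> (\<lambda>n. LINT x|?M. \<bar>g n x - f x\<bar>) \<longlonglongrightarrow> 0 \<longrightarrow> (\<lambda>n. T (g n) \<pi>) \<longlonglongrightarrow> v"
  proof (intro allI impI)
    fix g :: "nat \<Rightarrow> 'a \<Rightarrow> real"
    assume g: "\<forall>n. bounded_lipschitz (g n)" "(\<lambda>n. LINT x|?M. \<bar>g n x - f x\<bar>) \<longlonglongrightarrow> 0"
    have "(\<lambda>n. T (g n) \<pi> - v) \<longlonglongrightarrow> 0"
    proof (rule Lim_null_comparison)
      show "\<forall>\<^sub>F n in sequentially. norm (T (g n) \<pi> - v) \<le> C * (LINT x|?M. \<bar>g n x - f x\<bar>)"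
        using v g(1) by (intro always_eventually) simp
      show "(\<lambda>n. C * (LINT x|?M. \<bar>g n x - f x\<bar>)) \<longlonglongrightarrow> 0"
        using tendsto_mult[OF tendsto_const g(2), of C] by simp
    qed
    then show "(\<lambda>n. T (g n) \<pi>) \<longlonglongrightarrow> v" by (simp add: LIM_zero_iff)
  qed
  fix w
  assume w: "\<forall>g. (\<forall>n. bounded_lipschitz (g n)) \<longrightarrow> (\<lambda>n. LINT x|?M. \<bar>g n x - f x\<bar>) \<longlonglongrightarrow> 0 \<longrightarrow> (\<lambda>n. T (g n) \<pi>) \<longlonglongrightarrow> w"
  obtain s :: "nat \<Rightarrow> 'a \<Rightarrow> real" where s: "\<And>n. bounded_lipschitz (s n)" "(\<lambda>n. LINT x|?M. \<bar>s n x - f x\<bar>) \<longlonglongrightarrow> 0"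
    by (rule bounded_lipschitz_dense_seq[OF f]) blast
  show "w = v"
    using LIMSEQ_unique[OF w[rule_format, OF s] 1[rule_format, OF s]] .
qed

section \<open>One-dimensional currents of finite mass\<close>

lemma length_1_iff: "length \<pi> = 1 \<longleftrightarrow> (\<exists>p. \<pi> = [p])"
  by (cases \<pi>) auto

locale metric_current1 =
  fixes T :: "'a::metric_space functional"
  assumes current: "current 1 T" and fin_mass: "finite_mass 1 T"
begin

abbreviation \<mu> :: "'a measure" where "\<mu> \<equiv> mass_measure 1 T"

lemma multilinear: "multilinear_functional 1 T"
  using current by (simp add: current_def)

lemma mass_bound: "mass_bound 1 T \<mu>"
  by (rule mass_bound_mass_measure[OF multilinear fin_mass])

sublocale finite_borel_measure \<mu>
  by (rule finite_borel_mass_measure[OF multilinear fin_mass])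

lemma form1: "bounded_lipschitz f \<Longrightarrow> lipschitz p \<Longrightarrow> (f, [p]) \<in> forms 1"
  by (simp add: forms_iff)

lemma T_bound: "bounded_lipschitz f \<Longrightarrow> lipschitz p \<Longrightarrow> \<bar>T f [p]\<bar> \<le> Lip p * (LINT x|\<mu>. \<bar>f x\<bar>)"
  using mass_bound form1[of f p] by (auto simp: mass_bound_def)

lemma T_linear1: "bounded_lipschitz f \<Longrightarrow> bounded_lipschitz g \<Longrightarrow> lipschitz p \<Longrightarrow>
    T (\<lambda>x. a * f x + b * g x) [p] = a * T f [p] + b * T g [p]"
  using multilinear form1 unfolding multilinear_functional_def by blast

lemma T_linear2:
  assumes "bounded_lipschitz f" "lipschitz p" "lipschitz q"
  shows "T f [\<lambda>x. a * p x + b * q x] = a * T f [p] + b * T f [q]"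
proof -
  have "T f ([p][0 := (\<lambda>x. a * p x + b * q x)]) = a * T f ([p][0 := p]) + b * T f ([p][0 := q])"
    using multilinear form1[OF assms(1,2)] assms unfolding multilinear_functional_def by blast
  then show ?thesis by simp
qed

lemma lipschitz_functional: "lipschitz p \<Longrightarrow> lipschitz_functional \<mu> (\<lambda>f. T f [p]) (Lip p)"
  by unfold_locales (auto intro: T_linear1 T_bound Lip_nonneg)

lemma density_exists:
  "\<exists>G. \<forall>p. lipschitz p \<longrightarrow> G p \<in> borel_measurable borel \<and> (\<forall>x. \<bar>G p x\<bar> \<le> Lip p) \<and>
     (\<forall>f. bounded_lipschitz f \<longrightarrow> T f [p] = (LINT x|\<mu>. f x * G p x))"
proof -
  have "\<exists>h. h \<in> borel_measurable borel \<and> (\<forall>x. \<bar>h x\<bar> \<le> Lip p) \<and>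
     (\<forall>f. bounded_lipschitz f \<longrightarrow> T f [p] = (LINT x|\<mu>. f x * h x))" if "lipschitz p" for p
  proof -
    interpret L: lipschitz_functional \<mu> "\<lambda>f. T f [p]" "Lip p" by (rule lipschitz_functional[OF that])
    obtain h where "h \<in> borel_measurable borel" "\<And>x. \<bar>h x\<bar> \<le> Lip p" "\<And>f. integrable \<mu> f \<Longrightarrow> L.ext f = (LINT x|\<mu>. f x * h x)"
      using L.has_density by blast
    then show ?thesis
      using L.ext_bounded_lipschitz integrable_bounded_lipschitz by metis
  qed
  then show ?thesis by metis
qed

text \<open>One density of \<open>T\<close> in its first argument is fixed for each Lipschitz
  \<open>p\<close>. As these choices are unrelated, linearity and locality in \<open>p\<close> hold
  only almost everywhere, with an exceptional set depending on the functions involved.\<close>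

definition G :: "('a \<Rightarrow> real) \<Rightarrow> 'a \<Rightarrow> real" where
  "G = (SOME G. \<forall>p. lipschitz p \<longrightarrow> G p \<in> borel_measurable borel \<and> (\<forall>x. \<bar>G p x\<bar> \<le> Lip p) \<and>
     (\<forall>f. bounded_lipschitz f \<longrightarrow> T f [p] = (LINT x|\<mu>. f x * G p x)))"

lemma
  assumes "lipschitz p"
  shows G_measurable: "G p \<in> borel_measurable borel" and G_bound: "\<bar>G p x\<bar> \<le> Lip p"
    and T_eq: "bounded_lipschitz f \<Longrightarrow> T f [p] = (LINT x|\<mu>. f x * G p x)"
  using someI_ex[OF density_exists] assms unfolding G_def[symmetric] by blast+

lemma G_bound': "C-lipschitz_on UNIV p \<Longrightarrow> \<bar>G p x\<bar> \<le> C"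
  using G_bound[OF lipschitzI] Lip_le order_trans by blast

lemma integrable_G: "lipschitz p \<Longrightarrow> integrable \<mu> f \<Longrightarrow> integrable \<mu> (\<lambda>x. f x * G p x)"
  by (rule integrable_times_bounded[OF G_measurable G_bound])

lemma integral_G_le: "C-lipschitz_on UNIV p \<Longrightarrow> integrable \<mu> f \<Longrightarrow> \<bar>LINT x|\<mu>. f x * G p x\<bar> \<le> C * (LINT x|\<mu>. \<bar>f x\<bar>)"
  by (rule integral_times_le[OF G_measurable[OF lipschitzI] G_bound'])

text \<open>\<open>sgn h\<close> is a limit in L1 of bounded Lipschitz functions, so the integral of
  \<open>\<bar>h\<bar>\<close> vanishes.\<close>

lemma AE_zero_iff:
  assumes h: "h \<in> borel_measurable borel" "\<And>x. \<bar>h x\<bar> \<le> (B::real)"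
    and zero: "\<And>f. bounded_lipschitz f \<Longrightarrow> (LINT x|\<mu>. f x * h x) = 0"
  shows "AE x in \<mu>. h x = 0"
proof -
  define s where "s x = sgn (h x)" for x
  have s: "s \<in> borel_measurable borel" "\<And>x. \<bar>s x\<bar> \<le> 1"
    using h unfolding s_def by (auto simp: abs_sgn_eq)
  obtain g :: "nat \<Rightarrow> 'a \<Rightarrow> real" where g: "\<And>n. bounded_lipschitz (g n)" "(\<lambda>n. LINT x|\<mu>. \<bar>g n x - s x\<bar>) \<longlonglongrightarrow> 0"
    by (rule bounded_lipschitz_dense_seq[OF integrable_bounded[OF s]]) blast
  have "(\<lambda>n. LINT x|\<mu>. g n x * h x) \<longlonglongrightarrow> (LINT x|\<mu>. s x * h x)"
    by (rule integral_times_tendsto[OF h integrable_bounded_lipschitz[OF g(1)] integrable_bounded[OF s] g(2)])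
  then have "(LINT x|\<mu>. s x * h x) = 0" by (simp add: zero[OF g(1)] LIMSEQ_const_iff)
  then have "(LINT x|\<mu>. \<bar>h x\<bar>) = 0" by (simp add: s_def abs_sgn mult.commute)
  moreover have "integrable \<mu> (\<lambda>x. \<bar>h x\<bar>)" using h by (intro integrable_abs integrable_bounded)
  ultimately show ?thesis
    by (subst (asm) integral_nonneg_eq_0_iff_AE) auto
qed

lemma G_linear:
  assumes p: "lipschitz p" and q: "lipschitz q"
  shows "AE x in \<mu>. G (\<lambda>x. a * p x + b * q x) x = a * G p x + b * G q x"
proof -
  let ?r = "\<lambda>x. a * p x + b * q x"
  have r: "lipschitz ?r" by (rule lipschitz_linear[OF p q])
  have "AE x in \<mu>. G ?r x - (a * G p x + b * G q x) = 0"
  proof (rule AE_zero_iff)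
    show "(\<lambda>x. G ?r x - (a * G p x + b * G q x)) \<in> borel_measurable borel"
      using G_measurable[OF p] G_measurable[OF q] G_measurable[OF r] by measurable
    show "\<bar>G ?r x - (a * G p x + b * G q x)\<bar> \<le> Lip ?r + (\<bar>a\<bar> * Lip p + \<bar>b\<bar> * Lip q)" for x
      using G_bound[OF p, of x] G_bound[OF q, of x] G_bound[OF r, of x]
      by (intro order_trans[OF abs_triangle_ineq4] add_mono order_trans[OF abs_triangle_ineq])
        (simp_all add: abs_mult mult_left_mono)
    fix f :: "'a \<Rightarrow> real" assume f: "bounded_lipschitz f"
    note i = integrable_bounded_lipschitz[OF f]
    have "(LINT x|\<mu>. f x * (G ?r x - (a * G p x + b * G q x))) =
      (LINT x|\<mu>. f x * G ?r x - (a * (f x * G p x) + b * (f x * G q x)))"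
      by (simp add: algebra_simps)
    also have "\<dots> = T f [?r] - (a * T f [p] + b * T f [q])"
      using integrable_G[OF p i] integrable_G[OF q i] integrable_G[OF r i]
      by (simp add: T_eq[OF p f] T_eq[OF q f] T_eq[OF r f])
    finally show "(LINT x|\<mu>. f x * (G ?r x - (a * G p x + b * G q x))) = 0"
      using T_linear2[OF f p q] by simp
  qed
  then show ?thesis by simp
qed

lemma T_continuous:
  assumes "bounded_lipschitz f" "\<And>n::nat. C-lipschitz_on UNIV (p n)" "\<And>x. (\<lambda>n. p n x) \<longlonglongrightarrow> q x" "lipschitz q"
  shows "(\<lambda>n. T f [p n]) \<longlonglongrightarrow> T f [q]"
proof -
  have "continuous_functional 1 T" using current by (simp add: current_def)
  from this[unfolded continuous_functional_def, rule_format, of f "[q]" "\<lambda>n. [p n]" C]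
  show ?thesis using assms form1 by auto
qed

lemma T_local:
  assumes "bounded_lipschitz f" "lipschitz p" "open U" "\<And>x. f x \<noteq> 0 \<Longrightarrow> x \<in> U" "\<And>x. x \<in> U \<Longrightarrow> p x = c"
  shows "T f [p] = 0"
proof -
  have "local_functional 1 T" using current by (simp add: current_def)
  moreover have "\<exists>j<1. \<exists>U c. open U \<and> {x. f x \<noteq> 0} \<subseteq> U \<and> (\<forall>x\<in>U. ([p] ! j) x = c)"
    using assms(3-) by (intro exI[of _ 0] exI[of _ U] exI[of _ c] conjI) auto
  ultimately show ?thesis
    unfolding local_functional_def using form1[OF assms(1,2)] by blast
qed

text \<open>A Lipschitz function vanishing on \<open>F\<close> is approximated by functions that vanish near \<open>F\<close>.\<close>

lemma G_eq_0_on_closed: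
  assumes F: "closed F" and p: "lipschitz p" and p0: "\<And>x. x \<in> F \<Longrightarrow> p x = 0"
  shows "AE x in \<mu>. x \<in> F \<longrightarrow> G p x = 0"
proof (cases "F = {}")
  case False
  obtain L where L: "L-lipschitz_on UNIV p" using p by (auto simp: lipschitz_def)
  have L0: "0 \<le> L" using lipschitz_on_nonneg[OF L] .
  have p_le: "\<bar>p x\<bar> \<le> L * infdist x F" for x
  proof (cases "L = 0")
    case True
    obtain y where "y \<in> F" using False by blast
    then show ?thesis using lipschitz_realD[OF L, of x y] p0 True by simp
  next
    case L: False
    have "\<bar>p x\<bar> / L \<le> infdist x F"
      unfolding infdist_notempty[OF False]
    proof (rule cINF_greatest[OF False])
      fix y assume "y \<in> F"
      then show "\<bar>p x\<bar> / L \<le> dist x y"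
        using lipschitz_realD[OF \<open>L-lipschitz_on UNIV p\<close>, of x y] p0 L L0 by (simp add: divide_le_eq mult.commute)
    qed
    then show ?thesis using L L0 by (simp add: divide_le_eq mult.commute)
  qed
  \<comment> \<open>Soft thresholding: \<open>q k\<close> vanishes where
    \<open>\<bar>p x\<bar> < 1 / (k + 1)\<close>, an open set containing \<open>F\<close>, as
    locality demands; it stays \<open>2 * L\<close>-Lipschitz and tends to \<open>p\<close>
    pointwise, as the continuity of \<open>T\<close> demands.\<close>
  define q where "q k x = max (p x - 1 / real (Suc k)) 0 + min (p x + 1 / real (Suc k)) 0" for k x
  have qL: "(2 * L)-lipschitz_on UNIV (q k)" for k
  proof -
    have 1: "(L + 0)-lipschitz_on UNIV (\<lambda>x. p x - 1 / real (Suc k))"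
      by (rule lipschitz_on_diff[OF L lipschitz_on_constant])
    have 2: "(L + 0)-lipschitz_on UNIV (\<lambda>x. p x + 1 / real (Suc k))"
      by (rule lipschitz_on_add[OF L lipschitz_on_constant])
    show ?thesis
      using lipschitz_on_add[OF lipschitz_on_max[OF 1 lipschitz_on_constant[of _ 0]] lipschitz_on_min[OF 2 lipschitz_on_constant[of _ 0]]] L0
      by (simp add: q_def[abs_def])
  qed
  note lq = lipschitzI[OF qL]
  have q_lim: "(\<lambda>k. q k x) \<longlonglongrightarrow> p x" for x
  proof -
    have "(\<lambda>k. max (p x - 1 / real (Suc k)) 0 + min (p x + 1 / real (Suc k)) 0) \<longlonglongrightarrow> max (p x - 0) 0 + min (p x + 0) 0"
      using LIMSEQ_inverse_real_of_nat unfolding inverse_eq_divide by (intro tendsto_intros)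
    then show ?thesis by (simp add: q_def max_def min_def split: if_splits)
  qed
  have q0: "q k x = 0" if "\<bar>p x\<bar> < 1 / real (Suc k)" for k x
    using that by (auto simp: q_def abs_less_iff max_def min_def)
  have cF: "integrable \<mu> (cutoff F n)" "integrable \<mu> (indicator F :: 'a \<Rightarrow> real)" for n
    using integrable_bounded_lipschitz[OF bounded_lipschitz_cutoff] F
    by (auto intro: integrable_indicator)
  note cut_lim = cutoff_L1_tendsto[OF F False]
  have diffle: "\<bar>(LINT x|\<mu>. f x * cutoff F n x * G r x) - (LINT x|\<mu>. f x * indicator F x * G r x)\<bar>
      \<le> 2 * L * B * (LINT x|\<mu>. \<bar>cutoff F n x - indicator F x\<bar>)"
    if f: "bounded_lipschitz f" "\<And>x. \<bar>f x\<bar> \<le> B" and r: "(2 * L)-lipschitz_on UNIV r" for f B r n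
  proof -
    have lr: "lipschitz r" using r by (rule lipschitzI)
    have B: "0 \<le> B" using f(2)[of undefined] by simp
    have fm: "f \<in> borel_measurable borel" using bounded_lipschitz_borel[OF f(1)] .
    have i: "integrable \<mu> (\<lambda>x. f x * cutoff F n x)"
      by (rule integrable_bounded_lipschitz[OF bounded_lipschitz_mult[OF f(1) bounded_lipschitz_cutoff]])
    have i': "integrable \<mu> (\<lambda>x. f x * indicator F x)"
      using fm F f(2) by (intro integrable_times_indicator) auto
    have "(LINT x|\<mu>. f x * cutoff F n x * G r x) - (LINT x|\<mu>. f x * indicator F x * G r x) =
      (LINT x|\<mu>. (f x * cutoff F n x - f x * indicator F x) * G r x)"
      using integrable_G[OF lr i] integrable_G[OF lr i'] by (simp add: left_diff_distrib Bochner_Integration.integral_diff)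
    also have "\<bar>\<dots>\<bar> \<le> 2 * L * (LINT x|\<mu>. \<bar>f x * cutoff F n x - f x * indicator F x\<bar>)"
      using i i' by (intro integral_G_le r) auto
    also have "\<dots> \<le> 2 * L * (LINT x|\<mu>. B * \<bar>cutoff F n x - indicator F x\<bar>)"
    proof (intro mult_left_mono integral_mono)
      show "\<bar>f x * cutoff F n x - f x * indicator F x\<bar> \<le> B * \<bar>cutoff F n x - indicator F x\<bar>" for x
        using f(2)[of x] by (simp add: right_diff_distrib[symmetric] abs_mult mult_right_mono)
    qed (use i i' cF L0 in auto)
    finally show ?thesis by simp
  qed
  \<comment> \<open>For \<open>n\<close> above \<open>L * (k + 1)\<close> the cutoff lives in the
    set where \<open>q k\<close> vanishes: there \<open>infdist x F < 1 / n\<close>, hence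
    \<open>\<bar>p x\<bar> < 1 / (k + 1)\<close>. Locality applies, and \<open>n\<close> tends to
    infinity.\<close>
  have zero: "(LINT x|\<mu>. f x * indicator F x * G (q k) x) = 0" if f: "bounded_lipschitz f" for f k
  proof -
    obtain B where B: "\<And>x. \<bar>f x\<bar> \<le> B" using bounded_lipschitzE[OF f] by blast
    obtain N where N: "L * real (Suc k) < real N" using reals_Archimedean2 by blast
    have "(LINT x|\<mu>. f x * cutoff F n x * G (q k) x) = 0" if "n \<ge> N" for n
    proof -
      have fc: "bounded_lipschitz (\<lambda>x. f x * cutoff F n x)" by (rule bounded_lipschitz_mult[OF f bounded_lipschitz_cutoff])
      have "T (\<lambda>x. f x * cutoff F n x) [q k] = 0"
      proof (rule T_local[OF fc lq])
        show "open {x. \<bar>p x\<bar> < 1 / real (Suc k)}"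
          using lipschitz_continuous[OF p, of UNIV] by (intro open_Collect_less continuous_intros)
        show "q k x = 0" if "x \<in> {x. \<bar>p x\<bar> < 1 / real (Suc k)}" for x using q0 that by simp
        fix x assume "f x * cutoff F n x \<noteq> 0"
        then have n1: "real n * infdist x F < 1" using cutoff_nonzeroD by auto
        have "L * real (Suc k) * infdist x F \<le> real n * infdist x F"
          using N \<open>n \<ge> N\<close> by (intro mult_right_mono infdist_nonneg) auto
        moreover have "real (Suc k) * \<bar>p x\<bar> \<le> real (Suc k) * (L * infdist x F)"
          using p_le by (intro mult_left_mono) auto
        moreover have "real (Suc k) * (L * infdist x F) = L * real (Suc k) * infdist x F" by simp
        ultimately have "real (Suc k) * \<bar>p x\<bar> < 1" using n1 by linarith
        then show "x \<in> {x. \<bar>p x\<bar> < 1 / real (Suc k)}" by (simp add: field_simps)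
      qed
      then show ?thesis using T_eq[OF lq fc] by simp
    qed
    then have "\<bar>LINT x|\<mu>. f x * indicator F x * G (q k) x\<bar> \<le> 2 * L * B * (LINT x|\<mu>. \<bar>cutoff F n x - indicator F x\<bar>)" if "n \<ge> N" for n
      using diffle[OF f B qL, of n k] that by simp
    then have "\<bar>LINT x|\<mu>. f x * indicator F x * G (q k) x\<bar> \<le> 2 * L * B * 0"
      by (intro LIMSEQ_le_const[OF tendsto_mult[OF tendsto_const cut_lim]]) auto
    then show ?thesis by simp
  qed
  have p2: "(2 * L)-lipschitz_on UNIV p" using L0 by (intro lipschitz_on_mono[OF L]) auto
  \<comment> \<open>The limits are taken one after the other: for fixed \<open>n\<close> the
    continuity of \<open>T\<close> lets \<open>k\<close> tend to infinity under a bound that does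
    not depend on \<open>k\<close>; only then does \<open>n\<close> tend to infinity.\<close>
  have pF: "(LINT x|\<mu>. f x * (indicator F x * G p x)) = 0" if f: "bounded_lipschitz f" for f
  proof -
    obtain B where B: "\<And>x. \<bar>f x\<bar> \<le> B" using bounded_lipschitzE[OF f] by blast
    have fc: "bounded_lipschitz (\<lambda>x. f x * cutoff F n x)" for n by (rule bounded_lipschitz_mult[OF f bounded_lipschitz_cutoff])
    have le: "\<bar>T (\<lambda>x. f x * cutoff F n x) [p]\<bar> \<le> 2 * L * B * (LINT x|\<mu>. \<bar>cutoff F n x - indicator F x\<bar>)" for n
    proof (rule LIMSEQ_le_const2)
      show "(\<lambda>k. \<bar>T (\<lambda>x. f x * cutoff F n x) [q k]\<bar>) \<longlonglongrightarrow> \<bar>T (\<lambda>x. f x * cutoff F n x) [p]\<bar>"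
        by (intro tendsto_rabs T_continuous[OF fc qL q_lim p])
      have "\<bar>T (\<lambda>x. f x * cutoff F n x) [q k]\<bar> \<le> 2 * L * B * (LINT x|\<mu>. \<bar>cutoff F n x - indicator F x\<bar>)" for k
        using diffle[OF f B qL, of n k] zero[OF f, of k] T_eq[OF lq fc, of n k] by simp
      then show "\<exists>N. \<forall>k\<ge>N. \<bar>T (\<lambda>x. f x * cutoff F n x) [q k]\<bar> \<le> 2 * L * B * (LINT x|\<mu>. \<bar>cutoff F n x - indicator F x\<bar>)" by blast
    qed
    have "\<bar>LINT x|\<mu>. f x * indicator F x * G p x\<bar> \<le> 2 * (2 * L * B * (LINT x|\<mu>. \<bar>cutoff F n x - indicator F x\<bar>))" for n
      using diffle[OF f B p2, of n] le[of n] T_eq[OF p fc, of n] by simp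
    then have "\<bar>LINT x|\<mu>. f x * indicator F x * G p x\<bar> \<le> 2 * (2 * L * B * 0)"
      by (intro LIMSEQ_le_const[OF tendsto_mult[OF tendsto_const tendsto_mult[OF tendsto_const cut_lim]]]) auto
    then show ?thesis by (simp add: mult.assoc)
  qed
  have "AE x in \<mu>. indicator F x * G p x = 0"
  proof (rule AE_zero_iff[OF _ _ pF])
    show "(\<lambda>x. indicator F x * G p x) \<in> borel_measurable borel"
      using F G_measurable[OF p] by (intro borel_measurable_times borel_measurable_indicator) auto
    show "\<bar>indicator F x * G p x\<bar> \<le> L" for x using G_bound'[OF L] L0 by (auto simp: indicator_def)
  qed
  then show ?thesis by eventually_elim auto
qed simp

lemma G_eq_on_closed:
  assumes F: "closed F" and p: "lipschitz p" and q: "lipschitz q" and eq: "\<And>x. x \<in> F \<Longrightarrow> p x = q x"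
  shows "AE x in \<mu>. x \<in> F \<longrightarrow> G p x = G q x"
proof -
  have "AE x in \<mu>. x \<in> F \<longrightarrow> G (\<lambda>x. 1 * p x + (-1) * q x) x = 0"
    using eq by (intro G_eq_0_on_closed F lipschitz_linear p q) simp
  then show ?thesis using G_linear[OF p q, of 1 "-1"]
    by eventually_elim auto
qed

text \<open>Replaces the limit in the definition of the restriction by an integral against the
  density of \<open>T\<close>.\<close>

lemma restrict_current_eq:
  assumes f: "bounded_lipschitz f" and A: "A \<in> sets borel" and p: "lipschitz p"
  shows "restrict_current 1 T A f [p] = (LINT x|\<mu>. f x * indicator A x * G p x)"
  unfolding restrict_current_def
proof (rule extend_eqI[where C="Lip p"])
  show "finite_borel_measure \<mu>" by (rule finite_borel_measure_axioms)
  obtain B where B: "\<And>x. \<bar>f x\<bar> \<le> B" using bounded_lipschitzE[OF f] by blast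
  show i: "integrable \<mu> (\<lambda>x. f x * indicator A x)"
    by (rule integrable_times_indicator[OF bounded_lipschitz_borel[OF f] B A])
  fix g :: "'a \<Rightarrow> real" assume g: "bounded_lipschitz g"
  note ig = integrable_bounded_lipschitz[OF g]
  have "T g [p] - (LINT x|\<mu>. f x * indicator A x * G p x) = (LINT x|\<mu>. (g x - f x * indicator A x) * G p x)"
    unfolding T_eq[OF p g]
    using integrable_G[OF p i] integrable_G[OF p ig] by (simp add: left_diff_distrib Bochner_Integration.integral_diff)
  also have "\<bar>\<dots>\<bar> \<le> Lip p * (LINT x|\<mu>. \<bar>g x - f x * indicator A x\<bar>)"
    using i ig by (intro integral_G_le lipschitz_on_Lip p) auto
  finally show "\<bar>T g [p] - (LINT x|\<mu>. f x * indicator A x * G p x)\<bar> \<le> Lip p * (LINT x|\<mu>. \<bar>g x - f x * indicator A x\<bar>)" .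
qed

end

section \<open>Open sets and primitives on the line\<close>

lemma open_real_intervals:
  fixes U :: "real set"
  assumes "open U" "bounded U"
  obtains a b :: "nat \<Rightarrow> real" where "\<And>i. a i \<le> b i" "disjoint_family (\<lambda>i. {a i<..<b i})"
    "U = (\<Union>i. {a i<..<b i})"
proof -
  let ?D = "components U"
  have op: "open c" if "c \<in> ?D" for c using open_components[OF assms(1) that] .
  have eq: "c = {Inf c<..<Sup c}" and le: "Inf c \<le> Sup c" if c: "c \<in> ?D" for c
  proof -
    have bd: "bounded c" using bounded_subset[OF assms(2) in_components_subset[OF c]] .
    then have ba: "bdd_above c" "bdd_below c" by (auto intro: bounded_imp_bdd_above bounded_imp_bdd_below)
    have ne: "c \<noteq> {}" by (rule in_components_nonempty[OF c])
    show "Inf c \<le> Sup c" using cInf_le_cSup[OF ne] ba by auto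
    show "c = {Inf c<..<Sup c}"
    proof (intro set_eqI iffI)
      fix x assume x: "x \<in> c"
      obtain e where e: "0 < e" "ball x e \<subseteq> c" using op[OF c] x openE by blast
      have "x - e/2 \<in> c" "x + e/2 \<in> c" using e by (auto simp: subset_iff dist_real_def)
      then have "Inf c \<le> x - e/2" "x + e/2 \<le> Sup c" using ba by (auto intro: cInf_lower cSup_upper)
      then show "x \<in> {Inf c<..<Sup c}" using e by auto
    next
      fix x assume x: "x \<in> {Inf c<..<Sup c}"
      obtain y where y: "y \<in> c" "y < x" using x cInf_less_iff[OF ne ba(2)] by auto
      obtain z where z: "z \<in> c" "x < z" using x less_cSup_iff[OF ne ba(1)] by auto
      show "x \<in> c"
        using connected_contains_Icc[OF in_components_connected[OF c] y(1) z(1)] y z by auto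
    qed
  qed
  have "pairwise disjnt ?D"
    using pairwise_disjoint_components[of U] by (simp add: pairwise_def disjnt_def)
  then have cD: "countable ?D" using op by (intro countable_disjoint_open_subsets)
  \<comment> \<open>There may be only finitely many components; an index without a component gets
    the empty interval, with both end points 0.\<close>
  define c where "c i = (if i \<in> to_nat_on ?D ` ?D then from_nat_into ?D i else {})" for i
  have c_in: "c i \<in> ?D" if "i \<in> to_nat_on ?D ` ?D" for i
    using that by (auto simp: c_def cD)
  define a where "a i = (if i \<in> to_nat_on ?D ` ?D then Inf (c i) else 0)" for i
  define b where "b i = (if i \<in> to_nat_on ?D ` ?D then Sup (c i) else 0)" for i
  have cab: "{a i<..<b i} = c i" for i
    using eq[OF c_in] by (auto simp: a_def b_def c_def)
  show thesis
  proof (rule that[of a b])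
    show "a i \<le> b i" for i using le[OF c_in] by (auto simp: a_def b_def)
    show "disjoint_family (\<lambda>i. {a i<..<b i})"
      unfolding cab disjoint_family_on_def
    proof (intro ballI impI)
      fix i j :: nat assume "i \<noteq> j"
      have inv: "to_nat_on ?D (c i) = i" if "i \<in> to_nat_on ?D ` ?D" for i
        using that cD by (auto simp: c_def)
      show "c i \<inter> c j = {}"
      proof (cases "i \<in> to_nat_on ?D ` ?D \<and> j \<in> to_nat_on ?D ` ?D")
        case True
        then have "c i \<noteq> c j" using inv[of i] inv[of j] \<open>i \<noteq> j\<close> by metis
        then show ?thesis
          using \<open>pairwise disjnt ?D\<close> c_in True unfolding pairwise_def disjnt_def by blast
      qed (auto simp: c_def)
    qed
    show "U = (\<Union>i. {a i<..<b i})"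
      unfolding cab
    proof (intro set_eqI iffI)
      fix x assume "x \<in> U"
      then obtain d where d: "d \<in> ?D" "x \<in> d" by (metis UnionE Union_components)
      then have "c (to_nat_on ?D d) = d" using cD by (simp add: c_def)
      then show "x \<in> (\<Union>i. c i)" using d by blast
    next
      fix x assume "x \<in> (\<Union>i. c i)"
      then obtain i where "x \<in> c i" by blast
      then show "x \<in> U" using c_in[of i] in_components_subset by (auto simp: c_def split: if_splits)
    qed
  qed
qed

lemma integral_primitive:
  fixes m :: "real \<Rightarrow> real"
  assumes m: "m \<in> borel_measurable borel" "\<And>x. \<bar>m x\<bar> \<le> C"
  obtains M where "\<And>a b. a \<le> b \<Longrightarrow> M b - M a = (LINT x:{a..b}|lborel. m x)"
proof -
  have add: "(LINT x:{a..c}|lborel. m x) = (LINT x:{a..b}|lborel. m x) + (LINT x:{b..c}|lborel. m x)"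
    if "a \<le> b" "b \<le> c" for a b c
  proof -
    have "{a..c} = {a..b} \<union> {b..c}" using that by auto
    then have "(LINT x:{a..c}|lborel. m x) = (LINT x:{a..b} \<union> {b..c}|lborel. m x)" by simp
    also have "\<dots> = (LINT x:{a..b}|lborel. m x) + (LINT x:{b..c}|lborel. m x)"
    proof (rule set_integral_Un_AE)
      show "AE x in lborel. \<not> (x \<in> {a..b} \<and> x \<in> {b..c})"
        using AE_lborel_singleton[of b] by eventually_elim auto
    qed (use set_integrable_bounded_interval[OF m] in auto)
    finally show ?thesis .
  qed
  define M where "M t = (if 0 \<le> t then (LINT x:{0..t}|lborel. m x) else - (LINT x:{t..0}|lborel. m x))" for t
  show thesis
  proof (rule that[of M])
    fix a b :: real assume ab: "a \<le> b"
    consider "0 \<le> a" | "a < 0" "0 \<le> b" | "b < 0" by linarith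
    then show "M b - M a = (LINT x:{a..b}|lborel. m x)"
    proof cases
      case 1
      then show ?thesis using ab add[of 0 a b] by (simp add: M_def)
    next
      case 2
      then show ?thesis using add[of a 0 b] by (simp add: M_def)
    next
      case 3
      then show ?thesis using ab add[of a b 0] by (simp add: M_def)
    qed
  qed
qed

section \<open>McShane extension\<close>

lemma lipschitz_extension:
  fixes f :: "'a::metric_space \<Rightarrow> real"
  assumes f: "C-lipschitz_on S f"
  obtains g where "C-lipschitz_on UNIV g" "\<And>x. x \<in> S \<Longrightarrow> g x = f x"
proof (cases "S = {}")
  case True
  then show thesis
    using lipschitz_on_nonneg[OF f] by (intro that[of "\<lambda>_. 0"]) (auto intro: lipschitz_on_mono[OF lipschitz_on_constant])
next
  case False
  have C: "0 \<le> C" by (rule lipschitz_on_nonneg[OF f])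
  have le: "f t - C * dist x t \<le> f s + C * dist x s" if "s \<in> S" "t \<in> S" for s t x
  proof -
    have "f t - f s \<le> C * dist t s" using lipschitz_realD[OF f that(2,1)] by simp
    also have "\<dots> \<le> C * (dist x t + dist x s)"
      using C by (intro mult_left_mono) (metis dist_commute dist_triangle)
    finally show ?thesis by (simp add: algebra_simps)
  qed
  define g where "g x = (INF s\<in>S. f s + C * dist x s)" for x
  obtain t where t: "t \<in> S" using False by blast
  have bdd: "bdd_below ((\<lambda>s. f s + C * dist x s) ` S)" for x
    using le[OF _ t] by (auto intro!: bdd_belowI2)
  have upper: "g x \<le> f s + C * dist x s" if "s \<in> S" for x s
    unfolding g_def by (rule cINF_lower[OF bdd that])
  show thesis
  proof (rule that[of g])
    show "C-lipschitz_on UNIV g"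
    proof (rule lipschitz_realI[OF C])
      fix x y
      have "g x - C * dist x y \<le> g y"
        unfolding g_def[of y]
      proof (rule cINF_greatest[OF False])
        fix s assume s: "s \<in> S"
        have "C * dist x s \<le> C * (dist x y + dist y s)"
          using C by (intro mult_left_mono dist_triangle)
        then show "g x - C * dist x y \<le> f s + C * dist y s"
          using upper[OF s, of x] by (simp add: algebra_simps)
      qed
      then show "g x - g y \<le> C * dist x y" by simp
    qed
    fix x assume x: "x \<in> S"
    have "f x \<le> g x"
      unfolding g_def using le[OF _ x, of _ x] by (intro cINF_greatest[OF False]) simp
    then show "g x = f x" using upper[OF x, of x] by simp
  qed
qed

lemma bounded_lipschitz_extension:
  fixes f :: "'a::metric_space \<Rightarrow> real"
  assumes f: "C-lipschitz_on S f" and l: "\<And>x. x \<in> S \<Longrightarrow> l \<le> f x" and u: "\<And>x. x \<in> S \<Longrightarrow> f x \<le> u" and "l \<le> u"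
  obtains g where "C-lipschitz_on UNIV g" "\<And>x. x \<in> S \<Longrightarrow> g x = f x" "\<And>x. l \<le> g x" "\<And>x. g x \<le> u"
proof -
  obtain g where g: "C-lipschitz_on UNIV g" "\<And>x. x \<in> S \<Longrightarrow> g x = f x"
    using lipschitz_extension[OF f] by blast
  have "(max (max C 0) 0)-lipschitz_on UNIV (\<lambda>x. max (min (g x) u) l)"
    by (rule lipschitz_on_max[OF lipschitz_on_min[OF g(1) lipschitz_on_constant] lipschitz_on_constant])
  then show thesis
    using l u g(2) \<open>l \<le> u\<close> lipschitz_on_nonneg[OF f]
    by (intro that[of "\<lambda>x. max (min (g x) u) l"]) auto
qed

section \<open>Sets of vanishing one-dimensional Hausdorff measure\<close>

definition h1_null :: "'a::metric_space set \<Rightarrow> bool" where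
  "h1_null S \<longleftrightarrow> (\<forall>e>0. \<exists>C::nat \<Rightarrow> 'a set. S \<subseteq> (\<Union>i. C i) \<and> (\<forall>i. bounded (C i)) \<and>
     (\<Sum>i. ennreal (diameter (C i))) \<le> ennreal e)"

text \<open>In dimension 1 the weight of a covering set is its diameter, since the unit ball has
  volume 2, and the empty set has diameter 0. A restriction on the mesh is automatic, because a
  small sum of diameters bounds each of them.\<close>

lemma h1_null_iff: "h1_null S \<longleftrightarrow> hausdorff_measure 1 S = 0"
proof -
  have term_eq: "(if D = {} then 0 else ennreal (unit_ball_vol (real 1) * (diameter D / 2) ^ 1)) = ennreal (diameter D)"
    for D :: "'a set" by auto
  have pre: "hausdorff_pre 1 \<delta> S = (INF C\<in>{C :: nat \<Rightarrow> 'a set. S \<subseteq> (\<Union>i. C i) \<and> (\<forall>i. bounded (C i) \<and> diameter (C i) \<le> \<delta>)}.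
      \<Sum>i. ennreal (diameter (C i)))" for \<delta>
    unfolding hausdorff_pre_def term_eq ..
  show ?thesis
  proof
    assume S: "h1_null S"
    have *: "hausdorff_pre 1 \<delta> S \<le> 0 + ennreal e" if pos: "0 < \<delta>" "0 < e" for \<delta> e :: real
    proof -
      obtain C :: "nat \<Rightarrow> 'a set" where C: "S \<subseteq> (\<Union>i. C i)" "\<And>i. bounded (C i)"
        "(\<Sum>i. ennreal (diameter (C i))) \<le> ennreal (min \<delta> e)"
        using S[unfolded h1_null_def, rule_format, of "min \<delta> e"] pos by auto
      have "diameter (C i) \<le> \<delta>" for i
      proof -
        have "ennreal (diameter (C i)) \<le> (\<Sum>i. ennreal (diameter (C i)))"
          using sum_le_suminf[of "\<lambda>i. ennreal (diameter (C i))" "{i}"] by simp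
        also note C(3)
        finally show ?thesis using that by (subst (asm) ennreal_le_iff) auto
      qed
      then have "hausdorff_pre 1 \<delta> S \<le> (\<Sum>i. ennreal (diameter (C i)))"
        unfolding pre using C by (intro INF_lower) auto
      also have "\<dots> \<le> ennreal e" using C(3) that by (auto intro: order_trans simp: ennreal_leI)
      finally show ?thesis by simp
    qed
    have "hausdorff_pre 1 \<delta> S \<le> 0" if "0 < \<delta>" for \<delta>
      by (rule ennreal_le_epsilon) (rule *[OF that])
    then show "hausdorff_measure 1 S = 0"
      unfolding hausdorff_measure_def by (intro antisym SUP_least) auto
  next
    assume S: "hausdorff_measure 1 S = 0"
    have "hausdorff_pre 1 1 S \<le> hausdorff_measure 1 S"
      unfolding hausdorff_measure_def by (intro SUP_upper) auto
    then have 0: "hausdorff_pre 1 1 S = 0" using S by simp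
    show "h1_null S"
      unfolding h1_null_def
    proof (intro allI impI)
      fix e :: real assume "0 < e"
      then have "hausdorff_pre 1 1 S < ennreal e" using 0 by simp
      then obtain C :: "nat \<Rightarrow> 'a set" where "S \<subseteq> (\<Union>i. C i)" "\<forall>i. bounded (C i) \<and> diameter (C i) \<le> 1"
         "(\<Sum>i. ennreal (diameter (C i))) < ennreal e"
        unfolding pre INF_less_iff by auto
      then show "\<exists>C::nat \<Rightarrow> 'a set. S \<subseteq> (\<Union>i. C i) \<and> (\<forall>i. bounded (C i)) \<and> (\<Sum>i. ennreal (diameter (C i))) \<le> ennreal e"
        by (intro exI[of _ C]) auto
    qed
  qed
qed

lemma h1_null_subset: "h1_null T \<Longrightarrow> S \<subseteq> T \<Longrightarrow> h1_null S"
  unfolding h1_null_def by (meson order_trans)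

lemma h1_null_UN:
  assumes "\<And>n::nat. h1_null (S n)"
  shows "h1_null (\<Union>n. S n)"
  unfolding h1_null_def
proof (intro allI impI)
  fix e :: real assume e: "0 < e"
  have "\<exists>C::nat \<Rightarrow> 'a set. S n \<subseteq> (\<Union>i. C i) \<and> (\<forall>i. bounded (C i)) \<and> (\<Sum>i. ennreal (diameter (C i))) \<le> ennreal (e * (1/2) ^ Suc n)" for n
    using assms[of n] e unfolding h1_null_def by simp
  then obtain C :: "nat \<Rightarrow> nat \<Rightarrow> 'a set" where C: "\<And>n. S n \<subseteq> (\<Union>i. C n i)" "\<And>n i. bounded (C n i)"
    "\<And>n. (\<Sum>i. ennreal (diameter (C n i))) \<le> ennreal (e * (1/2) ^ Suc n)"
    by metis
  define D where "D k = case_prod C (prod_decode k)" for k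
  have "(\<Sum>k. ennreal (diameter (D k))) = (\<Sum>n. \<Sum>i. ennreal (diameter (C n i)))"
    unfolding D_def by (subst suminf_ennreal_2dimen[of "\<lambda>n. \<Sum>i. ennreal (diameter (C n i))" "\<lambda>(n,i). ennreal (diameter (C n i))", symmetric])
      (auto simp: split_beta comp_def)
  also have "\<dots> \<le> (\<Sum>n. ennreal (e * (1/2) ^ Suc n))"
    by (intro suminf_le C) auto
  also have "\<dots> = ennreal e"
    using sums_mult[OF power_half_series, of e] e by (intro suminf_ennreal_eq) auto
  finally have "(\<Sum>k. ennreal (diameter (D k))) \<le> ennreal e" .
  moreover have "(\<Union>n. S n) \<subseteq> (\<Union>k. D k)"
  proof
    fix x assume "x \<in> (\<Union>n. S n)"
    then obtain n i where "x \<in> C n i" using C(1) by blast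
    then have "x \<in> D (prod_encode (n, i))" by (simp add: D_def)
    then show "x \<in> (\<Union>k. D k)" by blast
  qed
  moreover have "bounded (D k)" for k using C(2) by (simp add: D_def split_beta)
  ultimately show "\<exists>C::nat \<Rightarrow> 'a set. (\<Union>n. S n) \<subseteq> (\<Union>i. C i) \<and> (\<forall>i. bounded (C i)) \<and> (\<Sum>i. ennreal (diameter (C i))) \<le> ennreal e"
    by blast
qed

lemma h1_null_Un: "h1_null S \<Longrightarrow> h1_null T \<Longrightarrow> h1_null (S \<union> T)"
  by (rule h1_null_subset[OF h1_null_UN[of "\<lambda>n. if n = 0 then S else T"]]) (auto split: if_splits intro: exI[of _ "0::nat"] exI[of _ "1::nat"])

text \<open>Closures have the same diameters. The enlargement serves the absolute continuity of the
  mass measure, which is assumed for Borel sets, whereas the uncovered part of a rectifiable set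
  need not be Borel.\<close>

lemma h1_null_borel:
  assumes "h1_null S"
  obtains B where "B \<in> sets borel" "S \<subseteq> B" "h1_null B"
proof -
  have "\<exists>C::nat \<Rightarrow> 'a set. S \<subseteq> (\<Union>i. C i) \<and> (\<forall>i. bounded (C i)) \<and> (\<Sum>i. ennreal (diameter (C i))) \<le> ennreal (1 / real (Suc n))" for n
    using assms unfolding h1_null_def by simp
  then obtain C :: "nat \<Rightarrow> nat \<Rightarrow> 'a set" where C: "\<And>n. S \<subseteq> (\<Union>i. C n i)" "\<And>n i. bounded (C n i)"
    "\<And>n. (\<Sum>i. ennreal (diameter (C n i))) \<le> ennreal (1 / real (Suc n))"
    by metis
  define B where "B = (\<Inter>n. \<Union>i. closure (C n i))"
  have "h1_null B"
    unfolding h1_null_def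
  proof (intro allI impI)
    fix e :: real assume "0 < e"
    then obtain n where n: "1 / real (Suc n) < e" using nat_approx_posE by (metis inverse_eq_divide)
    have "(\<Sum>i. ennreal (diameter (closure (C n i)))) \<le> ennreal e"
      using C(3)[of n] n C(2) by (simp add: diameter_closure) (meson ennreal_leI less_imp_le order_trans)
    then show "\<exists>C::nat \<Rightarrow> 'a set. B \<subseteq> (\<Union>i. C i) \<and> (\<forall>i. bounded (C i)) \<and> (\<Sum>i. ennreal (diameter (C i))) \<le> ennreal e"
      using C(2) by (intro exI[of _ "\<lambda>i. closure (C n i)"]) (auto simp: B_def)
  qed
  moreover have "S \<subseteq> (\<Union>i. closure (C n i))" for n
    using C(1)[of n] closure_subset by blast
  moreover have "(\<Inter>n::nat. \<Union>i::nat. closure (C n i)) \<in> sets borel"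
    by (intro sets.countable_INT'' sets.countable_UN) auto
  ultimately show thesis using that unfolding B_def by blast
qed

text \<open>A Sard type estimate. The measure \<open>N\<close> with density \<open>m\<close> bounds
  distances between image points and vanishes on \<open>E\<close>. A bounded piece of
  \<open>E\<close> has an open neighbourhood of small \<open>N\<close>-measure, and the images of
  its component intervals have diameters at most their \<open>N\<close>-measures.\<close>

lemma h1_null_image:
  fixes F :: "real \<Rightarrow> 'a::metric_space" and m :: "real \<Rightarrow> real"
  assumes m [measurable]: "m \<in> borel_measurable borel" and m0: "\<And>x. 0 \<le> m x" and mC: "\<And>x. m x \<le> C"
    and F: "\<And>s t. s \<in> A \<Longrightarrow> t \<in> A \<Longrightarrow> s \<le> t \<Longrightarrow> dist (F s) (F t) \<le> (LINT x:{s..t}|lborel. m x)"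
    and E: "E \<in> sets borel" and null: "AE x in lborel. x \<in> E \<longrightarrow> m x = 0"
  shows "h1_null (F ` (A \<inter> E))"
proof -
  have C: "0 \<le> C" using order_trans[OF m0 mC] .
  define N where "N = density lborel (\<lambda>x. ennreal (m x))"
  have eN: "emeasure N {s..t} = ennreal (LINT x:{s..t}|lborel. m x)" for s t
  proof -
    have "integrable lborel (\<lambda>x. indicator {s..t} x *\<^sub>R m x)"
      using m0 mC by (intro integrableI_bounded_set_indicator[where B=C]) (auto simp: emeasure_lborel_Icc_eq)
    then have "ennreal (LINT x:{s..t}|lborel. m x) = (\<integral>\<^sup>+x. ennreal (indicator {s..t} x *\<^sub>R m x) \<partial>lborel)"
      unfolding set_lebesgue_integral_def using m0 by (intro nn_integral_eq_integral[symmetric]) auto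
    also have "\<dots> = emeasure N {s..t}"
      unfolding N_def by (subst emeasure_density) (auto intro!: nn_integral_cong simp: indicator_def)
    finally show ?thesis ..
  qed
  have N_le: "emeasure N B \<le> ennreal C * emeasure lborel B" if "B \<in> sets borel" for B
  proof -
    have "emeasure N B = (\<integral>\<^sup>+x. ennreal (m x) * indicator B x \<partial>lborel)"
      unfolding N_def using that by (subst emeasure_density) auto
    also have "\<dots> \<le> (\<integral>\<^sup>+x. ennreal C * indicator B x \<partial>lborel)"
      using mC by (intro nn_integral_mono mult_right_mono ennreal_leI) auto
    finally show ?thesis using that by (simp add: nn_integral_cmult_indicator)
  qed
  \<comment> \<open>Cut into bounded pieces, because the decomposition into intervals is stated for
    bounded open sets.\<close>
  have "h1_null (F ` (A \<inter> (E \<inter> {-real n<..<real n})))" for n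
    unfolding h1_null_def
  proof (intro allI impI)
    fix e :: real assume e: "0 < e"
    define E' where "E' = E \<inter> {-real n<..<real n}"
    have E': "E' \<in> sets borel" using E by (simp add: E'_def)
    have NE': "emeasure N E' = 0"
    proof -
      have "AE x in lborel. ennreal (m x) * indicator E' x = 0"
        using null by eventually_elim (auto simp: E'_def indicator_def)
      then have "(\<integral>\<^sup>+x. ennreal (m x) * indicator E' x \<partial>lborel) = (\<integral>\<^sup>+x. 0 \<partial>(lborel :: real measure))"
        by (rule nn_integral_cong_AE)
      then show ?thesis
        unfolding N_def using E' by (subst emeasure_density) auto
    qed
    obtain V where V: "open V" "E' \<subseteq> V" "emeasure lebesgue (V - E') < ennreal (e / (C + 1))"
      using sets_lebesgue_outer_open[of E' "e / (C + 1)"] E' e C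
      by (metis add_nonneg_pos divide_pos_pos sets_completionI_sets sets_lborel zero_less_one)
    define U where "U = V \<inter> {-real n<..<real n}"
    have U: "open U" "E' \<subseteq> U" "bounded U"
      using V by (auto simp: U_def E'_def intro: bounded_subset[of "{-real n<..<real n}"])
    have UE: "emeasure lborel (U - E') \<le> ennreal (e / (C + 1))"
    proof -
      have "emeasure lborel (U - E') \<le> emeasure lborel (V - E')"
        using V E' by (intro emeasure_mono) (auto simp: U_def)
      also have "\<dots> = emeasure lebesgue (V - E')" using V E' by simp
      finally show ?thesis using V(3) by simp
    qed
    obtain a b where ab: "\<And>i. a i \<le> b i" "disjoint_family (\<lambda>i. {a i<..<b i})" "U = (\<Union>i::nat. {a i<..<b i})"
      using open_real_intervals[OF U(1,3)] by blast
    have NU: "emeasure N U \<le> ennreal e"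
    proof -
      have "emeasure N U = emeasure N E' + emeasure N (U - E')"
        using U E' by (subst plus_emeasure) (auto simp: N_def Un_absorb1 intro!: arg_cong[where f="emeasure _"])
      also have "\<dots> \<le> ennreal C * ennreal (e / (C + 1))"
      proof -
        have "emeasure N (U - E') \<le> ennreal C * emeasure lborel (U - E')"
          using N_le[of "U - E'"] U E' by auto
        also have "\<dots> \<le> ennreal C * ennreal (e / (C + 1))" using UE by (rule mult_left_mono) simp
        finally show ?thesis using NE' by simp
      qed
      also have "\<dots> = ennreal (C * (e / (C + 1)))" by (rule ennreal_mult[symmetric]) (use C e in auto)
      also have "\<dots> \<le> ennreal e" using C e by (intro ennreal_leI) (simp add: field_simps)
      finally show ?thesis .
    qed
    have diam: "ennreal (diameter (F ` (A \<inter> {a i<..<b i}))) \<le> emeasure N {a i<..<b i}"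
      and bdd: "bounded (F ` (A \<inter> {a i<..<b i}))" for i
    proof -
      have eq: "emeasure N {a i<..<b i} = emeasure N {a i..b i}"
        unfolding N_def using m0
        by (subst (1 2) emeasure_density) (auto intro!: nn_integral_cong_AE eventually_mono[OF eventually_conj[OF AE_lborel_singleton[of "a i"] AE_lborel_singleton[of "b i"]]] simp: indicator_def)
      define R where "R = (LINT x:{a i..b i}|lborel. m x)"
      have R: "0 \<le> R" unfolding R_def set_lebesgue_integral_def using m0 by (intro Bochner_Integration.integral_nonneg) auto
      have le: "dist (F s) (F t) \<le> R" if st: "s \<in> A \<inter> {a i<..<b i}" "t \<in> A \<inter> {a i<..<b i}" "s \<le> t" for s t
      proof -
        have "ennreal (dist (F s) (F t)) \<le> emeasure N {s..t}"
          unfolding eN using F[of s t] st by (intro ennreal_leI) auto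
        also have "\<dots> \<le> emeasure N {a i..b i}" using st by (intro emeasure_mono) (auto simp: N_def)
        also have "\<dots> = ennreal R" by (simp add: eN R_def)
        finally show ?thesis using R by simp
      qed
      have le': "dist x y \<le> R" if xy: "x \<in> F ` (A \<inter> {a i<..<b i})" "y \<in> F ` (A \<inter> {a i<..<b i})" for x y
      proof -
        obtain s t where "x = F s" "y = F t" "s \<in> A \<inter> {a i<..<b i}" "t \<in> A \<inter> {a i<..<b i}" using xy by blast
        then show ?thesis using le[of s t] le[of t s] linear[of s t] by (auto simp: dist_commute)
      qed
      show "bounded (F ` (A \<inter> {a i<..<b i}))"
        unfolding bounded_two_points using le' by blast
      have "diameter (F ` (A \<inter> {a i<..<b i})) \<le> R"
        unfolding diameter_def using R le' by (auto intro!: cSUP_least)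
      then show "ennreal (diameter (F ` (A \<inter> {a i<..<b i}))) \<le> emeasure N {a i<..<b i}"
        unfolding eq eN R_def[symmetric] by (rule ennreal_leI)
    qed
    have "(\<Sum>i. ennreal (diameter (F ` (A \<inter> {a i<..<b i})))) \<le> (\<Sum>i. emeasure N {a i<..<b i})"
      using diam by (intro suminf_le) auto
    also have "\<dots> = emeasure N U"
      unfolding ab(3) using ab(2) by (intro suminf_emeasure) (auto simp: N_def)
    finally have "(\<Sum>i. ennreal (diameter (F ` (A \<inter> {a i<..<b i})))) \<le> ennreal e" using NU by simp
    moreover have "F ` (A \<inter> (E \<inter> {-real n<..<real n})) \<subseteq> (\<Union>i. F ` (A \<inter> {a i<..<b i}))"
      using U(2) ab(3) unfolding E'_def by blast
    ultimately show "\<exists>C::nat \<Rightarrow> 'a set. F ` (A \<inter> (E \<inter> {-real n<..<real n})) \<subseteq> (\<Union>i. C i) \<and> (\<forall>i. bounded (C i)) \<and>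
        (\<Sum>i. ennreal (diameter (C i))) \<le> ennreal e"
      using bdd by (intro exI[of _ "\<lambda>i. F ` (A \<inter> {a i<..<b i})"]) auto
  qed
  then have "h1_null (\<Union>n. F ` (A \<inter> (E \<inter> {-real n<..<real n})))" by (rule h1_null_UN)
  moreover have "F ` (A \<inter> E) \<subseteq> (\<Union>n. F ` (A \<inter> (E \<inter> {-real n<..<real n})))"
  proof
    fix y assume "y \<in> F ` (A \<inter> E)"
    then obtain x where x: "y = F x" "x \<in> A \<inter> E" by blast
    obtain n where "\<bar>x\<bar> < real n" using reals_Archimedean2 by blast
    then show "y \<in> (\<Union>n. F ` (A \<inter> (E \<inter> {-real n<..<real n})))" using x by (auto intro!: exI[of _ n] imageI simp: abs_less_iff)
  qed
  ultimately show ?thesis by (rule h1_null_subset)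
qed

section \<open>Covering by sets on which a distance function is almost isometric\<close>

text \<open>The reverse estimate, with constant 1, is the triangle inequality. So the distance from
  \<open>z\<close> is injective on \<open>K\<close> and its inverse is Lipschitz with constant
  \<open>1 + \<epsilon>\<close>.\<close>

definition near_isometry :: "real \<Rightarrow> 'a::metric_space \<Rightarrow> 'a set \<Rightarrow> bool" where
  "near_isometry \<epsilon> z K \<longleftrightarrow> (\<forall>x\<in>K. \<forall>y\<in>K. dist x y \<le> (1 + \<epsilon>) * \<bar>dist z x - dist z y\<bar>)"

text \<open>The distances \<open>v n\<close> from a dense sequence of image points are real
  Lipschitz functions, differentiable almost everywhere, and the supremum \<open>m\<close> of the
  moduli of their derivatives acts as the metric speed of \<open>F\<close>. Where it vanishes the
  image is null. Elsewhere some \<open>v n\<close> has slope above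
  \<open>m / (1 + \<epsilon>)\<close>, and near such a point \<open>v n\<close> measures distances
  along \<open>F\<close> up to the factor \<open>1 + \<epsilon>\<close>.\<close>

lemma near_isometry_cover:
  fixes F :: "real \<Rightarrow> 'a::metric_space"
  assumes A: "closed A" and F: "C-lipschitz_on A F" and \<epsilon>: "0 < \<epsilon>"
  shows "\<exists>\<C>. countable \<C> \<and> (\<forall>K\<in>\<C>. compact K \<and> (\<exists>z. near_isometry \<epsilon> z K)) \<and> h1_null (F ` A - \<Union>\<C>)"
proof (cases "A = {}")
  case True
  have "h1_null {}" unfolding h1_null_def by (intro allI impI exI[of _ "\<lambda>_. {}"]) auto
  then show ?thesis using True by (intro exI[of _ "{}"]) auto
next
  case False
  have C: "0 \<le> C" by (rule lipschitz_on_nonneg[OF F])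
  obtain D where D: "countable D" "D \<subseteq> A" "A \<subseteq> closure D" using separable[of A] by blast
  have "D \<noteq> {}" using D False by auto
  define r where "r = from_nat_into D"
  have rA: "r n \<in> A" for n using from_nat_into[OF \<open>D \<noteq> {}\<close>, of n] D by (auto simp: r_def)
  have dense: "\<exists>n. \<bar>r n - s\<bar> < e" if s: "s \<in> A" "0 < e" for s e
  proof -
    obtain d where "d \<in> D" "dist d s < e" using D(3) s by (meson closure_approachable subsetD)
    then show ?thesis using from_nat_into_surj[OF D(1)] by (metis dist_real_def r_def)
  qed
  have "\<exists>w. C-lipschitz_on UNIV w \<and> (\<forall>s\<in>A. w s = dist (F (r n)) (F s))" for n
  proof -
    have "(1 * C)-lipschitz_on A (\<lambda>s. dist (F (r n)) (F s))"
      by (rule lipschitz_on_compose2[OF F lipschitz_on_subset[OF lipschitz_on_dist]]) simp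
    then show ?thesis using lipschitz_extension[of C A "\<lambda>s. dist (F (r n)) (F s)"] by (metis mult_1)
  qed
  then obtain v where v: "\<And>n. C-lipschitz_on UNIV (v n)" "\<And>n s. s \<in> A \<Longrightarrow> v n s = dist (F (r n)) (F s)"
    by metis
  have "\<forall>n. \<exists>g. g \<in> borel_measurable borel \<and> (\<forall>x. \<bar>g x\<bar> \<le> C) \<and> (\<forall>a b. a \<le> b \<longrightarrow> v n b - v n a = (LINT x:{a..b}|lborel. g x)) \<and>
      (AE x in lebesgue. (v n has_real_derivative g x) (at x))"
    by (intro allI, rule lipschitz_real_AE_derivative[OF v(1)]) blast
  note choice[OF this]
  then obtain g where g: "\<And>n. g n \<in> borel_measurable borel" "\<And>n x. \<bar>g n x\<bar> \<le> C"
    "\<And>n a b. a \<le> b \<Longrightarrow> v n b - v n a = (LINT x:{a..b}|lborel. g n x)"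
    "\<And>n. AE x in lebesgue. (v n has_real_derivative g n x) (at x)"
    by blast
  define m where "m x = (SUP n. \<bar>g n x\<bar>)" for x
  have bdd: "bdd_above (range (\<lambda>n. \<bar>g n x\<bar>))" for x using g(2) by (intro bdd_aboveI2[where M=C])
  have gm: "\<bar>g n x\<bar> \<le> m x" for n x unfolding m_def using bdd by (intro cSUP_upper) auto
  have mC: "m x \<le> C" for x unfolding m_def using g(2) by (intro cSUP_least) auto
  have m0: "0 \<le> m x" for x using order_trans[OF abs_ge_zero gm] .
  have m: "m \<in> borel_measurable borel"
    unfolding m_def[abs_def] using g(1) bdd by (intro borel_measurable_cSUP) auto
  have int: "set_integrable lborel {a..b} h" if "h \<in> borel_measurable borel" "\<And>x. \<bar>h x\<bar> \<le> C" for a b and h :: "real \<Rightarrow> real"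
    unfolding set_integrable_def using that
    by (intro integrableI_bounded_set_indicator[where B=C]) (auto simp: emeasure_lborel_Icc_eq)
  have vle: "\<bar>v n t - v n s\<bar> \<le> (LINT x:{s..t}|lborel. m x)" if "s \<le> t" for n s t
  proof -
    have "\<bar>LINT x|lborel. indicator {s..t} x *\<^sub>R g n x\<bar> \<le> (LINT x|lborel. \<bar>indicator {s..t} x *\<^sub>R g n x\<bar>)"
      by (rule integral_abs_bound)
    also have "\<dots> \<le> (LINT x|lborel. indicator {s..t} x *\<^sub>R m x)"
    proof (rule integral_mono)
      show "integrable lborel (\<lambda>x. indicator {s..t} x *\<^sub>R m x)"
        using int[OF m] m0 mC unfolding set_integrable_def by simp
      show "integrable lborel (\<lambda>x. \<bar>indicator {s..t} x *\<^sub>R g n x\<bar>)"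
        using int[OF g(1,2)] unfolding set_integrable_def by (intro integrable_abs)
    qed (use gm in \<open>auto simp: indicator_def\<close>)
    finally show ?thesis using g(3)[OF that, of n] by (simp add: set_lebesgue_integral_def)
  qed
  \<comment> \<open>For \<open>r n\<close> close to \<open>s\<close> the term
    \<open>dist (F (r n)) (F s)\<close> is negligible, so the increment of \<open>v n\<close> nearly
    equals the distance.\<close>
  have distF: "dist (F s) (F t) \<le> (LINT x:{s..t}|lborel. m x)" if st: "s \<in> A" "t \<in> A" "s \<le> t" for s t
  proof (rule field_le_epsilon)
    fix e :: real assume e: "0 < e"
    obtain n where n: "\<bar>r n - s\<bar> < e / (2 * (C + 1))" using dense[OF st(1), of "e / (2 * (C + 1))"] e C by auto
    have "C * \<bar>r n - s\<bar> \<le> (C + 1) * (e / (2 * (C + 1)))" using n C by (intro mult_mono) auto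
    also have "\<dots> = e / 2" using C by (simp add: field_simps)
    finally have "C * \<bar>r n - s\<bar> \<le> e / 2" .
    moreover have "dist (F (r n)) (F s) \<le> C * \<bar>r n - s\<bar>"
      using lipschitz_onD[OF F rA st(1)] by (simp add: dist_real_def)
    moreover have "dist (F s) (F t) \<le> dist (F (r n)) (F s) + dist (F (r n)) (F t)"
      by (rule dist_triangle3)
    ultimately show "dist (F s) (F t) \<le> (LINT x:{s..t}|lborel. m x) + e"
      using vle[OF st(3), of n] v(2) st by auto
  qed
  \<comment> \<open>The primitive of \<open>m\<close> has derivative \<open>m\<close> almost
    everywhere, which bounds distances near such a point by nearly \<open>m s\<close> times the
    difference of the parameters.\<close>
  obtain M where M: "\<And>a b. a \<le> b \<Longrightarrow> M b - M a = (LINT x:{a..b}|lborel. m x)"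
    using integral_primitive[OF m, of C] m0 mC by auto
  have "AE x in lebesgue. (M has_real_derivative m x) (at x)"
    using m0 mC by (intro AE_has_derivative_integral[OF m _ M, of C]) auto
  then have "AE x in lebesgue. (M has_real_derivative m x) (at x) \<and> (\<forall>n. (v n has_real_derivative g n x) (at x))"
    using g(4) by (simp add: AE_all_countable)
  then have "AE x in lborel. (M has_real_derivative m x) (at x) \<and> (\<forall>n. (v n has_real_derivative g n x) (at x))"
    by (simp add: AE_completion_iff)
  then obtain N where N: "N \<in> null_sets lborel" "{x. \<not> ((M has_real_derivative m x) (at x) \<and> (\<forall>n. (v n has_real_derivative g n x) (at x)))} \<subseteq> N"
  proof (rule AE_E)
    fix N assume "{x \<in> space lborel. \<not> ((M has_real_derivative m x) (at x) \<and> (\<forall>n. (v n has_real_derivative g n x) (at x)))} \<subseteq> N"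
      "emeasure lborel N = 0" "N \<in> sets lborel"
    then show thesis by (intro that[of N]) (auto simp: null_sets_def)
  qed
  \<comment> \<open>Besides the zeros of \<open>m\<close>, \<open>E\<close> takes up the null set of
    parameters where some derivative fails; it remains true that \<open>m\<close> vanishes almost
    everywhere on \<open>E\<close>.\<close>
  define E where "E = N \<union> {x. m x = 0}"
  have Eb: "E \<in> sets borel" unfolding E_def using N(1) m by (auto simp: null_sets_def)
  have "AE x in lborel. x \<in> E \<longrightarrow> m x = 0"
    using AE_not_in[OF N(1)] by eventually_elim (auto simp: E_def)
  then have nullE: "h1_null (F ` (A \<inter> E))"
    using distF by (intro h1_null_image[OF m m0 mC _ Eb]) auto
  \<comment> \<open>The parameters at which \<open>v n\<close> works on the whole scale
    \<open>1 / (k + 1)\<close>. Fixing the scale makes this set closed, so that its bounded pieces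
    have compact images.\<close>
  define B where "B n k = {s \<in> A. \<forall>t\<in>A. \<bar>t - s\<bar> < 1 / real (Suc k) \<longrightarrow> dist (F s) (F t) \<le> (1 + \<epsilon>) * \<bar>v n s - v n t\<bar>}" for n k
  have cont: "continuous_on A F" by (rule lipschitz_on_continuous_on[OF F])
  have Bclosed: "closed (B n k)" for n k
  proof (unfold closed_sequential_limits, intro allI impI, elim conjE)
    fix x l assume x: "\<forall>i. x i \<in> B n k" "x \<longlonglongrightarrow> l"
    have l: "l \<in> A" using closed_sequentially[OF A _ x(2)] x(1) by (auto simp: B_def)
    have "dist (F l) (F t) \<le> (1 + \<epsilon>) * \<bar>v n l - v n t\<bar>" if t: "t \<in> A" "\<bar>t - l\<bar> < 1 / real (Suc k)" for t
    proof (rule LIMSEQ_le)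
      have "(\<lambda>i. F (x i)) \<longlonglongrightarrow> F l"
        using continuous_on_tendsto_compose[OF cont x(2) l] x(1) by (auto simp: B_def)
      then show "(\<lambda>i. dist (F (x i)) (F t)) \<longlonglongrightarrow> dist (F l) (F t)" by (intro tendsto_intros)
      have "(\<lambda>i. v n (x i)) \<longlonglongrightarrow> v n l"
        using continuous_on_tendsto_compose[OF lipschitz_on_continuous_on[OF v(1)] x(2)] by auto
      then show "(\<lambda>i. (1 + \<epsilon>) * \<bar>v n (x i) - v n t\<bar>) \<longlonglongrightarrow> (1 + \<epsilon>) * \<bar>v n l - v n t\<bar>" by (intro tendsto_intros)
      have "(\<lambda>i. \<bar>t - x i\<bar>) \<longlonglongrightarrow> \<bar>t - l\<bar>" using x(2) by (intro tendsto_intros)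
      then have "eventually (\<lambda>i. \<bar>t - x i\<bar> < 1 / real (Suc k)) sequentially" using t(2) by (rule order_tendstoD)
      then show "\<exists>N. \<forall>i\<ge>N. dist (F (x i)) (F t) \<le> (1 + \<epsilon>) * \<bar>v n (x i) - v n t\<bar>"
        using x(1) t(1) unfolding eventually_sequentially B_def by blast
    qed
    then show "l \<in> B n k" using l by (auto simp: B_def)
  qed
  have good: "\<exists>n k. s \<in> B n k" if s: "s \<in> A" "s \<notin> E" for s
  proof -
    have dM: "(M has_real_derivative m s) (at s)" and dv: "\<And>n. (v n has_real_derivative g n s) (at s)" and "0 < m s"
      using s N(2) m0[of s] unfolding E_def by (auto simp: less_le)
    have "m s / (1 + \<epsilon>) < m s" using \<open>0 < m s\<close> \<epsilon> by (simp add: field_simps)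
    then obtain n where n: "m s / (1 + \<epsilon>) < \<bar>g n s\<bar>"
      using less_cSUP_iff[OF _ bdd] unfolding m_def by auto
    then have ms: "m s < (1 + \<epsilon>) * \<bar>g n s\<bar>" using \<epsilon> by (simp add: field_simps)
    \<comment> \<open>The solution of \<open>m s + \<eta> = (1 + \<epsilon>) * (\<bar>g n s\<bar> -
      \<eta>)\<close>: the upper bound for the distance and the lower bound for the increment of
      \<open>v n\<close> then match.\<close>
    define \<eta> where "\<eta> = ((1 + \<epsilon>) * \<bar>g n s\<bar> - m s) / (2 + \<epsilon>)"
    have \<eta>: "0 < \<eta>" using ms \<epsilon> by (simp add: \<eta>_def)
    have \<eta>eq: "m s + \<eta> = (1 + \<epsilon>) * (\<bar>g n s\<bar> - \<eta>)"
    proof -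
      have "\<eta> * (2 + \<epsilon>) = (1 + \<epsilon>) * \<bar>g n s\<bar> - m s" using \<epsilon> by (simp add: \<eta>_def)
      then show ?thesis by (simp add: algebra_simps)
    qed
    have quot: "\<exists>d>0. \<forall>t. \<bar>t - s\<bar> < d \<longrightarrow> \<bar>f t - f s - f' * (t - s)\<bar> \<le> \<eta> * \<bar>t - s\<bar>"
      if "(f has_real_derivative f') (at s)" for f f'
    proof -
      have "((\<lambda>t. (f t - f s) / (t - s)) \<longlongrightarrow> f') (at s)" using that by (simp add: has_field_derivative_iff)
      then obtain d where d: "d > 0" "\<And>t. t \<noteq> s \<Longrightarrow> \<bar>t - s\<bar> < d \<Longrightarrow> \<bar>(f t - f s) / (t - s) - f'\<bar> < \<eta>"
        using \<eta> unfolding LIM_eq by force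
      have "\<bar>f t - f s - f' * (t - s)\<bar> \<le> \<eta> * \<bar>t - s\<bar>" if "\<bar>t - s\<bar> < d" for t
      proof (cases "t = s")
        case False
        have "f t - f s - f' * (t - s) = ((f t - f s) / (t - s) - f') * (t - s)"
          using False by (simp add: field_simps)
        also have "\<bar>\<dots>\<bar> \<le> \<eta> * \<bar>t - s\<bar>"
          unfolding abs_mult using d(2)[OF False that] by (intro mult_right_mono) auto
        finally show ?thesis .
      qed simp
      with d(1) show ?thesis by blast
    qed
    obtain d1 where d1: "d1 > 0" "\<And>t. \<bar>t - s\<bar> < d1 \<Longrightarrow> \<bar>M t - M s - m s * (t - s)\<bar> \<le> \<eta> * \<bar>t - s\<bar>"
      using quot[OF dM] by blast
    obtain d2 where d2: "d2 > 0" "\<And>t. \<bar>t - s\<bar> < d2 \<Longrightarrow> \<bar>v n t - v n s - g n s * (t - s)\<bar> \<le> \<eta> * \<bar>t - s\<bar>"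
      using quot[OF dv[of n]] by blast
    obtain k where k: "1 / real (Suc k) < min d1 d2"
      using nat_approx_posE[of "min d1 d2"] d1(1) d2(1) by (metis inverse_eq_divide min_less_iff_conj)
    have "dist (F s) (F t) \<le> (1 + \<epsilon>) * \<bar>v n s - v n t\<bar>" if t: "t \<in> A" "\<bar>t - s\<bar> < 1 / real (Suc k)" for t
    proof -
      have "dist (F s) (F t) \<le> \<bar>M t - M s\<bar>"
      proof (cases "s \<le> t")
        case True
        then show ?thesis using distF[OF s(1) t(1)] M by fastforce
      next
        case False
        then show ?thesis using distF[OF t(1) s(1)] M[of t s] by (simp add: dist_commute)
      qed
      also have "\<dots> \<le> (m s + \<eta>) * \<bar>t - s\<bar>"
      proof -
        have "\<bar>M t - M s\<bar> \<le> \<bar>m s * (t - s)\<bar> + \<eta> * \<bar>t - s\<bar>" using d1(2)[of t] t k by simp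
        then show ?thesis using m0[of s] by (simp add: abs_mult distrib_right)
      qed
      also have "\<dots> = (1 + \<epsilon>) * ((\<bar>g n s\<bar> - \<eta>) * \<bar>t - s\<bar>)" unfolding \<eta>eq by simp
      also have "\<dots> \<le> (1 + \<epsilon>) * \<bar>v n s - v n t\<bar>"
      proof (intro mult_left_mono)
        have "\<bar>g n s * (t - s)\<bar> \<le> \<bar>v n s - v n t\<bar> + \<eta> * \<bar>t - s\<bar>" using d2(2)[of t] t k by simp
        then show "(\<bar>g n s\<bar> - \<eta>) * \<bar>t - s\<bar> \<le> \<bar>v n s - v n t\<bar>" by (simp add: abs_mult left_diff_distrib)
      qed (use \<epsilon> in simp)
      finally show ?thesis .
    qed
    then show ?thesis using s by (auto simp: B_def)
  qed
  \<comment> \<open>Cells of half the scale of \<open>B n k\<close>, so that any two parameters in a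
    cell are comparable.\<close>
  define P where "P = (\<lambda>(n, k, j). F ` (B n k \<inter> {of_int j / (2 * real (Suc k)) .. (of_int j + 1) / (2 * real (Suc k))}))"
  let ?\<C> = "P ` (UNIV :: (nat \<times> nat \<times> int) set)"
  have "compact (P i) \<and> (\<exists>z. near_isometry \<epsilon> z (P i))" for i
  proof -
    obtain n k j where i: "i = (n, k, j)" by (cases i)
    let ?Q = "B n k \<inter> {of_int j / (2 * real (Suc k)) .. (of_int j + 1) / (2 * real (Suc k))}"
    have BA: "B n k \<subseteq> A" by (auto simp: B_def)
    have "compact ?Q" using Bclosed by (intro closed_Int_compact) auto
    then have "compact (F ` ?Q)"
      using BA by (intro compact_continuous_image continuous_on_subset[OF cont]) auto
    moreover have "near_isometry \<epsilon> (F (r n)) (F ` ?Q)"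
      unfolding near_isometry_def
    proof (clarify)
      fix s t assume s: "s \<in> B n k" "s \<in> {of_int j / (2 * real (Suc k)) .. (of_int j + 1) / (2 * real (Suc k))}"
        and t: "t \<in> B n k" "t \<in> {of_int j / (2 * real (Suc k)) .. (of_int j + 1) / (2 * real (Suc k))}"
      have "\<bar>t - s\<bar> \<le> (of_int j + 1) / (2 * real (Suc k)) - of_int j / (2 * real (Suc k))"
        using s t by auto
      also have "\<dots> = 1 / (2 * real (Suc k))" by (simp add: diff_divide_distrib[symmetric])
      also have "\<dots> < 1 / real (Suc k)" by (intro divide_strict_left_mono) auto
      finally have "dist (F s) (F t) \<le> (1 + \<epsilon>) * \<bar>v n s - v n t\<bar>" using s t BA by (auto simp: B_def)
      then show "dist (F s) (F t) \<le> (1 + \<epsilon>) * \<bar>dist (F (r n)) (F s) - dist (F (r n)) (F t)\<bar>"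
        using v(2) s t BA by (metis subsetD)
    qed
    ultimately show ?thesis by (auto simp: P_def i)
  qed
  moreover have "F ` A - \<Union>?\<C> \<subseteq> F ` (A \<inter> E)"
  proof
    fix y assume y: "y \<in> F ` A - \<Union>?\<C>"
    then obtain s where s: "s \<in> A" "y = F s" by blast
    have "s \<in> E"
    proof (rule ccontr)
      assume "s \<notin> E"
      then obtain n k where nk: "s \<in> B n k" using good s by blast
      define j where "j = \<lfloor>s * (2 * real (Suc k))\<rfloor>"
      have "of_int j \<le> s * (2 * real (Suc k))" "s * (2 * real (Suc k)) \<le> of_int j + 1"
        unfolding j_def by linarith+
      then have "s \<in> {of_int j / (2 * real (Suc k)) .. (of_int j + 1) / (2 * real (Suc k))}"
        by (simp add: pos_divide_le_eq pos_le_divide_eq)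
      then have "y \<in> P (n, k, j)" using nk s by (auto simp: P_def)
      then show False using y by blast
    qed
    then show "y \<in> F ` (A \<inter> E)" using s by blast
  qed
  ultimately show ?thesis
    using h1_null_subset[OF nullE] by (intro exI[of _ ?\<C>]) auto
qed

text \<open>The premise \<open>X\<close>, extension of Lipschitz maps to the closure of their
  domain, makes the domains of the charts closed. What the compact sets miss is null for
  one-dimensional Hausdorff measure and, after enlargement to a Borel set, for
  \<open>\<mu>\<close>.\<close>

lemma (in metric_current1) near_isometry_cover:
  fixes \<epsilon> :: real
  assumes X: "\<And>A (F :: real \<Rightarrow> 'a) C. C-lipschitz_on A F \<Longrightarrow> \<exists>F'. C-lipschitz_on (closure A) F' \<and> (\<forall>x\<in>A. F' x = F x)"
    and rect: "countably_rectifiable TYPE(real) S" "AE x in \<mu>. x \<in> S"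
    and null: "\<And>B. B \<in> sets borel \<Longrightarrow> hausdorff_measure 1 B = 0 \<Longrightarrow> emeasure \<mu> B = 0"
    and \<epsilon>: "0 < \<epsilon>"
  obtains K :: "nat \<Rightarrow> 'a set" and z where "\<And>j. compact (K j)" "\<And>j. near_isometry \<epsilon> (z j) (K j)"
    "AE x in \<mu>. x \<in> (\<Union>j. K j)"
proof -
  obtain A :: "nat \<Rightarrow> real set" and F where AF: "\<And>i. \<exists>C. C-lipschitz_on (A i) (F i)"
    "hausdorff_measure 1 (S - (\<Union>i. F i ` A i)) = 0"
    using rect(1) unfolding countably_rectifiable_def DIM_real by blast
  have "\<exists>\<C>. countable \<C> \<and> (\<forall>K\<in>\<C>. compact K \<and> (\<exists>z. near_isometry \<epsilon> z K)) \<and> h1_null (F i ` A i - \<Union>\<C>)" for i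
  proof -
    obtain C where "C-lipschitz_on (A i) (F i)" using AF(1) by blast
    from X[OF this] obtain F' where F': "C-lipschitz_on (closure (A i)) F'" "\<And>x. x \<in> A i \<Longrightarrow> F' x = F i x" by blast
    obtain \<C> where \<C>: "countable \<C>" "\<forall>K\<in>\<C>. compact K \<and> (\<exists>z. near_isometry \<epsilon> z K)" "h1_null (F' ` closure (A i) - \<Union>\<C>)"
      using near_isometry_cover[OF closed_closure F'(1) \<epsilon>] by blast
    have "F i ` A i \<subseteq> F' ` closure (A i)" using F'(2) closure_subset[of "A i"] by force
    then have "h1_null (F i ` A i - \<Union>\<C>)" by (intro h1_null_subset[OF \<C>(3)]) auto
    with \<C> show ?thesis by blast
  qed
  then obtain \<C> where \<C>: "\<And>i. countable (\<C> i)" "\<And>i K. K \<in> \<C> i \<Longrightarrow> compact K \<and> (\<exists>z. near_isometry \<epsilon> z K)"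
    "\<And>i::nat. h1_null (F i ` A i - \<Union>(\<C> i))"
    by metis
  \<comment> \<open>The empty set makes the family nonempty, so that it can be enumerated by all
    natural numbers.\<close>
  define \<D> where "\<D> = insert {} (\<Union>i. \<C> i)"
  have cD: "countable \<D>" "\<D> \<noteq> {}" using \<C>(1) by (auto simp: \<D>_def)
  have D: "compact K \<and> (\<exists>z. near_isometry \<epsilon> z K)" if "K \<in> \<D>" for K
    using that \<C>(2) by (auto simp: \<D>_def near_isometry_def)
  define K where "K = from_nat_into \<D>"
  have KD: "range K = \<D>" unfolding K_def using range_from_nat_into[OF cD(2,1)] .
  have "h1_null ((S - (\<Union>i. F i ` A i)) \<union> (\<Union>i. F i ` A i - \<Union>(\<C> i)))"
    using AF(2) \<C>(3) by (intro h1_null_Un h1_null_UN) (auto simp: h1_null_iff)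
  then obtain B where B: "B \<in> sets borel" "(S - (\<Union>i. F i ` A i)) \<union> (\<Union>i. F i ` A i - \<Union>(\<C> i)) \<subseteq> B" "h1_null B"
    by (rule h1_null_borel)
  have "B \<in> null_sets \<mu>" using null[OF B(1)] B by (auto simp: h1_null_iff null_sets_def sets_borel)
  then have "AE x in \<mu>. x \<notin> B" by (rule AE_not_in)
  then have "AE x in \<mu>. x \<in> (\<Union>j. K j)"
    using rect(2)
  proof eventually_elim
    fix x assume "x \<notin> B" "x \<in> S"
    then have "\<exists>i. x \<in> \<Union>(\<C> i)" using B(2) by blast
    then have "x \<in> \<Union>\<D>" by (auto simp: \<D>_def)
    then show "x \<in> (\<Union>j. K j)" using KD by blast
  qed
  moreover have "\<forall>j. \<exists>z. near_isometry \<epsilon> z (K j)" using D KD by blast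
  then have "\<exists>z. \<forall>j. near_isometry \<epsilon> (z j) (K j)" by (rule choice)
  moreover have "compact (K j)" for j using D KD by blast
  ultimately show thesis using that by blast
qed

section \<open>Discretising integrals over compact sets of reals\<close>

lemma sum_list_abs_diff_le:
  fixes u v :: "'b \<Rightarrow> real"
  assumes "\<And>k. k \<in> set ks \<Longrightarrow> \<bar>u k - v k\<bar> \<le> c"
  shows "\<bar>(\<Sum>k\<leftarrow>ks. u k) - (\<Sum>k\<leftarrow>ks. v k)\<bar> \<le> real (length ks) * c"
  using assms
proof (induction ks)
  case (Cons k ks)
  have "\<bar>u k - v k\<bar> \<le> c" "\<bar>(\<Sum>k\<leftarrow>ks. u k) - (\<Sum>k\<leftarrow>ks. v k)\<bar> \<le> real (length ks) * c"
    using Cons by auto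
  then show ?case by (simp add: distrib_right)
qed simp

text \<open>Replacing \<open>F x\<close> by \<open>F c\<close> changes a factor by at most
  \<open>A * (b - a)\<close>; integration over the interval adds a second factor
  \<open>b - a\<close>. Quadratic errors vanish in sum as a partition gets finer.\<close>

lemma riemann_step:
  fixes F r :: "real \<Rightarrow> real"
  assumes F: "A-lipschitz_on UNIV F" "\<And>x. \<bar>F x\<bar> \<le> A" and r: "r \<in> borel_measurable borel" "\<And>x. \<bar>r x\<bar> \<le> C"
    and c: "a \<le> c" "c \<le> b"
  shows "\<bar>(LINT x:{a..b}|lborel. F x * r x) - F c * (LINT x:{a..b}|lborel. r x)\<bar> \<le> A * C * (b - a)\<^sup>2"
proof -
  have AC: "0 \<le> A" "0 \<le> C" using lipschitz_on_nonneg[OF F(1)] order_trans[OF abs_ge_zero r(2)] by auto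
  have F_meas: "F \<in> borel_measurable borel" by (rule lipschitz_on_borel[OF F(1)])
  have m: "(\<lambda>x. F x * r x) \<in> borel_measurable borel" using F_meas r(1) by measurable
  have b: "\<bar>F y * r x\<bar> \<le> A * C" for x y unfolding abs_mult using F(2) r(2) AC by (intro mult_mono) auto
  have "(LINT x:{a..b}|lborel. F x * r x) - F c * (LINT x:{a..b}|lborel. r x) = (LINT x:{a..b}|lborel. F x * r x - F c * r x)"
    unfolding set_integral_mult_right[symmetric]
    by (intro set_integral_diff(2)[symmetric] set_integrable_bounded_interval[OF m b]
      set_integrable_mult_right set_integrable_bounded_interval[OF r])
  also have "\<bar>\<dots>\<bar> \<le> (A * (b - a) * C) * (b - a)"
  proof (rule set_integral_interval_le[where B="2 * (A * C)"])
    show "(\<lambda>x. F x * r x - F c * r x) \<in> borel_measurable borel" using m r(1) by measurable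
    show "\<bar>F x * r x - F c * r x\<bar> \<le> 2 * (A * C)" for x using b[of x x] b[of c x] by linarith
    show "\<bar>F x * r x - F c * r x\<bar> \<le> A * (b - a) * C" if x: "a \<le> x" "x \<le> b" for x
    proof -
      have "\<bar>F x - F c\<bar> \<le> A * dist x c" by (rule lipschitz_realD[OF F(1)]) auto
      also have "\<dots> \<le> A * (b - a)" using c x AC by (intro mult_left_mono) (auto simp: dist_real_def)
      finally have "\<bar>F x - F c\<bar> * \<bar>r x\<bar> \<le> A * (b - a) * C" using r(2) AC x by (intro mult_mono) auto
      then show ?thesis by (simp add: abs_mult flip: left_diff_distrib)
    qed
  qed (use c in simp)
  finally show ?thesis by (simp add: power2_eq_square mult_ac)
qed

text \<open>The line is cut into cells of length \<open>h\<close>, and a cell that meets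
  \<open>K\<close> contributes the hull of its part of \<open>K\<close>. Thus all end points lie in
  \<open>K\<close>, where alone the inverse of a distance function will be defined. The list is
  fixed before the functions. The tag \<open>\<tau>\<close> is left free because reversed edges
  evaluate their function at the right end point.\<close>

lemma compact_discretization:
  fixes K :: "real set"
  assumes K: "compact K" and \<delta>: "0 < \<delta>"
  obtains es :: "(real \<times> real) list"
  where "\<And>a b. (a, b) \<in> set es \<Longrightarrow> a \<in> K \<and> b \<in> K \<and> a \<le> b \<and> b - a \<le> \<delta>"
    "\<And>A C F Q q \<tau>. \<lbrakk>0 \<le> C; A-lipschitz_on UNIV F; \<And>x. \<bar>F x\<bar> \<le> A; q \<in> borel_measurable borel; \<And>x. \<bar>q x\<bar> \<le> C;
       \<And>a b. a \<le> b \<Longrightarrow> Q b - Q a = (LINT x:{a..b}|lborel. q x); \<And>a b. a \<le> b \<Longrightarrow> a \<le> \<tau> a b \<and> \<tau> a b \<le> b\<rbrakk>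
       \<Longrightarrow> \<bar>(LINT x|lborel. indicator K x * (F x * q x)) - (\<Sum>(a, b)\<leftarrow>es. F (\<tau> a b) * (Q b - Q a))\<bar> \<le> \<delta> * A * C"
proof -
  obtain B where B: "0 < B" "\<And>x. x \<in> K \<Longrightarrow> \<bar>x\<bar> \<le> B" using compact_imp_bounded[OF K] by (auto simp: bounded_pos)
  have bK: "K \<in> sets borel" using K by (simp add: compact_imp_closed)
  obtain U where U: "open U" "K \<subseteq> U" "U - K \<in> lmeasurable" "emeasure lebesgue (U - K) < ennreal (\<delta> / 2)"
    using sets_lebesgue_outer_open[of K "\<delta> / 2"] bK \<delta>
    by (metis half_gt_zero sets_completionI_sets sets_lborel)
  have UK: "U - K \<in> sets borel" "emeasure lborel (U - K) < ennreal (\<delta> / 2)" using U bK by auto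
  obtain h0 where h0: "0 < h0" "(\<Union>x\<in>K. ball x h0) \<subseteq> U"
    using compact_subset_open_imp_ball_epsilon_subset[OF K U(1,2)] by blast
  \<comment> \<open>The first bound keeps the hulls inside \<open>U\<close>, the second makes the
    edges short, and the third keeps the Riemann error of about
    \<open>(2 * B / h + 1) * h\<^sup>2\<close> below \<open>\<delta> / 2\<close>.\<close>
  define h where "h = min (h0 / 2) (min \<delta> (\<delta> / (2 * (2 * B + \<delta> + 1))))"
  have h: "0 < h" "h < h0" "h \<le> \<delta>" "h * (2 * B + h) \<le> \<delta> / 2"
  proof -
    show h': "0 < h" "h < h0" "h \<le> \<delta>" using h0 \<delta> B(1) by (auto simp: h_def min_less_iff_disj)
    have "h * (2 * B + h) \<le> \<delta> / (2 * (2 * B + \<delta> + 1)) * (2 * B + \<delta> + 1)"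
      using h' \<delta> B(1) by (intro mult_mono) (auto simp: h_def)
    also have "\<dots> = \<delta> / 2" using \<delta> B(1) by (simp add: field_simps)
    finally show "h * (2 * B + h) \<le> \<delta> / 2" .
  qed
  define N where "N = nat \<lfloor>2 * B / h\<rfloor> + 1"
  have N: "real N * h \<le> 2 * B + h"
  proof -
    have "real (nat \<lfloor>2 * B / h\<rfloor>) \<le> 2 * B / h" using B(1) h(1) by simp
    then show ?thesis using h(1) by (simp add: N_def pos_le_divide_eq algebra_simps)
  qed
  define idx where "idx x = nat \<lfloor>(x + B) / h\<rfloor>" for x
  define a b where "a n = Inf (K \<inter> idx -` {n})" and "b n = Sup (K \<inter> idx -` {n})" for n
  define J where "J = filter (\<lambda>n. K \<inter> idx -` {n} \<noteq> {}) [0..<N]"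
  have cell: "real n * h - B \<le> x \<and> x \<le> real (Suc n) * h - B" if "x \<in> K" "idx x = n" for x n
  proof -
    have "0 \<le> (x + B) / h" using B(2)[OF that(1)] h(1) by simp
    then have "real n \<le> (x + B) / h" "(x + B) / h \<le> real (Suc n)" using that(2) unfolding idx_def by linarith+
    then show ?thesis using h(1) by (simp add: field_simps)
  qed
  have ab: "a n \<in> K" "b n \<in> K" "K \<inter> idx -` {n} \<subseteq> {a n..b n}" "a n \<le> b n" "b n - a n \<le> h" "{a n..b n} \<subseteq> U"
    "real n * h - B \<le> a n" "b n \<le> real (Suc n) * h - B" if "n \<in> set J" for n
  proof -
    have ne: "K \<inter> idx -` {n} \<noteq> {}" using that by (simp add: J_def)
    have bd: "bdd_above (K \<inter> idx -` {n})" "bdd_below (K \<inter> idx -` {n})"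
      using compact_imp_bounded[OF K] by (auto intro: bdd_above_mono bdd_below_mono bounded_imp_bdd_above bounded_imp_bdd_below)
    have "closure (K \<inter> idx -` {n}) \<subseteq> K" using K by (intro closure_minimal) (auto simp: compact_imp_closed)
    then show abK: "a n \<in> K" "b n \<in> K"
      using closure_contains_Inf[OF ne bd(2)] closure_contains_Sup[OF ne bd(1)] by (auto simp: a_def b_def)
    show in_ab: "K \<inter> idx -` {n} \<subseteq> {a n..b n}" using cInf_lower[OF _ bd(2)] cSup_upper[OF _ bd(1)] by (auto simp: a_def b_def)
    then show "a n \<le> b n" using ne by fastforce
    show lu: "real n * h - B \<le> a n" "b n \<le> real (Suc n) * h - B"
      unfolding a_def b_def using ne cell by (auto intro!: cInf_greatest cSup_least)
    then show len: "b n - a n \<le> h" by (simp add: algebra_simps)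
    show "{a n..b n} \<subseteq> U"
    proof
      fix x assume "x \<in> {a n..b n}"
      then have "x \<in> ball (a n) h0" using len h(2) by (auto simp: dist_real_def)
      then show "x \<in> U" using h0(2) abK(1) by blast
    qed
  qed
  define s :: "real \<Rightarrow> real" where "s x = (\<Sum>n\<leftarrow>J. indicator {a n..b n} x)" for x
  \<comment> \<open>Adjacent hulls may share an end point on the grid. Off the grid at most one hull
    contains \<open>x\<close>; the hulls cover \<open>K\<close> and stay in
    \<open>U\<close>.\<close>
  have s_AE: "AE x in lborel. \<bar>indicator K x - s x\<bar> \<le> indicator (U - K) x"
  proof -
    have "AE x in lborel. x \<notin> (\<lambda>n. real n * h - B) ` {..N}"
      by (intro AE_not_in finite_imp_null_set_lborel) simp
    then show ?thesis
    proof eventually_elim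
      fix x assume x: "x \<notin> (\<lambda>n. real n * h - B) ` {..N}"
      have idx_x: "idx x = n" if n: "n \<in> set J" "x \<in> {a n..b n}" for n
      proof -
        have "n < N" using n(1) by (simp add: J_def)
        then have "real (Suc n) * h - B \<in> (\<lambda>n. real n * h - B) ` {..N}" by (intro imageI) simp
        then have "x \<noteq> real (Suc n) * h - B" using x by blast
        then have "real n * h \<le> x + B" "x + B < real (Suc n) * h" using n(2) ab(7,8)[OF n(1)] by auto
        then have "real n \<le> (x + B) / h" "(x + B) / h < real n + 1"
          using h(1) by (simp_all add: pos_le_divide_eq pos_divide_less_eq algebra_simps)
        then show ?thesis unfolding idx_def by linarith
      qed
      have s_x: "s x = (if idx x \<in> set J then indicator {a (idx x)..b (idx x)} x else 0)"
      proof -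
        have "s x = (\<Sum>n\<in>set J. indicator {a n..b n} x)"
          unfolding s_def by (rule sum_list_distinct_conv_sum_set) (simp add: J_def)
        also have "\<dots> = (\<Sum>n\<in>set J. if n = idx x then indicator {a n..b n} x else 0)"
        proof (rule sum.cong[OF refl])
          show "indicator {a n..b n} x = (if n = idx x then indicator {a n..b n} x else 0)" if "n \<in> set J" for n
            using idx_x[OF that] by (auto simp only: indicator_def of_bool_def if_True if_False split: if_split)
        qed
        finally show ?thesis by (simp add: sum.delta)
      qed
      have "s x = 1" if "x \<in> K"
      proof -
        have "(x + B) / h \<le> 2 * B / h" using B(2)[OF that] h(1) by (intro divide_right_mono) auto
        then have "idx x < N" unfolding idx_def N_def by linarith
        then have "idx x \<in> set J" using that by (auto simp: J_def)
        then show ?thesis using ab(3)[of "idx x"] that s_x by auto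
      qed
      moreover have "s x = 0" if "x \<notin> U" using that s_x ab(6)[of "idx x"] by (auto simp: indicator_def subset_iff)
      moreover have "0 \<le> s x" "s x \<le> 1" by (auto simp: s_x indicator_def)
      ultimately show "\<bar>indicator K x - s x\<bar> \<le> indicator (U - K) x" using U(2) by (auto simp: indicator_def)
    qed
  qed
  show thesis
  proof (rule that[of "map (\<lambda>n. (a n, b n)) J"])
    show "c \<in> K \<and> d \<in> K \<and> c \<le> d \<and> d - c \<le> \<delta>" if "(c, d) \<in> set (map (\<lambda>n. (a n, b n)) J)" for c d
      using that ab h(3) by fastforce
    fix A C :: real and F Q q :: "real \<Rightarrow> real" and \<tau> :: "real \<Rightarrow> real \<Rightarrow> real"
    assume C0: "0 \<le> C" and F: "A-lipschitz_on UNIV F" "\<And>x. \<bar>F x\<bar> \<le> A" and q: "q \<in> borel_measurable borel" "\<And>x. \<bar>q x\<bar> \<le> C"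
      and Q: "\<And>a b. a \<le> b \<Longrightarrow> Q b - Q a = (LINT x:{a..b}|lborel. q x)" and \<tau>: "\<And>a b. a \<le> b \<Longrightarrow> a \<le> \<tau> a b \<and> \<tau> a b \<le> b"
    have A0: "0 \<le> A" by (rule lipschitz_on_nonneg[OF F(1)])
    have Fq [measurable]: "(\<lambda>x. F x * q x) \<in> borel_measurable borel"
      using lipschitz_on_borel[OF F(1)] q(1) by measurable
    have Fqb: "\<bar>F x * q x\<bar> \<le> A * C" for x unfolding abs_mult using F(2) q(2) A0 by (intro mult_mono) auto
    have i: "integrable lborel (\<lambda>x. indicator S x * (F x * q x))" if "S \<in> sets borel" "bounded S" for S
      using integrableI_bounded_set_indicator[of S lborel "\<lambda>x. F x * q x" "A * C"] emeasure_bounded_finite[of S] that Fqb by simp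
    have int_s: "integrable lborel (\<lambda>x. s x * (F x * q x)) \<and>
      (LINT x|lborel. s x * (F x * q x)) = (\<Sum>n\<leftarrow>J. LINT x:{a n..b n}|lborel. F x * q x)"
      unfolding s_def set_lebesgue_integral_def using i[of "{_.._}"]
      by (induction J) (auto simp: distrib_right)
    have iK: "integrable lborel (\<lambda>x. indicator K x * (F x * q x))" using i bK compact_imp_bounded[OF K] by blast
    have iUK: "integrable lborel (\<lambda>x. A * C * indicator (U - K) x)"
      using UK by (intro integrable_mult_right integrable_real_indicator) (auto intro: less_trans)
    have "\<bar>(LINT x|lborel. indicator K x * (F x * q x)) - (LINT x|lborel. s x * (F x * q x))\<bar> =
        \<bar>LINT x|lborel. (indicator K x - s x) * (F x * q x)\<bar>"
      using int_s iK by (simp add: left_diff_distrib)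
    also have "\<dots> \<le> (LINT x|lborel. \<bar>(indicator K x - s x) * (F x * q x)\<bar>)" by (rule integral_abs_bound)
    also have "\<dots> \<le> (LINT x|lborel. A * C * indicator (U - K) x)"
    proof (rule integral_mono_AE[OF _ iUK])
      show "integrable lborel (\<lambda>x. \<bar>(indicator K x - s x) * (F x * q x)\<bar>)"
        using int_s iK by (intro integrable_abs) (simp add: left_diff_distrib)
      show "AE x in lborel. \<bar>(indicator K x - s x) * (F x * q x)\<bar> \<le> A * C * indicator (U - K) x"
        using s_AE
      proof eventually_elim
        fix x assume "\<bar>indicator K x - s x\<bar> \<le> indicator (U - K) x"
        then show "\<bar>(indicator K x - s x) * (F x * q x)\<bar> \<le> A * C * indicator (U - K) x"
          unfolding abs_mult[of "_ - _"] mult.commute[of "A * C"] by (intro mult_mono Fqb) auto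
      qed
    qed
    also have "\<dots> = A * C * measure lborel (U - K)" using UK(1) by simp
    also have "\<dots> \<le> A * C * (\<delta> / 2)"
    proof (intro mult_left_mono)
      show "measure lborel (U - K) \<le> \<delta> / 2" using UK \<delta> unfolding measure_def by (intro enn2real_leI) auto
    qed (use A0 C0 in simp)
    finally have 1: "\<bar>(LINT x|lborel. indicator K x * (F x * q x)) - (\<Sum>n\<leftarrow>J. LINT x:{a n..b n}|lborel. F x * q x)\<bar> \<le> A * C * (\<delta> / 2)"
      using int_s by simp
    have "\<bar>(\<Sum>n\<leftarrow>J. LINT x:{a n..b n}|lborel. F x * q x) - (\<Sum>n\<leftarrow>J. F (\<tau> (a n) (b n)) * (Q (b n) - Q (a n)))\<bar>
        \<le> real (length J) * (A * C * h\<^sup>2)"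
    proof (rule sum_list_abs_diff_le)
      fix n assume n: "n \<in> set J"
      have "\<bar>(LINT x:{a n..b n}|lborel. F x * q x) - F (\<tau> (a n) (b n)) * (Q (b n) - Q (a n))\<bar> \<le> A * C * (b n - a n)\<^sup>2"
        unfolding Q[OF ab(4)[OF n]] using \<tau>[OF ab(4)[OF n]] by (intro riemann_step[OF F q]) auto
      also have "\<dots> \<le> A * C * h\<^sup>2"
        using ab(4,5)[OF n] A0 C0 by (intro mult_left_mono power_mono) auto
      finally show "\<bar>(LINT x:{a n..b n}|lborel. F x * q x) - F (\<tau> (a n) (b n)) * (Q (b n) - Q (a n))\<bar> \<le> A * C * h\<^sup>2" .
    qed
    also have "\<dots> \<le> A * C * (\<delta> / 2)"
    proof -
      have "real (length J) \<le> real N" using length_filter_le[of _ "[0..<N]"] by (simp add: J_def)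
      then have "real (length J) * h * h \<le> real N * h * h" using h(1) by (intro mult_right_mono) auto
      also have "\<dots> \<le> (2 * B + h) * h" using N h(1) by (intro mult_right_mono) auto
      also have "\<dots> \<le> \<delta> / 2" using h(4) by (simp only: mult.commute)
      finally have "A * C * (real (length J) * h * h) \<le> A * C * (\<delta> / 2)" using A0 C0 by (intro mult_left_mono) auto
      then show ?thesis by (simp add: power2_eq_square mult_ac)
    qed
    finally have "\<bar>(LINT x|lborel. indicator K x * (F x * q x)) - (\<Sum>n\<leftarrow>J. F (\<tau> (a n) (b n)) * (Q (b n) - Q (a n)))\<bar> \<le>
      A * C * (\<delta> / 2) + A * C * (\<delta> / 2)" using 1 by linarith
    then show "\<bar>(LINT x|lborel. indicator K x * (F x * q x)) - (\<Sum>(a, b)\<leftarrow>map (\<lambda>n. (a n, b n)) J. F (\<tau> a b) * (Q b - Q a))\<bar> \<le> \<delta> * A * C"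
      by (simp add: comp_def mult.commute[of \<delta>] mult.assoc)
  qed
qed

section \<open>Integer valued functions and their level sets\<close>

lemma compact_inner_approximation:
  fixes S :: "real set"
  assumes "S \<in> sets borel" "bounded S" "0 < e"
  obtains K where "compact K" "K \<subseteq> S" "measure lborel (S - K) < e"
proof -
  obtain T where T: "closed T" "T \<subseteq> S" "S - T \<in> lmeasurable" "emeasure lebesgue (S - T) < ennreal e"
    using sets_lebesgue_inner_closed[of S e] assms by (metis sets_completionI_sets sets_lborel)
  have "measure lborel (S - T) < e"
    using T assms by (simp add: emeasure_eq_measure2 ennreal_less_iff)
  moreover have "compact T" using T assms by (meson bounded_subset compact_eq_bounded_closed)
  ultimately show thesis using that T by blast
qed

lemma sum_integer_levels:
  fixes z :: real
  assumes "z \<in> \<int>"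
  shows "(\<Sum>n<N. if real n + 1 \<le> z then 1 else 0 :: real) = min (real N) (max z 0)"
proof (induction N)
  case (Suc N)
  obtain k where k: "z = of_int k" using assms by (rule Ints_cases)
  have "real N + 1 \<le> z \<longleftrightarrow> int N + 1 \<le> k" unfolding k by linarith
  then show ?case using Suc unfolding k by auto
qed simp

text \<open>Layer cake: \<open>g\<close> is the sum of the indicators of its superlevel sets at
  positive integers minus those for \<open>- g\<close>. Truncating at level \<open>N\<close> and
  shrinking the level sets to compact ones costs little in L1, and shrinking keeps the number of
  sets over \<open>x\<close> at most \<open>\<bar>g x\<bar>\<close>. That last bound is what later
  limits the length of the edges by the mass.\<close>

lemma integer_function_compact_approximation:
  fixes g :: "real \<Rightarrow> real"
  assumes g: "integrable lborel g" "g \<in> borel_measurable borel" "range g \<subseteq> \<int>" and D: "compact D" and \<delta>: "0 < \<delta>"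
  obtains ks :: "(real \<times> real set) list" where "\<And>s K. (s, K) \<in> set ks \<Longrightarrow> (s = 1 \<or> s = -1) \<and> compact K \<and> K \<subseteq> D"
    "(LINT x|lborel. \<bar>indicator D x * g x - (\<Sum>(s, K)\<leftarrow>ks. s * indicator K x)\<bar>) < \<delta>"
    "\<And>x. (\<Sum>(s, K)\<leftarrow>ks. indicator K x) \<le> \<bar>g x\<bar>"
proof -
  note g(2) [measurable]
  have gI: "g x \<in> \<int>" "- g x \<in> \<int>" for x using g(3) by auto
  have "(\<lambda>N. LINT x|lborel. max 0 (\<bar>g x\<bar> - real N)) \<longlonglongrightarrow> (LINT (x::real)|lborel. 0)"
  proof (rule integral_dominated_convergence[where w="\<lambda>x. \<bar>g x\<bar>"])
    show "AE x in lborel. (\<lambda>N. max 0 (\<bar>g x\<bar> - real N)) \<longlonglongrightarrow> 0"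
    proof (intro AE_I2 tendsto_eventually)
      fix x
      obtain N0 where "\<bar>g x\<bar> \<le> real N0" using real_arch_simple by blast
      then have "max 0 (\<bar>g x\<bar> - real N) = 0" if "N0 \<le> N" for N using that of_nat_mono[OF that, where 'a=real] by linarith
      then show "eventually (\<lambda>N. max 0 (\<bar>g x\<bar> - real N) = 0) sequentially" by (auto simp: eventually_sequentially)
    qed
  qed (use g in auto)
  then have "eventually (\<lambda>N. (LINT x|lborel. max 0 (\<bar>g x\<bar> - real N)) < \<delta> / 2) sequentially"
    using \<delta> by (intro order_tendstoD(2)) auto
  then obtain N where N: "(LINT x|lborel. max 0 (\<bar>g x\<bar> - real N)) < \<delta> / 2" by (auto simp: eventually_sequentially)
  have bD [measurable]: "D \<in> sets borel" using D by (simp add: compact_imp_closed)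
  define S where "S h n = {x\<in>D. real n + 1 \<le> h x}" for h :: "real \<Rightarrow> real" and n :: nat
  \<comment> \<open>There are \<open>2 * N\<close> level sets, each approximated up to
    \<open>e\<close>; together they use the half of \<open>\<delta>\<close> that truncation
    leaves.\<close>
  define e where "e = \<delta> / (4 * real (Suc N))"
  have e: "0 < e" using \<delta> by (simp add: e_def)
  have eN: "real N * (e + e) \<le> \<delta> / 2"
  proof -
    have "real N * (e + e) \<le> real (Suc N) * (2 * e)" using e by (simp add: algebra_simps)
    also have "\<dots> = \<delta> / 2" by (simp add: e_def del: of_nat_Suc)
    finally show ?thesis .
  qed
  have "\<exists>K. \<forall>n. compact (K n) \<and> K n \<subseteq> S h n \<and> integrable lborel (indicator (S h n - K n) :: real \<Rightarrow> real) \<and>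
      (LINT x|lborel. indicator (S h n - K n) x) \<le> e"
    if h [measurable]: "h \<in> borel_measurable borel" for h
  proof (rule choice, rule allI)
    fix n
    have "{x\<in>D. real n + 1 \<le> h x} \<in> sets borel" by measurable
    then have S: "S h n \<in> sets borel" "bounded (S h n)"
      using compact_imp_bounded[OF D] by (auto simp: S_def intro: bounded_subset)
    obtain K where K: "compact K" "K \<subseteq> S h n" "measure lborel (S h n - K) < e"
      by (rule compact_inner_approximation[OF S e])
    have "integrable lborel (indicator (S h n - K) :: real \<Rightarrow> real)"
      using S K(1) by (intro integrable_real_indicator emeasure_bounded_finite) (auto intro: bounded_subset simp: compact_imp_closed)
    then show "\<exists>K. compact K \<and> K \<subseteq> S h n \<and> integrable lborel (indicator (S h n - K) :: real \<Rightarrow> real) \<and>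
      (LINT x|lborel. indicator (S h n - K) x) \<le> e" using K by (intro exI[of _ K]) simp
  qed
  note ex = this
  obtain P where P: "\<And>n. compact (P n)" "\<And>n. P n \<subseteq> S g n" "\<And>n. integrable lborel (indicator (S g n - P n) :: real \<Rightarrow> real)"
    "\<And>n. (LINT x|lborel. indicator (S g n - P n) x) \<le> e"
    using ex[OF g(2)] by blast
  let ?g = "\<lambda>x. - g x"
  obtain M where M: "\<And>n. compact (M n)" "\<And>n. M n \<subseteq> S ?g n" "\<And>n. integrable lborel (indicator (S ?g n - M n) :: real \<Rightarrow> real)"
    "\<And>n. (LINT x|lborel. indicator (S ?g n - M n) x) \<le> e"
    using ex[OF borel_measurable_uminus[OF g(2)]] by blast
  define ks where "ks = concat (map (\<lambda>n. [(1::real, P n), (-1, M n)]) [0..<N])"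
  have sum_ks: "(\<Sum>(s, K)\<leftarrow>ks. F s K) = (\<Sum>n<N. F 1 (P n) + F (-1) (M n))" for F :: "real \<Rightarrow> real set \<Rightarrow> real"
    unfolding ks_def by (induction N) (auto simp: algebra_simps)
  have level: "(\<Sum>n<N. indicator (S h n) x) = indicator D x * min (real N) (max (h x) 0)" if "h x \<in> \<int>" for h x
    unfolding sum_integer_levels[OF that, symmetric] sum_distrib_left by (intro sum.cong) (auto simp: S_def indicator_def)
  define R where "R n x = indicator (S g n - P n) x + (indicator (S ?g n - M n) x :: real)" for n x
  have R: "integrable lborel (R n)" "(LINT x|lborel. R n x) \<le> e + e" for n
    unfolding R_def using P(3)[of n] M(3)[of n] P(4)[of n] M(4)[of n] by simp_all
  have split: "indicator (S h n) x = indicator K x + (indicator (S h n - K) x :: real)" if "K \<subseteq> S h n" for h n K x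
    using that by (auto simp: indicator_def)
  have err: "\<bar>indicator D x * g x - (\<Sum>(s, K)\<leftarrow>ks. s * indicator K x)\<bar> \<le> max 0 (\<bar>g x\<bar> - real N) + (\<Sum>n<N. R n x)" for x
  proof -
    have "indicator D x * (min (real N) (max (g x) 0) - min (real N) (max (- g x) 0)) =
        (\<Sum>n<N. indicator (S g n) x - indicator (S ?g n) x)"
      using level[of g x] level[of ?g x] gI[of x] by (simp add: sum_subtractf right_diff_distrib)
    also have "\<dots> = (\<Sum>(s, K)\<leftarrow>ks. s * indicator K x) + (\<Sum>n<N. indicator (S g n - P n) x - indicator (S ?g n - M n) x)"
      unfolding sum_ks using split[OF P(2)] split[OF M(2)] by (simp add: sum.distrib sum_subtractf)
    finally have "indicator D x * g x - (\<Sum>(s, K)\<leftarrow>ks. s * indicator K x) =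
        indicator D x * (g x - (min (real N) (max (g x) 0) - min (real N) (max (- g x) 0))) +
        (\<Sum>n<N. indicator (S g n - P n) x - indicator (S ?g n - M n) x)"
      by (simp add: right_diff_distrib)
    also have "\<bar>\<dots>\<bar> \<le> max 0 (\<bar>g x\<bar> - real N) + (\<Sum>n<N. R n x)"
    proof (intro order_trans[OF abs_triangle_ineq] add_mono order_trans[OF sum_abs] sum_mono)
      show "\<bar>indicator D x * (g x - (min (real N) (max (g x) 0) - min (real N) (max (- g x) 0)))\<bar> \<le> max 0 (\<bar>g x\<bar> - real N)"
        by (auto simp: indicator_def min_def max_def)
    qed (auto simp: R_def indicator_def)
    finally show ?thesis .
  qed
  have i: "integrable lborel (\<lambda>x. max 0 (\<bar>g x\<bar> - real N))"
    using g(1) by (intro Bochner_Integration.integrable_bound[OF g(1)]) auto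
  show thesis
  proof (rule that[of ks])
    show "(s = 1 \<or> s = -1) \<and> compact K \<and> K \<subseteq> D" if "(s, K) \<in> set ks" for s K
      using that P(1,2) M(1,2) by (force simp: ks_def S_def)
    have "(LINT x|lborel. \<bar>indicator D x * g x - (\<Sum>(s, K)\<leftarrow>ks. s * indicator K x)\<bar>) \<le> (LINT x|lborel. max 0 (\<bar>g x\<bar> - real N) + (\<Sum>n<N. R n x))"
      by (intro integral_mono' err Bochner_Integration.integrable_add i Bochner_Integration.integrable_sum R(1))
        (auto simp: R_def intro!: add_nonneg_nonneg sum_nonneg)
    also have "\<dots> = (LINT x|lborel. max 0 (\<bar>g x\<bar> - real N)) + (\<Sum>n<N. LINT x|lborel. R n x)"
      using i R(1) by simp
    also have "\<dots> < \<delta>" using N sum_bounded_above[of "{..<N}" "\<lambda>n. LINT x|lborel. R n x" "e + e"] R(2) eN by simp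
    finally show "(LINT x|lborel. \<bar>indicator D x * g x - (\<Sum>(s, K)\<leftarrow>ks. s * indicator K x)\<bar>) < \<delta>" .
    show "(\<Sum>(s, K)\<leftarrow>ks. indicator K x) \<le> \<bar>g x\<bar>" for x
    proof -
      have "(\<Sum>(s, K)\<leftarrow>ks. indicator K x :: real) \<le> (\<Sum>n<N. indicator (S g n) x + indicator (S ?g n) x)"
        unfolding sum_ks using P(2) M(2) by (intro sum_mono add_mono) (auto simp: indicator_def subset_iff)
      also have "\<dots> \<le> \<bar>g x\<bar>"
        using level[of g x] level[of ?g x] gI[of x] by (auto simp: sum.distrib indicator_def min_def max_def)
      finally show ?thesis .
    qed
  qed
qed

section \<open>Push-forwards to the line and their integer densities\<close>

lemma agree_on_bounded_measurable:
  assumes M: "finite_borel_measure M" and N: "finite_borel_measure N"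
    and a: "a \<in> borel_measurable borel" "\<And>x. \<bar>a x\<bar> \<le> (1::real)"
    and b: "b \<in> borel_measurable borel" "\<And>x. \<bar>b x\<bar> \<le> (1::real)"
    and eq: "\<And>f. bounded_lipschitz f \<Longrightarrow> (LINT x|M. f x * a x) = (LINT x|N. f x * b x)"
    and h: "h \<in> borel_measurable borel" "\<And>x. \<bar>h x\<bar> \<le> B"
  shows "(LINT x|M. h x * a x) = (LINT x|N. h x * b x)"
proof -
  interpret M: finite_borel_measure M by fact
  interpret N: finite_borel_measure N by fact
  obtain g :: "nat \<Rightarrow> 'a \<Rightarrow> real" where g: "\<And>n. bounded_lipschitz (g n)"
    "(\<lambda>n. LINT x|M. \<bar>g n x - h x\<bar>) \<longlonglongrightarrow> 0" "(\<lambda>n. LINT x|N. \<bar>g n x - h x\<bar>) \<longlonglongrightarrow> 0"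
    by (rule common_approximation[OF M N h]) blast
  show ?thesis
    using M.integral_times_tendsto[OF a M.integrable_bounded_lipschitz[OF g(1)] M.integrable_bounded[OF h] g(2)]
      N.integral_times_tendsto[OF b N.integrable_bounded_lipschitz[OF g(1)] N.integrable_bounded[OF h] g(3)]
    unfolding eq[OF g(1)] by (rule LIMSEQ_unique)
qed

text \<open>Where \<open>p\<close> is not differentiable the Jacobian is a default value, so even
  its measurability is read off from the almost everywhere equality with \<open>q\<close>.\<close>

lemma euclidean_current_real:
  fixes p q :: "real \<Rightarrow> real"
  assumes g: "g \<in> borel_measurable lebesgue" and f: "f \<in> borel_measurable lebesgue" and q: "q \<in> borel_measurable lebesgue"
    and d: "AE x in lebesgue. (p has_real_derivative q x) (at x)"
  shows "euclidean_current g f [p] = (LINT x|lebesgue. g x * f x * q x)"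
  unfolding euclidean_current_def
proof (rule integral_cong_AE)
  have eq: "AE x in lebesgue. q x = jacobian_det [p] x"
    using d
  proof eventually_elim
    fix x assume x: "(p has_real_derivative q x) (at x)"
    then have "p differentiable (at x)" using real_differentiable_def by blast
    then show "q x = jacobian_det [p] x" using jacobian_det_real[of p x] DERIV_imp_deriv[OF x] by simp
  qed
  have "jacobian_det [p] \<in> borel_measurable lebesgue" by (rule borel_measurable_AE[OF q eq])
  then show "(\<lambda>x. g x * f x * jacobian_det [p] x) \<in> borel_measurable lebesgue" using g f by measurable
  show "(\<lambda>x. g x * f x * q x) \<in> borel_measurable lebesgue" using g f q by measurable
  show "AE x in lebesgue. g x * f x * jacobian_det [p] x = g x * f x * q x" using eq by eventually_elim simp
qed

definition integer_slices :: "'a::metric_space functional \<Rightarrow> bool" where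
  "integer_slices T \<longleftrightarrow> (\<forall>(\<phi> :: 'a \<Rightarrow> real) U. lipschitz \<phi> \<longrightarrow> open U \<longrightarrow>
     (\<exists>g :: real \<Rightarrow> real. integrable lebesgue g \<and> range g \<subseteq> \<int> \<and>
       same_current 1 (pushforward \<phi> (restrict_current 1 T U)) (euclidean_current g)))"

text \<open>The density given by integer rectifiability is merely Lebesgue measurable. Rounding a
  Borel version of it changes it on a null set only and makes it integer valued everywhere.\<close>

lemma (in metric_current1) integer_density:
  fixes \<phi> :: "'a \<Rightarrow> real"
  assumes T: "integer_slices T" and \<phi>: "lipschitz \<phi>" and U: "open U"
  obtains g :: "real \<Rightarrow> real" where "integrable lborel g" "g \<in> borel_measurable borel" "range g \<subseteq> \<int>"
    "\<And>f p q. \<lbrakk>bounded_lipschitz f; lipschitz p; q \<in> borel_measurable borel; AE x in lebesgue. (p has_real_derivative q x) (at x)\<rbrakk>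
      \<Longrightarrow> (LINT x|\<mu>. f (\<phi> x) * indicator U x * G (p \<circ> \<phi>) x) = (LINT x|lborel. g x * f x * q x)"
proof -
  obtain g :: "real \<Rightarrow> real" where g: "integrable lebesgue g" "range g \<subseteq> \<int>"
    "same_current 1 (pushforward \<phi> (restrict_current 1 T U)) (euclidean_current g)"
    using T \<phi> U unfolding integer_slices_def by blast
  have gm: "g \<in> borel_measurable lebesgue" using g(1) by auto
  obtain g1 where g1: "g1 \<in> borel_measurable lborel" "AE x in lborel. g x = g1 x"
    using completion_ex_borel_measurable_real[OF gm] by blast
  define k where "k x = real_of_int (round (g1 x))" for x
  have kb: "k \<in> borel_measurable borel" unfolding k_def round_def using g1(1) by measurable
  have "AE x in lborel. g x = k x"
    using g1(2)
  proof eventually_elim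
    fix x assume "g x = g1 x"
    moreover obtain i :: int where "g x = of_int i" using g(2) by (metis Ints_cases rangeI subsetD)
    ultimately show "g x = k x" by (metis k_def round_of_int)
  qed
  then have gk: "AE x in lebesgue. g x = k x" by (rule AE_completion)
  have kl: "k \<in> borel_measurable lebesgue" using kb by (simp add: measurable_completion)
  have "integrable lebesgue k" using g(1) gk kl gm integrable_cong_AE by blast
  then have ik: "integrable lborel k" using kb by (simp add: integrable_completion)
  show thesis
  proof (rule that[of k])
    show "integrable lborel k" by (rule ik)
    show "range k \<subseteq> \<int>" by (auto simp: k_def)
    fix f p q :: "real \<Rightarrow> real"
    assume f: "bounded_lipschitz f" and p: "lipschitz p" and q: "q \<in> borel_measurable borel"
      and d: "AE x in lebesgue. (p has_real_derivative q x) (at x)"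
    have fb: "f \<in> borel_measurable borel" by (rule bounded_lipschitz_borel[OF f])
    have fl: "f \<in> borel_measurable lebesgue" and ql: "q \<in> borel_measurable lebesgue"
      using fb q by (simp_all add: measurable_completion)
    have "(f, [p]) \<in> forms 1" using f p by (simp add: forms_iff)
    then have "pushforward \<phi> (restrict_current 1 T U) f [p] = euclidean_current g f [p]"
      using g(3) by (auto simp: same_current_def)
    moreover have "pushforward \<phi> (restrict_current 1 T U) f [p] = (LINT x|\<mu>. f (\<phi> x) * indicator U x * G (p \<circ> \<phi>) x)"
      using restrict_current_eq[OF bounded_lipschitz_compose[OF f \<phi>] _ lipschitz_compose[OF p \<phi>], of U] U
      by (simp add: pushforward_def)
    moreover have "euclidean_current g f [p] = (LINT x|lebesgue. g x * f x * q x)"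
      by (rule euclidean_current_real[OF gm fl ql d])
    moreover have "(LINT x|lebesgue. g x * f x * q x) = (LINT x|lebesgue. k x * f x * q x)"
      using gm kl fl ql gk by (intro integral_cong_AE) auto
    moreover have "(LINT x|lebesgue. k x * f x * q x) = (LINT x|lborel. k x * f x * q x)"
      using kb fb q by (intro integral_completion) auto
    ultimately show "(LINT x|\<mu>. f (\<phi> x) * indicator U x * G (p \<circ> \<phi>) x) = (LINT x|lborel. k x * f x * q x)"
      by simp
  qed (rule kb)
qed

text \<open>With \<open>p\<close> the identity and \<open>\<phi>\<close> 1-Lipschitz, the signed
  measure with density \<open>g\<close> is bounded by the image \<open>M\<close> of the mass of
  \<open>T\<close> in \<open>U\<close>, and therefore so is its variation. The variation is attained
  by the test function \<open>h * sgn g\<close>, which is reached by passing from bounded Lipschitz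
  to bounded Borel functions.\<close>

lemma (in metric_current1) integer_density_bound:
  fixes \<phi> :: "'a \<Rightarrow> real"
  assumes \<phi>: "1-lipschitz_on UNIV \<phi>" and U: "open U"
    and g: "integrable lborel g" "g \<in> borel_measurable borel"
    and eq: "\<And>f p q. \<lbrakk>bounded_lipschitz f; lipschitz p; q \<in> borel_measurable borel; AE x in lebesgue. (p has_real_derivative q x) (at x)\<rbrakk>
      \<Longrightarrow> (LINT x|\<mu>. f (\<phi> x) * indicator U x * G (p \<circ> \<phi>) x) = (LINT x|lborel. g x * f x * q x)"
    and h: "h \<in> borel_measurable borel" "\<And>x. 0 \<le> h x" "\<And>x. h x \<le> B"
  shows "(LINT x|lborel. \<bar>g x\<bar> * h x) \<le> (LINT x|\<mu>. h (\<phi> x) * indicator U x)"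
proof -
  have l\<phi>: "lipschitz \<phi>" by (rule lipschitzI[OF \<phi>])
  have \<phi>b: "\<phi> \<in> borel_measurable borel" by (rule borel_measurable_lipschitz[OF l\<phi>])
  have \<phi>\<mu>: "\<phi> \<in> borel_measurable \<mu>" using \<phi>b borel_measurable_iff by blast
  have U\<mu>: "U \<in> sets \<mu>" using U by (simp add: sets_borel)
  have indU: "(indicator U :: 'a \<Rightarrow> real) \<in> borel_measurable \<mu>" using U\<mu> by measurable
  define M where "M = distr (density \<mu> (\<lambda>x. ennreal (indicator U x))) borel \<phi>"
  have intM: "(LINT x|M. f x) = (LINT x|\<mu>. f (\<phi> x) * indicator U x)" if "f \<in> borel_measurable borel" for f :: "real \<Rightarrow> real"
  proof -
    have "(LINT x|M. f x) = (LINT x|density \<mu> (\<lambda>x. ennreal (indicator U x)). f (\<phi> x))"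
      unfolding M_def using that \<phi>\<mu> by (intro integral_distr) auto
    also have "\<dots> = (LINT x|\<mu>. indicator U x * f (\<phi> x))"
      using that \<phi>\<mu> indU by (subst integral_density) auto
    finally show ?thesis by (simp add: mult.commute)
  qed
  have "emeasure M UNIV < \<infinity>"
  proof -
    have "emeasure M UNIV = emeasure (density \<mu> (\<lambda>x. ennreal (indicator U x))) (space \<mu>)"
      unfolding M_def using \<phi>\<mu> by (subst emeasure_distr) auto
    also have "\<dots> = (\<integral>\<^sup>+x. indicator U x \<partial>\<mu>)"
    proof -
      have "(\<lambda>x. ennreal (indicator U x)) \<in> borel_measurable \<mu>" using indU by measurable
      then show ?thesis
        by (subst emeasure_density) (auto intro!: nn_integral_cong simp del: ennreal_indicator simp: indicator_def split: if_splits)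
    qed
    also have "\<dots> = emeasure \<mu> U" using U\<mu> by simp
    finally show ?thesis using emeasure_finite[of U] by (simp add: less_top[symmetric])
  qed
  then have finM: "finite_borel_measure M" by (intro finite_borel_measureI) (simp_all add: M_def)
  define N where "N = density lborel (\<lambda>x. ennreal \<bar>g x\<bar>)"
  have intN: "(LINT x|N. f x) = (LINT x|lborel. \<bar>g x\<bar> * f x)" if "f \<in> borel_measurable borel" for f :: "real \<Rightarrow> real"
    unfolding N_def using that g by (subst integral_density) auto
  have finN: "finite_borel_measure N"
  proof (rule finite_borel_measureI)
    have "emeasure N UNIV = (\<integral>\<^sup>+x. ennreal \<bar>g x\<bar> \<partial>lborel)"
      unfolding N_def using g by (subst emeasure_density) auto
    also have "\<dots> = ennreal (LINT x|lborel. \<bar>g x\<bar>)" using g by (intro nn_integral_eq_integral) auto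
    finally show "emeasure N UNIV < \<infinity>" by simp
  qed (simp add: N_def)
  have AEid: "AE x in lebesgue. ((\<lambda>x. x) has_real_derivative 1) (at x)" by (intro AE_I2 DERIV_ident)
  have eq1: "(LINT x|\<mu>. f (\<phi> x) * indicator U x * G \<phi> x) = (LINT x|lborel. g x * f x)" if "bounded_lipschitz f" for f
    using eq[OF that lipschitzI[OF lipschitz_on_id] borel_measurable_const AEid] by (simp add: o_def)
  interpret M: finite_borel_measure M by (rule finM)
  interpret N: finite_borel_measure N by (rule finN)
  have ig: "integrable lborel (\<lambda>x. g x * f x)" if f: "f \<in> borel_measurable borel" "\<And>x. \<bar>f x\<bar> \<le> c" for f and c :: real
  proof (rule Bochner_Integration.integrable_bound)
    show "integrable lborel (\<lambda>x. c * g x)" using g by simp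
    show "AE x in lborel. norm (g x * f x) \<le> norm (c * g x)"
    proof (intro AE_I2)
      fix x
      have "0 \<le> c" using order_trans[OF abs_ge_zero f(2)] .
      then show "norm (g x * f x) \<le> norm (c * g x)" using f(2)[of x] by (simp add: abs_mult mult.commute[of c] mult_left_mono)
    qed
  qed (use f g in measurable)
  interpret L: lipschitz_functional M "\<lambda>f. LINT x|lborel. g x * f x" 1
  proof
    fix f1 f2 :: "real \<Rightarrow> real" and a b :: real assume f: "bounded_lipschitz f1" "bounded_lipschitz f2"
    have i: "integrable lborel (\<lambda>x. g x * f x)" if bl: "bounded_lipschitz f" for f
    proof -
      obtain c where c: "\<And>x. \<bar>f x\<bar> \<le> c" using bounded_lipschitzE[OF bl] by blast
      show ?thesis by (rule ig[OF bounded_lipschitz_borel[OF bl] c])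
    qed
    have "(LINT x|lborel. g x * (a * f1 x + b * f2 x)) = (LINT x|lborel. a * (g x * f1 x) + b * (g x * f2 x))"
      by (simp add: algebra_simps)
    also have "\<dots> = a * (LINT x|lborel. g x * f1 x) + b * (LINT x|lborel. g x * f2 x)"
      using i[OF f(1)] i[OF f(2)] by simp
    finally show "(LINT x|lborel. g x * (a * f1 x + b * f2 x)) = a * (LINT x|lborel. g x * f1 x) + b * (LINT x|lborel. g x * f2 x)" .
  next
    fix f :: "real \<Rightarrow> real" assume f: "bounded_lipschitz f"
    have fb: "f \<in> borel_measurable borel" by (rule bounded_lipschitz_borel[OF f])
    obtain c where c: "\<And>x. \<bar>f x\<bar> \<le> c" using bounded_lipschitzE[OF f] by blast
    have i: "integrable \<mu> (\<lambda>x. f (\<phi> x) * indicator U x)"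
      using fb \<phi>b U c by (intro integrable_times_indicator[of "\<lambda>x. f (\<phi> x)" c]) auto
    have "\<bar>LINT x|lborel. g x * f x\<bar> \<le> 1 * (LINT x|\<mu>. \<bar>f (\<phi> x) * indicator U x\<bar>)"
      using integral_G_le[OF \<phi> i] eq1[OF f] by simp
    also have "(LINT x|\<mu>. \<bar>f (\<phi> x) * indicator U x\<bar>) = (LINT x|M. \<bar>f x\<bar>)"
      using intM[of "\<lambda>x. \<bar>f x\<bar>"] fb by (simp add: abs_mult)
    finally show "\<bar>LINT x|lborel. g x * f x\<bar> \<le> 1 * (LINT x|M. \<bar>f x\<bar>)" .
  qed simp
  obtain k where k: "k \<in> borel_measurable borel" "\<And>x. \<bar>k x\<bar> \<le> 1" "\<And>f. integrable M f \<Longrightarrow> L.ext f = (LINT x|M. f x * k x)"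
    using L.has_density by blast
  have sg: "(\<lambda>x. sgn (g x)) \<in> borel_measurable borel" "\<And>x. \<bar>sgn (g x)\<bar> \<le> 1" using g(2) by (auto simp: abs_sgn_eq)
  have agree: "(LINT x|M. f x * k x) = (LINT x|N. f x * sgn (g x))" if f: "bounded_lipschitz f" for f
  proof -
    have fb: "f \<in> borel_measurable borel" by (rule bounded_lipschitz_borel[OF f])
    have "(LINT x|N. f x * sgn (g x)) = (LINT x|lborel. g x * f x)"
    proof -
      have "(LINT x|lborel. \<bar>g x\<bar> * (f x * sgn (g x))) = (LINT x|lborel. g x * f x)"
        by (intro Bochner_Integration.integral_cong refl) (auto simp: sgn_if)
      then show ?thesis using intN[of "\<lambda>x. f x * sgn (g x)"] fb sg(1) by simp
    qed
    also have "\<dots> = (LINT x|M. f x * k x)"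
      using k(3)[OF M.integrable_bounded_lipschitz[OF f]] L.ext_bounded_lipschitz[OF f] by simp
    finally show ?thesis ..
  qed
  define H where "H x = h x * sgn (g x)" for x
  have H: "H \<in> borel_measurable borel" unfolding H_def using h(1) sg(1) by measurable
  have HB: "\<bar>H x\<bar> \<le> B" for x
    using h(2,3)[of x] by (auto simp: H_def sgn_if)
  have hk: "integrable M h" using h by (intro M.integrable_bounded[of h B]) (auto simp: abs_le_iff intro: order_trans[of _ 0])
  have "(LINT x|lborel. \<bar>g x\<bar> * h x) = (LINT x|N. H x * sgn (g x))"
  proof -
    have "\<bar>g x\<bar> * h x = \<bar>g x\<bar> * (H x * sgn (g x))" for x by (auto simp: H_def sgn_if)
    then have "(LINT x|lborel. \<bar>g x\<bar> * h x) = (LINT x|lborel. \<bar>g x\<bar> * (H x * sgn (g x)))"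
      by (intro Bochner_Integration.integral_cong) auto
    moreover have "(\<lambda>x. H x * sgn (g x)) \<in> borel_measurable borel" using H sg(1) by measurable
    ultimately show ?thesis using intN[of "\<lambda>x. H x * sgn (g x)"] by simp
  qed
  also have "\<dots> = (LINT x|M. H x * k x)"
    by (rule agree_on_bounded_measurable[OF finM finN k(1,2) sg agree H HB, symmetric])
  also have "\<dots> \<le> (LINT x|M. h x)"
  proof (rule integral_mono[OF _ hk])
    have "(\<lambda>x. H x * k x) \<in> borel_measurable borel" using H k(1) by measurable
    moreover have "\<bar>H x * k x\<bar> \<le> B * 1" for x
      unfolding abs_mult using HB[of x] k(2)[of x] by (intro mult_mono) auto
    ultimately show "integrable M (\<lambda>x. H x * k x)" by (rule M.integrable_bounded)
    show "H x * k x \<le> h x" for x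
    proof -
      have "H x * k x \<le> \<bar>H x\<bar> * \<bar>k x\<bar>" by (metis abs_ge_self abs_mult)
      also have "\<dots> \<le> h x * 1" using h(2) k(2) by (intro mult_mono) (auto simp: H_def sgn_if)
      finally show ?thesis by simp
    qed
  qed
  also have "\<dots> = (LINT x|\<mu>. h (\<phi> x) * indicator U x)" by (rule intM[OF h(1)])
  finally show ?thesis .
qed

section \<open>Approximation by finite families of edges\<close>

lemma near_isometryD: "near_isometry \<epsilon> z K \<Longrightarrow> x \<in> K \<Longrightarrow> y \<in> K \<Longrightarrow> dist x y \<le> (1 + \<epsilon>) * \<bar>dist z x - dist z y\<bar>"
  by (auto simp: near_isometry_def)

text \<open>The edge from \<open>x\<close> to \<open>y\<close> stands for a path of length
  \<open>dist x y\<close>, although no curve between the points need exist; its action is the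
  one-step Riemann sum with \<open>f\<close> taken at the tail.\<close>

definition edge_sum :: "('a \<times> 'a) list \<Rightarrow> ('a \<Rightarrow> real) \<Rightarrow> ('a \<Rightarrow> real) \<Rightarrow> real" where
  "edge_sum es f p = (\<Sum>(x, y)\<leftarrow>es. f x * (p y - p x))"

definition edge_length :: "('a::metric_space \<times> 'a) list \<Rightarrow> ('a \<Rightarrow> real) \<Rightarrow> real" where
  "edge_length es h = (\<Sum>(x, y)\<leftarrow>es. h x * dist x y)"

lemma edge_sum_simps [simp]: "edge_sum [] f p = 0" "edge_sum (e # es) f p = f (fst e) * (p (snd e) - p (fst e)) + edge_sum es f p"
  "edge_sum (es @ es') f p = edge_sum es f p + edge_sum es' f p"
  by (simp_all add: edge_sum_def split_beta)

lemma edge_length_simps [simp]: "edge_length [] h = 0" "edge_length (e # es) h = h (fst e) * dist (fst e) (snd e) + edge_length es h"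
  "edge_length (es @ es') h = edge_length es h + edge_length es' h"
  by (simp_all add: edge_length_def split_beta)

lemma edge_sum_concat_map: "edge_sum (concat (map g ks)) f p = (\<Sum>k\<leftarrow>ks. edge_sum (g k) f p)"
  by (induction ks) auto

lemma edge_length_concat_map: "edge_length (concat (map g ks)) h = (\<Sum>k\<leftarrow>ks. edge_length (g k) h)"
  by (induction ks) auto

lemma sum_list_le_add:
  fixes u v :: "'b \<Rightarrow> real"
  assumes "\<And>k. k \<in> set ks \<Longrightarrow> u k \<le> v k + c"
  shows "(\<Sum>k\<leftarrow>ks. u k) \<le> (\<Sum>k\<leftarrow>ks. v k) + real (length ks) * c"
  using assms
proof (induction ks)
  case (Cons k ks)
  have "u k \<le> v k + c" "(\<Sum>k\<leftarrow>ks. u k) \<le> (\<Sum>k\<leftarrow>ks. v k) + real (length ks) * c"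
    using Cons by auto
  then show ?case by (simp add: distrib_right)
qed simp

lemma integral_compact_step:
  fixes ks :: "('b \<times> real set) list" and w :: "'b \<Rightarrow> real"
  assumes "\<forall>k\<in>set ks. compact (snd k)" and H: "H \<in> borel_measurable borel" "\<And>x. \<bar>H x\<bar> \<le> B"
  shows "integrable lborel (\<lambda>x. (\<Sum>(s, K)\<leftarrow>ks. w s * indicator K x) * H x)"
    and "(LINT x|lborel. (\<Sum>(s, K)\<leftarrow>ks. w s * indicator K x) * H x) = (\<Sum>(s, K)\<leftarrow>ks. w s * (LINT x|lborel. indicator K x * H x))"
proof -
  have i: "integrable lborel (\<lambda>x. indicator K x * H x)" if "compact K" for K
    using integrableI_bounded_set_indicator[of K lborel H B] emeasure_compact_finite[OF that] H that
    by (simp add: compact_imp_closed)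
  have "integrable lborel (\<lambda>x. (\<Sum>(s, K)\<leftarrow>ks. w s * indicator K x) * H x) \<and>
    (LINT x|lborel. (\<Sum>(s, K)\<leftarrow>ks. w s * indicator K x) * H x) = (\<Sum>(s, K)\<leftarrow>ks. w s * (LINT x|lborel. indicator K x * H x))"
    using assms(1)
  proof (induction ks)
    case (Cons k ks)
    obtain s K where k: "k = (s, K)" by (cases k)
    have K: "integrable lborel (\<lambda>x. indicator K x * H x)" using Cons.prems i k by auto
    have IH: "integrable lborel (\<lambda>x. (\<Sum>(s, K)\<leftarrow>ks. w s * indicator K x) * H x)"
      "(LINT x|lborel. (\<Sum>(s, K)\<leftarrow>ks. w s * indicator K x) * H x) = (\<Sum>(s, K)\<leftarrow>ks. w s * (LINT x|lborel. indicator K x * H x))"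
      using Cons.IH Cons.prems by auto
    have eq: "(\<Sum>(s, K)\<leftarrow>k # ks. w s * indicator K x) * H x = w s * (indicator K x * H x) + (\<Sum>(s, K)\<leftarrow>ks. w s * indicator K x) * H x" for x
      by (simp add: k algebra_simps)
    show ?case unfolding eq using K IH by (simp add: k)
  qed simp
  then show "integrable lborel (\<lambda>x. (\<Sum>(s, K)\<leftarrow>ks. w s * indicator K x) * H x)"
    and "(LINT x|lborel. (\<Sum>(s, K)\<leftarrow>ks. w s * indicator K x) * H x) = (\<Sum>(s, K)\<leftarrow>ks. w s * (LINT x|lborel. indicator K x * H x))"
    by auto
qed

text \<open>The distance \<open>\<phi>\<close> from \<open>z\<close> is injective on
  \<open>K\<close>, with Lipschitz inverse \<open>\<psi>\<close>. The push-forward of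
  \<open>T\<close> under \<open>\<phi>\<close> is an integer density on the line; its level sets in
  \<open>D\<close> are discretised and the end points are lifted to \<open>K\<close> by
  \<open>\<psi>\<close>, edges being reversed where the density is negative. The mass bound for the
  density becomes the length bound for the edges.\<close>

lemma (in metric_current1) edges_on_near_isometry:
  assumes T: "integer_slices T" and K: "compact K" and iso: "near_isometry \<epsilon> z K" and \<epsilon>: "0 < \<epsilon>" "\<epsilon> \<le> 1"
    and V: "open V" and \<delta>: "0 < \<delta>"
  obtains es where "\<And>x y. (x, y) \<in> set es \<Longrightarrow> dist x y \<le> \<delta>"
    "\<And>A C f p. A-lipschitz_on UNIV f \<Longrightarrow> (\<And>x. \<bar>f x\<bar> \<le> A) \<Longrightarrow> C-lipschitz_on UNIV p \<Longrightarrow>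
       \<bar>(LINT x|\<mu>. f x * indicator (K \<inter> V) x * G p x) - edge_sum es f p\<bar> \<le> \<delta> * A * C"
    "\<And>A h. A-lipschitz_on UNIV h \<Longrightarrow> (\<And>x. 0 \<le> h x) \<Longrightarrow> (\<And>x. h x \<le> A) \<Longrightarrow>
       edge_length es h \<le> (1 + \<epsilon>) * (LINT x|\<mu>. h x * indicator (K \<inter> V) x) + \<delta> * A"
proof -
  \<comment> \<open>A sixteenth covers all errors below: they add up to
    \<open>10 * A * C * \<delta>1\<close> for the sums and to \<open>6 * A * \<delta>1\<close> for
    the lengths.\<close>
  define \<delta>1 where "\<delta>1 = \<delta> / 16"
  have \<delta>1: "0 < \<delta>1" using \<delta> by (simp add: \<delta>1_def)
  define \<phi> where "\<phi> = dist z"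
  have \<phi>: "1-lipschitz_on UNIV \<phi>" unfolding \<phi>_def by (rule lipschitz_on_dist)
  have \<phi>b: "\<phi> \<in> borel_measurable borel" by (rule lipschitz_on_borel[OF \<phi>])
  define D where "D = \<phi> ` K"
  have D: "compact D" unfolding D_def by (intro compact_continuous_image K lipschitz_continuous lipschitzI[OF \<phi>])
  have bD: "D \<in> sets borel" using D by (simp add: compact_imp_closed)
  have inj: "inj_on \<phi> K"
  proof (rule inj_onI)
    fix x y assume "x \<in> K" "y \<in> K" "\<phi> x = \<phi> y"
    then have "dist x y \<le> 0" using near_isometryD[OF iso, of x y] by (simp add: \<phi>_def)
    then show "x = y" by simp
  qed
  define \<psi> where "\<psi> = the_inv_into K \<phi>"
  have \<psi>\<phi>: "\<psi> (\<phi> x) = x" if "x \<in> K" for x unfolding \<psi>_def by (rule the_inv_into_f_f[OF inj that])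
  have \<psi>K: "\<psi> t \<in> K" and \<phi>\<psi>: "\<phi> (\<psi> t) = t" if "t \<in> D" for t
    using that \<psi>\<phi> by (auto simp: D_def)
  have \<psi>d: "dist (\<psi> s) (\<psi> t) \<le> (1 + \<epsilon>) * \<bar>s - t\<bar>" if "s \<in> D" "t \<in> D" for s t
    using near_isometryD[OF iso \<psi>K[OF that(1)] \<psi>K[OF that(2)]] \<phi>\<psi>[OF that(1)] \<phi>\<psi>[OF that(2)]
    by (simp add: \<phi>_def)
  have KV: "K \<inter> V \<in> sets borel" using K V by (auto simp: compact_imp_closed)
  \<comment> \<open>Densities are given for restrictions to open sets only, so
    \<open>K \<inter> V\<close> is replaced by an open set \<open>W\<close> that exceeds it by mass
    less than \<open>\<delta>1\<close>.\<close>
  obtain U where U: "open U" "K \<subseteq> U" "measure \<mu> (U - K) < \<delta>1"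
    by (rule closed_outer_open[OF compact_imp_closed[OF K] \<delta>1])
  define W where "W = U \<inter> V"
  have W: "open W" "K \<inter> W = K \<inter> V" using U V by (auto simp: W_def)
  have WKb: "W - K \<in> sets borel" using W K by (auto simp: compact_imp_closed)
  have "measure \<mu> (W - K) \<le> measure \<mu> (U - K)"
    using U K by (intro finite_measure_mono) (auto simp: W_def sets_borel compact_imp_closed)
  then have mWK: "measure \<mu> (W - K) < \<delta>1" using U(3) by simp
  obtain g :: "real \<Rightarrow> real" where g: "integrable lborel g" "g \<in> borel_measurable borel" "range g \<subseteq> \<int>"
    and geq: "\<And>f p q. \<lbrakk>bounded_lipschitz f; lipschitz p; q \<in> borel_measurable borel; AE x in lebesgue. (p has_real_derivative q x) (at x)\<rbrakk>
      \<Longrightarrow> (LINT x|\<mu>. f (\<phi> x) * indicator W x * G (p \<circ> \<phi>) x) = (LINT x|lborel. g x * f x * q x)"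
    by (rule integer_density[OF T lipschitzI[OF \<phi>] W(1)]) blast
  note gbound = integer_density_bound[OF \<phi> W(1) g(1,2) geq]
  obtain ks :: "(real \<times> real set) list" where ks: "\<And>s K. (s, K) \<in> set ks \<Longrightarrow> (s = 1 \<or> s = -1) \<and> compact K \<and> K \<subseteq> D"
    "(LINT x|lborel. \<bar>indicator D x * g x - (\<Sum>(s, K)\<leftarrow>ks. s * indicator K x)\<bar>) < \<delta>1"
    "\<And>x. (\<Sum>(s, K)\<leftarrow>ks. indicator K x) \<le> \<bar>g x\<bar>"
    by (rule integer_function_compact_approximation[OF g D \<delta>1]) blast
  define r where "r = length ks"
  \<comment> \<open>Each of the \<open>r\<close> signed compact sets gets an equal share of
    \<open>\<delta>1\<close>.\<close>
  define \<delta>3 where "\<delta>3 = \<delta>1 / (real r + 1)"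
  have \<delta>3: "0 < \<delta>3" "\<delta>3 \<le> \<delta>1" "real r * \<delta>3 \<le> \<delta>1"
    using \<delta>1 by (auto simp: \<delta>3_def field_simps)
  have "\<exists>E. (\<forall>a b. (a, b) \<in> set E \<longrightarrow> a \<in> L \<and> b \<in> L \<and> a \<le> b \<and> b - a \<le> \<delta>3) \<and>
    (\<forall>A C F Q q \<tau>. 0 \<le> C \<longrightarrow> A-lipschitz_on UNIV F \<longrightarrow> (\<forall>x. \<bar>F x\<bar> \<le> A) \<longrightarrow> q \<in> borel_measurable borel \<longrightarrow> (\<forall>x. \<bar>q x\<bar> \<le> C) \<longrightarrow>
       (\<forall>a b. a \<le> b \<longrightarrow> Q b - Q a = (LINT x:{a..b}|lborel. q x)) \<longrightarrow> (\<forall>a b. a \<le> b \<longrightarrow> a \<le> \<tau> a b \<and> \<tau> a b \<le> b)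
       \<longrightarrow> \<bar>(LINT x|lborel. indicator L x * (F x * q x)) - (\<Sum>(a, b)\<leftarrow>E. F (\<tau> a b) * (Q b - Q a))\<bar> \<le> \<delta>3 * A * C)" (is "\<exists>E. ?P L E")
    if "compact L" for L
    by (rule compact_discretization[OF that \<delta>3(1)]) blast
  note ex = this
  define E where "E L = (SOME E. ?P L E)" for L
  have E: "?P L (E L)" if "compact L" for L
    unfolding E_def by (rule someI_ex[OF ex[OF that]])
  have E1: "a \<in> L \<and> b \<in> L \<and> a \<le> b \<and> b - a \<le> \<delta>3" if "compact L" "(a, b) \<in> set (E L)" for L a b
    using E[OF that(1)] that(2) by blast
  have E2: "\<bar>(LINT x|lborel. indicator L x * (F x * q x)) - (\<Sum>(a, b)\<leftarrow>E L. F (\<tau> a b) * (Q b - Q a))\<bar> \<le> \<delta>3 * A * C"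
    if "compact L" "0 \<le> C" "A-lipschitz_on UNIV F" "\<And>x. \<bar>F x\<bar> \<le> A" "q \<in> borel_measurable borel" "\<And>x. \<bar>q x\<bar> \<le> C"
       "\<And>a b. a \<le> b \<Longrightarrow> Q b - Q a = (LINT x:{a..b}|lborel. q x)" "\<And>a b. a \<le> b \<Longrightarrow> a \<le> \<tau> a b \<and> \<tau> a b \<le> b"
    for L A C F Q q \<tau>
    using E[OF that(1)] that(2-) by blast
  \<comment> \<open>\<open>edge_sum\<close> evaluates \<open>f\<close> at the tail of an edge, and
    for a reversed edge this is the right end point of its interval.\<close>
  define tag :: "real \<Rightarrow> real \<Rightarrow> real \<Rightarrow> real" where "tag s a b = (if s = 1 then a else b)" for s a b
  have tag: "a \<le> tag s a b \<and> tag s a b \<le> b" if "a \<le> b" for s a b using that by (simp add: tag_def)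
  define ed where "ed = (\<lambda>(s, L). map (\<lambda>(a, b). if s = (1::real) then (\<psi> a, \<psi> b) else (\<psi> b, \<psi> a)) (E L))"
  define es where "es = concat (map ed ks)"
  \<comment> \<open>Composition with \<open>\<psi>\<close> is Lipschitz on \<open>D\<close> only,
    with constant \<open>2 * A\<close> as \<open>1 + \<epsilon> \<le> 2\<close>; the extension to
    the line keeps the bounds on the values.\<close>
  have ext: "\<exists>F. (2 * A)-lipschitz_on UNIV F \<and> (\<forall>t\<in>D. F t = f (\<psi> t)) \<and> (\<forall>t. l \<le> F t) \<and> (\<forall>t. F t \<le> A)"
    if f: "A-lipschitz_on UNIV f" "\<And>x. l \<le> f x" "\<And>x. f x \<le> A" for f l A
  proof -
    have A0: "0 \<le> A" by (rule lipschitz_on_nonneg[OF f(1)])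
    have "(2 * A)-lipschitz_on D (\<lambda>t. f (\<psi> t))"
    proof (rule lipschitz_onI)
      fix s t assume st: "s \<in> D" "t \<in> D"
      have "dist (f (\<psi> s)) (f (\<psi> t)) \<le> A * dist (\<psi> s) (\<psi> t)" using lipschitz_onD[OF f(1)] by simp
      also have "\<dots> \<le> A * (2 * dist s t)"
        using \<psi>d[OF st] \<epsilon> A0 mult_right_mono[of "1 + \<epsilon>" 2 "\<bar>s - t\<bar>"] by (intro mult_left_mono) (auto simp: dist_real_def)
      finally show "dist (f (\<psi> s)) (f (\<psi> t)) \<le> 2 * A * dist s t" by simp
    qed (use A0 in simp)
    then show ?thesis
      using bounded_lipschitz_extension[of "2 * A" D "\<lambda>t. f (\<psi> t)" l A] f(2,3) order_trans[OF f(2) f(3)] by metis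
  qed
  have ext': "\<exists>P. (2 * C)-lipschitz_on UNIV P \<and> (\<forall>t\<in>D. P t = p (\<psi> t))"
    if p: "C-lipschitz_on UNIV p" for p :: "'a \<Rightarrow> real" and C
  proof -
    have C0: "0 \<le> C" by (rule lipschitz_on_nonneg[OF p])
    have "(2 * C)-lipschitz_on D (\<lambda>t. p (\<psi> t))"
    proof (rule lipschitz_onI)
      fix s t assume st: "s \<in> D" "t \<in> D"
      have "dist (p (\<psi> s)) (p (\<psi> t)) \<le> C * dist (\<psi> s) (\<psi> t)" using lipschitz_onD[OF p] by simp
      also have "\<dots> \<le> C * (2 * dist s t)"
        using \<psi>d[OF st] \<epsilon> C0 mult_right_mono[of "1 + \<epsilon>" 2 "\<bar>s - t\<bar>"] by (intro mult_left_mono) (auto simp: dist_real_def)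
      finally show "dist (p (\<psi> s)) (p (\<psi> t)) \<le> 2 * C * dist s t" by simp
    qed (use C0 in simp)
    then show ?thesis using lipschitz_extension[of "2 * C" D "\<lambda>t. p (\<psi> t)"] by metis
  qed
  have intind: "integrable \<mu> (\<lambda>x. f x * indicator B x)" if "f \<in> borel_measurable borel" "\<And>x. \<bar>f x\<bar> \<le> c" "B \<in> sets borel" for f :: "'a \<Rightarrow> real" and c B
    using that by (rule integrable_times_indicator)
  show thesis
  proof (rule that[of es])
    fix x y assume "(x, y) \<in> set es"
    then obtain s L a b where sL: "(s, L) \<in> set ks" "(a, b) \<in> set (E L)" "(x, y) = (if s = 1 then (\<psi> a, \<psi> b) else (\<psi> b, \<psi> a))"
      by (auto simp: es_def ed_def)
    have L: "compact L" "L \<subseteq> D" using ks(1)[OF sL(1)] by auto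
    note ab = E1[OF L(1) sL(2)]
    have "dist x y = dist (\<psi> a) (\<psi> b)" using sL(3) by (auto split: if_splits simp: dist_commute)
    also have "\<dots> \<le> (1 + \<epsilon>) * \<bar>a - b\<bar>" using ab L(2) by (intro \<psi>d) auto
    also have "\<dots> \<le> 2 * \<delta>3" using ab \<epsilon> by (intro mult_mono) auto
    also have "\<dots> \<le> \<delta>" using \<delta>3 \<delta> by (simp add: \<delta>1_def)
    finally show "dist x y \<le> \<delta>" .
  next
    fix A C :: real and f p :: "'a \<Rightarrow> real"
    assume f: "A-lipschitz_on UNIV f" "\<And>x. \<bar>f x\<bar> \<le> A" and p: "C-lipschitz_on UNIV p"
    have A0: "0 \<le> A" by (rule lipschitz_on_nonneg[OF f(1)])
    have C0: "0 \<le> C" by (rule lipschitz_on_nonneg[OF p])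
    have "- A \<le> f x" "f x \<le> A" for x using f(2)[of x] by auto
    from ext[OF f(1) this] obtain F where F: "(2 * A)-lipschitz_on UNIV F" "\<And>t. t \<in> D \<Longrightarrow> F t = f (\<psi> t)" "\<And>t. - A \<le> F t" "\<And>t. F t \<le> A"
      by blast
    have FA: "\<bar>F t\<bar> \<le> A" for t using F(3,4)[of t] by auto
    obtain P where P: "(2 * C)-lipschitz_on UNIV P" "\<And>t. t \<in> D \<Longrightarrow> P t = p (\<psi> t)" using ext'[OF p] by blast
    obtain q where q: "q \<in> borel_measurable borel" "\<And>x. \<bar>q x\<bar> \<le> 2 * C" "\<And>a b. a \<le> b \<Longrightarrow> P b - P a = (LINT x:{a..b}|lborel. q x)"
      "AE x in lebesgue. (P has_real_derivative q x) (at x)"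
      using lipschitz_real_AE_derivative[OF P(1)] by blast
    have F2: "\<bar>F t\<bar> \<le> 2 * A" for t using FA[of t] A0 by linarith
    have Fb: "F \<in> borel_measurable borel" by (rule lipschitz_on_borel[OF F(1)])
    have blF: "bounded_lipschitz F" using F(1) FA by (rule bounded_lipschitzI)
    have fb: "f \<in> borel_measurable borel" by (rule lipschitz_on_borel[OF f(1)])
    have F\<phi>: "F \<circ> \<phi> \<in> borel_measurable borel" using Fb \<phi>b by measurable
    have P\<phi>: "(2 * C)-lipschitz_on UNIV (P \<circ> \<phi>)"
      using lipschitz_on_compose[OF \<phi> lipschitz_on_subset[OF P(1)]] by simp
    have lP\<phi>: "lipschitz (P \<circ> \<phi>)" and lp: "lipschitz p" using lipschitzI[OF P\<phi>] lipschitzI[OF p] by auto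
    have FqB: "\<bar>F x * q x\<bar> \<le> A * (2 * C)" for x
      unfolding abs_mult using FA[of x] q(2)[of x] A0 by (intro mult_mono) auto
    have FKeq: "F (\<phi> x) = f x" "P (\<phi> x) = p x" if "x \<in> K" for x
      using that F(2)[of "\<phi> x"] P(2)[of "\<phi> x"] \<psi>\<phi>[OF that] by (auto simp: D_def)
    \<comment> \<open>Only the values of \<open>f\<close> and \<open>p\<close> on \<open>K\<close> matter, so both may be replaced by functions of \<open>\<phi>\<close>.\<close>
    have s1: "(LINT x|\<mu>. f x * indicator (K \<inter> V) x * G p x) = (LINT x|\<mu>. (F \<circ> \<phi>) x * indicator (K \<inter> V) x * G (P \<circ> \<phi>) x)"
    proof (rule integral_cong_AE)
      show "(\<lambda>x. f x * indicator (K \<inter> V) x * G p x) \<in> borel_measurable \<mu>"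
        using integrable_G[OF lp intind[OF fb f(2) KV]] by auto
      show "(\<lambda>x. (F \<circ> \<phi>) x * indicator (K \<inter> V) x * G (P \<circ> \<phi>) x) \<in> borel_measurable \<mu>"
        using integrable_G[OF lP\<phi> intind[OF F\<phi> _ KV]] FA by auto
      have "AE x in \<mu>. x \<in> K \<longrightarrow> G p x = G (P \<circ> \<phi>) x"
        using FKeq(2) by (intro G_eq_on_closed lp lP\<phi> compact_imp_closed K) auto
      then show "AE x in \<mu>. f x * indicator (K \<inter> V) x * G p x = (F \<circ> \<phi>) x * indicator (K \<inter> V) x * G (P \<circ> \<phi>) x"
        by eventually_elim (use FKeq(1) in \<open>auto simp: indicator_def\<close>)
    qed
    have iW: "integrable \<mu> (\<lambda>x. (F \<circ> \<phi>) x * indicator W x)" "integrable \<mu> (\<lambda>x. (F \<circ> \<phi>) x * indicator (K \<inter> V) x)"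
      "integrable \<mu> (\<lambda>x. (F \<circ> \<phi>) x * indicator (W - K) x)"
      using FA W KV WKb by (intro intind[OF F\<phi>, of A]; simp)+
    have s2: "\<bar>(LINT x|\<mu>. (F \<circ> \<phi>) x * indicator (K \<inter> V) x * G (P \<circ> \<phi>) x) - (LINT x|\<mu>. (F \<circ> \<phi>) x * indicator W x * G (P \<circ> \<phi>) x)\<bar>
       \<le> 2 * A * C * \<delta>1"
    proof -
      have "(\<lambda>x. (F \<circ> \<phi>) x * indicator W x * G (P \<circ> \<phi>) x) =
        (\<lambda>x. (F \<circ> \<phi>) x * indicator (K \<inter> V) x * G (P \<circ> \<phi>) x + (F \<circ> \<phi>) x * indicator (W - K) x * G (P \<circ> \<phi>) x)"
        using W(2) by (auto simp: fun_eq_iff indicator_def)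
      then have eq: "(LINT x|\<mu>. (F \<circ> \<phi>) x * indicator (K \<inter> V) x * G (P \<circ> \<phi>) x) - (LINT x|\<mu>. (F \<circ> \<phi>) x * indicator W x * G (P \<circ> \<phi>) x)
        = - (LINT x|\<mu>. (F \<circ> \<phi>) x * indicator (W - K) x * G (P \<circ> \<phi>) x)"
        using integrable_G[OF lP\<phi> iW(2)] integrable_G[OF lP\<phi> iW(3)] by simp
      have "\<bar>LINT x|\<mu>. (F \<circ> \<phi>) x * indicator (W - K) x * G (P \<circ> \<phi>) x\<bar> \<le> 2 * C * (LINT x|\<mu>. \<bar>(F \<circ> \<phi>) x * indicator (W - K) x\<bar>)"
        by (rule integral_G_le[OF P\<phi> iW(3)])
      also have "\<dots> \<le> 2 * C * (LINT x|\<mu>. A * indicator (W - K) x)"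
      proof (intro mult_left_mono integral_mono)
        show "\<bar>(F \<circ> \<phi>) x * indicator (W - K) x\<bar> \<le> A * indicator (W - K) x" for x
          using FA[of "\<phi> x"] A0 by (simp add: indicator_def)
        show "integrable \<mu> (\<lambda>x. A * indicator (W - K) x)"
          by (intro integrable_mult_right integrable_indicator WKb)
      qed (use C0 iW(3) in \<open>auto intro: integrable_abs\<close>)
      also have "\<dots> = 2 * C * (A * measure \<mu> (W - K))" by (simp add: space_UNIV)
      also have "\<dots> \<le> 2 * C * (A * \<delta>1)" using C0 A0 mWK by (intro mult_left_mono) auto
      finally show ?thesis unfolding eq by (simp add: mult_ac)
    qed
    have s3: "(LINT x|\<mu>. (F \<circ> \<phi>) x * indicator W x * G (P \<circ> \<phi>) x) = (LINT x|lborel. g x * F x * q x)"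
      using geq[OF blF lipschitzI[OF P(1)] q(1,4)] by simp
    define kk where "kk x = (\<Sum>(s, K)\<leftarrow>ks. s * indicator K x)" for x
    have cks: "\<forall>k\<in>set ks. compact (snd k)" using ks(1) by auto
    have Fq: "(\<lambda>x. F x * q x) \<in> borel_measurable borel" using Fb q(1) by measurable
    note st = integral_compact_step[OF cks Fq FqB, where w="\<lambda>s. s"]
    have ikk: "integrable lborel kk"
      using integral_compact_step(1)[where H="\<lambda>_. 1" and B=1 and w="\<lambda>s. s" and ks=ks, OF cks] by (simp add: kk_def[abs_def])
    have iDg: "integrable lborel (\<lambda>x. indicator D x * g x)"
      using integrable_mult_indicator[of D lborel g] bD g(1) by simp
    have iDg': "integrable lborel (\<lambda>x. \<bar>g x\<bar> * indicator (- D) x)"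
      using integrable_mult_indicator[of "- D" lborel "\<lambda>x. \<bar>g x\<bar>"] bD g(1) by (simp add: mult.commute)
    have igFq: "integrable lborel (\<lambda>x. g x * F x * q x)"
    proof (rule Bochner_Integration.integrable_bound)
      show "integrable lborel (\<lambda>x. (A * (2 * C)) * g x)" using g(1) by simp
      show "AE x in lborel. norm (g x * F x * q x) \<le> norm ((A * (2 * C)) * g x)"
      proof (intro AE_I2)
        fix x
        have "\<bar>g x\<bar> * \<bar>F x * q x\<bar> \<le> \<bar>g x\<bar> * (A * (2 * C))" using FqB[of x] by (intro mult_left_mono) auto
        moreover have "norm (g x * F x * q x) = \<bar>g x\<bar> * \<bar>F x * q x\<bar>" by (simp add: abs_mult mult.assoc)
        moreover have "norm ((A * (2 * C)) * g x) = \<bar>g x\<bar> * (A * (2 * C))" using A0 C0 by (simp add: abs_mult)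
        ultimately show "norm (g x * F x * q x) \<le> norm ((A * (2 * C)) * g x)" by simp
      qed
    qed (use g Fb q in measurable)
    have s4: "\<bar>(LINT x|lborel. g x * F x * q x) - (\<Sum>(s, L)\<leftarrow>ks. s * (LINT x|lborel. indicator L x * (F x * q x)))\<bar> \<le> 4 * A * C * \<delta>1"
    proof -
      have eq: "(LINT x|lborel. g x * F x * q x) - (\<Sum>(s, L)\<leftarrow>ks. s * (LINT x|lborel. indicator L x * (F x * q x)))
        = (LINT x|lborel. (g x - kk x) * (F x * q x))"
        unfolding st(2)[symmetric] kk_def[symmetric]
        using igFq st(1) by (subst Bochner_Integration.integral_diff[symmetric]) (auto simp: kk_def algebra_simps)
      have "\<bar>LINT x|lborel. (g x - kk x) * (F x * q x)\<bar> \<le> (LINT x|lborel. \<bar>(g x - kk x) * (F x * q x)\<bar>)"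
        by (rule integral_abs_bound)
      also have "\<dots> \<le> (LINT x|lborel. (A * (2 * C)) * (\<bar>indicator D x * g x - kk x\<bar> + \<bar>g x\<bar> * indicator (- D) x))"
      proof (rule integral_mono)
        show "integrable lborel (\<lambda>x. \<bar>(g x - kk x) * (F x * q x)\<bar>)"
          using igFq st(1) by (intro integrable_abs) (auto simp: kk_def left_diff_distrib mult.assoc)
        show "integrable lborel (\<lambda>x. (A * (2 * C)) * (\<bar>indicator D x * g x - kk x\<bar> + \<bar>g x\<bar> * indicator (- D) x))"
          using iDg ikk iDg' by auto
        fix x
        have "\<bar>g x - kk x\<bar> \<le> \<bar>indicator D x * g x - kk x\<bar> + \<bar>g x\<bar> * indicator (- D) x"
          by (auto simp: indicator_def)
        then have "\<bar>g x - kk x\<bar> * \<bar>F x * q x\<bar> \<le> (\<bar>indicator D x * g x - kk x\<bar> + \<bar>g x\<bar> * indicator (- D) x) * (A * (2 * C))"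
          using FqB by (intro mult_mono) auto
        then show "\<bar>(g x - kk x) * (F x * q x)\<bar> \<le> (A * (2 * C)) * (\<bar>indicator D x * g x - kk x\<bar> + \<bar>g x\<bar> * indicator (- D) x)"
          by (simp only: abs_mult mult.commute)
      qed
      also have "\<dots> = (A * (2 * C)) * ((LINT x|lborel. \<bar>indicator D x * g x - kk x\<bar>) + (LINT x|lborel. \<bar>g x\<bar> * indicator (- D) x))"
        using iDg ikk iDg' by simp
      also have "\<dots> \<le> (A * (2 * C)) * (\<delta>1 + \<delta>1)"
      proof (intro mult_left_mono add_mono)
        show "(LINT x|lborel. \<bar>indicator D x * g x - kk x\<bar>) \<le> \<delta>1" using ks(2) by (simp add: kk_def)
        \<comment> \<open>Points of \<open>K\<close> are mapped into \<open>D\<close>, so the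
          density outside \<open>D\<close> carries at most the mass of \<open>T\<close> in
          \<open>W - K\<close>.\<close>
        have "(LINT x|lborel. \<bar>g x\<bar> * indicator (- D) x) \<le> (LINT x|\<mu>. indicator (- D) (\<phi> x) * indicator W x)"
          using bD by (intro gbound[of "indicator (- D)" 1]) (auto simp: indicator_def)
        also have "\<dots> \<le> (LINT x|\<mu>. indicator (W - K) x)"
        proof (rule integral_mono)
          show "integrable \<mu> (\<lambda>x. indicator (- D) (\<phi> x) * indicator W x :: real)"
          proof (rule intind[of _ 1])
            show "(\<lambda>x. indicator (- D) (\<phi> x) :: real) \<in> borel_measurable borel"
              by (rule measurable_compose[OF \<phi>b]) (use bD in simp)
          qed (use W(1) in \<open>auto simp: indicator_def\<close>)
          show "integrable \<mu> (indicator (W - K) :: 'a \<Rightarrow> real)" by (rule integrable_indicator[OF WKb])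
          show "indicator (- D) (\<phi> x) * indicator W x \<le> (indicator (W - K) x :: real)" for x
            by (auto simp: indicator_def D_def)
        qed
        also have "\<dots> \<le> \<delta>1" using mWK by (simp add: space_UNIV)
        finally show "(LINT x|lborel. \<bar>g x\<bar> * indicator (- D) x) \<le> \<delta>1" .
      qed (use A0 C0 in auto)
      finally show ?thesis unfolding eq by (simp add: mult_ac)
    qed
    have s5: "\<bar>(\<Sum>(s, L)\<leftarrow>ks. s * (LINT x|lborel. indicator L x * (F x * q x))) - edge_sum es f p\<bar> \<le> real r * (\<delta>3 * (2 * A) * (2 * C))"
      unfolding es_def edge_sum_concat_map r_def
    proof (rule sum_list_abs_diff_le)
      fix k assume "k \<in> set ks"
      then obtain s L where k: "k = (s, L)" "(s, L) \<in> set ks" by (metis surj_pair)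
      have L: "compact L" "L \<subseteq> D" "s = 1 \<or> s = -1" using ks(1)[OF k(2)] by auto
      have "edge_sum (ed k) f p = s * (\<Sum>(a, b)\<leftarrow>E L. F (tag s a b) * (P b - P a))"
      proof -
        have "edge_sum (ed k) f p = (\<Sum>e\<leftarrow>E L. s * (case e of (a, b) \<Rightarrow> F (tag s a b) * (P b - P a)))"
          unfolding edge_sum_def ed_def k(1) using L(3) E1[OF L(1)] L(2) F(2) P(2)
          by (auto simp: tag_def comp_def split_beta intro!: arg_cong[where f=sum_list] map_cong) (auto simp: subset_iff algebra_simps)
        then show ?thesis by (simp add: sum_list_const_mult)
      qed
      moreover have "\<bar>(LINT x|lborel. indicator L x * (F x * q x)) - (\<Sum>(a, b)\<leftarrow>E L. F (tag s a b) * (P b - P a))\<bar> \<le> \<delta>3 * (2 * A) * (2 * C)"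
        by (rule E2[OF L(1) _ F(1) F2 q(1,2,3) tag]) (use C0 in simp)
      ultimately show "\<bar>(case k of (s, L) \<Rightarrow> s * (LINT x|lborel. indicator L x * (F x * q x))) - edge_sum (ed k) f p\<bar> \<le> \<delta>3 * (2 * A) * (2 * C)"
        using L(3) by (auto simp: k(1))
    qed
    have "real r * (\<delta>3 * (2 * A) * (2 * C)) = (real r * \<delta>3) * (4 * A * C)" by simp
    also have "\<dots> \<le> \<delta>1 * (4 * A * C)" using \<delta>3 A0 C0 by (intro mult_right_mono) auto
    finally have "\<bar>(LINT x|\<mu>. f x * indicator (K \<inter> V) x * G p x) - edge_sum es f p\<bar> \<le> 2 * A * C * \<delta>1 + 4 * A * C * \<delta>1 + \<delta>1 * (4 * A * C)"
      using s2 s4 s5 unfolding s1 s3 by linarith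
    also have "\<dots> = 10 / 16 * (\<delta> * A * C)" by (simp add: \<delta>1_def algebra_simps)
    also have "\<dots> \<le> \<delta> * A * C" using \<delta> A0 C0 by simp
    finally show "\<bar>(LINT x|\<mu>. f x * indicator (K \<inter> V) x * G p x) - edge_sum es f p\<bar> \<le> \<delta> * A * C" .
  next
    fix A :: real and h :: "'a \<Rightarrow> real"
    assume h: "A-lipschitz_on UNIV h" "\<And>x. 0 \<le> h x" "\<And>x. h x \<le> A"
    have A0: "0 \<le> A" by (rule lipschitz_on_nonneg[OF h(1)])
    obtain H where H: "(2 * A)-lipschitz_on UNIV H" "\<And>t. t \<in> D \<Longrightarrow> H t = h (\<psi> t)" "\<And>t. 0 \<le> H t" "\<And>t. H t \<le> A"
      using ext[OF h] by blast
    have Hb: "H \<in> borel_measurable borel" by (rule lipschitz_on_borel[OF H(1)])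
    have hb: "h \<in> borel_measurable borel" by (rule lipschitz_on_borel[OF h(1)])
    have H\<phi>: "(\<lambda>x. H (\<phi> x)) \<in> borel_measurable borel" using Hb \<phi>b by measurable
    have HA: "\<bar>H x\<bar> \<le> A" for x using H(3,4)[of x] by simp
    have H2: "\<bar>H x\<bar> \<le> 2 * A" for x using HA[of x] A0 by linarith
    have hA: "\<bar>h x\<bar> \<le> A" for x using h(2,3)[of x] by simp
    have cks: "\<forall>k\<in>set ks. compact (snd k)" using ks(1) by auto
    note st = integral_compact_step[OF cks Hb HA, where w="\<lambda>_. 1"]
    have "edge_length es h = (\<Sum>k\<leftarrow>ks. edge_length (ed k) h)" unfolding es_def by (rule edge_length_concat_map)
    also have "\<dots> \<le> (\<Sum>k\<leftarrow>ks. (1 + \<epsilon>) * (case k of (s, L) \<Rightarrow> 1 * (LINT x|lborel. indicator L x * H x))) + real (length ks) * ((1 + \<epsilon>) * (\<delta>3 * (2 * A) * 1))"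
    proof (rule sum_list_le_add)
      fix k assume "k \<in> set ks"
      then obtain s L where k: "k = (s, L)" "(s, L) \<in> set ks" by (metis surj_pair)
      have L: "compact L" "L \<subseteq> D" "s = 1 \<or> s = -1" using ks(1)[OF k(2)] by auto
      have "edge_length (ed k) h \<le> (\<Sum>e\<leftarrow>E L. (1 + \<epsilon>) * (case e of (a, b) \<Rightarrow> H (tag s a b) * (b - a)))"
        unfolding edge_length_def ed_def k(1) map_map comp_def prod.case
      proof (rule sum_list_mono)
        fix e assume "e \<in> set (E L)"
        then obtain a b where e: "e = (a, b)" "(a, b) \<in> set (E L)" by (metis surj_pair)
        note ab = E1[OF L(1) e(2)]
        have d: "dist (\<psi> a) (\<psi> b) \<le> (1 + \<epsilon>) * (b - a)"
          using \<psi>d[of a b] ab L(2) by auto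
        have "H (tag s a b) * dist (\<psi> a) (\<psi> b) \<le> H (tag s a b) * ((1 + \<epsilon>) * (b - a))"
          using d H(3) by (intro mult_left_mono) auto
        moreover have "H a = h (\<psi> a)" "H b = h (\<psi> b)" using H(2) ab L(2) by auto
        ultimately show "(case case e of (a, b) \<Rightarrow> if s = 1 then (\<psi> a, \<psi> b) else (\<psi> b, \<psi> a) of (x, y) \<Rightarrow> h x * dist x y)
            \<le> (1 + \<epsilon>) * (case e of (a, b) \<Rightarrow> H (tag s a b) * (b - a))"
          by (auto simp: e tag_def dist_commute mult_ac split: if_splits)
      qed
      also have "\<dots> = (1 + \<epsilon>) * (\<Sum>(a, b)\<leftarrow>E L. H (tag s a b) * (b - a))" by (simp add: sum_list_const_mult)
      also have "\<dots> \<le> (1 + \<epsilon>) * ((LINT x|lborel. indicator L x * H x) + \<delta>3 * (2 * A) * 1)"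
      proof (intro mult_left_mono)
        have "\<bar>(LINT x|lborel. indicator L x * (H x * 1)) - (\<Sum>(a, b)\<leftarrow>E L. H (tag s a b) * (b - a))\<bar> \<le> \<delta>3 * (2 * A) * 1"
          by (rule E2[OF L(1) _ H(1) H2 _ _ _ tag, where q="\<lambda>_. 1" and Q="\<lambda>x. x"]) (auto simp: set_lebesgue_integral_def)
        then show "(\<Sum>(a, b)\<leftarrow>E L. H (tag s a b) * (b - a)) \<le> (LINT x|lborel. indicator L x * H x) + \<delta>3 * (2 * A) * 1"
          by simp
      qed (use \<epsilon> in simp)
      finally show "edge_length (ed k) h \<le> (1 + \<epsilon>) * (case k of (s, L) \<Rightarrow> 1 * (LINT x|lborel. indicator L x * H x)) + (1 + \<epsilon>) * (\<delta>3 * (2 * A) * 1)"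
        by (simp add: k(1) distrib_left)
    qed
    also have "(\<Sum>k\<leftarrow>ks. (1 + \<epsilon>) * (case k of (s, L) \<Rightarrow> 1 * (LINT x|lborel. indicator L x * H x))) =
        (1 + \<epsilon>) * (LINT x|lborel. (\<Sum>(s, K)\<leftarrow>ks. 1 * indicator K x) * H x)"
      by (simp only: st(2) sum_list_const_mult)
    also have "\<dots> \<le> (1 + \<epsilon>) * ((LINT x|\<mu>. h x * indicator (K \<inter> V) x) + A * \<delta>1)"
    proof (rule mult_left_mono)
      have DH: "(\<lambda>x. indicator D x * H x) \<in> borel_measurable borel" using bD Hb by (intro borel_measurable_times borel_measurable_indicator)
      \<comment> \<open>The bound of the multiplicity of the compact sets by
        \<open>\<bar>g\<bar>\<close> enters here; with the mass bound for \<open>g\<close> it limits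
        the length by the mass of \<open>T\<close> near \<open>K\<close>.\<close>
      have "(LINT x|lborel. (\<Sum>(s, K)\<leftarrow>ks. 1 * indicator K x) * H x) \<le> (LINT x|lborel. \<bar>g x\<bar> * (indicator D x * H x))"
      proof (rule integral_mono[OF st(1)])
        show "integrable lborel (\<lambda>x. \<bar>g x\<bar> * (indicator D x * H x))"
        proof (rule Bochner_Integration.integrable_bound)
          show "integrable lborel (\<lambda>x. A * g x)" using g(1) by simp
          show "AE x in lborel. norm (\<bar>g x\<bar> * (indicator D x * H x)) \<le> norm (A * g x)"
            using H(3,4) A0 by (intro AE_I2) (auto simp: abs_mult indicator_def mult.commute[of A] intro!: mult_left_mono)
        qed (use g(2) DH in measurable)
        fix x
        have "(\<Sum>(s, K)\<leftarrow>ks. 1 * indicator K x) \<le> \<bar>g x\<bar> * indicator D x"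
        proof (cases "x \<in> D")
          case False
          have "(\<Sum>(s, K)\<leftarrow>ks. indicator K x) = (\<Sum>k\<leftarrow>ks. (0::real))"
            using False ks(1) by (intro arg_cong[where f=sum_list] map_cong) (fastforce simp: indicator_def)+
          then show ?thesis using False by simp
        qed (use ks(3) in simp)
        then show "(\<Sum>(s, K)\<leftarrow>ks. 1 * indicator K x) * H x \<le> \<bar>g x\<bar> * (indicator D x * H x)"
          using mult_right_mono[OF _ H(3)[of x]] by (simp only: mult.assoc[symmetric])
      qed
      also have "\<dots> \<le> (LINT x|\<mu>. (indicator D (\<phi> x) * H (\<phi> x)) * indicator W x)"
        by (rule gbound[where h="\<lambda>x. indicator D x * H x" and B=A]) (use DH H(3,4) A0 in \<open>auto simp: indicator_def\<close>)
      also have "\<dots> \<le> (LINT x|\<mu>. h x * indicator (K \<inter> V) x + A * indicator (W - K) x)"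
      proof (rule integral_mono)
        have "(\<lambda>x. indicator D (\<phi> x) * H (\<phi> x)) \<in> borel_measurable borel" by (rule measurable_compose[OF \<phi>b DH])
        then show "integrable \<mu> (\<lambda>x. (indicator D (\<phi> x) * H (\<phi> x)) * indicator W x)"
          using W(1) HA A0 by (intro intind[of _ A]) (auto simp: indicator_def)
        show "integrable \<mu> (\<lambda>x. h x * indicator (K \<inter> V) x + A * indicator (W - K) x)"
          by (intro Bochner_Integration.integrable_add intind[OF hb hA KV] integrable_mult_right integrable_indicator WKb)
        show "(indicator D (\<phi> x) * H (\<phi> x)) * indicator W x \<le> h x * indicator (K \<inter> V) x + A * indicator (W - K) x" for x
        proof (cases "x \<in> K")
          case True
          then have "H (\<phi> x) = h x" using H(2)[of "\<phi> x"] \<psi>\<phi>[OF True] by (auto simp: D_def)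
          then show ?thesis using True W(2) h(2)[of x] by (auto simp: indicator_def)
        next
          case False
          then show ?thesis using H(4)[of "\<phi> x"] A0 by (auto simp: indicator_def)
        qed
      qed
      also have "\<dots> = (LINT x|\<mu>. h x * indicator (K \<inter> V) x) + A * measure \<mu> (W - K)"
        using intind[OF hb hA KV] integrable_indicator[OF WKb] by (simp add: space_UNIV)
      also have "\<dots> \<le> (LINT x|\<mu>. h x * indicator (K \<inter> V) x) + A * \<delta>1"
        using mWK A0 by (intro add_left_mono mult_left_mono) auto
      finally show "(LINT x|lborel. (\<Sum>(s, K)\<leftarrow>ks. 1 * indicator K x) * H x) \<le> (LINT x|\<mu>. h x * indicator (K \<inter> V) x) + A * \<delta>1" .
    qed (use \<epsilon> in simp)
    finally have "edge_length es h \<le> (1 + \<epsilon>) * (LINT x|\<mu>. h x * indicator (K \<inter> V) x) + (1 + \<epsilon>) * (A * \<delta>1 + real r * \<delta>3 * (2 * A))"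
      by (simp add: r_def algebra_simps)
    also have "(1 + \<epsilon>) * (A * \<delta>1 + real r * \<delta>3 * (2 * A)) \<le> 2 * (A * \<delta>1 + \<delta>1 * (2 * A))"
      using \<epsilon> A0 \<delta>1 \<delta>3 by (intro mult_mono add_mono mult_right_mono) auto
    also have "\<dots> = 6 / 16 * (\<delta> * A)" by (simp add: \<delta>1_def)
    also have "\<dots> \<le> \<delta> * A" using \<delta> A0 by simp
    finally show "edge_length es h \<le> (1 + \<epsilon>) * (LINT x|\<mu>. h x * indicator (K \<inter> V) x) + \<delta> * A" by simp
  qed
qed

section \<open>Exhaustion of the mass measure by compact sets and global approximation by
  edges\<close>

lemma integer_rectifiableD:
  fixes T :: "'a::complete_space functional"
  assumes "integer_rectifiable TYPE(real) T"
  shows "metric_current1 T" "integer_slices T"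
    and "0 < \<epsilon> \<Longrightarrow> \<exists>(K :: nat \<Rightarrow> 'a set) z. (\<forall>j. compact (K j)) \<and> (\<forall>j. near_isometry \<epsilon> (z j) (K j)) \<and>
      (AE x in mass_measure 1 T. x \<in> (\<Union>j. K j))"
proof -
  have T: "current 1 T" "finite_mass 1 T" "\<exists>S. countably_rectifiable TYPE(real) S \<and> (AE x in mass_measure 1 T. x \<in> S)"
    "\<forall>B\<in>sets borel. hausdorff_measure 1 B = 0 \<longrightarrow> emeasure (mass_measure 1 T) B = 0" "integer_slices T"
    using assms unfolding integer_rectifiable_def DIM_real integer_slices_def by blast+
  show "metric_current1 T" using T(1,2) by unfold_locales
  then interpret metric_current1 T .
  show "integer_slices T" by fact
  assume "0 < \<epsilon>"
  obtain S where S: "countably_rectifiable TYPE(real) S" "AE x in \<mu>. x \<in> S" using T(3) by blast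
  \<comment> \<open>Completeness of the space enters through the extension of Lipschitz charts to
    closed domains.\<close>
  obtain K :: "nat \<Rightarrow> 'a set" and z where "\<And>j. compact (K j)" "\<And>j. near_isometry \<epsilon> (z j) (K j)" "AE x in \<mu>. x \<in> (\<Union>j. K j)"
    by (rule near_isometry_cover[OF lipschitz_extend_closure S T(4)[rule_format] \<open>0 < \<epsilon>\<close>]) blast+
  then show "\<exists>(K :: nat \<Rightarrow> 'a set) z. (\<forall>j. compact (K j)) \<and> (\<forall>j. near_isometry \<epsilon> (z j) (K j)) \<and>
      (AE x in \<mu>. x \<in> (\<Union>j. K j))" by blast
qed

lemma (in finite_borel_measure) finite_subcover_measure:
  fixes K :: "nat \<Rightarrow> 'a set"
  assumes K: "\<And>j. K j \<in> sets borel" "AE x in M. x \<in> (\<Union>j. K j)" and "0 < \<delta>"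
  obtains J where "measure M (UNIV - (\<Union>j<J. K j)) < \<delta>"
proof -
  let ?B = "\<lambda>n. UNIV - (\<Union>j<n. K j)"
  have "(\<lambda>n. measure M (?B n)) \<longlonglongrightarrow> measure M (\<Inter>n. ?B n)"
    using K(1) by (intro finite_Lim_measure_decseq) (auto simp: sets_borel decseq_def)
  moreover have "measure M (\<Inter>n. ?B n) = 0"
  proof -
    have "AE x in M. x \<notin> (\<Inter>n. ?B n)" using K(2) by eventually_elim auto
    from emeasure_eq_0_AE[OF this] have "emeasure M (\<Inter>n. ?B n) = 0"
      by (simp only: space_UNIV UNIV_I simp_thms Collect_mem_eq)
    then show ?thesis by (simp add: measure_def)
  qed
  ultimately have "eventually (\<lambda>n. measure M (?B n) < \<delta>) sequentially"
    using order_tendstoD(2)[of "\<lambda>n. measure M (?B n)" 0 sequentially \<delta>] \<open>0 < \<delta>\<close> by simp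
  then show thesis using that by (auto simp: eventually_sequentially)
qed

text \<open>Tightness comes from rectifiability rather than from separability: countably many
  compact sets carry the mass measure, and finitely many of them suffice up to
  \<open>\<delta>\<close>. The point \<open>undefined\<close> makes the compact set
  nonempty.\<close>

lemma integer_rectifiable_tight:
  fixes T :: "'a::complete_space functional"
  assumes "integer_rectifiable TYPE(real) T" "0 < \<delta>"
  obtains K where "compact K" "K \<noteq> {}" "measure (mass_measure 1 T) (UNIV - K) < \<delta>"
proof -
  interpret metric_current1 T by (rule integer_rectifiableD[OF assms(1)])
  obtain K :: "nat \<Rightarrow> 'a set" where K: "\<And>j. compact (K j)" "AE x in \<mu>. x \<in> (\<Union>j. K j)"
    using integer_rectifiableD(3)[OF assms(1), of 1] by auto
  obtain J where J: "measure \<mu> (UNIV - (\<Union>j<J. K j)) < \<delta>"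
    using finite_subcover_measure[of K \<delta>] K assms(2) by (auto simp: compact_imp_closed)
  have c: "compact (insert undefined (\<Union>j<J. K j))" using K(1) by (intro compact_insert compact_UN) auto
  have "measure \<mu> (UNIV - insert undefined (\<Union>j<J. K j)) \<le> measure \<mu> (UNIV - (\<Union>j<J. K j))"
    using K(1) by (intro finite_measure_mono) (auto simp: sets_borel compact_imp_closed intro!: sets.Diff)
  then show thesis using J c by (intro that[of "insert undefined (\<Union>j<J. K j)"]) auto
qed

lemma edge_approximation:
  fixes T :: "'a::complete_space functional"
  assumes T: "integer_rectifiable TYPE(real) T" and \<epsilon>: "0 < \<epsilon>"
  obtains es where "\<And>x y. (x, y) \<in> set es \<Longrightarrow> dist x y \<le> \<epsilon>"
    "\<And>A C f p. A-lipschitz_on UNIV f \<Longrightarrow> (\<And>x. \<bar>f x\<bar> \<le> A) \<Longrightarrow> C-lipschitz_on UNIV p \<Longrightarrow>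
       \<bar>T f [p] - edge_sum es f p\<bar> \<le> \<epsilon> * A * C"
    "\<And>A h. A-lipschitz_on UNIV h \<Longrightarrow> (\<And>x. 0 \<le> h x) \<Longrightarrow> (\<And>x. h x \<le> A) \<Longrightarrow>
       edge_length es h \<le> (LINT x|mass_measure 1 T. h x) + \<epsilon> * A"
proof -
  interpret metric_current1 T by (rule integer_rectifiableD[OF T])
  define m where "m = measure \<mu> UNIV"
  have m: "0 \<le> m" by (simp add: m_def)
  \<comment> \<open>The factor \<open>1 + \<eta>\<close> of the near isometries adds at most
    \<open>\<eta> * m\<close> to a length with weights at most 1, which is half of the allowed
    error.\<close>
  define \<eta> where "\<eta> = min 1 (\<epsilon> / (2 * (m + 1)))"
  have \<eta>: "0 < \<eta>" "\<eta> \<le> 1" "\<eta> * m \<le> \<epsilon> / 2"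
  proof -
    show "0 < \<eta>" "\<eta> \<le> 1" using \<epsilon> m by (auto simp: \<eta>_def)
    have "\<eta> * m \<le> (\<epsilon> / (2 * (m + 1))) * (m + 1)" using \<epsilon> m by (intro mult_mono) (auto simp: \<eta>_def)
    also have "\<dots> = \<epsilon> / 2" using m by (simp add: field_simps)
    finally show "\<eta> * m \<le> \<epsilon> / 2" .
  qed
  obtain K :: "nat \<Rightarrow> 'a set" and z where K: "\<And>j. compact (K j)" "\<And>j. near_isometry \<eta> (z j) (K j)" "AE x in \<mu>. x \<in> (\<Union>j. K j)"
    using integer_rectifiableD(3)[OF T \<eta>(1)] by blast
  have Kb: "K j \<in> sets borel" for j using K(1) by (simp add: compact_imp_closed)
  obtain J where J: "measure \<mu> (UNIV - (\<Union>j<J. K j)) < \<epsilon> / 2"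
    using finite_subcover_measure[OF Kb K(3), of "\<epsilon>/2"] \<epsilon> by auto
  define \<delta> where "\<delta> = \<epsilon> / (2 * (real J + 1))"
  have \<delta>: "0 < \<delta>" "\<delta> \<le> \<epsilon>" "real J * \<delta> \<le> \<epsilon> / 2"
    using \<epsilon> by (auto simp: \<delta>_def field_simps)
  \<comment> \<open>The complement of the earlier compact sets is open, so the sets
    \<open>K j \<inter> V j\<close> are disjoint and still of the form treated on a single near
    isometry.\<close>
  define V where "V j = - (\<Union>i<j. K i)" for j
  have V: "open (V j)" for j
    unfolding V_def using K(1) by (intro open_Compl closed_UN) (auto simp: compact_imp_closed)
  have KVb: "K j \<inter> V j \<in> sets borel" for j using Kb V by auto
  have "\<forall>j. \<exists>es. (\<forall>x y. (x, y) \<in> set es \<longrightarrow> dist x y \<le> \<delta>) \<and>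
    (\<forall>A C f p. A-lipschitz_on UNIV f \<longrightarrow> (\<forall>x. \<bar>f x\<bar> \<le> A) \<longrightarrow> C-lipschitz_on UNIV p \<longrightarrow>
       \<bar>(LINT x|\<mu>. f x * indicator (K j \<inter> V j) x * G p x) - edge_sum es f p\<bar> \<le> \<delta> * A * C) \<and>
    (\<forall>A h. A-lipschitz_on UNIV h \<longrightarrow> (\<forall>x. 0 \<le> h x) \<longrightarrow> (\<forall>x. h x \<le> A) \<longrightarrow>
       edge_length es h \<le> (1 + \<eta>) * (LINT x|\<mu>. h x * indicator (K j \<inter> V j) x) + \<delta> * A)"
    (is "\<forall>j. \<exists>es. ?P j es")
    by (intro allI, rule edges_on_near_isometry[OF integer_rectifiableD(2)[OF T] K(1,2) \<eta>(1,2) V \<delta>(1)]) blast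
  from choice[OF this] obtain es where es0: "\<And>j. ?P j (es j)" by blast
  have es: "dist x y \<le> \<delta>" if "(x, y) \<in> set (es j)" for j x y
    using es0[of j, THEN conjunct1] that by blast
  have es_sum: "\<bar>(LINT x|\<mu>. f x * indicator (K j \<inter> V j) x * G p x) - edge_sum (es j) f p\<bar> \<le> \<delta> * A * C"
    if "A-lipschitz_on UNIV f" "\<forall>x. \<bar>f x\<bar> \<le> A" "C-lipschitz_on UNIV p" for j A C f p
    using es0[of j, THEN conjunct2, THEN conjunct1] that by blast
  have es_length: "edge_length (es j) h \<le> (1 + \<eta>) * (LINT x|\<mu>. h x * indicator (K j \<inter> V j) x) + \<delta> * A"
    if "A-lipschitz_on UNIV h" "\<forall>x. 0 \<le> h x" "\<forall>x. h x \<le> A" for j A h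
    using es0[of j, THEN conjunct2, THEN conjunct2] that by blast
  define S where "S n = (\<Union>j<n. K j)" for n
  have Sb: "S n \<in> sets borel" for n unfolding S_def using Kb by auto
  have S_Suc: "(indicator (S (Suc n)) x :: real) = indicator (S n) x + indicator (K n \<inter> V n) x" for n x
    by (auto simp: S_def V_def indicator_def less_Suc_eq)
  show thesis
  proof (rule that[of "concat (map es [0..<J])"])
    show "dist x y \<le> \<epsilon>" if "(x, y) \<in> set (concat (map es [0..<J]))" for x y
      using that es \<delta>(2) by fastforce
  next
    fix A C :: real and f p :: "'a \<Rightarrow> real"
    assume f: "A-lipschitz_on UNIV f" "\<And>x. \<bar>f x\<bar> \<le> A" and p: "C-lipschitz_on UNIV p"
    have A0: "0 \<le> A" by (rule lipschitz_on_nonneg[OF f(1)])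
    have C0: "0 \<le> C" by (rule lipschitz_on_nonneg[OF p])
    have fb: "f \<in> borel_measurable borel" by (rule lipschitz_on_borel[OF f(1)])
    have lp: "lipschitz p" by (rule lipschitzI[OF p])
    have i: "integrable \<mu> (\<lambda>x. f x * indicator B x)" if "B \<in> sets borel" for B
      by (rule integrable_times_indicator[OF fb f(2) that])
    have sum: "(LINT x|\<mu>. f x * indicator (S n) x * G p x) = (\<Sum>j\<leftarrow>[0..<n]. LINT x|\<mu>. f x * indicator (K j \<inter> V j) x * G p x)" for n
    proof (induction n)
      case (Suc n)
      have "(LINT x|\<mu>. f x * indicator (S (Suc n)) x * G p x) =
        (LINT x|\<mu>. f x * indicator (S n) x * G p x + f x * indicator (K n \<inter> V n) x * G p x)"
        unfolding S_Suc by (simp add: distrib_left distrib_right)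
      also have "\<dots> = (LINT x|\<mu>. f x * indicator (S n) x * G p x) + (LINT x|\<mu>. f x * indicator (K n \<inter> V n) x * G p x)"
        by (rule Bochner_Integration.integral_add[OF integrable_G[OF lp i[OF Sb]] integrable_G[OF lp i[OF KVb]]])
      finally show ?case using Suc by simp
    qed (simp add: S_def)
    have 1: "\<bar>(LINT x|\<mu>. f x * indicator (S J) x * G p x) - edge_sum (concat (map es [0..<J])) f p\<bar> \<le> real (length [0..<J]) * (\<delta> * A * C)"
      unfolding sum edge_sum_concat_map using f p by (intro sum_list_abs_diff_le es_sum) auto
    have 2: "\<bar>T f [p] - (LINT x|\<mu>. f x * indicator (S J) x * G p x)\<bar> \<le> C * (A * (\<epsilon> / 2))"
    proof -
      have "T f [p] = (LINT x|\<mu>. f x * indicator (S J) x * G p x + f x * indicator (UNIV - S J) x * G p x)"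
        unfolding T_eq[OF lp bounded_lipschitzI[OF f]] by (intro Bochner_Integration.integral_cong) (auto simp: indicator_def)
      also have "\<dots> = (LINT x|\<mu>. f x * indicator (S J) x * G p x) + (LINT x|\<mu>. f x * indicator (UNIV - S J) x * G p x)"
        using Sb by (intro Bochner_Integration.integral_add integrable_G lp i) auto
      finally have eq: "T f [p] - (LINT x|\<mu>. f x * indicator (S J) x * G p x) = (LINT x|\<mu>. f x * indicator (UNIV - S J) x * G p x)"
        by simp
      have SJ: "UNIV - S J \<in> sets borel" using Sb by auto
      have "\<bar>LINT x|\<mu>. f x * indicator (UNIV - S J) x * G p x\<bar> \<le> C * (LINT x|\<mu>. \<bar>f x * indicator (UNIV - S J) x\<bar>)"
        by (rule integral_G_le[OF p i[OF SJ]])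
      also have "\<dots> \<le> C * (LINT x|\<mu>. A * indicator (UNIV - S J) x)"
      proof (intro mult_left_mono integral_mono)
        show "\<bar>f x * indicator (UNIV - S J) x\<bar> \<le> A * indicator (UNIV - S J) x" for x
          using f(2)[of x] by (simp add: indicator_def)
        show "integrable \<mu> (\<lambda>x. A * indicator (UNIV - S J) x)"
          by (intro integrable_mult_right integrable_indicator SJ)
      qed (use C0 i[OF SJ] in \<open>auto intro: integrable_abs\<close>)
      also have "\<dots> = C * (A * measure \<mu> (UNIV - S J))" by (simp add: space_UNIV)
      also have "\<dots> \<le> C * (A * (\<epsilon> / 2))" using J A0 C0 by (intro mult_left_mono) (auto simp: S_def)
      finally show ?thesis unfolding eq .
    qed
    have "real J * (\<delta> * A * C) \<le> (\<epsilon> / 2) * (A * C)"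
      using mult_right_mono[OF \<delta>(3), of "A * C"] A0 C0 by (simp add: mult.assoc)
    moreover have "C * (A * (\<epsilon> / 2)) = (\<epsilon> / 2) * (A * C)" "\<epsilon> * A * C = (\<epsilon> / 2) * (A * C) + (\<epsilon> / 2) * (A * C)"
      by (simp_all add: field_simps)
    ultimately show "\<bar>T f [p] - edge_sum (concat (map es [0..<J])) f p\<bar> \<le> \<epsilon> * A * C"
      using 1 2 unfolding length_upt minus_nat.diff_0 by linarith
  next
    fix A :: real and h :: "'a \<Rightarrow> real"
    assume h: "A-lipschitz_on UNIV h" "\<And>x. 0 \<le> h x" "\<And>x. h x \<le> A"
    have A0: "0 \<le> A" by (rule lipschitz_on_nonneg[OF h(1)])
    have hA: "\<bar>h x\<bar> \<le> A" for x using h(2,3)[of x] by simp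
    have hb: "h \<in> borel_measurable borel" by (rule lipschitz_on_borel[OF h(1)])
    have i: "integrable \<mu> (\<lambda>x. h x * indicator B x)" if "B \<in> sets borel" for B
      by (rule integrable_times_indicator[OF hb hA that])
    have ih: "integrable \<mu> h" by (rule integrable_bounded[OF hb hA])
    have sum: "(LINT x|\<mu>. h x * indicator (S n) x) = (\<Sum>j\<leftarrow>[0..<n]. LINT x|\<mu>. h x * indicator (K j \<inter> V j) x)" for n
    proof (induction n)
      case (Suc n)
      have "(LINT x|\<mu>. h x * indicator (S (Suc n)) x) = (LINT x|\<mu>. h x * indicator (S n) x + h x * indicator (K n \<inter> V n) x)"
        unfolding S_Suc by (simp add: distrib_left)
      also have "\<dots> = (LINT x|\<mu>. h x * indicator (S n) x) + (LINT x|\<mu>. h x * indicator (K n \<inter> V n) x)"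
        by (rule Bochner_Integration.integral_add[OF i[OF Sb] i[OF KVb]])
      finally show ?case using Suc by simp
    qed (simp add: S_def)
    have "edge_length (concat (map es [0..<J])) h \<le> (\<Sum>j\<leftarrow>[0..<J]. (1 + \<eta>) * (LINT x|\<mu>. h x * indicator (K j \<inter> V j) x)) + real (length [0..<J]) * (\<delta> * A)"
      unfolding edge_length_concat_map using h by (intro sum_list_le_add es_length) auto
    also have "(\<Sum>j\<leftarrow>[0..<J]. (1 + \<eta>) * (LINT x|\<mu>. h x * indicator (K j \<inter> V j) x)) = (1 + \<eta>) * (LINT x|\<mu>. h x * indicator (S J) x)"
      unfolding sum by (rule sum_list_const_mult)
    also have "(1 + \<eta>) * (LINT x|\<mu>. h x * indicator (S J) x) \<le> (1 + \<eta>) * (LINT x|\<mu>. h x)"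
      using h(2) \<eta>(1) by (intro mult_left_mono integral_mono i Sb ih) (auto simp: indicator_def)
    also have "(1 + \<eta>) * (LINT x|\<mu>. h x) \<le> (LINT x|\<mu>. h x) + (\<epsilon> / 2) * A"
    proof -
      have "(LINT x|\<mu>. h x) \<le> (LINT x|\<mu>. A)" using h(3) ih by (intro integral_mono) auto
      also have "\<dots> = A * m" by (simp add: m_def space_UNIV)
      finally have "\<eta> * (LINT x|\<mu>. h x) \<le> \<eta> * (A * m)" using \<eta> by (intro mult_left_mono) auto
      also have "\<dots> = A * (\<eta> * m)" by simp
      also have "\<dots> \<le> A * (\<epsilon> / 2)" using \<eta> A0 by (intro mult_left_mono)
      finally show ?thesis by (simp add: algebra_simps)
    qed
    also have "real (length [0..<J]) * (\<delta> * A) \<le> (\<epsilon> / 2) * A"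
      using mult_right_mono[OF \<delta>(3) A0] by (simp add: mult.assoc)
    finally show "edge_length (concat (map es [0..<J])) h \<le> (LINT x|\<mu>. h x) + \<epsilon> * A"
      by (simp add: algebra_simps)
  qed
qed

section \<open>Optimal matchings\<close>

definition steps :: "'a list \<Rightarrow> ('a \<times> 'a) list" where
  "steps xs = zip xs (tl xs)"

lemma steps_simps [simp]: "steps [] = []" "steps [x] = []" "steps (x # y # ys) = (x, y) # steps (y # ys)"
  by (simp_all add: steps_def)

lemma steps_append: "steps (xs @ y # ys) = steps (xs @ [y]) @ steps (y # ys)"
proof (induction xs)
  case (Cons x xs)
  then show ?case by (cases xs) auto
qed simp

lemma steps_snoc: "xs \<noteq> [] \<Longrightarrow> steps (xs @ [z]) = zip xs (tl xs @ [z])"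
proof (induction xs)
  case (Cons x xs)
  then show ?case by (cases xs) auto
qed simp

lemma steps_snoc_last: "xs \<noteq> [] \<Longrightarrow> steps (xs @ [z]) = steps xs @ [(last xs, z)]"
proof (induction xs)
  case (Cons x xs)
  then show ?case by (cases xs) auto
qed simp

lemma steps_join: "xs \<noteq> [] \<Longrightarrow> ys \<noteq> [] \<Longrightarrow> last xs = hd ys \<Longrightarrow> steps (xs @ tl ys) = steps xs @ steps ys"
  by (metis append.assoc append_butlast_last_id append_Cons append_Nil list.collapse steps_append)

lemma sum_steps_telescope:
  fixes g :: "'a \<Rightarrow> 'b::ab_group_add"
  shows "xs \<noteq> [] \<Longrightarrow> (\<Sum>(x, y)\<leftarrow>steps xs. g y - g x) = g (last xs) - g (hd xs)"
proof (induction xs rule: induct_list012)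
  case (3 x y zs)
  then show ?case by simp
qed auto

text \<open>At a repeated vertex a closed walk splits into two shorter closed walks that together
  have the same steps.\<close>

lemma closed_walk_nonneg:
  fixes w :: "'a \<Rightarrow> 'a \<Rightarrow> real"
  assumes simple: "\<And>xs. xs \<noteq> [] \<Longrightarrow> distinct xs \<Longrightarrow> set xs \<subseteq> S \<Longrightarrow> 0 \<le> (\<Sum>(i, j)\<leftarrow>steps (xs @ [hd xs]). w i j)"
    and "xs \<noteq> []" "set xs \<subseteq> S"
  shows "0 \<le> (\<Sum>(i, j)\<leftarrow>steps (xs @ [hd xs]). w i j)"
  using assms(2,3)
proof (induction "length xs" arbitrary: xs rule: less_induct)
  case less
  show ?case
  proof (cases "distinct xs")
    case True
    then show ?thesis using simple less.prems by blast
  next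
    case False
    then obtain as y bs cs where xs: "xs = as @ [y] @ bs @ [y] @ cs" using not_distinct_decomp by blast
    have inner: "0 \<le> (\<Sum>(i, j)\<leftarrow>steps ((y # bs) @ [hd (y # bs)]). w i j)"
      using xs less.prems by (intro less.hyps) auto
    have outer: "0 \<le> (\<Sum>(i, j)\<leftarrow>steps ((as @ y # cs) @ [hd (as @ y # cs)]). w i j)"
      using xs less.prems by (intro less.hyps) auto
    have "hd (as @ y # cs) = hd xs" using xs by (cases as) auto
    then have "steps ((as @ y # cs) @ [hd (as @ y # cs)]) = steps (as @ [y]) @ steps (y # cs @ [hd xs])"
      using steps_append[of as y "cs @ [hd xs]"] by simp
    moreover have "steps (xs @ [hd xs]) = steps (as @ [y]) @ steps (y # bs @ [y]) @ steps (y # cs @ [hd xs])"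
      using xs steps_append[of as y "bs @ [y] @ cs @ [hd xs]"] steps_append[of "y # bs" y "cs @ [hd xs]"] by simp
    ultimately show ?thesis using inner outer by simp
  qed
qed

text \<open>Finite Kantorovich duality by shortest paths. As \<open>\<sigma>\<close> is optimal,
  exchanging partners along a cycle does not lower the cost, so the exchange weights
  \<open>w\<close> admit no negative cycle. Infima over walks then give finite potentials
  \<open>a\<close>, and \<open>g\<close> arises by the McShane formula from the values
  \<open>a i - c (p i) (q' i)\<close> at the points \<open>q' i\<close>.\<close>

lemma optimal_matching:
  fixes c :: "'a \<Rightarrow> 'a \<Rightarrow> real" and p q :: "nat \<Rightarrow> 'a"
  assumes c0: "\<And>x. c x x = 0" and c_nonneg: "\<And>x y. 0 \<le> c x y" and tri: "\<And>x y z. c x z \<le> c x y + c y z"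
  obtains \<sigma> g where "\<sigma> permutes {..<N}" "\<And>x y. g x - g y \<le> c x y"
    "(\<Sum>i<N. c (p i) (q (\<sigma> i))) \<le> (\<Sum>i<N. g (p i) - g (q i))"
proof (cases "N = 0")
  case True
  then show thesis using that[OF permutes_id, of "\<lambda>_. 0"] c_nonneg by simp
next
  case N: False
  let ?P = "{\<sigma>. \<sigma> permutes {..<N}}"
  have "finite ?P" "?P \<noteq> {}" using finite_permutations[of "{..<N}"] permutes_id[of "{..<N}"] by blast+
  then obtain \<sigma> where \<sigma>: "\<sigma> permutes {..<N}"
    and opt: "\<And>\<tau>. \<tau> permutes {..<N} \<Longrightarrow> (\<Sum>i<N. c (p i) (q (\<sigma> i))) \<le> (\<Sum>i<N. c (p i) (q (\<tau> i)))"
    using arg_min_if_finite(1)[of ?P "\<lambda>\<sigma>. \<Sum>i<N. c (p i) (q (\<sigma> i))"]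
      arg_min_least[of ?P _ "\<lambda>\<sigma>. \<Sum>i<N. c (p i) (q (\<sigma> i))"] by blast
  define q' where "q' i = q (\<sigma> i)" for i
  \<comment> \<open>The change of cost at \<open>q' j\<close> when its partner \<open>p j\<close> is
    replaced by \<open>p i\<close>.\<close>
  define w where "w i j = c (p i) (q' j) - c (p j) (q' j)" for i j
  have simple: "0 \<le> (\<Sum>(i, j)\<leftarrow>steps (xs @ [hd xs]). w i j)" if xs: "xs \<noteq> []" "distinct xs" "set xs \<subseteq> {..<N}" for xs
  proof -
    define \<pi> where "\<pi> = cycle_of_list xs"
    have \<pi>xs: "\<pi> permutes set xs" unfolding \<pi>_def by (rule cycle_permutes)
    then have \<pi>N: "\<pi> permutes {..<N}" using xs(3) by (rule permutes_subset)
    have "map \<pi> xs = rotate1 xs" using cyclic_rotation[OF xs(2), of "Suc 0"] by (simp add: \<pi>_def)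
    then have "tl xs @ [hd xs] = map \<pi> xs" using xs(1) by (simp add: rotate1_hd_tl)
    then have "(\<Sum>(i, j)\<leftarrow>steps (xs @ [hd xs]). w i j) = (\<Sum>i\<leftarrow>xs. w i (\<pi> i))"
      unfolding steps_snoc[OF xs(1)] by (simp add: zip_map2 zip_same_conv_map comp_def)
    also have "\<dots> = (\<Sum>i\<in>set xs. w i (\<pi> i))" using xs(2) by (simp add: sum_list_distinct_conv_sum_set)
    also have "\<dots> = (\<Sum>i<N. w i (\<pi> i))"
    proof (rule sum.mono_neutral_left)
      show "\<forall>i\<in>{..<N} - set xs. w i (\<pi> i) = 0"
        using \<pi>xs by (auto simp: w_def permutes_not_in)
    qed (use xs(3) in auto)
    also have "\<dots> = (\<Sum>i<N. c (p i) (q' (\<pi> i))) - (\<Sum>i<N. c (p (\<pi> i)) (q' (\<pi> i)))"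
      by (simp add: w_def sum_subtractf)
    also have "(\<Sum>i<N. c (p (\<pi> i)) (q' (\<pi> i))) = (\<Sum>i<N. c (p i) (q' i))"
      using sum.permute[OF \<pi>N, of "\<lambda>i. c (p i) (q' i)"] by (simp add: comp_def)
    finally show ?thesis
      using opt[OF permutes_compose[OF \<pi>N \<sigma>]] by (simp add: q'_def)
  qed
  define wt where "wt xs = (\<Sum>(i, j)\<leftarrow>steps xs. w i j)" for xs
  define W where "W = (\<Sum>i<N. \<Sum>j<N. \<bar>w i j\<bar>)"
  have wW: "w i j \<le> W" if "i < N" "j < N" for i j
  proof -
    have "w i j \<le> \<bar>w i j\<bar>" by simp
    also have "\<dots> \<le> (\<Sum>j<N. \<bar>w i j\<bar>)" using that by (intro member_le_sum) auto
    also have "\<dots> \<le> W" unfolding W_def using that by (intro member_le_sum[where f="\<lambda>i. \<Sum>j<N. \<bar>w i j\<bar>"] sum_nonneg) auto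
    finally show ?thesis .
  qed
  \<comment> \<open>One more step, of weight at most \<open>W\<close>, closes the walk up. Hence
    walks of any length have weight at least \<open>- W\<close>, and the infimum defining
    \<open>a\<close> is finite.\<close>
  have lower: "- W \<le> wt (i # xs)" if "i < N" "set xs \<subseteq> {..<N}" for i xs
  proof -
    have "0 \<le> (\<Sum>(i, j)\<leftarrow>steps ((i # xs) @ [hd (i # xs)]). w i j)"
      using that by (intro closed_walk_nonneg[OF simple]) auto
    also have "steps ((i # xs) @ [hd (i # xs)]) = steps (i # xs) @ [(last (i # xs), i)]"
      using steps_snoc_last[of "i # xs" i] unfolding list.sel by blast
    finally have "0 \<le> wt (i # xs) + w (last (i # xs)) i" by (simp add: wt_def)
    moreover have "last (i # xs) < N" using that last_in_set[of "i # xs"] by auto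
    ultimately show ?thesis using wW[of "last (i # xs)" i] that by simp
  qed
  define Wk where "Wk i = {wt (i # xs) | xs. set xs \<subseteq> {..<N}}" for i
  define a where "a i = Inf (Wk i)" for i
  have bdd: "bdd_below (Wk i)" if "i < N" for i using lower[OF that] by (auto simp: Wk_def intro!: bdd_belowI[of _ "- W"])
  have ne: "Wk i \<noteq> {}" for i unfolding Wk_def by (auto intro: exI[of _ "[]"])
  have a_le: "a i \<le> w i j + a j" if ij: "i < N" "j < N" for i j
  proof -
    have "a i - w i j \<le> a j"
      unfolding a_def[of j]
    proof (rule cInf_greatest[OF ne])
      fix t assume "t \<in> Wk j"
      then obtain xs where xs: "t = wt (j # xs)" "set xs \<subseteq> {..<N}" by (auto simp: Wk_def)
      have "a i \<le> wt (i # j # xs)"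
        unfolding a_def using bdd[OF ij(1)] xs(2) ij by (intro cInf_lower) (auto simp: Wk_def intro!: exI[of _ "j # xs"])
      then show "a i - w i j \<le> t" by (simp add: wt_def xs(1))
    qed
    then show ?thesis by simp
  qed
  define g where "g x = Min ((\<lambda>i. a i - c (p i) (q' i) + c x (q' i)) ` {..<N})" for x
  have fin: "finite ((\<lambda>i. a i - c (p i) (q' i) + c x (q' i)) ` {..<N})" "(\<lambda>i. a i - c (p i) (q' i) + c x (q' i)) ` {..<N} \<noteq> {}" for x
    using N by auto
  have g_le: "g x \<le> a i - c (p i) (q' i) + c x (q' i)" if "i < N" for x i
    unfolding g_def using fin(1) that by (intro Min_le) auto
  have g_lip: "g x - g y \<le> c x y" for x y
  proof -
    have "g x - c x y \<le> g y"
      unfolding g_def[of y]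
    proof (intro Min.boundedI[OF fin], elim imageE, simp only:)
      fix i assume "i \<in> {..<N}"
      then show "g x - c x y \<le> a i - c (p i) (q' i) + c y (q' i)"
        using g_le[of i x] tri[of x "q' i" y] by simp
    qed
    then show ?thesis by simp
  qed
  have g_p: "a i \<le> g (p i)" if "i < N" for i
    unfolding g_def
  proof (intro Min.boundedI[OF fin], elim imageE, simp only:)
    fix j assume "j \<in> {..<N}"
    then show "a i \<le> a j - c (p j) (q' j) + c (p i) (q' j)"
      using a_le[OF that, of j] by (simp add: w_def)
  qed
  have g_q: "g (q' i) \<le> a i - c (p i) (q' i)" if "i < N" for i
    using g_le[OF that, of "q' i"] c0 by simp
  have "(\<Sum>i<N. c (p i) (q (\<sigma> i))) \<le> (\<Sum>i<N. g (p i) - g (q' i))"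
    using g_p g_q by (intro sum_mono) (force simp: q'_def)
  also have "\<dots> = (\<Sum>i<N. g (p i)) - (\<Sum>i<N. g (q (\<sigma> i)))" by (simp add: sum_subtractf q'_def)
  also have "(\<Sum>i<N. g (q (\<sigma> i))) = (\<Sum>i<N. g (q i))"
    using sum.permute[OF \<sigma>, of "\<lambda>i. g (q i)"] by (simp add: comp_def)
  finally show thesis using that[OF \<sigma> g_lip] by (simp add: sum_subtractf)
qed

section \<open>Decomposition of finite families of edges into chains\<close>

definition open_chain :: "'a list \<Rightarrow> bool" where
  "open_chain c \<longleftrightarrow> hd c \<noteq> last c"

text \<open>Merging two open chains decreases their number, so in a decomposition with the fewest open
  chains the final points of open chains are disjoint from the initial ones.\<close>

lemma chain_decomposition:
  fixes E :: "('a \<times> 'a) list"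
  obtains C :: "'a list multiset" where "\<And>c. c \<in># C \<Longrightarrow> c \<noteq> []" "(\<Sum>c\<in>#C. mset (steps c)) = mset E"
    "\<And>c c'. c \<in># C \<Longrightarrow> c' \<in># C \<Longrightarrow> open_chain c \<Longrightarrow> open_chain c' \<Longrightarrow> last c \<noteq> hd c'"
proof -
  define Q where "Q C \<longleftrightarrow> (\<forall>c. c \<in># C \<longrightarrow> c \<noteq> []) \<and> (\<Sum>c\<in>#C. mset (steps c)) = mset E" for C :: "'a list multiset"
  have "Q (mset (map (\<lambda>(x, y). [x, y]) E))"
    unfolding Q_def by (induction E) auto
  then obtain C where C: "Q C" and min: "\<And>C'. Q C' \<Longrightarrow> size (filter_mset open_chain C) \<le> size (filter_mset open_chain C')"
    using ex_has_least_nat[of Q _ "\<lambda>C. size (filter_mset open_chain C)"] by blast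
  show thesis
  proof (rule that[of C])
    show "c \<noteq> []" if "c \<in># C" for c using C that by (auto simp: Q_def)
    show "(\<Sum>c\<in>#C. mset (steps c)) = mset E" using C by (auto simp: Q_def)
    fix c c' assume cc: "c \<in># C" "c' \<in># C" "open_chain c" "open_chain c'"
    show "last c \<noteq> hd c'"
    proof
      assume eq: "last c = hd c'"
      \<comment> \<open>If the two were equal, the chain would end where it begins and not be
        open.\<close>
      then have "c \<noteq> c'" using cc(3) by (auto simp: open_chain_def)
      then have "c' \<in># C - {#c#}" using cc(2) by (simp add: in_diff_count)
      then obtain D where D: "C = add_mset c (add_mset c' D)" using cc(1) by (metis insert_DiffM)
      let ?C = "add_mset (c @ tl c') D"
      have nn: "c \<noteq> []" "c' \<noteq> []" using C cc by (auto simp: Q_def)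
      have "Q ?C"
        using C nn steps_join[OF nn eq] by (auto simp: Q_def D add.assoc)
      then have "size (filter_mset open_chain C) \<le> size (filter_mset open_chain ?C)" by (rule min)
      then show False using cc(3,4) by (simp add: D split: if_splits)
    qed
  qed
qed

lemma sum_mset_steps:
  fixes F :: "'a \<times> 'a \<Rightarrow> real"
  assumes "(\<Sum>c\<in>#C. mset (steps c)) = mset E"
  shows "(\<Sum>c\<in>#C. \<Sum>e\<leftarrow>steps c. F e) = (\<Sum>e\<leftarrow>E. F e)"
proof -
  have "(\<Sum>c\<in>#C. \<Sum>e\<leftarrow>steps c. F e) = (\<Sum>c\<in>#C. \<Sum>e\<in>#mset (steps c). F e)"
    by (simp add: sum_mset_sum_list[symmetric] mset_map[symmetric] del: mset_map)
  also have "\<dots> = (\<Sum>e\<in>#(\<Sum>c\<in>#C. mset (steps c)). F e)" by (induction C) auto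
  also have "\<dots> = (\<Sum>e\<leftarrow>E. F e)" unfolding assms by (simp add: sum_mset_sum_list[symmetric] mset_map[symmetric] del: mset_map)
  finally show ?thesis .
qed

text \<open>The test function is 1 at the final points of open chains and -1 elsewhere. Telescoping
  yields 2 for each open chain, because its initial point is no final point of an open chain, and 0
  for each closed chain.\<close>

lemma number_of_open_chains:
  fixes C :: "'a list multiset"
  assumes ne: "\<And>c. c \<in># C \<Longrightarrow> c \<noteq> []" and E: "(\<Sum>c\<in>#C. mset (steps c)) = mset E"
    and disj: "\<And>c c'. c \<in># C \<Longrightarrow> c' \<in># C \<Longrightarrow> open_chain c \<Longrightarrow> open_chain c' \<Longrightarrow> last c \<noteq> hd c'"
    and bd: "\<And>g :: 'a \<Rightarrow> real. (\<And>x. \<bar>g x\<bar> \<le> 1) \<Longrightarrow> (\<Sum>(x, y)\<leftarrow>E. g y - g x) \<le> 2 * real r"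
  shows "size (filter_mset open_chain C) \<le> r"
proof -
  define g :: "'a \<Rightarrow> real" where "g x = (if \<exists>c\<in>#C. open_chain c \<and> x = last c then 1 else -1)" for x
  have "(\<Sum>c\<in>#C. \<Sum>(x, y)\<leftarrow>steps c. g y - g x) = (\<Sum>c\<in>#C. if open_chain c then 2 else 0)"
  proof (intro arg_cong[where f=sum_mset] image_mset_cong)
    fix c assume c: "c \<in># C"
    have "(\<Sum>(x, y)\<leftarrow>steps c. g y - g x) = g (last c) - g (hd c)" by (rule sum_steps_telescope[OF ne[OF c]])
    also have "\<dots> = (if open_chain c then 2 else 0)"
    proof (cases "open_chain c")
      case True
      then have "g (last c) = 1" "g (hd c) = -1" using c disj by (auto simp: g_def) (metis)
      then show ?thesis using True by simp
    qed (simp add: open_chain_def)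
    finally show "(\<Sum>(x, y)\<leftarrow>steps c. g y - g x) = (if open_chain c then 2 else 0)" .
  qed
  also have "\<dots> = 2 * real (size (filter_mset open_chain C))" by (induction C) auto
  finally have "2 * real (size (filter_mset open_chain C)) \<le> 2 * real r"
    using sum_mset_steps[OF E, of "\<lambda>(x, y). g y - g x"] bd[of g] by (simp add: g_def)
  then show ?thesis by simp
qed

section \<open>Joining edges and the count of unmatched heads\<close>

lemma edge_sum_bound:
  assumes "\<And>x. \<bar>f x\<bar> \<le> A" "C-lipschitz_on UNIV p"
  shows "\<bar>edge_sum es f p\<bar> \<le> A * C * edge_length es (\<lambda>_. 1)"
proof (induction es)
  case (Cons e es)
  have "\<bar>f (fst e) * (p (snd e) - p (fst e))\<bar> \<le> A * (C * dist (fst e) (snd e))"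
    unfolding abs_mult using assms(1)[of "fst e"] lipschitz_realD[OF assms(2), of "snd e" "fst e"]
    by (intro mult_mono) (auto simp: dist_commute)
  then show ?case using Cons by (simp add: algebra_simps)
qed simp

lemma edge_length_bound: "(\<And>x. h x \<le> A) \<Longrightarrow> edge_length es h \<le> A * edge_length es (\<lambda>_. 1)"
proof (induction es)
  case (Cons e es)
  then show ?case using mult_right_mono[of "h (fst e)" A "dist (fst e) (snd e)"] by (simp add: algebra_simps)
qed simp

lemma edge_length_nonneg: "0 \<le> edge_length es (\<lambda>_. 1)"
  by (induction es) auto

lemma (in metric_current1) multilinear_boundary: "multilinear_functional 0 (boundary T)"
  unfolding multilinear_functional_def boundary_def
  using T_linear2[of "\<lambda>_. 1"] by (auto simp: forms_iff bounded_lipschitz_lipschitz)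

lemma (in metric_current1) boundary_bound:
  assumes fin: "finite_mass 0 (boundary T)" and g: "bounded_lipschitz g" "\<And>x. \<bar>g x\<bar> \<le> l"
  shows "\<bar>T (\<lambda>_. 1) [g]\<bar> \<le> mass 0 (boundary T) * l"
proof -
  let ?M = "mass_measure 0 (boundary T)"
  interpret B: finite_borel_measure ?M by (rule finite_borel_mass_measure[OF multilinear_boundary fin])
  have "\<bar>T (\<lambda>_. 1) [g]\<bar> \<le> (LINT x|?M. \<bar>g x\<bar>)"
    using mass_bound_mass_measure[OF multilinear_boundary fin] g(1)
    by (auto simp: mass_bound_def forms_iff boundary_def)
  also have "\<dots> \<le> (LINT x|?M. l)"
    using g B.integrable_bounded_lipschitz[OF g(1)] by (intro integral_mono integrable_abs) auto
  finally show ?thesis by (simp add: mass_def B.space_UNIV)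
qed

lemma sum_list_filter_upt:
  "(\<Sum>i\<leftarrow>filter P [0..<N]. F i) = (\<Sum>i | i < N \<and> P i. F i :: 'b::comm_monoid_add)"
proof -
  have "set (filter P [0..<N]) = {i. i < N \<and> P i}" by auto
  then show ?thesis using sum_list_distinct_conv_sum_set[of "filter P [0..<N]" F] by simp
qed

lemma sum_split_filter:
  fixes F :: "nat \<Rightarrow> real"
  shows "(\<Sum>i<N. F i) = (\<Sum>i | i < N \<and> P i. F i) + (\<Sum>i | i < N \<and> \<not> P i. F i)"
proof -
  have "{..<N} = {i. i < N \<and> P i} \<union> {i. i < N \<and> \<not> P i}" by auto
  then show ?thesis by (simp, subst sum.union_disjoint) auto
qed

text \<open>The optimal matching between heads and tails of the edges is tested against the boundary of
  \<open>T\<close>: its dual potential, shifted to take values in \<open>{-l..l}\<close>, bounds the cost of the matching.\<close>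

lemma (in metric_current1) close_edges:
  assumes fin: "finite_mass 0 (boundary T)" and l: "0 < l"
    and es: "\<And>f p. 1-lipschitz_on UNIV f \<Longrightarrow> (\<And>x. \<bar>f x\<bar> \<le> 1) \<Longrightarrow> 1-lipschitz_on UNIV p \<Longrightarrow>
       \<bar>T f [p] - edge_sum es f p\<bar> \<le> \<eta>"
  obtains js r where "\<And>x y. (x, y) \<in> set js \<Longrightarrow> dist x y \<le> 2 * l"
    "edge_length js (\<lambda>_. 1) \<le> mass 0 (boundary T) * l + \<eta>"
    "2 * l * real r \<le> mass 0 (boundary T) * l + \<eta>"
    "\<And>g. (\<And>x. \<bar>g x\<bar> \<le> 1) \<Longrightarrow> (\<Sum>(x, y)\<leftarrow>es @ js. g y - g x) \<le> 2 * real r"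
proof -
  define N where "N = length es"
  define p q where "p i = snd (es ! i)" and "q i = fst (es ! i)" for i
  \<comment> \<open>The truncation caps the price of leaving a head unmatched and bounds the
    oscillation of the dual potential by the same number.\<close>
  define c where "c x y = min (dist x y) (2 * l)" for x y :: 'a
  have tri: "c x z \<le> c x y + c y z" for x y z
    using dist_triangle[of x z y] l zero_le_dist[of x y] zero_le_dist[of y z] unfolding c_def by linarith
  obtain \<sigma> g where \<sigma>: "\<sigma> permutes {..<N}" and g: "\<And>x y. g x - g y \<le> c x y"
    and opt: "(\<Sum>i<N. c (p i) (q (\<sigma> i))) \<le> (\<Sum>i<N. g (p i) - g (q i))"
    using optimal_matching[of c N p q] tri l by (auto simp: c_def)
  have sum_es: "(\<Sum>(x, y)\<leftarrow>es. h y - h x) = (\<Sum>i<N. h (p i) - h (q i))" for h :: "'a \<Rightarrow> real"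
    by (simp add: sum_list_sum_nth N_def p_def q_def case_prod_beta atLeast0LessThan)
  \<comment> \<open>The centre of the range: an oscillation of \<open>2 * l\<close> becomes a
    supremum norm of \<open>l\<close>. This factor 2 is the origin of half the boundary mass in the
    count of open chains.\<close>
  define k where "k = Inf (range g) + l"
  have gd: "g x - 2 * l \<le> g y" for x y using g[of x y] by (simp add: c_def)
  have bdd: "bdd_below (range g)" using gd[of undefined] by (intro bdd_belowI) auto
  define g' where "g' x = g x - k" for x
  have "g x \<le> Inf (range g) + 2 * l" for x
  proof -
    have "g x - 2 * l \<le> Inf (range g)" using gd by (intro cInf_greatest) auto
    then show ?thesis by simp
  qed
  then have g'_bd: "\<bar>g' x\<bar> \<le> l" for x
    using cInf_lower[OF rangeI bdd, of x] unfolding g'_def k_def abs_le_iff by (smt (verit))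
  have g'_lip: "1-lipschitz_on UNIV g'"
  proof (rule lipschitz_realI)
    show "g' x - g' y \<le> 1 * dist x y" for x y using g[of x y] by (simp add: g'_def c_def)
  qed simp
  have "(\<Sum>i<N. c (p i) (q (\<sigma> i))) \<le> edge_sum es (\<lambda>_. 1) g'"
    using opt sum_es[of g'] by (simp add: edge_sum_def g'_def)
  moreover have "\<bar>T (\<lambda>_. 1) [g'] - edge_sum es (\<lambda>_. 1) g'\<bar> \<le> \<eta>"
    using g'_lip by (intro es) (auto intro: lipschitz_on_constant lipschitz_realI)
  moreover have "\<bar>T (\<lambda>_. 1) [g']\<bar> \<le> mass 0 (boundary T) * l"
  proof (rule boundary_bound[OF fin _ g'_bd])
    show "bounded_lipschitz g'" by (rule bounded_lipschitzI[OF g'_lip g'_bd])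
  qed
  ultimately have cost: "(\<Sum>i<N. c (p i) (q (\<sigma> i))) \<le> mass 0 (boundary T) * l + \<eta>" by linarith
  define P where "P i \<longleftrightarrow> dist (p i) (q (\<sigma> i)) < 2 * l" for i
  define js where "js = map (\<lambda>i. (p i, q (\<sigma> i))) (filter P [0..<N])"
  define r where "r = card {i. i < N \<and> \<not> P i}"
  \<comment> \<open>A matched pair pays for the edge that joins it; each of the \<open>r\<close>
    other pairs pays exactly \<open>2 * l\<close>.\<close>
  have cost_split: "(\<Sum>i<N. c (p i) (q (\<sigma> i))) = edge_length js (\<lambda>_. 1) + 2 * l * real r"
  proof -
    have "(\<Sum>i | i < N \<and> P i. c (p i) (q (\<sigma> i))) = (\<Sum>i | i < N \<and> P i. dist (p i) (q (\<sigma> i)))"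
      by (intro sum.cong) (auto simp: P_def c_def)
    moreover have "(\<Sum>i | i < N \<and> \<not> P i. c (p i) (q (\<sigma> i))) = (\<Sum>i | i < N \<and> \<not> P i. 2 * l)"
      by (intro sum.cong) (auto simp: P_def c_def)
    ultimately show ?thesis
      unfolding sum_split_filter[of _ N P]
      by (simp add: js_def edge_length_def sum_list_filter_upt comp_def r_def)
  qed
  show thesis
  proof (rule that[of js r])
    show "dist x y \<le> 2 * l" if "(x, y) \<in> set js" for x y using that by (auto simp: js_def P_def)
    show "edge_length js (\<lambda>_. 1) \<le> mass 0 (boundary T) * l + \<eta>"
      "2 * l * real r \<le> mass 0 (boundary T) * l + \<eta>"
      using cost cost_split l edge_length_nonneg[of js] by (auto simp: add_increasing2 intro: order_trans[rotated])
    fix h :: "'a \<Rightarrow> real" assume h: "\<And>x. \<bar>h x\<bar> \<le> 1"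
    \<comment> \<open>A joining edge runs from the head of one edge to the tail assigned to it, so
      it cancels the contribution of that pair to the boundary.\<close>
    have "(\<Sum>(x, y)\<leftarrow>js. h y - h x) = (\<Sum>i | i < N \<and> P i. h (q (\<sigma> i)) - h (p i))"
      by (simp add: js_def sum_list_filter_upt comp_def)
    moreover have "(\<Sum>i<N. h (q (\<sigma> i))) = (\<Sum>i<N. h (q i))"
      using sum.permute[OF \<sigma>, of "\<lambda>i. h (q i)"] by (simp add: comp_def)
    ultimately have "(\<Sum>(x, y)\<leftarrow>es @ js. h y - h x) =
        (\<Sum>i<N. h (p i) - h (q (\<sigma> i))) + (\<Sum>i | i < N \<and> P i. h (q (\<sigma> i)) - h (p i))"
      by (simp add: sum_es sum_subtractf)
    also have "\<dots> = (\<Sum>i | i < N \<and> \<not> P i. h (p i) - h (q (\<sigma> i)))"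
      unfolding sum_split_filter[of _ N P] by (simp add: sum_subtractf)
    also have "\<dots> \<le> (\<Sum>i | i < N \<and> \<not> P i. 2)"
    proof (rule sum_mono)
      show "h (p i) - h (q (\<sigma> i)) \<le> 2" for i using h[of "p i"] h[of "q (\<sigma> i)"] by (simp add: abs_le_iff)
    qed
    finally show "(\<Sum>(x, y)\<leftarrow>es @ js. h y - h x) \<le> 2 * real r" by (simp add: r_def)
  qed
qed

section \<open>Numbering the chains by length\<close>

lemma sorted_sum_bound:
  fixes u :: "nat \<Rightarrow> real"
  assumes "\<And>i j. i \<le> j \<Longrightarrow> j < n \<Longrightarrow> u j \<le> u i" "\<And>i. i < n \<Longrightarrow> 0 \<le> u i" "j < n"
  shows "real (Suc j) * u j \<le> (\<Sum>i<n. u i)"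
proof -
  have "real (Suc j) * u j = (\<Sum>i<Suc j. u j)" by simp
  also have "\<dots> \<le> (\<Sum>i<Suc j. u i)" using assms by (intro sum_mono) auto
  also have "\<dots> \<le> (\<Sum>i<n. u i)" using assms by (intro sum_mono2) auto
  finally show ?thesis .
qed

definition chain_length :: "'a::metric_space list \<Rightarrow> real" where
  "chain_length c = edge_length (steps c) (\<lambda>_. 1)"

text \<open>Fixed slots make the chains of different approximations comparable. Open chains occupy
  the indices below \<open>k\<close>, filled up with one-point chains; closed chains follow in order
  of decreasing length, so each of them is at most the total length divided by its rank.\<close>

lemma enumerate_chains:
  fixes C :: "'a::metric_space list multiset"
  assumes ne: "\<And>c. c \<in># C \<Longrightarrow> c \<noteq> []" and k: "size (filter_mset open_chain C) \<le> k"
  obtains N and c :: "nat \<Rightarrow> 'a list" where "\<And>i. c i \<noteq> []" "\<And>i. c i \<in># C \<or> steps (c i) = []"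
    "\<And>i. k \<le> i \<Longrightarrow> hd (c i) = last (c i)" "\<And>i. N \<le> i \<Longrightarrow> steps (c i) = []"
    "\<And>F :: ('a \<times> 'a) list \<Rightarrow> real. F [] = 0 \<Longrightarrow> (\<Sum>i<N. F (steps (c i))) = (\<Sum>x\<in>#C. F (steps x))"
    "\<And>i. real (Suc i) * chain_length (c (k + i)) \<le> (\<Sum>i<N. chain_length (c i))"
proof -
  obtain os where os: "mset os = filter_mset open_chain C" using ex_mset by blast
  obtain cs0 where cs0: "mset cs0 = filter_mset (\<lambda>c. \<not> open_chain c) C" using ex_mset by blast
  define cs where "cs = sort_key (\<lambda>c. - chain_length c) cs0"
  have cs: "mset cs = filter_mset (\<lambda>c. \<not> open_chain c) C" by (simp add: cs_def cs0)
  define L where "L = os @ replicate (k - length os) [undefined] @ cs"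
  have len_os: "length os \<le> k" using k by (simp flip: os)
  have len_L: "length L = k + length cs" using len_os by (simp add: L_def)
  define c where "c i = (if i < length L then L ! i else [undefined])" for i
  have L_cs: "c (k + j) = cs ! j" if "j < length cs" for j
    using that len_os len_L nth_append_length_plus[of "os @ replicate (k - length os) [undefined]" cs j]
    by (simp add: c_def L_def)
  have set_os: "x \<in># C \<and> open_chain x" if "x \<in> set os" for x
    using arg_cong[OF os, of set_mset] that by auto
  have set_cs: "x \<in># C \<and> \<not> open_chain x" if "x \<in> set cs" for x
    using arg_cong[OF cs, of set_mset] that by auto
  have c_cases: "c i \<in># C \<or> c i = [undefined]" for i
  proof (cases "i < length L")
    case True
    then have "c i \<in> set L" by (simp add: c_def)
    then show ?thesis using set_os set_cs by (auto simp: L_def)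
  qed (simp add: c_def)
  have sum: "(\<Sum>i<length L. F (steps (c i))) = (\<Sum>x\<in>#C. F (steps x))"
    if F: "F [] = 0" for F :: "('a \<times> 'a) list \<Rightarrow> real"
  proof -
    have "(\<Sum>i<length L. F (steps (c i))) = (\<Sum>x\<leftarrow>L. F (steps x))"
      by (simp add: sum_list_sum_nth c_def atLeast0LessThan)
    also have "\<dots> = (\<Sum>x\<leftarrow>os. F (steps x)) + (\<Sum>x\<leftarrow>cs. F (steps x))"
      using F by (simp add: L_def sum_list_replicate)
    also have "\<dots> = (\<Sum>x\<in>#mset os + mset cs. F (steps x))"
      by (simp add: sum_mset_sum_list[symmetric] flip: mset_map)
    also have "mset os + mset cs = C" by (simp add: os cs)
    finally show ?thesis .
  qed
  show thesis
  proof (rule that[of c "length L"])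
    show "c i \<noteq> []" for i using c_cases[of i] ne by auto
    show "c i \<in># C \<or> steps (c i) = []" for i using c_cases[of i] by auto
    show "hd (c i) = last (c i)" if "k \<le> i" for i
    proof (cases "i < length L")
      case True
      then have j: "i - k < length cs" using len_L that by simp
      then have "c i \<in> set cs" using L_cs[OF j] that by simp
      then show ?thesis using set_cs by (auto simp: open_chain_def)
    qed (simp add: c_def)
    show "steps (c i) = []" if "length L \<le> i" for i using that by (simp add: c_def)
    show "(\<Sum>i<length L. F (steps (c i))) = (\<Sum>x\<in>#C. F (steps x))" if "F [] = 0" for F :: "('a \<times> 'a) list \<Rightarrow> real"
      using that by (rule sum)
    fix i
    have nn: "0 \<le> (\<Sum>i<n. chain_length (c i))" for n
      by (simp add: chain_length_def edge_length_nonneg sum_nonneg)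
    show "real (Suc i) * chain_length (c (k + i)) \<le> (\<Sum>i<length L. chain_length (c i))"
    proof (cases "i < length cs")
      case True
      have sorted: "sorted (map (\<lambda>c. - chain_length c) cs)" unfolding cs_def by (rule sorted_sort_key)
      have "real (Suc i) * chain_length (cs ! i) \<le> (\<Sum>j<length cs. chain_length (cs ! j))"
      proof (rule sorted_sum_bound[OF _ _ True])
        show "chain_length (cs ! b) \<le> chain_length (cs ! a)" if "a \<le> b" "b < length cs" for a b
          using sorted_nth_mono[OF sorted that(1)] that by simp
      qed (simp add: chain_length_def edge_length_nonneg)
      also have "\<dots> = (\<Sum>j<length cs. chain_length (c (k + j)))" by (intro sum.cong) (auto simp: L_cs)
      also have "\<dots> = (\<Sum>j\<in>(+) k ` {..<length cs}. chain_length (c j))"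
        by (subst sum.reindex) auto
      also have "\<dots> \<le> (\<Sum>j<length L. chain_length (c j))"
        using len_L by (intro sum_mono2) (auto simp: chain_length_def edge_length_nonneg)
      finally show ?thesis by (simp add: L_cs[OF True])
    next
      case False
      then have "chain_length (c (k + i)) = 0" using len_L by (simp add: c_def chain_length_def)
      then show ?thesis using nn by simp
    qed
  qed
qed

lemma chain_approximation:
  fixes T :: "'a::complete_space functional"
  assumes T: "integer_rectifiable TYPE(real) T" and fin: "finite_mass 0 (boundary T)" and \<epsilon>: "0 < \<epsilon>"
    and k: "mass 0 (boundary T) / 2 < real k + 1"
  obtains N and c :: "nat \<Rightarrow> 'a list" where "\<And>i. c i \<noteq> []" "\<And>i x y. (x, y) \<in> set (steps (c i)) \<Longrightarrow> dist x y \<le> \<epsilon>"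
    "\<And>i. k \<le> i \<Longrightarrow> hd (c i) = last (c i)" "\<And>i. N \<le> i \<Longrightarrow> steps (c i) = []"
    "\<And>i. real (Suc i) * chain_length (c (k + i)) \<le> (\<Sum>i<N. chain_length (c i))"
    "\<And>A C f p. A-lipschitz_on UNIV f \<Longrightarrow> (\<And>x. \<bar>f x\<bar> \<le> A) \<Longrightarrow> C-lipschitz_on UNIV p \<Longrightarrow>
       \<bar>T f [p] - (\<Sum>i<N. edge_sum (steps (c i)) f p)\<bar> \<le> \<epsilon> * A * C"
    "\<And>A h. A-lipschitz_on UNIV h \<Longrightarrow> (\<And>x. 0 \<le> h x) \<Longrightarrow> (\<And>x. h x \<le> A) \<Longrightarrow>
       (\<Sum>i<N. edge_length (steps (c i)) h) \<le> (LINT x|mass_measure 1 T. h x) + \<epsilon> * A"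
proof -
  interpret metric_current1 T by (rule integer_rectifiableD(1)[OF T])
  define m where "m = mass 0 (boundary T)"
  have m: "0 \<le> m" by (simp add: m_def mass_nonneg)
  \<comment> \<open>This \<open>l\<close> keeps joining edges below \<open>\<epsilon>\<close> and
    their total length below \<open>\<epsilon> / 2 + \<eta>\<close>. The number
    \<open>\<kappa>\<close> is the positive gap between \<open>m / 2\<close> and
    \<open>k + 1\<close>: with \<open>\<eta> \<le> l * \<kappa>\<close> the matching bound becomes
    \<open>2 * r \<le> m + \<kappa> < 2 * (k + 1)\<close>, and integrality gives
    \<open>r \<le> k\<close>.\<close>
  define l where "l = \<epsilon> / (2 * (m + 2))"
  define \<kappa> where "\<kappa> = real k + 1 - m / 2"
  define \<eta> where "\<eta> = min (\<epsilon> / 4) (l * \<kappa>)"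
  have l: "0 < l" "2 * l \<le> \<epsilon>" "m * l \<le> \<epsilon> / 2" using m \<epsilon> by (simp_all add: l_def field_simps)
  have \<kappa>: "0 < \<kappa>" using k by (simp add: \<kappa>_def m_def)
  have \<eta>: "0 < \<eta>" "\<eta> \<le> \<epsilon> / 4" "\<eta> \<le> l * \<kappa>" using l \<kappa> \<epsilon> by (simp_all add: \<eta>_def)
  obtain es where es: "\<And>x y. (x, y) \<in> set es \<Longrightarrow> dist x y \<le> \<eta>"
    "\<And>A C f p. A-lipschitz_on UNIV f \<Longrightarrow> (\<And>x. \<bar>f x\<bar> \<le> A) \<Longrightarrow> C-lipschitz_on UNIV p \<Longrightarrow>
       \<bar>T f [p] - edge_sum es f p\<bar> \<le> \<eta> * A * C"
    "\<And>A h. A-lipschitz_on UNIV h \<Longrightarrow> (\<And>x. 0 \<le> h x) \<Longrightarrow> (\<And>x. h x \<le> A) \<Longrightarrow>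
       edge_length es h \<le> (LINT x|mass_measure 1 T. h x) + \<eta> * A"
    using edge_approximation[OF T \<eta>(1)] by blast
  obtain js r where js: "\<And>x y. (x, y) \<in> set js \<Longrightarrow> dist x y \<le> 2 * l"
    "edge_length js (\<lambda>_. 1) \<le> m * l + \<eta>" "2 * l * real r \<le> m * l + \<eta>"
    "\<And>g. (\<And>x. \<bar>g x\<bar> \<le> 1) \<Longrightarrow> (\<Sum>(x, y)\<leftarrow>es @ js. g y - g x) \<le> 2 * real r"
  proof (rule close_edges[OF fin l(1), of es \<eta>])
    show "\<bar>T f [p] - edge_sum es f p\<bar> \<le> \<eta>"
      if "1-lipschitz_on UNIV f" "\<And>x. \<bar>f x\<bar> \<le> 1" "1-lipschitz_on UNIV p" for f p
      using es(2)[OF that] by simp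
  qed (auto simp: m_def)
  have small: "edge_length js (\<lambda>_. 1) + \<eta> \<le> \<epsilon>" using js(2) l \<eta> by linarith
  have r: "r \<le> k"
  proof -
    have "l * (2 * real r) \<le> l * (m + \<kappa>)" using js(3) \<eta>(3) by (simp add: algebra_simps)
    then have "2 * real r \<le> m + \<kappa>" using l(1) by simp
    also have "\<dots> < 2 * (real k + 1)" using \<kappa> by (simp add: \<kappa>_def)
    finally show ?thesis by simp
  qed
  obtain C :: "'a list multiset" where C: "\<And>c. c \<in># C \<Longrightarrow> c \<noteq> []" "(\<Sum>c\<in>#C. mset (steps c)) = mset (es @ js)"
    "\<And>c c'. c \<in># C \<Longrightarrow> c' \<in># C \<Longrightarrow> open_chain c \<Longrightarrow> open_chain c' \<Longrightarrow> last c \<noteq> hd c'"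
    using chain_decomposition[of "es @ js"] by metis
  have "size (filter_mset open_chain C) \<le> r"
  proof (rule number_of_open_chains[OF C])
    show "(\<Sum>(x, y)\<leftarrow>es @ js. g y - g x) \<le> 2 * real r" if "\<And>x. \<bar>g x\<bar> \<le> 1" for g :: "'a \<Rightarrow> real"
      using that by (rule js(4))
  qed
  then have size_C: "size (filter_mset open_chain C) \<le> k" using r by simp
  obtain N and c :: "nat \<Rightarrow> 'a list" where c: "\<And>i. c i \<noteq> []" "\<And>i. c i \<in># C \<or> steps (c i) = []"
    "\<And>i. k \<le> i \<Longrightarrow> hd (c i) = last (c i)" "\<And>i. N \<le> i \<Longrightarrow> steps (c i) = []"
    "\<And>F :: ('a \<times> 'a) list \<Rightarrow> real. F [] = 0 \<Longrightarrow> (\<Sum>i<N. F (steps (c i))) = (\<Sum>x\<in>#C. F (steps x))"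
    "\<And>i. real (Suc i) * chain_length (c (k + i)) \<le> (\<Sum>i<N. chain_length (c i))"
    by (rule enumerate_chains[where C=C and k=k]) (use C(1) size_C in blast)+
  show thesis
  proof (rule that[of c N, OF c(1) _ c(3,4,6)])
    show "dist x y \<le> \<epsilon>" if xy: "(x, y) \<in> set (steps (c i))" for i x y
    proof -
      have "c i \<in># C" using c(2)[of i] xy by auto
      then have "(x, y) \<in># (\<Sum>c\<in>#C. mset (steps c))" using xy by (auto simp: set_mset_Union_mset)
      then have "(x, y) \<in> set es \<union> set js" unfolding C(2) by auto
      then show ?thesis using es(1)[of x y] js(1)[of x y] l(2) \<eta>(2) \<epsilon> by auto
    qed
    have sum: "(\<Sum>i<N. \<Sum>e\<leftarrow>steps (c i). F e) = (\<Sum>e\<leftarrow>es. F e) + (\<Sum>e\<leftarrow>js. F e)" for F :: "'a \<times> 'a \<Rightarrow> real"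
      using c(5)[of "\<lambda>s. \<Sum>e\<leftarrow>s. F e"] sum_mset_steps[OF C(2), of F] by simp
    show "\<bar>T f [p] - (\<Sum>i<N. edge_sum (steps (c i)) f p)\<bar> \<le> \<epsilon> * A * B"
      if f: "A-lipschitz_on UNIV f" "\<And>x. \<bar>f x\<bar> \<le> A" and p: "B-lipschitz_on UNIV p" for A B f p
    proof -
      have AB: "0 \<le> A * B" using lipschitz_on_nonneg[OF f(1)] lipschitz_on_nonneg[OF p] by simp
      have "(\<Sum>i<N. edge_sum (steps (c i)) f p) = edge_sum es f p + edge_sum js f p"
        unfolding edge_sum_def by (rule sum)
      moreover have "\<bar>edge_sum js f p\<bar> \<le> A * B * edge_length js (\<lambda>_. 1)" by (rule edge_sum_bound[OF f(2) p])
      moreover have "A * B * (edge_length js (\<lambda>_. 1) + \<eta>) \<le> A * B * \<epsilon>" by (rule mult_left_mono[OF small AB])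
      ultimately show ?thesis using es(2)[OF f p] by (simp add: algebra_simps)
    qed
    show "(\<Sum>i<N. edge_length (steps (c i)) h) \<le> (LINT x|mass_measure 1 T. h x) + \<epsilon> * A"
      if h: "A-lipschitz_on UNIV h" "\<And>x. 0 \<le> h x" "\<And>x. h x \<le> A" for A h
    proof -
      have A: "0 \<le> A" by (rule lipschitz_on_nonneg[OF h(1)])
      have "(\<Sum>i<N. edge_length (steps (c i)) h) = edge_length es h + edge_length js h"
        unfolding edge_length_def by (rule sum)
      moreover have "edge_length js h \<le> A * edge_length js (\<lambda>_. 1)" by (rule edge_length_bound[OF h(3)])
      moreover have "A * (edge_length js (\<lambda>_. 1) + \<eta>) \<le> A * \<epsilon>" by (rule mult_left_mono[OF small A])
      ultimately show ?thesis using es(3)[OF h] by (simp add: algebra_simps)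
    qed
  qed
qed

section \<open>Limits of chains\<close>

text \<open>\<open>walk c\<close> is the step function that runs through the points of \<open>c\<close>, spending the time
  \<open>dist x y\<close> in \<open>x\<close> before it jumps to the next point \<open>y\<close>; \<open>walk_sum f p c t\<close> is the part of
  \<open>edge_sum (steps c) f p\<close> accumulated by the jumps up to time \<open>t\<close>.\<close>

fun walk :: "'a::metric_space list \<Rightarrow> real \<Rightarrow> 'a" where
  "walk [] t = undefined"
| "walk [x] t = x"
| "walk (x # y # c) t = (if t < dist x y then x else walk (y # c) (t - dist x y))"

fun walk_sum :: "('a::metric_space \<Rightarrow> real) \<Rightarrow> ('a \<Rightarrow> real) \<Rightarrow> 'a list \<Rightarrow> real \<Rightarrow> real" where
  "walk_sum f p (x # y # c) t = (if t < dist x y then 0 else f x * (p y - p x) + walk_sum f p (y # c) (t - dist x y))"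
| "walk_sum f p _ t = 0"

lemma chain_length_simps [simp]:
  "chain_length [] = 0" "chain_length [x] = 0" "chain_length (x # y # c) = dist x y + chain_length (y # c)"
  by (simp_all add: chain_length_def)

lemma chain_length_nonneg: "0 \<le> chain_length c"
  by (simp add: chain_length_def edge_length_nonneg)

lemma walk_0: "t \<le> 0 \<Longrightarrow> c \<noteq> [] \<Longrightarrow> walk c t = hd c"
proof (induction c t rule: walk.induct)
  case (3 x y c t)
  moreover have "t < dist x y \<or> x = y" using 3 zero_less_dist_iff[of x y] by linarith
  ultimately show ?case by (cases "x = y") (auto simp: not_less)
qed auto

lemma walk_end: "chain_length c \<le> t \<Longrightarrow> c \<noteq> [] \<Longrightarrow> walk c t = last c"
proof (induction c t rule: walk.induct)
  case (3 x y c t)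
  then show ?case using chain_length_nonneg[of "y # c"] by auto
qed auto

lemma walk_sum_end: "chain_length c \<le> t \<Longrightarrow> walk_sum f p c t = edge_sum (steps c) f p"
proof (induction f p c t rule: walk_sum.induct)
  case (1 f p x y c t)
  then show ?case using chain_length_nonneg[of "y # c"] by auto
qed auto

lemma walk_sum_0: "t \<le> 0 \<Longrightarrow> walk_sum f p c t = 0"
proof (induction f p c t rule: walk_sum.induct)
  case (1 f p x y c t)
  moreover have "t < dist x y \<or> x = y" using 1 zero_less_dist_iff[of x y] by linarith
  ultimately show ?case by (cases "x = y") auto
qed auto

lemma dist_walk_hd: "0 \<le> t \<Longrightarrow> c \<noteq> [] \<Longrightarrow> dist (hd c) (walk c t) \<le> t"
proof (induction c t rule: walk.induct)
  case (3 x y c t)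
  show ?case
  proof (cases "t < dist x y")
    case False
    then have "dist y (walk (y # c) (t - dist x y)) \<le> t - dist x y" using 3 by auto
    then show ?thesis using False dist_triangle[of x "walk (y # c) (t - dist x y)" y] by auto
  qed (use 3 in auto)
qed auto

text \<open>Between two times the walk can use the elapsed time and the time it has already waited
  at its present point, which is at most one step.\<close>

lemma dist_walk:
  assumes "\<And>x y. (x, y) \<in> set (steps c) \<Longrightarrow> dist x y \<le> \<epsilon>" "0 \<le> \<epsilon>" "c \<noteq> []" "s \<le> t"
  shows "dist (walk c s) (walk c t) \<le> t - s + \<epsilon>"
  using assms
proof (induction c s arbitrary: t rule: walk.induct)
  case (3 x y c s)
  have d: "dist x y \<le> \<epsilon>" using 3 by simp
  show ?case
  proof (cases "s < dist x y")
    case True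
    have "dist x (walk (x # y # c) t) \<le> \<epsilon> + (t - s)"
    proof (cases "0 \<le> t")
      case True
      show ?thesis
      proof (cases "t < dist x y")
        case False
        have "dist x (walk (x # y # c) t) \<le> t" using dist_walk_hd[OF True, of "x # y # c"] by simp
        then show ?thesis using \<open>s < dist x y\<close> d by linarith
      qed (use 3 in simp)
    next
      case False
      then show ?thesis using 3 walk_0[of t "x # y # c"] by simp
    qed
    then show ?thesis using True by simp
  next
    case False
    then have "dist (walk (y # c) (s - dist x y)) (walk (y # c) (t - dist x y)) \<le> (t - dist x y) - (s - dist x y) + \<epsilon>"
      using 3 by (intro "3.IH") auto
    then show ?thesis using False 3 by simp
  qed
qed auto

text \<open>Freezing \<open>f\<close> at the first point costs the variation of \<open>f\<close>
  along the chain times that of \<open>p\<close>, hence a quadratic error. In the induction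
  \<open>u\<^sup>2 + d * u \<le> (u + d)\<^sup>2\<close> absorbs the change of base point from
  \<open>y\<close> to \<open>x\<close>.\<close>

lemma walk_sum_start:
  assumes f: "A-lipschitz_on UNIV f" and p: "C-lipschitz_on UNIV p"
  shows "0 \<le> t \<Longrightarrow> c \<noteq> [] \<Longrightarrow> \<bar>walk_sum f p c t - f (hd c) * (p (walk c t) - p (hd c))\<bar> \<le> A * C * t\<^sup>2"
proof (induction c t rule: walk.induct)
  case (2 x t)
  then show ?case using lipschitz_on_nonneg[OF f] lipschitz_on_nonneg[OF p] by simp
next
  case (3 x y c t)
  have AC: "0 \<le> A" "0 \<le> C" "0 \<le> A * C" using lipschitz_on_nonneg[OF f] lipschitz_on_nonneg[OF p] by auto
  show ?case
  proof (cases "t < dist x y")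
    case False
    define d u where "d = dist x y" and "u = t - dist x y"
    have u: "0 \<le> u" "0 \<le> d" "t = u + d" using False by (simp_all add: u_def d_def)
    have IH: "\<bar>walk_sum f p (y # c) u - f y * (p (walk (y # c) u) - p y)\<bar> \<le> A * C * u\<^sup>2"
      using "3.IH"[OF False] u(1) by (simp add: u_def)
    have "\<bar>(f y - f x) * (p (walk (y # c) u) - p y)\<bar> \<le> (A * d) * (C * u)"
      unfolding abs_mult
    proof (intro mult_mono)
      show "\<bar>f y - f x\<bar> \<le> A * d" using lipschitz_realD[OF f, of y x] by (simp add: d_def dist_commute)
      have "\<bar>p (walk (y # c) u) - p y\<bar> \<le> C * dist y (walk (y # c) u)"
        using lipschitz_realD[OF p, of "walk (y # c) u" y] by (simp add: dist_commute)
      also have "\<dots> \<le> C * u" using dist_walk_hd[OF u(1), of "y # c"] AC by (intro mult_left_mono) auto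
      finally show "\<bar>p (walk (y # c) u) - p y\<bar> \<le> C * u" .
    qed (use AC u in auto)
    moreover have "A * C * u\<^sup>2 + A * d * (C * u) \<le> A * C * t\<^sup>2"
    proof -
      have "A * C * u\<^sup>2 + A * d * (C * u) = A * C * (u\<^sup>2 + d * u)" by (simp add: algebra_simps)
      also have "\<dots> \<le> A * C * t\<^sup>2"
        using AC u by (intro mult_left_mono) (auto simp: power2_eq_square algebra_simps)
      finally show ?thesis .
    qed
    moreover have "walk_sum f p (x # y # c) t - f (hd (x # y # c)) * (p (walk (x # y # c) t) - p (hd (x # y # c))) =
        (walk_sum f p (y # c) u - f y * (p (walk (y # c) u) - p y)) + (f y - f x) * (p (walk (y # c) u) - p y)"
      using False by (simp add: u_def algebra_simps)
    ultimately show ?thesis using IH by linarith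
  qed (use AC in simp)
qed auto

text \<open>Dropping the edges completed by time \<open>s\<close> reduces this to a walk at its
  first point, where up to \<open>\<epsilon>\<close> of time has already been waited; hence
  \<open>t - s + \<epsilon>\<close> in place of \<open>t - s\<close>.\<close>

lemma walk_sum_diff:
  assumes f: "A-lipschitz_on UNIV f" and p: "C-lipschitz_on UNIV p"
    and "\<And>x y. (x, y) \<in> set (steps c) \<Longrightarrow> dist x y \<le> \<epsilon>" "0 \<le> \<epsilon>" "c \<noteq> []" "s \<le> t"
  shows "\<bar>walk_sum f p c t - walk_sum f p c s - f (walk c s) * (p (walk c t) - p (walk c s))\<bar> \<le> A * C * (t - s + \<epsilon>)\<^sup>2"
  using assms(3-)
proof (induction c s arbitrary: t rule: walk.induct)
  case (2 x s)
  then show ?case using lipschitz_on_nonneg[OF f] lipschitz_on_nonneg[OF p] by simp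
next
  case (3 x y c s)
  have AC: "0 \<le> A * C" using lipschitz_on_nonneg[OF f] lipschitz_on_nonneg[OF p] by auto
  have d: "dist x y \<le> \<epsilon>" using 3 by simp
  show ?case
  proof (cases "s < dist x y")
    case True
    show ?thesis
    proof (cases "t < dist x y")
      case False
      then have "\<bar>walk_sum f p (x # y # c) t - f x * (p (walk (x # y # c) t) - p x)\<bar> \<le> A * C * t\<^sup>2"
        using walk_sum_start[OF f p, of t "x # y # c"] order_trans[OF zero_le_dist[of x y], of t] by simp
      also have "\<dots> \<le> A * C * (t - s + \<epsilon>)\<^sup>2"
        using AC True d False order_trans[OF zero_le_dist[of x y], of t] by (intro mult_left_mono power_mono) auto
      finally show ?thesis using True by simp
    qed (use True AC in simp)
  next
    case False
    then have "\<bar>walk_sum f p (y # c) (t - dist x y) - walk_sum f p (y # c) (s - dist x y) -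
        f (walk (y # c) (s - dist x y)) * (p (walk (y # c) (t - dist x y)) - p (walk (y # c) (s - dist x y)))\<bar>
        \<le> A * C * ((t - dist x y) - (s - dist x y) + \<epsilon>)\<^sup>2"
      using 3 by (intro "3.IH") auto
    then show ?thesis using False 3 by simp
  qed
qed auto

text \<open>Along the chain \<open>h\<close> decreases at most at unit speed, so the weighted length
  of the first \<open>m\<close> units is at least the integral of \<open>h (hd c) - s\<close> over
  \<open>s\<close> from 0 to \<open>m\<close>.\<close>

lemma edge_length_ge_hd:
  assumes h: "1-lipschitz_on UNIV h" "\<And>x. 0 \<le> h x"
  shows "0 \<le> m \<Longrightarrow> m \<le> chain_length c \<Longrightarrow> c \<noteq> [] \<Longrightarrow> h (hd c) * m - m\<^sup>2 / 2 \<le> edge_length (steps c) h"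
proof (induction c arbitrary: m rule: induct_list012)
  case (3 x y c)
  define d where "d = dist x y"
  have eq: "edge_length (steps (x # y # c)) h = h x * d + edge_length (steps (y # c)) h" by (simp add: d_def)
  have nn: "0 \<le> edge_length (steps (y # c)) h"
    unfolding edge_length_def using h(2) by (intro sum_list_nonneg) auto
  show ?case
  proof (cases "m \<le> d")
    case True
    have "h x * m \<le> h x * d" using True h(2) by (intro mult_left_mono)
    then show ?thesis unfolding eq list.sel using nn zero_le_power2[of m] by linarith
  next
    case False
    have "h y * (m - d) - (m - d)\<^sup>2 / 2 \<le> edge_length (steps (y # c)) h"
      using 3 False by (simp add: d_def)
    moreover have "(h x - d) * (m - d) \<le> h y * (m - d)"
      using False lipschitz_realD[OF h(1), of x y] by (intro mult_right_mono) (auto simp: d_def)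
    moreover have "(h x - d) * (m - d) - (m - d)\<^sup>2 / 2 + h x * d = h x * m - m\<^sup>2 / 2 + d\<^sup>2 / 2"
      by (simp add: power2_eq_square field_simps)
    ultimately show ?thesis unfolding eq list.sel using zero_le_power2[of d] by linarith
  qed
qed auto

lemma edge_length_ge_walk:
  assumes h: "1-lipschitz_on UNIV h" "\<And>x. 0 \<le> h x"
  shows "0 \<le> s \<Longrightarrow> 0 \<le> m \<Longrightarrow> s + m \<le> chain_length c \<Longrightarrow> c \<noteq> [] \<Longrightarrow>
    h (walk c s) * m - m\<^sup>2 / 2 \<le> edge_length (steps c) h"
proof (induction c s rule: walk.induct)
  case (3 x y c s)
  show ?case
  proof (cases "s < dist x y")
    case True
    then show ?thesis using edge_length_ge_hd[OF h, of m "x # y # c"] 3 by simp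
  next
    case False
    then have "h (walk (y # c) (s - dist x y)) * m - m\<^sup>2 / 2 \<le> edge_length (steps (y # c)) h"
      using 3 by simp
    moreover have "0 \<le> h x * dist x y" using h(2) by simp
    ultimately show ?thesis using False by simp
  qed
next
  case (2 x t)
  then have "m = 0" by simp
  then show ?case by simp
qed auto

text \<open>A large value of \<open>h\<close> would persist along a stretch of length
  \<open>\<rho>\<close>, which the small weighted length excludes; the remaining times are at
  distance at most \<open>\<rho>\<close> from the start of such a stretch.\<close>

lemma walk_near:
  assumes h: "1-lipschitz_on UNIV h" "\<And>x. 0 \<le> h x"
    and c: "\<And>x y. (x, y) \<in> set (steps c) \<Longrightarrow> dist x y \<le> \<epsilon>" "0 \<le> \<epsilon>" "c \<noteq> []"
    and \<rho>: "0 < \<rho>" "\<rho> \<le> chain_length c" and small: "edge_length (steps c) h \<le> \<rho>\<^sup>2 / 2"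
  shows "h (walk c t) \<le> 2 * \<rho> + \<epsilon>"
proof -
  \<comment> \<open>The walk is constant before time 0 and after the length of the chain.\<close>
  define u where "u = max 0 (min t (chain_length c))"
  have u: "walk c u = walk c t"
    using walk_0[of t c] walk_0[of 0 c] walk_end[of c t] walk_end[of c "chain_length c"] c(3) chain_length_nonneg[of c]
    by (auto simp: u_def max_def min_def)
  \<comment> \<open>At most \<open>\<rho>\<close> before \<open>u\<close>, and with a stretch of
    length \<open>\<rho>\<close> left before the chain ends.\<close>
  define s where "s = min u (chain_length c - \<rho>)"
  have s: "0 \<le> s" "s + \<rho> \<le> chain_length c" "s \<le> u" "u - s \<le> \<rho>"
    using \<rho> chain_length_nonneg[of c] by (auto simp: s_def u_def)
  have "h (walk c s) * \<rho> - \<rho>\<^sup>2 / 2 \<le> \<rho>\<^sup>2 / 2"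
    using edge_length_ge_walk[OF h s(1) _ s(2) c(3)] \<rho> small by simp
  then have "h (walk c s) * \<rho> \<le> \<rho> * \<rho>" unfolding power2_eq_square by linarith
  then have "h (walk c s) \<le> \<rho>" using \<rho>(1) by (rule mult_right_le_imp_le)
  moreover have "h (walk c u) - h (walk c s) \<le> dist (walk c s) (walk c u)"
    using lipschitz_realD[OF h(1), of "walk c u" "walk c s"] by (simp add: dist_commute)
  moreover have "dist (walk c s) (walk c u) \<le> u - s + \<epsilon>" by (rule dist_walk[OF c s(3)])
  ultimately show ?thesis using s(4) u by simp
qed

text \<open>The compact set may depend on \<open>e\<close>: a finite net of it and finitely many
  initial members form a net of the sequence. So the range is totally bounded, and completeness
  makes its closure compact.\<close>

lemma convergent_subsequence_near_compact:
  fixes x :: "nat \<Rightarrow> 'a::complete_space"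
  assumes near: "\<And>e. 0 < e \<Longrightarrow> \<exists>K. compact K \<and> K \<noteq> {} \<and> (\<forall>\<^sub>F n in sequentially. infdist (x n) K \<le> e)"
  obtains r l where "strict_mono (r :: nat \<Rightarrow> nat)" "(x \<circ> r) \<longlonglongrightarrow> l"
proof -
  have "compact (closure (range x))"
    unfolding compact_eq_totally_bounded
  proof (intro conjI allI impI)
    show "complete (closure (range x))" by (simp add: complete_eq_closed)
    fix e :: real assume e: "0 < e"
    then obtain K n0 where K: "compact K" "K \<noteq> {}" and n0: "\<And>n. n0 \<le> n \<Longrightarrow> infdist (x n) K \<le> e / 4"
      using near[of "e / 4"] by (auto simp: eventually_sequentially)
    obtain F where F: "finite F" "K \<subseteq> (\<Union>z\<in>F. ball z (e / 4))"
      using K(1) e unfolding compact_eq_totally_bounded by (meson divide_pos_pos zero_less_numeral)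
    have near_K: "\<exists>y\<in>K. dist z y < e / 2" if "infdist z K \<le> e / 4" for z
    proof -
      have "(INF y\<in>K. dist z y) < e / 2" using that K(2) e by (simp add: infdist_notempty)
      then show ?thesis using cINF_less_iff[OF K(2), of "dist z" "e / 2"] by (auto intro: bdd_belowI2[of _ 0])
    qed
    let ?F = "F \<union> x ` {..<n0}"
    have finF: "finite ?F" using F(1) by simp
    \<comment> \<open>Radius \<open>e / 4\<close> of the net and distance \<open>e / 2\<close> to
      \<open>K\<close> leave closed balls of radius \<open>3 * e / 4\<close>, whose finite union is
      closed and so contains the closure of the range.\<close>
    have "x n \<in> (\<Union>z\<in>?F. cball z (3 * e / 4))" for n
    proof (cases "n < n0")
      case False
      obtain y where y: "y \<in> K" "dist (x n) y < e / 2" using near_K n0[of n] False by auto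
      obtain z where z: "z \<in> F" "dist z y < e / 4" using F(2) y(1) by (auto simp: subset_iff)
      have "dist z (x n) \<le> 3 * e / 4" using dist_triangle[of z "x n" y] y z by (simp add: dist_commute)
      then show ?thesis using z by auto
    qed (use e in force)
    then have "range x \<subseteq> (\<Union>z\<in>?F. cball z (3 * e / 4))" by blast
    then have "closure (range x) \<subseteq> (\<Union>z\<in>?F. cball z (3 * e / 4))"
      by (intro closure_minimal closed_UN finF ballI closed_cball)
    moreover have "cball z (3 * e / 4) \<subseteq> ball z e" for z using e by auto
    then have "(\<Union>z\<in>?F. cball z (3 * e / 4)) \<subseteq> (\<Union>z\<in>?F. ball z e)" by (rule UN_mono[OF order_refl])
    ultimately have "closure (range x) \<subseteq> (\<Union>z\<in>?F. ball z e)" by (rule order_trans)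
    then show "\<exists>k. finite k \<and> closure (range x) \<subseteq> (\<Union>z\<in>k. ball z e)" using finF by blast
  qed
  then show thesis
    using compact_def[of "closure (range x)"] closure_subset[of "range x"] that by (metis rangeI subsetD)
qed

section \<open>Currents carried by curves\<close>

definition curve_current :: "(real \<Rightarrow> 'a) \<Rightarrow> real \<Rightarrow> 'a functional" where
  "curve_current \<sigma> L = pushforward \<sigma> (euclidean_current (indicator {0..L}))"

text \<open>Curves are 1-Lipschitz on the whole line, and only the current cuts off at
  \<open>L\<close>; so one derivative \<open>q\<close> of \<open>p\<close> along the curve serves
  all lengths.\<close>

lemma curve_density:
  fixes \<sigma> :: "real \<Rightarrow> 'a::metric_space"
  assumes \<sigma>: "1-lipschitz_on UNIV \<sigma>" and p: "C-lipschitz_on UNIV p"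
  obtains q where "q \<in> borel_measurable borel" "\<And>x. \<bar>q x\<bar> \<le> C"
    "\<And>a b. a \<le> b \<Longrightarrow> p (\<sigma> b) - p (\<sigma> a) = (LINT x:{a..b}|lborel. q x)"
    "AE x in lebesgue. (p \<circ> \<sigma> has_real_derivative q x) (at x)"
    "\<And>f L. f \<in> borel_measurable borel \<Longrightarrow> curve_current \<sigma> L f [p] = (LINT x:{0..L}|lborel. f (\<sigma> x) * q x)"
proof -
  have "C-lipschitz_on UNIV (p \<circ> \<sigma>)"
    using lipschitz_on_compose[OF \<sigma> lipschitz_on_subset[OF p]] by simp
  then obtain q where q: "q \<in> borel_measurable borel" "\<And>x. \<bar>q x\<bar> \<le> C"
    "\<And>a b. a \<le> b \<Longrightarrow> (p \<circ> \<sigma>) b - (p \<circ> \<sigma>) a = (LINT x:{a..b}|lborel. q x)"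
    "AE x in lebesgue. (p \<circ> \<sigma> has_real_derivative q x) (at x)"
    using lipschitz_real_AE_derivative by blast
  show thesis
  proof (rule that[OF q(1,2) _ q(4)])
    fix f :: "'a \<Rightarrow> real" and L assume f: "f \<in> borel_measurable borel"
    have \<sigma>b: "\<sigma> \<in> borel_measurable borel" by (rule lipschitz_on_borel[OF \<sigma>])
    have f\<sigma>: "(\<lambda>x. f (\<sigma> x)) \<in> borel_measurable borel" using f \<sigma>b by measurable
    have "curve_current \<sigma> L f [p] = (LINT x|lebesgue. indicator {0..L} x * (f \<circ> \<sigma>) x * q x)"
      unfolding curve_current_def pushforward_def list.map
      using f\<sigma> q(1) by (intro euclidean_current_real q(4)) (auto simp: comp_def intro!: measurable_completion)
    also have "\<dots> = (LINT x|lborel. indicator {0..L} x * (f \<circ> \<sigma>) x * q x)"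
      using f\<sigma> q(1) by (intro integral_completion) (simp add: comp_def)
    finally show "curve_current \<sigma> L f [p] = (LINT x:{0..L}|lborel. f (\<sigma> x) * q x)"
      by (simp add: set_lebesgue_integral_def mult.assoc)
  qed (use q(3) in simp)
qed

text \<open>The uniform partition is the one used for walks in \<open>walk_riemann\<close>; chains
  and their limit curves are compared through these common Riemann sums.\<close>

lemma curve_current_riemann:
  fixes \<sigma> :: "real \<Rightarrow> 'a::metric_space"
  assumes \<sigma>: "1-lipschitz_on UNIV \<sigma>" and f: "A-lipschitz_on UNIV f" "\<And>x. \<bar>f x\<bar> \<le> A"
    and p: "C-lipschitz_on UNIV p" and L: "0 \<le> L" and M: "0 < M"
  shows "\<bar>curve_current \<sigma> L f [p] - (\<Sum>j<M. f (\<sigma> (real j * (L / M))) *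
      (p (\<sigma> (real (Suc j) * (L / M))) - p (\<sigma> (real j * (L / M)))))\<bar> \<le> A * C * L\<^sup>2 / M"
proof -
  obtain q where q: "q \<in> borel_measurable borel" "\<And>x. \<bar>q x\<bar> \<le> C"
    "\<And>a b. a \<le> b \<Longrightarrow> p (\<sigma> b) - p (\<sigma> a) = (LINT x:{a..b}|lborel. q x)"
    "AE x in lebesgue. (p \<circ> \<sigma> has_real_derivative q x) (at x)"
    "\<And>f L. f \<in> borel_measurable borel \<Longrightarrow> curve_current \<sigma> L f [p] = (LINT x:{0..L}|lborel. f (\<sigma> x) * q x)"
    by (rule curve_density[OF \<sigma> p]) (rule that; assumption)
  have AC: "0 \<le> A" "0 \<le> C" using lipschitz_on_nonneg[OF f(1)] lipschitz_on_nonneg[OF p] by auto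
  have fb: "f \<in> borel_measurable borel" by (rule lipschitz_on_borel[OF f(1)])
  have \<sigma>b: "\<sigma> \<in> borel_measurable borel" by (rule lipschitz_on_borel[OF \<sigma>])
  have f\<sigma>: "(\<lambda>x. f (\<sigma> x)) \<in> borel_measurable borel" using fb \<sigma>b by measurable
  have m: "(\<lambda>x. f (\<sigma> x) * q x) \<in> borel_measurable borel" using f\<sigma> q(1) by measurable
  have mb: "\<bar>f (\<sigma> x) * q x\<bar> \<le> A * C" for x unfolding abs_mult using f(2) q(2) AC by (intro mult_mono) auto
  obtain P where P: "\<And>a b. a \<le> b \<Longrightarrow> P b - P a = (LINT x:{a..b}|lborel. f (\<sigma> x) * q x)"
    by (rule integral_primitive[OF m mb]) blast
  have f\<sigma>_lip: "A-lipschitz_on UNIV (\<lambda>x. f (\<sigma> x))"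
    using lipschitz_on_compose[OF \<sigma> lipschitz_on_subset[OF f(1)]] by (simp add: comp_def)
  have piece: "\<bar>(P b - P a) - f (\<sigma> a) * (p (\<sigma> b) - p (\<sigma> a))\<bar> \<le> A * C * (b - a)\<^sup>2" if "a \<le> b" for a b
    unfolding P[OF that] q(3)[OF that] by (rule riemann_step[OF f\<sigma>_lip f(2) q(1,2)]) (use that in auto)
  define t where "t j = real j * (L / M)" for j
  have "t (Suc j) = t j + L / M" for j by (simp only: t_def of_nat_Suc distrib_right mult_1 add.commute)
  then have t: "t j \<le> t (Suc j)" "t (Suc j) - t j = L / M" for j using L by simp_all
  have t_ends: "t 0 = 0" "t M = L" using M by (simp_all add: t_def)
  have "curve_current \<sigma> L f [p] = P L - P 0" using q(5)[OF fb] P[OF L] by simp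
  also have "\<dots> = (\<Sum>j<M. P (t (Suc j)) - P (t j))"
    using sum_lessThan_telescope[of "\<lambda>j. P (t j)" M] by (simp add: t_ends)
  finally have "\<bar>curve_current \<sigma> L f [p] - (\<Sum>j<M. f (\<sigma> (t j)) * (p (\<sigma> (t (Suc j))) - p (\<sigma> (t j))))\<bar>
      = \<bar>\<Sum>j<M. (P (t (Suc j)) - P (t j)) - f (\<sigma> (t j)) * (p (\<sigma> (t (Suc j))) - p (\<sigma> (t j)))\<bar>"
    by (simp add: sum_subtractf)
  also have "\<dots> \<le> (\<Sum>j<M. A * C * (L / M)\<^sup>2)"
    using piece[OF t(1)] t(2) by (intro order_trans[OF sum_abs] sum_mono) simp
  also have "\<dots> = A * C * L\<^sup>2 / M" using M by (simp add: power2_eq_square field_simps)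
  finally show ?thesis by (simp add: t_def)
qed

text \<open>The partition belongs to the limit length \<open>L\<close> and not to the length of the
  chain; the terms with \<open>d\<close> pay for the difference of the two.\<close>

lemma walk_riemann:
  assumes f: "A-lipschitz_on UNIV f" "\<And>x. \<bar>f x\<bar> \<le> A" and p: "C-lipschitz_on UNIV p"
    and c: "\<And>x y. (x, y) \<in> set (steps c) \<Longrightarrow> dist x y \<le> \<epsilon>" "0 \<le> \<epsilon>" "c \<noteq> []" and L: "0 \<le> L" and M: "0 < M"
    and d: "\<bar>chain_length c - L\<bar> + \<epsilon> \<le> d"
  shows "\<bar>edge_sum (steps c) f p - (\<Sum>j<M. f (walk c (real j * (L / M))) *
      (p (walk c (real (Suc j) * (L / M))) - p (walk c (real j * (L / M)))))\<bar>
    \<le> M * (A * C * (L / M + \<epsilon>)\<^sup>2) + A * C * (d + d\<^sup>2)"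
proof -
  have AC: "0 \<le> A" "0 \<le> C" using lipschitz_on_nonneg[OF f(1)] lipschitz_on_nonneg[OF p] by auto
  define S where "S = max L (chain_length c)"
  define W where "W = walk_sum f p c"
  define t where "t j = real j * (L / M)" for j
  have "t (Suc j) = t j + L / M" for j by (simp only: t_def of_nat_Suc distrib_right mult_1 add.commute)
  then have t: "t j \<le> t (Suc j)" "t (Suc j) - t j = L / M" for j using L by simp_all
  have t_ends: "t 0 = 0" "t M = L" using M by (simp_all add: t_def)
  have "W S = edge_sum (steps c) f p" unfolding W_def by (rule walk_sum_end) (simp add: S_def)
  moreover have "W L = (\<Sum>j<M. W (t (Suc j)) - W (t j))"
    using sum_lessThan_telescope[of "\<lambda>j. W (t j)" M] by (simp add: t_ends W_def walk_sum_0)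
  ultimately have eq: "edge_sum (steps c) f p - (\<Sum>j<M. f (walk c (t j)) * (p (walk c (t (Suc j))) - p (walk c (t j)))) =
      (\<Sum>j<M. (W (t (Suc j)) - W (t j)) - f (walk c (t j)) * (p (walk c (t (Suc j))) - p (walk c (t j)))) + (W S - W L)"
    by (simp add: sum_subtractf)
  have "\<bar>\<Sum>j<M. (W (t (Suc j)) - W (t j)) - f (walk c (t j)) * (p (walk c (t (Suc j))) - p (walk c (t j)))\<bar>
      \<le> (\<Sum>j<M. A * C * (L / M + \<epsilon>)\<^sup>2)"
    using walk_sum_diff[OF f(1) p c t(1)] t(2) unfolding W_def by (intro order_trans[OF sum_abs] sum_mono) simp
  moreover have "\<bar>W S - W L\<bar> \<le> A * C * (d + d\<^sup>2)"
  proof -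
    have LS: "L \<le> S" and Sd: "S - L + \<epsilon> \<le> d" using d by (auto simp: S_def)
    have "\<bar>f (walk c L) * (p (walk c S) - p (walk c L))\<bar> \<le> A * (C * (S - L + \<epsilon>))"
      unfolding abs_mult
    proof (intro mult_mono f(2))
      have "\<bar>p (walk c S) - p (walk c L)\<bar> \<le> C * dist (walk c L) (walk c S)"
        using lipschitz_realD[OF p, of "walk c S" "walk c L"] by (simp add: dist_commute)
      also have "\<dots> \<le> C * (S - L + \<epsilon>)" using dist_walk[OF c LS] AC by (intro mult_left_mono) auto
      finally show "\<bar>p (walk c S) - p (walk c L)\<bar> \<le> C * (S - L + \<epsilon>)" .
    qed (use AC in auto)
    then have "\<bar>W S - W L\<bar> \<le> A * C * (S - L + \<epsilon>)\<^sup>2 + A * C * (S - L + \<epsilon>)"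
      using walk_sum_diff[OF f(1) p c LS] unfolding W_def mult.assoc[of A C] by linarith
    also have "\<dots> = A * C * ((S - L + \<epsilon>) + (S - L + \<epsilon>)\<^sup>2)" by (simp add: algebra_simps)
    also have "\<dots> \<le> A * C * (d + d\<^sup>2)"
      using AC Sd LS c(2) by (intro mult_left_mono add_mono power_mono) auto
    finally show ?thesis .
  qed
  ultimately have "\<bar>edge_sum (steps c) f p - (\<Sum>j<M. f (walk c (t j)) * (p (walk c (t (Suc j))) - p (walk c (t j))))\<bar>
      \<le> (\<Sum>j<M. A * C * (L / M + \<epsilon>)\<^sup>2) + A * C * (d + d\<^sup>2)"
    unfolding eq by linarith
  then show ?thesis by (simp add: t_def)
qed

text \<open>For a fixed partition, pointwise convergence at finitely many times gives convergence of
  the Riemann sums; the errors of discretisation are of order \<open>1 / M\<close>, apart from terms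
  that vanish with \<open>\<epsilon> n\<close> and the difference of lengths.\<close>

lemma edge_sum_tendsto_curve_current:
  fixes \<sigma> :: "real \<Rightarrow> 'a::metric_space" and c :: "nat \<Rightarrow> 'a list"
  assumes \<sigma>: "1-lipschitz_on UNIV \<sigma>" and f: "bounded_lipschitz f" and p: "lipschitz p"
    and c: "\<And>n x y. (x, y) \<in> set (steps (c n)) \<Longrightarrow> dist x y \<le> \<epsilon> n" "\<And>n. 0 \<le> \<epsilon> n" "\<And>n. c n \<noteq> []" and \<epsilon>: "\<epsilon> \<longlonglongrightarrow> 0"
    and L: "(\<lambda>n. chain_length (c n)) \<longlonglongrightarrow> L" and lim: "\<And>t. (\<lambda>n. walk (c n) t) \<longlonglongrightarrow> \<sigma> t"
  shows "(\<lambda>n. edge_sum (steps (c n)) f p) \<longlonglongrightarrow> curve_current \<sigma> L f [p]"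
proof (rule LIMSEQ_I)
  fix e :: real assume e: "0 < e"
  obtain A where A: "0 \<le> A" "A-lipschitz_on UNIV f" "\<And>x. \<bar>f x\<bar> \<le> A" using bounded_lipschitzE[OF f] by blast
  obtain C where C: "C-lipschitz_on UNIV p" using p by (auto simp: lipschitz_def)
  have L0: "0 \<le> L" by (rule LIMSEQ_le_const[OF L]) (use chain_length_nonneg in blast)
  \<comment> \<open>The errors for the walks and for the curve each have the limit bound
    \<open>A * C * L\<^sup>2 / M\<close>; this \<open>M\<close> puts their sum below
    \<open>e\<close>.\<close>
  obtain M :: nat where M: "2 * (A * C * L\<^sup>2) / e < M" using reals_Archimedean2 by blast
  have AC: "0 \<le> A * C * L\<^sup>2" using A(1) lipschitz_on_nonneg[OF C] by simp
  then have M0: "0 < real M" using M e by (intro le_less_trans[OF _ M]) simp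
  have Me: "2 * (A * C * L\<^sup>2) / M < e" using M e M0 by (simp add: field_simps)
  define R where "R g = (\<Sum>j<M. f (g (real j * (L / M))) * (p (g (real (Suc j) * (L / M))) - p (g (real j * (L / M)))))"
    for g :: "real \<Rightarrow> 'a"
  have fc: "isCont f x" and pc: "isCont p x" for x
    using lipschitz_continuous[OF bounded_lipschitz_lipschitz[OF f], of UNIV] lipschitz_continuous[OF p, of UNIV]
    by (simp_all add: continuous_on_eq_continuous_at)
  have R: "(\<lambda>n. R (walk (c n))) \<longlonglongrightarrow> R \<sigma>"
    unfolding R_def by (intro tendsto_intros isCont_tendsto_compose[OF fc] isCont_tendsto_compose[OF pc] lim)
  define d where "d n = \<bar>chain_length (c n) - L\<bar> + \<epsilon> n" for n
  have d: "d \<longlonglongrightarrow> 0"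
    unfolding d_def using tendsto_add[OF tendsto_rabs[OF LIM_zero[OF L]] \<epsilon>] by simp
  define b where "b n = (M * (A * C * (L / M + \<epsilon> n)\<^sup>2) + A * C * (d n + (d n)\<^sup>2)) + \<bar>R (walk (c n)) - R \<sigma>\<bar> + A * C * L\<^sup>2 / M" for n
  have "b \<longlonglongrightarrow> (M * (A * C * (L / M + 0)\<^sup>2) + A * C * (0 + 0\<^sup>2)) + \<bar>R \<sigma> - R \<sigma>\<bar> + A * C * L\<^sup>2 / M"
    unfolding b_def by (intro tendsto_intros \<epsilon> d R)
  moreover have "(M * (A * C * (L / M + 0)\<^sup>2) + A * C * (0 + 0\<^sup>2)) + \<bar>R \<sigma> - R \<sigma>\<bar> + A * C * L\<^sup>2 / M = 2 * (A * C * L\<^sup>2) / M"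
    using M0 by (simp add: power2_eq_square field_simps)
  ultimately obtain n0 where n0: "\<And>n. n0 \<le> n \<Longrightarrow> b n < e"
    using order_tendstoD(2)[of b _ sequentially e] Me unfolding eventually_sequentially by auto
  have "\<bar>edge_sum (steps (c n)) f p - curve_current \<sigma> L f [p]\<bar> \<le> b n" for n
  proof -
    have "\<bar>edge_sum (steps (c n)) f p - R (walk (c n))\<bar> \<le> M * (A * C * (L / M + \<epsilon> n)\<^sup>2) + A * C * (d n + (d n)\<^sup>2)"
      unfolding R_def using M0 by (intro walk_riemann[OF A(2,3) C c L0]) (auto simp: d_def)
    moreover have "\<bar>curve_current \<sigma> L f [p] - R \<sigma>\<bar> \<le> A * C * L\<^sup>2 / M"
      unfolding R_def using M0 by (intro curve_current_riemann[OF \<sigma> A(2,3) C L0]) simp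
    ultimately show ?thesis unfolding b_def by linarith
  qed
  then show "\<exists>n0. \<forall>n\<ge>n0. norm (edge_sum (steps (c n)) f p - curve_current \<sigma> L f [p]) < e"
    using n0 by (intro exI[of _ n0]) (auto intro: le_less_trans)
qed

section \<open>Compactness of chains and the limit decomposition\<close>

lemma walk_limit:
  fixes c :: "nat \<Rightarrow> 'a::complete_space list"
  assumes c: "\<And>n x y. (x, y) \<in> set (steps (c n)) \<Longrightarrow> dist x y \<le> \<epsilon> n" "\<And>n. 0 \<le> \<epsilon> n" "\<And>n. c n \<noteq> []" and \<epsilon>: "\<epsilon> \<longlonglongrightarrow> 0"
    and conv: "\<And>t. t \<in> \<rat> \<Longrightarrow> convergent (\<lambda>n. walk (c n) t)"
  obtains \<sigma> where "1-lipschitz_on UNIV \<sigma>" "\<And>t. (\<lambda>n. walk (c n) t) \<longlonglongrightarrow> \<sigma> t"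
proof -
  have le: "dist (walk (c n) s) (walk (c n) t) \<le> t - s + \<epsilon> n" if "s \<le> t" for n s t
    by (rule dist_walk[OF c that])
  have dw: "dist (walk (c n) s) (walk (c n) t) \<le> \<bar>s - t\<bar> + \<epsilon> n" for n s t
    using le[of s t n] le[of t s n] dist_commute[of "walk (c n) s" "walk (c n) t"] by (cases "s \<le> t") simp_all
  have "convergent (\<lambda>n. walk (c n) t)" for t
  proof (rule Cauchy_convergent, rule metric_CauchyI)
    fix e :: real assume e: "0 < e"
    \<comment> \<open>The walks are 1-Lipschitz up to \<open>\<epsilon> n\<close>, so a nearby
      rational time, at which they converge, controls time \<open>t\<close>.\<close>
    obtain q where q: "q \<in> \<rat>" "t < q" "q < t + e / 6" using Rats_dense_in_real[of t "t + e / 6"] e by auto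
    obtain n1 where n1: "\<And>m n. n1 \<le> m \<Longrightarrow> n1 \<le> n \<Longrightarrow> dist (walk (c m) q) (walk (c n) q) < e / 3"
      using metric_CauchyD[OF convergent_Cauchy[OF conv[OF q(1)]], of "e / 3"] e by auto
    obtain n2 where n2: "\<And>n. n2 \<le> n \<Longrightarrow> \<epsilon> n < e / 6"
      using order_tendstoD(2)[OF \<epsilon>, of "e / 6"] e unfolding eventually_sequentially by auto
    show "\<exists>M. \<forall>m\<ge>M. \<forall>n\<ge>M. dist (walk (c m) t) (walk (c n) t) < e"
    proof (intro exI[of _ "max n1 n2"] allI impI)
      fix m n assume mn: "max n1 n2 \<le> m" "max n1 n2 \<le> n"
      have "dist (walk (c m) t) (walk (c n) t) \<le> dist (walk (c m) t) (walk (c m) q) + dist (walk (c m) q) (walk (c n) q) + dist (walk (c n) t) (walk (c n) q)"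
        using dist_triangle[of "walk (c m) t" "walk (c n) t" "walk (c m) q"] dist_triangle[of "walk (c m) q" "walk (c n) t" "walk (c n) q"]
        by (simp add: dist_commute)
      also have "\<dots> < e"
        using dw[of m t q] dw[of n t q] n1[of m n] n2[of m] n2[of n] mn q by auto
      finally show "dist (walk (c m) t) (walk (c n) t) < e" .
    qed
  qed
  then have lim: "(\<lambda>n. walk (c n) t) \<longlonglongrightarrow> lim (\<lambda>n. walk (c n) t)" for t
    by (simp add: convergent_LIMSEQ_iff)
  show thesis
  proof (rule that[OF _ lim])
    show "1-lipschitz_on UNIV (\<lambda>t. lim (\<lambda>n. walk (c n) t))"
    proof (rule lipschitz_onI)
      fix s t :: real
      have "(\<lambda>n. \<bar>s - t\<bar> + \<epsilon> n) \<longlonglongrightarrow> \<bar>s - t\<bar> + 0" by (intro tendsto_intros \<epsilon>)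
      then have "dist (lim (\<lambda>n. walk (c n) s)) (lim (\<lambda>n. walk (c n) t)) \<le> \<bar>s - t\<bar> + 0"
        using dw by (intro LIMSEQ_le[OF tendsto_dist[OF lim lim]]) auto
      then show "dist (lim (\<lambda>n. walk (c n) s)) (lim (\<lambda>n. walk (c n) t)) \<le> 1 * dist s t" by (simp add: dist_real_def)
    qed simp
  qed
qed

text \<open>In a closed chain the leading term, \<open>f\<close> at the base point times the
  increment of \<open>p\<close>, vanishes and only the quadratic error is left. This makes large
  numbers of short closed chains harmless.\<close>

lemma edge_sum_closed:
  assumes f: "A-lipschitz_on UNIV f" and p: "C-lipschitz_on UNIV p" and "c \<noteq> []" "hd c = last c"
  shows "\<bar>edge_sum (steps c) f p\<bar> \<le> A * C * (chain_length c)\<^sup>2"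
  using walk_sum_start[OF f p chain_length_nonneg[of c] assms(3)] assms(3,4)
  by (simp add: walk_sum_end walk_end)

lemma curve_current_0:
  fixes \<sigma> :: "real \<Rightarrow> 'a::metric_space"
  assumes \<sigma>: "1-lipschitz_on UNIV \<sigma>" and f: "bounded_lipschitz f" and p: "lipschitz p"
  shows "curve_current \<sigma> 0 f [p] = 0"
proof -
  obtain A where A: "0 \<le> A" "A-lipschitz_on UNIV f" "\<And>x. \<bar>f x\<bar> \<le> A" using bounded_lipschitzE[OF f] by blast
  show ?thesis using curve_current_riemann[OF \<sigma> A(2,3) lipschitz_on_Lip[OF p], of 0 1] by simp
qed

lemma edge_length_nonneg': "(\<And>x. 0 \<le> h x) \<Longrightarrow> 0 \<le> edge_length es h"
  unfolding edge_length_def by (intro sum_list_nonneg) auto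

text \<open>A chain of length at least \<open>\<rho>\<close> cannot leave the \<open>3\<rho>\<close>-neighbourhood of \<open>K\<close>: otherwise it would
  have a large weighted length for the weight \<open>min 1 (infdist x K)\<close>.\<close>

lemma walk_near_compact:
  assumes M: "finite_borel_measure M" and K: "compact K" "K \<noteq> {}" "measure M (UNIV - K) \<le> \<rho>\<^sup>2 / 4"
    and c: "\<And>x y. (x, y) \<in> set (steps c) \<Longrightarrow> dist x y \<le> \<epsilon>" "0 \<le> \<epsilon>" "c \<noteq> []"
    and len: "\<And>h. 1-lipschitz_on UNIV h \<Longrightarrow> (\<And>x. 0 \<le> h x) \<Longrightarrow> (\<And>x. h x \<le> 1) \<Longrightarrow> edge_length (steps c) h \<le> (LINT x|M. h x) + \<epsilon>"
    and \<rho>: "0 < \<rho>" "\<rho> \<le> chain_length c" "\<rho> < 1 / 3" and \<epsilon>: "\<epsilon> \<le> \<rho>" "\<epsilon> \<le> \<rho>\<^sup>2 / 4"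
  shows "infdist (walk c t) K \<le> 3 * \<rho>"
proof -
  interpret finite_borel_measure M by fact
  define h where "h x = min 1 (infdist x K)" for x
  have "(max 0 1)-lipschitz_on UNIV h"
    unfolding h_def by (intro lipschitz_on_min lipschitz_on_infdist) (simp add: lipschitz_on_def)
  then have h: "1-lipschitz_on UNIV h" "\<And>x. 0 \<le> h x" "\<And>x. h x \<le> 1" by (auto simp: h_def infdist_nonneg)
  have Kb: "UNIV - K \<in> sets borel" using compact_imp_closed[OF K(1)] by auto
  have "(LINT x|M. h x) \<le> (LINT x|M. indicator (UNIV - K) x)"
  proof (rule integral_mono)
    show "integrable M h" using h by (intro integrable_bounded_lipschitz bounded_lipschitzI[of 1 h 1]) auto
    show "integrable M (indicator (UNIV - K) :: 'a \<Rightarrow> real)"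
      using Kb by (intro integrable_real_indicator) (auto simp: sets_borel less_top[symmetric])
    show "h x \<le> indicator (UNIV - K) x" for x by (cases "x \<in> K") (auto simp: h_def)
  qed
  also have "\<dots> \<le> \<rho>\<^sup>2 / 4" using K(3) Kb by (simp add: sets_borel space_UNIV)
  finally have small: "edge_length (steps c) h \<le> \<rho>\<^sup>2 / 2" using len[OF h] \<epsilon>(2) by linarith
  have "h (walk c t) \<le> 2 * \<rho> + \<epsilon>" by (rule walk_near[OF h(1,2) c \<rho>(1,2) small])
  then show ?thesis using \<rho>(3) \<epsilon>(1) by (auto simp: h_def min_def split: if_splits)
qed

lemma curve_decomposition:
  fixes T :: "'a::complete_space functional"
  assumes T: "integer_rectifiable TYPE(real) T" and fin: "finite_mass 0 (boundary T)"
    and k: "mass 0 (boundary T) / 2 < real k + 1"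
  obtains L :: "nat \<Rightarrow> real" and \<sigma> :: "nat \<Rightarrow> real \<Rightarrow> 'a" where "\<And>i. 0 \<le> L i" "\<And>i. 1-lipschitz_on UNIV (\<sigma> i)"
    "\<And>i. k \<le> i \<Longrightarrow> \<sigma> i (L i) = \<sigma> i 0" "\<And>M. (\<Sum>i<M. L i) \<le> mass 1 T"
    "\<And>f p. bounded_lipschitz f \<Longrightarrow> lipschitz p \<Longrightarrow> (\<lambda>i. curve_current (\<sigma> i) (L i) f [p]) sums T f [p]"
proof -
  interpret metric_current1 T by (rule integer_rectifiableD(1)[OF T])
  define \<epsilon> where "\<epsilon> n = 1 / real (Suc n)" for n
  have \<epsilon>: "0 < \<epsilon> n" "\<epsilon> n \<le> 1" for n by (simp_all add: \<epsilon>_def)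
  have \<epsilon>_lim: "\<epsilon> \<longlonglongrightarrow> 0" unfolding \<epsilon>_def using LIMSEQ_inverse_real_of_nat by (simp add: inverse_eq_divide)
  define Q where "Q n N c \<longleftrightarrow> (\<forall>i. c i \<noteq> []) \<and> (\<forall>i x y. (x, y) \<in> set (steps (c i)) \<longrightarrow> dist x y \<le> \<epsilon> n) \<and>
    (\<forall>i. k \<le> i \<longrightarrow> hd (c i) = last (c i)) \<and> (\<forall>i. N \<le> i \<longrightarrow> steps (c i) = []) \<and>
    (\<forall>i. real (Suc i) * chain_length (c (k + i)) \<le> (\<Sum>i<N. chain_length (c i))) \<and>
    (\<forall>A C f p. A-lipschitz_on UNIV f \<longrightarrow> (\<forall>x. \<bar>f x\<bar> \<le> A) \<longrightarrow> C-lipschitz_on UNIV p \<longrightarrow>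
       \<bar>T f [p] - (\<Sum>i<N. edge_sum (steps (c i)) f p)\<bar> \<le> \<epsilon> n * A * C) \<and>
    (\<forall>A h. A-lipschitz_on UNIV h \<longrightarrow> (\<forall>x. 0 \<le> h x) \<longrightarrow> (\<forall>x. h x \<le> A) \<longrightarrow>
       (\<Sum>i<N. edge_length (steps (c i)) h) \<le> (LINT x|\<mu>. h x) + \<epsilon> n * A)"
    for n N :: nat and c :: "nat \<Rightarrow> 'a list"
  have "\<exists>N c. Q n N c" for n
  proof (rule chain_approximation[OF T fin \<epsilon>(1)[of n] k])
    show "\<exists>N c. Q n N c" if "\<And>i. c i \<noteq> []" "\<And>i x y. (x, y) \<in> set (steps (c i)) \<Longrightarrow> dist x y \<le> \<epsilon> n"
      "\<And>i. k \<le> i \<Longrightarrow> hd (c i) = last (c i)" "\<And>i. N \<le> i \<Longrightarrow> steps (c i) = []"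
      "\<And>i. real (Suc i) * chain_length (c (k + i)) \<le> (\<Sum>i<N. chain_length (c i))"
      "\<And>A C f p. A-lipschitz_on UNIV f \<Longrightarrow> (\<And>x. \<bar>f x\<bar> \<le> A) \<Longrightarrow> C-lipschitz_on UNIV p \<Longrightarrow>
         \<bar>T f [p] - (\<Sum>i<N. edge_sum (steps (c i)) f p)\<bar> \<le> \<epsilon> n * A * C"
      "\<And>A h. A-lipschitz_on UNIV h \<Longrightarrow> (\<And>x. 0 \<le> h x) \<Longrightarrow> (\<And>x. h x \<le> A) \<Longrightarrow>
         (\<Sum>i<N. edge_length (steps (c i)) h) \<le> (LINT x|\<mu>. h x) + \<epsilon> n * A" for N and c :: "nat \<Rightarrow> 'a list"
      unfolding Q_def using that by (intro exI[of _ N] exI[of _ c]) simp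
  qed
  then obtain N c where Q: "\<And>n. Q n (N n) (c n)" by metis
  have c_ne: "c n i \<noteq> []" and c_step: "(x, y) \<in> set (steps (c n i)) \<Longrightarrow> dist x y \<le> \<epsilon> n"
    and c_closed: "k \<le> i \<Longrightarrow> hd (c n i) = last (c n i)" and c_triv: "N n \<le> i \<Longrightarrow> steps (c n i) = []"
    and c_sorted: "real (Suc i) * chain_length (c n (k + i)) \<le> (\<Sum>i<N n. chain_length (c n i))" for n i x y
    using Q[of n] unfolding Q_def by blast+
  have c_sum: "\<bar>T f [p] - (\<Sum>i<N n. edge_sum (steps (c n i)) f p)\<bar> \<le> \<epsilon> n * A * C"
    if "A-lipschitz_on UNIV f" "\<And>x. \<bar>f x\<bar> \<le> A" "C-lipschitz_on UNIV p" for n A C f p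
    using Q[of n] that unfolding Q_def by blast
  have c_length: "(\<Sum>i<N n. edge_length (steps (c n i)) h) \<le> (LINT x|\<mu>. h x) + \<epsilon> n * A"
    if "A-lipschitz_on UNIV h" "\<And>x. 0 \<le> h x" "\<And>x. h x \<le> A" for n A h
    using Q[of n] that unfolding Q_def by blast
  define l where "l n i = chain_length (c n i)" for n i
  define B where "B = mass 1 T + 1"
  have B0: "0 \<le> B" by (simp add: B_def mass_nonneg)
  have l0: "0 \<le> l n i" for n i by (simp add: l_def chain_length_nonneg)
  have l_triv: "l n i = 0" if "N n \<le> i" for n i using c_triv[OF that] by (simp add: l_def chain_length_def)
  have l_total: "(\<Sum>i<N n. l n i) \<le> mass 1 T + \<epsilon> n" for n
    unfolding l_def chain_length_def using c_length[of 1 "\<lambda>_. 1" n]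
    by (simp add: mass_def space_UNIV lipschitz_on_def)
  have l_sum: "(\<Sum>i<M. l n i) \<le> mass 1 T + \<epsilon> n" for n M
  proof -
    have "(\<Sum>i<M. l n i) = (\<Sum>i\<in>{..<M} \<inter> {..<N n}. l n i)"
      by (rule sum.mono_neutral_right) (auto intro!: l_triv)
    also have "\<dots> \<le> (\<Sum>i<N n. l n i)" by (rule sum_mono2) (auto simp: l0)
    finally show ?thesis using l_total[of n] by linarith
  qed
  have lB: "l n i \<le> B" for n i
    using member_le_sum[of i "{..<Suc i}" "l n"] l_sum[where M="Suc i" and n=n] \<epsilon>(2)[of n] l0 by (simp add: B_def)
  \<comment> \<open>An index \<open>j\<close> codes a chain number together with a rational time, so
    that one diagonal sequence serves all pairs.\<close>
  define t where "t j = real_of_rat (from_nat (snd (prod_decode j)))" for j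
  \<comment> \<open>Chains whose lengths tend to 0 may wander off, as the tightness argument does
    not hold them; so convergence of the walks is demanded for positive limit length only.\<close>
  define P where "P j s \<longleftrightarrow> (\<exists>a. (\<lambda>n. l (s n) (fst (prod_decode j))) \<longlonglongrightarrow> a \<and>
    (a = 0 \<or> convergent (\<lambda>n. walk (c (s n) (fst (prod_decode j))) (t j))))" for j and s :: "nat \<Rightarrow> nat"
  interpret subseqs P
  proof
    fix j and s :: "nat \<Rightarrow> nat" assume s: "strict_mono s"
    define i where "i = fst (prod_decode j)"
    obtain a r1 where "strict_mono (r1 :: nat \<Rightarrow> nat)" "((\<lambda>n. l (s n) i) \<circ> r1) \<longlonglongrightarrow> a"
      using compact_Icc[of 0 B, unfolded compact_def, THEN spec, of "\<lambda>n. l (s n) i"] l0 lB by auto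
    then have a: "strict_mono r1" "(\<lambda>n. l (s (r1 n)) i) \<longlonglongrightarrow> a" by (auto simp: comp_def)
    have a0: "0 \<le> a" by (rule LIMSEQ_le_const[OF a(2)]) (use l0 in blast)
    show "\<exists>r. strict_mono r \<and> P j (s \<circ> r)"
    proof (cases "a = 0")
      case True
      then show ?thesis using a unfolding P_def i_def[symmetric] by (intro exI[of _ r1]) (auto simp: comp_def)
    next
      case False
      have "\<exists>K. compact K \<and> K \<noteq> {} \<and> (\<forall>\<^sub>F n in sequentially. infdist (walk (c (s (r1 n)) i) (t j)) K \<le> e)" if e: "0 < e" for e
      proof -
        \<comment> \<open>The bound \<open>e / 3\<close> gives \<open>3 * \<rho> \<le> e\<close>,
          \<open>1 / 4\<close> stays below the third at which the weight, capped at 1, is still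
          informative, and \<open>a / 2\<close> is eventually exceeded by the chain length.\<close>
        define \<rho> where "\<rho> = min (min (e / 3) (1 / 4)) (a / 2)"
        have \<rho>: "0 < \<rho>" "3 * \<rho> \<le> e" "\<rho> < 1 / 3" "\<rho> < a" using e a0 False by (auto simp: \<rho>_def)
        have "0 < \<rho>\<^sup>2 / 4" using \<rho>(1) by simp
        then obtain K where K: "compact K" "K \<noteq> {}" "measure \<mu> (UNIV - K) < \<rho>\<^sup>2 / 4"
          by (rule integer_rectifiable_tight[OF T])
        have sr: "strict_mono (s \<circ> r1)" using s a(1) by (rule strict_mono_o)
        have "(\<lambda>n. \<epsilon> (s (r1 n))) \<longlonglongrightarrow> 0" using LIMSEQ_subseq_LIMSEQ[OF \<epsilon>_lim sr] by (simp add: comp_def)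
        then have "\<forall>\<^sub>F n in sequentially. \<epsilon> (s (r1 n)) < min \<rho> (\<rho>\<^sup>2 / 4)" using \<rho> by (intro order_tendstoD) auto
        moreover have "\<forall>\<^sub>F n in sequentially. \<rho> < l (s (r1 n)) i" by (rule order_tendstoD(1)[OF a(2) \<rho>(4)])
        ultimately have "\<forall>\<^sub>F n in sequentially. infdist (walk (c (s (r1 n)) i) (t j)) K \<le> e"
        proof eventually_elim
          case (elim n)
          define m where "m = s (r1 n)"
          have len: "edge_length (steps (c m i)) h \<le> (LINT x|\<mu>. h x) + \<epsilon> m"
            if h: "1-lipschitz_on UNIV h" "\<And>x. 0 \<le> h x" "\<And>x. h x \<le> 1" for h
          proof (cases "i < N m")
            case True
            then have "edge_length (steps (c m i)) h \<le> (\<Sum>i<N m. edge_length (steps (c m i)) h)"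
              using h(2) by (intro member_le_sum) (auto intro: edge_length_nonneg')
            then show ?thesis using c_length[OF h, of m] by simp
          next
            case False
            then have "edge_length (steps (c m i)) h = 0" using c_triv by simp
            moreover have "0 \<le> (LINT x|\<mu>. h x)" using h(2) by simp
            ultimately show ?thesis using \<epsilon>(1)[of m] by linarith
          qed
          have "infdist (walk (c m i) (t j)) K \<le> 3 * \<rho>"
          proof (rule walk_near_compact[OF finite_borel_measure_axioms K(1,2), where \<epsilon>="\<epsilon> m"])
            show "\<rho> \<le> chain_length (c m i)" using elim by (simp add: l_def m_def)
            show "\<epsilon> m \<le> \<rho>" "\<epsilon> m \<le> \<rho>\<^sup>2 / 4" using elim by (auto simp: m_def)
          qed (use K(3) \<rho> \<epsilon>(1)[of m] len c_step c_ne in \<open>auto simp: less_imp_le\<close>)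
          then show ?case using \<rho>(2) by (simp add: m_def)
        qed
        then show ?thesis using K(1,2) by blast
      qed
      then obtain r2 y where r2: "strict_mono (r2 :: nat \<Rightarrow> nat)" "((\<lambda>n. walk (c (s (r1 n)) i) (t j)) \<circ> r2) \<longlonglongrightarrow> y"
        by (rule convergent_subsequence_near_compact)
      have "(\<lambda>n. l (s (r1 (r2 n))) i) \<longlonglongrightarrow> a" using LIMSEQ_subseq_LIMSEQ[OF a(2) r2(1)] by (simp add: comp_def)
      then have "P j (s \<circ> (r1 \<circ> r2))"
        using r2(2) unfolding P_def i_def[symmetric] by (intro exI[of _ a]) (auto simp: comp_def convergent_def)
      then show ?thesis using strict_mono_o[OF a(1) r2(1)] by blast
    qed
  qed
  define r where "r = diagseq"
  have r: "strict_mono r" unfolding r_def by (rule subseq_diagseq)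
  have P_r: "P j r" for j
  proof -
    have "P j (diagseq \<circ> (+) (Suc j))"
    proof (rule diagseq_holds)
      fix r s :: "nat \<Rightarrow> nat" and n assume rs: "strict_mono r" "P n s"
      then obtain a where a: "(\<lambda>n'. l (s n') (fst (prod_decode n))) \<longlonglongrightarrow> a"
        "a = 0 \<or> convergent (\<lambda>n'. walk (c (s n') (fst (prod_decode n))) (t n))"
        unfolding P_def by blast
      show "P n (s \<circ> r)"
        unfolding P_def
        using LIMSEQ_subseq_LIMSEQ[OF a(1) rs(1)] a(2) convergent_subseq_convergent[OF _ rs(1)]
        by (intro exI[of _ a]) (auto simp: comp_def)
    qed
    then obtain a where a: "(\<lambda>n. l (r (n + Suc j)) (fst (prod_decode j))) \<longlonglongrightarrow> a"
      "a = 0 \<or> convergent (\<lambda>n. walk (c (r (n + Suc j)) (fst (prod_decode j))) (t j))"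
      unfolding P_def r_def comp_def add.commute[of "Suc j"] by blast
    have "convergent (\<lambda>n. walk (c (r n) (fst (prod_decode j))) (t j))" if "a \<noteq> 0"
      using a(2) that by (simp only: simp_thms convergent_ignore_initial_segment[of "\<lambda>n. walk (c (r n) (fst (prod_decode j))) (t j)"])
    then show ?thesis unfolding P_def using LIMSEQ_offset[OF a(1)] by blast
  qed
  define L where "L i = lim (\<lambda>n. l (r n) i)" for i
  have P': "(\<lambda>n. l (r n) i) \<longlonglongrightarrow> L i \<and> (L i = 0 \<or> convergent (\<lambda>n. walk (c (r n) i) q))" if q: "q \<in> \<rat>" for i q
  proof -
    obtain u where u: "q = real_of_rat u" using q by (rule Rats_cases)
    define j where "j = prod_encode (i, to_nat u)"
    have ij: "fst (prod_decode j) = i" "t j = q" by (simp_all add: j_def t_def u)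
    then obtain a where a: "(\<lambda>n. l (r n) i) \<longlonglongrightarrow> a" "a = 0 \<or> convergent (\<lambda>n. walk (c (r n) i) q)"
      using P_r[of j] unfolding P_def by auto
    moreover have "L i = a" unfolding L_def by (rule limI[OF a(1)])
    ultimately show ?thesis by simp
  qed
  have L: "(\<lambda>n. l (r n) i) \<longlonglongrightarrow> L i" for i using P'[of 0 i] by simp
  have \<epsilon>_r: "(\<lambda>n. \<epsilon> (r n)) \<longlonglongrightarrow> 0" using LIMSEQ_subseq_LIMSEQ[OF \<epsilon>_lim r] by (simp add: comp_def)
  \<comment> \<open>For vanishing limit length a constant curve is taken; its current is
    zero.\<close>
  have "\<exists>\<sigma>. 1-lipschitz_on UNIV \<sigma> \<and> (L i = 0 \<longrightarrow> (\<forall>s t. \<sigma> s = \<sigma> t)) \<and> (L i \<noteq> 0 \<longrightarrow> (\<forall>t. (\<lambda>n. walk (c (r n) i) t) \<longlonglongrightarrow> \<sigma> t))" for i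
  proof (cases "L i = 0")
    case True
    have "1-lipschitz_on UNIV (\<lambda>_::real. undefined :: 'a)" by (simp add: lipschitz_on_def)
    then show ?thesis using True by blast
  next
    case False
    obtain \<sigma> where "1-lipschitz_on UNIV \<sigma>" "\<And>t. (\<lambda>n. walk (c (r n) i) t) \<longlonglongrightarrow> \<sigma> t"
    proof (rule walk_limit[of "\<lambda>n. c (r n) i" "\<lambda>n. \<epsilon> (r n)"])
      show "convergent (\<lambda>n. walk (c (r n) i) q)" if "q \<in> \<rat>" for q using P'[OF that, of i] False by simp
    qed (use c_step c_ne \<epsilon>(1) \<epsilon>_r in \<open>auto simp: less_imp_le\<close>)
    then show ?thesis using False by blast
  qed
  then obtain \<sigma> where \<sigma>: "\<And>i. 1-lipschitz_on UNIV (\<sigma> i)" "\<And>i s t. L i = 0 \<Longrightarrow> \<sigma> i s = \<sigma> i t"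
    "\<And>i t. L i \<noteq> 0 \<Longrightarrow> (\<lambda>n. walk (c (r n) i) t) \<longlonglongrightarrow> \<sigma> i t"
    by metis
  show thesis
  proof (rule that[of L \<sigma>])
    show L0: "0 \<le> L i" for i by (rule LIMSEQ_le_const[OF L]) (use l0 in blast)
    show "1-lipschitz_on UNIV (\<sigma> i)" for i by (rule \<sigma>(1))
    show "\<sigma> i (L i) = \<sigma> i 0" if i: "k \<le> i" for i
    proof (cases "L i = 0")
      case False
      have "dist (walk (c (r n) i) (L i)) (walk (c (r n) i) 0) \<le> \<bar>l (r n) i - L i\<bar> + \<epsilon> (r n)" for n
      proof -
        let ?w = "walk (c (r n) i)"
        \<comment> \<open>At the later of the times \<open>L i\<close> and \<open>l (r n) i\<close>
          the walk has reached its last point, which for a closed chain is its first.\<close>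
        have last: "?w (max (L i) (l (r n) i)) = ?w 0"
          using walk_end[of "c (r n) i" "max (L i) (l (r n) i)"] walk_0[of 0 "c (r n) i"] c_ne c_closed[OF i] by (simp add: l_def)
        have "dist (?w (L i)) (?w (max (L i) (l (r n) i))) \<le> max (L i) (l (r n) i) - L i + \<epsilon> (r n)"
          by (intro dist_walk) (use c_step c_ne \<epsilon>(1) in \<open>auto simp: less_imp_le\<close>)
        then show ?thesis unfolding last by linarith
      qed
      moreover have "(\<lambda>n. \<bar>l (r n) i - L i\<bar> + \<epsilon> (r n)) \<longlonglongrightarrow> 0"
        using tendsto_add[OF tendsto_rabs[OF LIM_zero[OF L]] \<epsilon>_r] by simp
      ultimately have "dist (\<sigma> i (L i)) (\<sigma> i 0) \<le> 0"
        by (intro LIMSEQ_le[OF tendsto_dist[OF \<sigma>(3)[OF False] \<sigma>(3)[OF False]]]) auto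
      then show ?thesis by simp
    qed (rule \<sigma>(2))
    show "(\<Sum>i<M. L i) \<le> mass 1 T" for M
    proof (rule LIMSEQ_le)
      show "(\<lambda>n. \<Sum>i<M. l (r n) i) \<longlonglongrightarrow> (\<Sum>i<M. L i)" by (intro tendsto_sum L)
      show "(\<lambda>n. mass 1 T + \<epsilon> (r n)) \<longlonglongrightarrow> mass 1 T" using tendsto_add[OF tendsto_const \<epsilon>_r] by simp
    qed (use l_sum in blast)
    fix f p :: "'a \<Rightarrow> real" assume f: "bounded_lipschitz f" and p: "lipschitz p"
    obtain A where A: "0 \<le> A" "A-lipschitz_on UNIV f" "\<And>x. \<bar>f x\<bar> \<le> A" using bounded_lipschitzE[OF f] by blast
    obtain C where C: "C-lipschitz_on UNIV p" using p by (auto simp: lipschitz_def)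
    have AC: "0 \<le> A * C" using A(1) lipschitz_on_nonneg[OF C] by simp
    define E where "E i n = edge_sum (steps (c (r n) i)) f p" for i n
    have E_le: "\<bar>E i n\<bar> \<le> A * C * l (r n) i" for i n
      unfolding E_def l_def chain_length_def by (rule edge_sum_bound[OF A(3) C])
    have E_lim: "E i \<longlonglongrightarrow> curve_current (\<sigma> i) (L i) f [p]" for i
    proof (cases "L i = 0")
      case True
      have "(\<lambda>n. A * C * l (r n) i) \<longlonglongrightarrow> 0" using tendsto_mult_left[OF L, of "A * C" i] True by simp
      then have "E i \<longlonglongrightarrow> 0" by (rule Lim_null_comparison[rotated]) (simp add: E_le)
      then show ?thesis using True curve_current_0[OF \<sigma>(1) f p] by simp
    next
      case False
      show ?thesis
        unfolding E_def
        by (rule edge_sum_tendsto_curve_current[OF \<sigma>(1) f p _ _ _ \<epsilon>_r L[unfolded l_def] \<sigma>(3)[OF False]])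
          (use c_step c_ne \<epsilon>(1) in \<open>auto simp: less_imp_le\<close>)
    qed
    \<comment> \<open>Dominating sequence for Tannery's theorem: the first \<open>k\<close> terms
      are merely bounded, the others decay like \<open>1 / j\<^sup>2\<close> by the quadratic
      estimate for closed chains and their ordering by length.\<close>
    define S where "S i = (if i < k then A * C * B else A * C * B\<^sup>2 * inverse (real (Suc (i - k)) ^ 2))" for i
    have E_S: "\<bar>E i n\<bar> \<le> S i" for i n
    proof (cases "i < k")
      case True
      then show ?thesis using order_trans[OF E_le mult_left_mono[OF lB AC]] by (simp add: S_def)
    next
      case False
      define j where "j = i - k"
      have i: "i = k + j" "k \<le> i" using False by (auto simp: j_def)
      have "\<bar>E i n\<bar> \<le> A * C * (l (r n) i)\<^sup>2"
        unfolding E_def l_def by (rule edge_sum_closed[OF A(2) C c_ne c_closed[OF i(2)]])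
      also have "\<dots> \<le> A * C * (B / real (Suc j))\<^sup>2"
      proof (intro mult_left_mono power_mono AC l0)
        have "real (Suc j) * l (r n) i \<le> B"
          using c_sorted[of j "r n"] l_total[of "r n"] \<epsilon>(2)[of "r n"] by (simp add: i(1) l_def B_def)
        then show "l (r n) i \<le> B / real (Suc j)" by (simp add: pos_le_divide_eq mult.commute)
      qed
      also have "\<dots> = S i" using False by (simp add: S_def j_def divide_inverse power_mult_distrib power_inverse)
      finally show ?thesis .
    qed
    have "summable (\<lambda>i. S (i + k))"
      using summable_mult[of "\<lambda>i. inverse (real (Suc i) ^ 2)" "A * C * B\<^sup>2"] inverse_power_summable[of 2, where 'a=real]
        summable_Suc_iff[of "\<lambda>i. inverse (real i ^ 2)"] by (simp add: S_def)
    then have S: "summable S" by (rule summable_iff_shift[THEN iffD1])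
    have tannery: "summable (\<lambda>i. norm (curve_current (\<sigma> i) (L i) f [p]))"
      "(\<lambda>n. suminf (\<lambda>i. E i n)) \<longlonglongrightarrow> suminf (\<lambda>i. curve_current (\<sigma> i) (L i) f [p])"
      using tannerys_theorem[OF E_lim _ S] E_S by (auto simp: always_eventually case_prod_beta)
    have "suminf (\<lambda>i. E i n) = (\<Sum>i<N (r n). edge_sum (steps (c (r n) i)) f p)" for n
      unfolding E_def by (rule suminf_finite) (auto simp: c_triv)
    then have "\<bar>suminf (\<lambda>i. E i n) - T f [p]\<bar> \<le> \<epsilon> (r n) * A * C" for n
      using c_sum[OF A(2,3) C, of "r n"] by (simp add: abs_minus_commute)
    moreover have "(\<lambda>n. \<epsilon> (r n) * A * C) \<longlonglongrightarrow> 0"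
      using tendsto_mult_left_zero[OF tendsto_mult_left_zero[OF \<epsilon>_r, of A], of C] by simp
    ultimately have "(\<lambda>n. suminf (\<lambda>i. E i n) - T f [p]) \<longlonglongrightarrow> 0"
      by (intro Lim_null_comparison[of "\<lambda>n. suminf (\<lambda>i. E i n) - T f [p]"]) auto
    then have "(\<lambda>n. suminf (\<lambda>i. E i n)) \<longlonglongrightarrow> T f [p]" by (rule LIM_zero_cancel)
    then have "T f [p] = suminf (\<lambda>i. curve_current (\<sigma> i) (L i) f [p])" using tannery(2) by (rule LIMSEQ_unique)
    then show "(\<lambda>i. curve_current (\<sigma> i) (L i) f [p]) sums T f [p]"
      using summable_sums[OF summable_norm_cancel[OF tannery(1)]] by simp
  qed
qed

section \<open>Curves as integral currents\<close>

definition curve_measure :: "(real \<Rightarrow> 'a::metric_space) \<Rightarrow> real \<Rightarrow> 'a measure" where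
  "curve_measure \<sigma> L = distr (restrict_space lborel {0..L}) borel \<sigma>"

text \<open>Unit masses at the two end points, realised as the image of counting measure on the
  booleans; coinciding end points count twice.\<close>

definition endpoint_measure :: "(real \<Rightarrow> 'a::metric_space) \<Rightarrow> real \<Rightarrow> 'a measure" where
  "endpoint_measure \<sigma> L = distr (count_space UNIV) borel (\<lambda>b. if b then \<sigma> L else \<sigma> 0)"

lemma
  shows finite_borel_endpoint_measure: "finite_borel_measure (endpoint_measure \<sigma> L)"
    and measure_endpoint_measure: "measure (endpoint_measure \<sigma> L) UNIV = 2"
    and integral_endpoint_measure: "f \<in> borel_measurable borel \<Longrightarrow> (LINT x|endpoint_measure \<sigma> L. f x) = (f (\<sigma> L) + f (\<sigma> 0 :: 'a::metric_space) :: real)"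
proof -
  have m: "(\<lambda>b. if b then \<sigma> L else \<sigma> 0) \<in> measurable (count_space UNIV) borel" by simp
  have e: "emeasure (endpoint_measure \<sigma> L) UNIV = 2"
    unfolding endpoint_measure_def by (subst emeasure_distr[OF m]) (simp_all add: UNIV_bool)
  show "finite_borel_measure (endpoint_measure \<sigma> L)"
    by (rule finite_borel_measureI) (simp_all add: e, simp add: endpoint_measure_def)
  show "measure (endpoint_measure \<sigma> L) UNIV = 2" by (simp add: measure_def e)
  show "(LINT x|endpoint_measure \<sigma> L. f x) = f (\<sigma> L) + f (\<sigma> 0)" if "f \<in> borel_measurable borel"
    unfolding endpoint_measure_def
    by (subst integral_distr[OF m that]) (simp_all add: lebesgue_integral_count_space_finite UNIV_bool)
qed

lemma countably_rectifiable_curve: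
  fixes \<sigma> :: "real \<Rightarrow> 'a::metric_space"
  assumes "1-lipschitz_on UNIV \<sigma>"
  shows "countably_rectifiable TYPE(real) (\<sigma> ` {0..L})"
proof -
  have "h1_null ({} :: 'a set)"
    unfolding h1_null_def by (auto intro!: exI[of _ "\<lambda>_. {}"])
  then have "hausdorff_measure 1 ({} :: 'a set) = 0" by (simp add: h1_null_iff)
  moreover have "1-lipschitz_on {0..L} \<sigma>" using assms by (rule lipschitz_on_subset) simp
  ultimately show ?thesis
    unfolding countably_rectifiable_def
    by - (rule exI[of _ "\<lambda>_. {0..L}"], rule exI[of _ "\<lambda>_. \<sigma>"], auto simp: One_nat_def)
qed

text \<open>\<open>g\<close> is the multiplicity function of countably many oriented intervals from
  \<open>\<alpha> i\<close> to \<open>\<beta> i\<close>, counted negatively when they run backwards.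
  Summability of the lengths makes its series converge almost everywhere.\<close>

lemma signed_intervals:
  fixes \<alpha> \<beta> :: "nat \<Rightarrow> real"
  assumes "summable (\<lambda>i. \<bar>\<beta> i - \<alpha> i\<bar>)"
  obtains g :: "real \<Rightarrow> real" where "integrable lborel g" "g \<in> borel_measurable borel" "range g \<subseteq> \<int>"
    "\<And>m B. m \<in> borel_measurable borel \<Longrightarrow> (\<And>x. \<bar>m x\<bar> \<le> B) \<Longrightarrow>
      (LINT x|lborel. g x * m x) = (\<Sum>i. (LINT x:{\<alpha> i..\<beta> i}|lborel. m x) - (LINT x:{\<beta> i..\<alpha> i}|lborel. m x))"
proof -
  \<comment> \<open>One of the two intervals is empty, or both are the same point and
    cancel.\<close>
  define s :: "nat \<Rightarrow> real \<Rightarrow> real" where "s i x = indicator {\<alpha> i..\<beta> i} x - indicator {\<beta> i..\<alpha> i} x" for i x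
  have s_meas [measurable]: "s i \<in> borel_measurable borel" for i unfolding s_def by measurable
  have s_int: "integrable lborel (s i)" for i
    unfolding s_def by (intro Bochner_Integration.integrable_diff integrable_real_indicator) (auto simp: emeasure_lborel_Icc_eq)
  have s_abs: "\<bar>s i x\<bar> \<le> indicator {min (\<alpha> i) (\<beta> i)..max (\<alpha> i) (\<beta> i)} x" for i x
    by (auto simp: s_def indicator_def)
  have s_norm: "(LINT x|lborel. \<bar>s i x\<bar>) \<le> \<bar>\<beta> i - \<alpha> i\<bar>" for i
  proof -
    have "(LINT x|lborel. \<bar>s i x\<bar>) \<le> (LINT x|lborel. indicator {min (\<alpha> i) (\<beta> i)..max (\<alpha> i) (\<beta> i)} x)"
      using s_abs s_int by (intro integral_mono integrable_real_indicator integrable_abs) (auto simp: emeasure_lborel_Icc_eq)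
    then show ?thesis by (simp add: min_def max_def split: if_splits)
  qed
  have "(\<integral>\<^sup>+x. (\<Sum>i. ennreal \<bar>s i x\<bar>) \<partial>lborel) = (\<Sum>i. \<integral>\<^sup>+x. ennreal \<bar>s i x\<bar> \<partial>lborel)"
    by (rule nn_integral_suminf) measurable
  also have "\<dots> \<le> (\<Sum>i. ennreal \<bar>\<beta> i - \<alpha> i\<bar>)"
  proof (rule suminf_le)
    show "(\<integral>\<^sup>+x. ennreal \<bar>s i x\<bar> \<partial>lborel) \<le> ennreal \<bar>\<beta> i - \<alpha> i\<bar>" for i
      using s_norm s_int by (subst nn_integral_eq_integral) (auto intro: integrable_abs ennreal_leI)
  qed auto
  also have "\<dots> < \<infinity>" using assms by (subst suminf_ennreal2) auto
  finally have "(\<integral>\<^sup>+x. (\<Sum>i. ennreal \<bar>s i x\<bar>) \<partial>lborel) \<noteq> \<infinity>" by simp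
  then have "AE x in lborel. (\<Sum>i. ennreal \<bar>s i x\<bar>) \<noteq> \<infinity>" by (intro nn_integral_PInf_AE) measurable
  then have AE: "AE x in lborel. summable (\<lambda>i. \<bar>s i x\<bar>)"
    by eventually_elim (simp add: summable_suminf_not_top)
  then obtain N where "N \<in> null_sets lborel" and N: "{x. \<not> summable (\<lambda>i. \<bar>s i x\<bar>)} \<subseteq> N"
    by (auto simp: eventually_ae_filter)
  then have N': "N \<in> sets borel" "AE x in lborel. x \<notin> N" by (auto intro: AE_not_in)
  \<comment> \<open>Putting the terms to 0 on a null set that contains all points of divergence
    makes \<open>g\<close> a limit of integers at every point, hence integer valued.\<close>
  define s' where "s' i x = s i x * indicator (- N) x" for i x
  have s'_meas [measurable]: "s' i \<in> borel_measurable borel" for i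
    unfolding s'_def using N'(1) by (intro borel_measurable_times s_meas borel_measurable_indicator) auto
  have s': "\<bar>s' i x\<bar> \<le> \<bar>s i x\<bar>" for i x by (simp add: s'_def indicator_def)
  have sum': "summable (\<lambda>i. \<bar>s' i x\<bar>)" for x
    using N by (cases "x \<in> N") (auto simp: s'_def)
  define g where "g x = (\<Sum>i. s' i x)" for x
  have key: "integrable lborel (\<lambda>x. g x * m x) \<and>
      (LINT x|lborel. g x * m x) = (\<Sum>i. (LINT x:{\<alpha> i..\<beta> i}|lborel. m x) - (LINT x:{\<beta> i..\<alpha> i}|lborel. m x))"
    if m [measurable]: "m \<in> borel_measurable borel" and B: "\<And>x. \<bar>m x\<bar> \<le> B" for m B
  proof -
    have B0: "0 \<le> B" using B[of 0] by simp
    have sm: "\<bar>s' i x * m x\<bar> \<le> B * \<bar>s i x\<bar>" for i x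
      unfolding abs_mult mult.commute[of B] using s' B by (intro mult_mono) auto
    have int: "integrable lborel (\<lambda>x. s' i x * m x)" for i
    proof (rule Bochner_Integration.integrable_bound[OF integrable_mult_right[OF integrable_abs[OF s_int[of i]], of B]])
      show "AE x in lborel. norm (s' i x * m x) \<le> norm (B * \<bar>s i x\<bar>)"
        using order_trans[OF sm abs_ge_self] by simp
    qed measurable
    have eq: "g x * m x = (\<Sum>i. s' i x * m x)" for x
      unfolding g_def by (rule suminf_mult2) (rule summable_rabs_cancel[OF sum'])
    have summ: "AE x in lborel. summable (\<lambda>i. norm (s' i x * m x))"
      using summable_mult2[OF sum'] by (simp add: abs_mult)
    have summ': "summable (\<lambda>i. LINT x|lborel. norm (s' i x * m x))"
    proof (rule summable_comparison_test'[OF summable_mult[OF assms, of B], of 0])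
      fix i
      have "(LINT x|lborel. norm (s' i x * m x)) \<le> (LINT x|lborel. B * \<bar>s i x\<bar>)"
        using sm int s_int by (intro integral_mono integrable_norm integrable_mult_right integrable_abs) auto
      also have "\<dots> \<le> B * \<bar>\<beta> i - \<alpha> i\<bar>" using s_norm B0 by (simp add: mult_left_mono)
      finally show "norm (LINT x|lborel. norm (s' i x * m x)) \<le> B * \<bar>\<beta> i - \<alpha> i\<bar>" by simp
    qed
    have piece: "(LINT x|lborel. s' i x * m x) = (LINT x:{\<alpha> i..\<beta> i}|lborel. m x) - (LINT x:{\<beta> i..\<alpha> i}|lborel. m x)" for i
    proof -
      have "(LINT x|lborel. s' i x * m x) = (LINT x|lborel. indicator {\<alpha> i..\<beta> i} x *\<^sub>R m x - indicator {\<beta> i..\<alpha> i} x *\<^sub>R m x)"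
      proof (rule integral_cong_AE)
        show "AE x in lborel. s' i x * m x = indicator {\<alpha> i..\<beta> i} x *\<^sub>R m x - indicator {\<beta> i..\<alpha> i} x *\<^sub>R m x"
          using N'(2) by eventually_elim (simp add: s'_def s_def left_diff_distrib)
      qed measurable
      also have "\<dots> = (LINT x:{\<alpha> i..\<beta> i}|lborel. m x) - (LINT x:{\<beta> i..\<alpha> i}|lborel. m x)"
        unfolding set_lebesgue_integral_def using set_integrable_bounded_interval[OF m B]
        by (intro Bochner_Integration.integral_diff) (auto simp: set_integrable_def)
      finally show ?thesis .
    qed
    show ?thesis
      unfolding eq piece[symmetric]
      using integrable_suminf[OF int summ summ'] integral_suminf[OF int summ summ'] by simp
  qed
  show thesis
  proof (rule that[of g])
    show "integrable lborel g" using key[of "\<lambda>_. 1" 1] by simp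
    show "g \<in> borel_measurable borel" unfolding g_def by measurable
    show "range g \<subseteq> \<int>"
    proof (rule image_subsetI)
      fix x
      have "s' i x \<in> \<int>" for i by (simp add: s'_def s_def indicator_def)
      then have "(\<Sum>i<n. s' i x) \<in> \<int>" for n by (intro Ints_sum)
      moreover have "(\<lambda>n. \<Sum>i<n. s' i x) \<longlonglongrightarrow> g x"
        unfolding g_def by (rule summable_LIMSEQ) (rule summable_rabs_cancel[OF sum'])
      ultimately show "g x \<in> \<int>" by (rule closed_sequentially[OF closed_Ints])
    qed
  qed (use key in blast)
qed

text \<open>The density \<open>r\<close> need not be the derivative of \<open>p\<close> at
  \<open>u x\<close>, since \<open>u\<close> may spend positive time in an exceptional null set. So
  the chain rule is derived from increments: for a primitive \<open>H\<close> of
  \<open>f * r\<close>, the increment of \<open>H\<close> is that of \<open>p\<close> times a value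
  of \<open>f\<close> up to a quadratic error, and thus \<open>H \<circ> u\<close> has derivative
  \<open>f (u x) * q x\<close> wherever both compositions are differentiable.\<close>

lemma lipschitz_primitive_compose:
  fixes u p f :: "real \<Rightarrow> real"
  assumes u: "K-lipschitz_on UNIV u" and f: "A-lipschitz_on UNIV f" "\<And>x. \<bar>f x\<bar> \<le> A" and p: "C-lipschitz_on UNIV p"
    and r: "r \<in> borel_measurable borel" "\<And>x. \<bar>r x\<bar> \<le> C" "\<And>a b. a \<le> b \<Longrightarrow> p b - p a = (LINT x:{a..b}|lborel. r x)"
    and q: "q \<in> borel_measurable borel" "AE x in lebesgue. (p \<circ> u has_real_derivative q x) (at x)" and "a \<le> b"
  shows "(LINT x:{a..b}|lborel. f (u x) * q x) =
    (LINT y:{u a..u b}|lborel. f y * r y) - (LINT y:{u b..u a}|lborel. f y * r y)"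
proof -
  have AC: "0 \<le> A" "0 \<le> C" "0 \<le> K" using lipschitz_on_nonneg[OF f(1)] lipschitz_on_nonneg[OF p] lipschitz_on_nonneg[OF u] by auto
  have fm [measurable]: "f \<in> borel_measurable borel" by (rule lipschitz_on_borel[OF f(1)])
  have um [measurable]: "u \<in> borel_measurable borel" by (rule lipschitz_on_borel[OF u])
  note r(1) [measurable] q(1) [measurable]
  have fr: "(\<lambda>y. f y * r y) \<in> borel_measurable borel" by measurable
  have frb: "\<bar>f y * r y\<bar> \<le> A * C" for y unfolding abs_mult using f(2) r(2) AC by (intro mult_mono) auto
  obtain H where H: "\<And>a b. a \<le> b \<Longrightarrow> H b - H a = (LINT y:{a..b}|lborel. f y * r y)"
    by (rule integral_primitive[OF fr frb]) blast
  have H_near: "\<bar>H b - H a - f c * (p b - p a)\<bar> \<le> A * C * \<bar>b - a\<bar>\<^sup>2"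
    if c: "c \<in> {a, b}" for a b c
  proof -
    have *: "\<bar>H b - H a - f c * (p b - p a)\<bar> \<le> A * C * \<bar>b - a\<bar>\<^sup>2" if "a \<le> b" "c \<in> {a, b}" for a b c
      unfolding H[OF that(1)] r(3)[OF that(1)] power2_abs by (rule riemann_step[OF f r(1,2)]) (use that in auto)
    show ?thesis
    proof (cases "a \<le> b")
      case False
      have "H b - H a - f c * (p b - p a) = - (H a - H b - f c * (p a - p b))" by (simp add: algebra_simps)
      then have "\<bar>H b - H a - f c * (p b - p a)\<bar> = \<bar>H a - H b - f c * (p a - p b)\<bar>" by (simp only: abs_minus_cancel)
      also have "\<dots> \<le> A * C * \<bar>a - b\<bar>\<^sup>2" using c False by (intro *) auto
      finally show ?thesis by (simp only: abs_minus_commute)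
    qed (use * c in auto)
  qed
  have H_le: "\<bar>H b - H a\<bar> \<le> A * C * (b - a)" if "a \<le> b" for a b
    unfolding H[OF that] by (rule set_integral_interval_le[OF fr frb that frb])
  have H_lip: "(A * C)-lipschitz_on UNIV H"
  proof (rule lipschitz_realI)
    show "H x - H y \<le> A * C * dist x y" for x y
      using H_le[of x y] H_le[of y x] by (cases "x \<le> y") (auto simp: dist_real_def abs_le_iff)
  qed (use AC in simp)
  have "(A * C * K)-lipschitz_on UNIV (H \<circ> u)"
    using lipschitz_on_compose[OF u lipschitz_on_subset[OF H_lip]] by simp
  then obtain w where w: "w \<in> borel_measurable borel" "\<And>x. \<bar>w x\<bar> \<le> A * C * K"
    "\<And>a b. a \<le> b \<Longrightarrow> (H \<circ> u) b - (H \<circ> u) a = (LINT x:{a..b}|lborel. w x)"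
    "AE x in lebesgue. (H \<circ> u has_real_derivative w x) (at x)"
    using lipschitz_real_AE_derivative by blast
  have deriv: "w x = f (u x) * q x" if wx: "(H \<circ> u has_real_derivative w x) (at x)" and qx: "(p \<circ> u has_real_derivative q x) (at x)" for x
  proof -
    have "((\<lambda>y. (((H \<circ> u) y - (H \<circ> u) x) / (y - x)) - f (u x) * (((p \<circ> u) y - (p \<circ> u) x) / (y - x))) \<longlongrightarrow> w x - f (u x) * q x) (at x)"
      using wx qx by (intro tendsto_intros) (auto simp: has_field_derivative_iff)
    moreover have "((\<lambda>y. (((H \<circ> u) y - (H \<circ> u) x) / (y - x)) - f (u x) * (((p \<circ> u) y - (p \<circ> u) x) / (y - x))) \<longlongrightarrow> 0) (at x)"
    proof (rule Lim_null_comparison)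
      have "norm (((H \<circ> u) y - (H \<circ> u) x) / (y - x) - f (u x) * (((p \<circ> u) y - (p \<circ> u) x) / (y - x))) \<le> A * C * K\<^sup>2 * \<bar>y - x\<bar>" for y
      proof (cases "y = x")
        case False
        have "\<bar>H (u y) - H (u x) - f (u x) * (p (u y) - p (u x))\<bar> \<le> A * C * \<bar>u y - u x\<bar>\<^sup>2" by (rule H_near) simp
        also have "\<dots> \<le> A * C * (K * \<bar>y - x\<bar>)\<^sup>2"
          using AC lipschitz_realD[OF u, of y x] by (intro mult_left_mono power_mono) (auto simp: dist_real_def)
        finally have "\<bar>H (u y) - H (u x) - f (u x) * (p (u y) - p (u x))\<bar> / \<bar>y - x\<bar> \<le> A * C * K\<^sup>2 * \<bar>y - x\<bar>"
          using False by (simp add: power2_eq_square pos_divide_le_eq algebra_simps)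
        then show ?thesis by (simp flip: abs_divide diff_divide_distrib)
      qed simp
      then show "\<forall>\<^sub>F y in at x. norm (((H \<circ> u) y - (H \<circ> u) x) / (y - x) - f (u x) * (((p \<circ> u) y - (p \<circ> u) x) / (y - x))) \<le> A * C * K\<^sup>2 * \<bar>y - x\<bar>"
        by simp
      show "((\<lambda>y. A * C * K\<^sup>2 * \<bar>y - x\<bar>) \<longlongrightarrow> 0) (at x)" by (auto intro!: tendsto_eq_intros)
    qed
    ultimately have "w x - f (u x) * q x = 0" by (rule LIM_unique)
    then show ?thesis by simp
  qed
  have "AE x in lebesgue. w x = f (u x) * q x" using w(4) q(2) by eventually_elim (rule deriv)
  then have "AE x in lborel. w x = f (u x) * q x" by (simp add: AE_completion_iff)
  then have "(LINT x:{a..b}|lborel. f (u x) * q x) = (LINT x:{a..b}|lborel. w x)"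
    using w(1) by (intro set_lebesgue_integral_cong_AE) auto
  also have "\<dots> = H (u b) - H (u a)" using w(3)[OF \<open>a \<le> b\<close>] by simp
  also have "\<dots> = (LINT y:{u a..u b}|lborel. f y * r y) - (LINT y:{u b..u a}|lborel. f y * r y)"
  proof (cases "u a" "u b" rule: linorder_cases)
    case less
    then show ?thesis using H[of "u a" "u b"] by (simp add: set_lebesgue_integral_def)
  next
    case greater
    then show ?thesis using H[of "u b" "u a"] by (simp add: set_lebesgue_integral_def)
  qed simp
  finally show ?thesis .
qed

section \<open>The current, its mass bounds and its integrality for a fixed curve\<close>

context
  fixes \<sigma> :: "real \<Rightarrow> 'a::metric_space" and L :: real
  assumes \<sigma>: "1-lipschitz_on UNIV \<sigma>" and L: "0 \<le> L"
begin

lemma curve_borel: "\<sigma> \<in> borel_measurable borel"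
  by (rule lipschitz_on_borel[OF \<sigma>])

lemma curve_restrict: "\<sigma> \<in> measurable (restrict_space lborel {0..L}) borel"
  using curve_borel by (intro measurable_restrict_space1) simp

lemma integral_curve_measure:
  "f \<in> borel_measurable borel \<Longrightarrow> (LINT x|curve_measure \<sigma> L. f x) = (LINT x:{0..L}|lborel. f (\<sigma> x) :: real)"
  unfolding curve_measure_def set_lebesgue_integral_def
  by (subst integral_distr[OF curve_restrict]) (simp_all add: integral_restrict_space)

lemma emeasure_curve_measure: "emeasure (curve_measure \<sigma> L) UNIV = ennreal L"
  unfolding curve_measure_def
  using L by (subst emeasure_distr[OF curve_restrict]) (simp_all add: emeasure_restrict_space space_restrict_space)

lemma sets_curve_measure: "sets (curve_measure \<sigma> L) = sets borel"
  by (simp add: curve_measure_def)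

lemma finite_borel_curve_measure: "finite_borel_measure (curve_measure \<sigma> L)"
  by (rule finite_borel_measureI) (simp_all add: emeasure_curve_measure sets_curve_measure)

lemma measure_curve_measure: "measure (curve_measure \<sigma> L) UNIV = L"
  using L by (simp add: measure_def emeasure_curve_measure)

lemma curve_integral_bound:
  fixes q :: "real \<Rightarrow> real" and h :: "'a \<Rightarrow> real"
  assumes q: "q \<in> borel_measurable borel" "\<And>x. \<bar>q x\<bar> \<le> C" and h: "h \<in> borel_measurable borel" "\<And>x. \<bar>h x\<bar> \<le> B"
  shows "set_integrable lborel {0..L} (\<lambda>x. h (\<sigma> x) * q x)"
    and "\<bar>LINT x:{0..L}|lborel. h (\<sigma> x) * q x\<bar> \<le> C * (LINT x|curve_measure \<sigma> L. \<bar>h x\<bar>)"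
proof -
  note q(1) [measurable] h(1) [measurable] curve_borel [measurable]
  have hq: "\<bar>h (\<sigma> x) * q x\<bar> \<le> C * \<bar>h (\<sigma> x)\<bar>" for x
    unfolding abs_mult mult.commute[of C] using q(2) by (intro mult_left_mono) auto
  have C0: "0 \<le> C" using order_trans[OF abs_ge_zero q(2)] by blast
  show int: "set_integrable lborel {0..L} (\<lambda>x. h (\<sigma> x) * q x)"
    by (rule set_integrable_bounded_interval[of _ "C * B"])
      (measurable, use hq mult_left_mono[OF h(2) C0] in \<open>blast intro: order_trans\<close>)
  have int': "set_integrable lborel {0..L} (\<lambda>x. \<bar>h (\<sigma> x)\<bar>)"
    using h(2) by (intro set_integrable_bounded_interval[of _ B]) auto
  have "\<bar>LINT x:{0..L}|lborel. h (\<sigma> x) * q x\<bar> \<le> (LINT x|lborel. \<bar>indicator {0..L} x *\<^sub>R (h (\<sigma> x) * q x)\<bar>)"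
    unfolding set_lebesgue_integral_def by (rule integral_abs_bound)
  also have "\<dots> \<le> (LINT x|lborel. C * (indicator {0..L} x *\<^sub>R \<bar>h (\<sigma> x)\<bar>))"
    using int int' hq unfolding set_integrable_def
    by (intro integral_mono integrable_abs integrable_mult_right) (auto simp: indicator_def)
  also have "\<dots> = C * (LINT x|curve_measure \<sigma> L. \<bar>h x\<bar>)"
    by (subst integral_curve_measure) (simp_all add: set_lebesgue_integral_def)
  finally show "\<bar>LINT x:{0..L}|lborel. h (\<sigma> x) * q x\<bar> \<le> C * (LINT x|curve_measure \<sigma> L. \<bar>h x\<bar>)" .
qed

text \<open>Riemann sums describe the current without a choice of derivatives; linearity in both
  arguments is inherited from the finite sums.\<close>

lemma curve_current_LIMSEQ:
  assumes f: "bounded_lipschitz f" and p: "lipschitz p"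
  shows "(\<lambda>n. \<Sum>j<Suc n. f (\<sigma> (real j * (L / Suc n))) *
      (p (\<sigma> (real (Suc j) * (L / Suc n))) - p (\<sigma> (real j * (L / Suc n))))) \<longlonglongrightarrow> curve_current \<sigma> L f [p]"
proof -
  obtain A where A: "0 \<le> A" "A-lipschitz_on UNIV f" "\<And>x. \<bar>f x\<bar> \<le> A" using bounded_lipschitzE[OF f] by blast
  have "(\<lambda>n. A * Lip p * L\<^sup>2 * (1 / real (Suc n))) \<longlonglongrightarrow> 0"
    using tendsto_mult_right_zero[OF LIMSEQ_inverse_real_of_nat] by (simp add: inverse_eq_divide)
  then show ?thesis
    by (rule LIM_zero_cancel[OF Lim_null_comparison[rotated]])
      (use curve_current_riemann[OF \<sigma> A(2,3) lipschitz_on_Lip[OF p] L, of "Suc n" for n] in \<open>simp add: abs_minus_commute\<close>)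
qed

lemma curve_current_linear1:
  assumes f: "bounded_lipschitz f" and g: "bounded_lipschitz g" and p: "lipschitz p"
  shows "curve_current \<sigma> L (\<lambda>x. a * f x + b * g x) [p] = a * curve_current \<sigma> L f [p] + b * curve_current \<sigma> L g [p]"
proof (rule LIMSEQ_unique[OF curve_current_LIMSEQ[OF bounded_lipschitz_linear[OF f g] p]])
  show "(\<lambda>n. \<Sum>j<Suc n. (a * f (\<sigma> (real j * (L / Suc n))) + b * g (\<sigma> (real j * (L / Suc n)))) *
      (p (\<sigma> (real (Suc j) * (L / Suc n))) - p (\<sigma> (real j * (L / Suc n))))) \<longlonglongrightarrow> a * curve_current \<sigma> L f [p] + b * curve_current \<sigma> L g [p]"
    unfolding distrib_right sum.distrib mult.assoc sum_distrib_left[symmetric]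
    by (intro tendsto_intros curve_current_LIMSEQ f g p)
qed

lemma curve_current_linear2:
  assumes f: "bounded_lipschitz f" and p: "lipschitz p" and q: "lipschitz q"
  shows "curve_current \<sigma> L f [\<lambda>x. a * p x + b * q x] = a * curve_current \<sigma> L f [p] + b * curve_current \<sigma> L f [q]"
proof (rule LIMSEQ_unique[OF curve_current_LIMSEQ[OF f lipschitz_linear[OF p q]]])
  have *: "f x * ((a * p y + b * q y) - (a * p x + b * q x)) = a * (f x * (p y - p x)) + b * (f x * (q y - q x))" for x y
    by (simp add: algebra_simps)
  show "(\<lambda>n. \<Sum>j<Suc n. f (\<sigma> (real j * (L / Suc n))) * ((a * p (\<sigma> (real (Suc j) * (L / Suc n))) + b * q (\<sigma> (real (Suc j) * (L / Suc n)))) -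
      (a * p (\<sigma> (real j * (L / Suc n))) + b * q (\<sigma> (real j * (L / Suc n)))))) \<longlonglongrightarrow> a * curve_current \<sigma> L f [p] + b * curve_current \<sigma> L f [q]"
    unfolding * sum.distrib sum_distrib_left[symmetric]
    by (intro tendsto_intros curve_current_LIMSEQ f p q)
qed

text \<open>The Riemann error depends on the common Lipschitz constant only, so a partition can be
  fixed before \<open>n\<close>, and finite sums converge pointwise.\<close>

lemma curve_current_continuous:
  assumes f: "bounded_lipschitz f" and p: "\<And>n::nat. C-lipschitz_on UNIV (p n)" and lim: "\<And>x. (\<lambda>n. p n x) \<longlonglongrightarrow> q x"
  shows "(\<lambda>n. curve_current \<sigma> L f [p n]) \<longlonglongrightarrow> curve_current \<sigma> L f [q]"
proof (rule LIMSEQ_I)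
  fix e :: real assume e: "0 < e"
  obtain A where A: "0 \<le> A" "A-lipschitz_on UNIV f" "\<And>x. \<bar>f x\<bar> \<le> A" using bounded_lipschitzE[OF f] by blast
  have C0: "0 \<le> C" by (rule lipschitz_on_nonneg[OF p])
  have q: "C-lipschitz_on UNIV q"
  proof (rule lipschitz_realI[OF C0])
    show "q x - q y \<le> C * dist x y" for x y
      by (rule LIMSEQ_le_const2[OF tendsto_diff[OF lim lim]])
        (use lipschitz_realD[OF p, of x y] in \<open>auto simp: abs_le_iff\<close>)
  qed
  define K where "K = A * C * L\<^sup>2"
  have K: "0 \<le> K" using A(1) C0 by (simp add: K_def)
  \<comment> \<open>Each of the two Riemann errors falls below \<open>e / 4\<close>; the difference
    of the sums gets the other half of \<open>e\<close>.\<close>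
  obtain M :: nat where M: "4 * K / e < M" using reals_Archimedean2 by blast
  have M0: "0 < real M" using M e K by (intro le_less_trans[OF _ M]) simp
  have KM: "K / M < e / 4" using M e M0 by (simp add: field_simps)
  define R where "R p = (\<Sum>j<M. f (\<sigma> (real j * (L / M))) * (p (\<sigma> (real (Suc j) * (L / M))) - p (\<sigma> (real j * (L / M)))))"
    for p :: "'a \<Rightarrow> real"
  have R: "\<bar>curve_current \<sigma> L f [p] - R p\<bar> \<le> K / M" if "C-lipschitz_on UNIV p" for p
    unfolding R_def K_def using M0 by (intro curve_current_riemann[OF \<sigma> A(2,3) that L]) simp
  have "(\<lambda>n. R (p n)) \<longlonglongrightarrow> R q" unfolding R_def by (intro tendsto_intros lim)
  then obtain n0 where n0: "\<And>n. n0 \<le> n \<Longrightarrow> \<bar>R (p n) - R q\<bar> < e / 2"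
    using LIMSEQ_D[of _ "R q" "e / 2"] e by (metis half_gt_zero real_norm_def)
  show "\<exists>n0. \<forall>n\<ge>n0. norm (curve_current \<sigma> L f [p n] - curve_current \<sigma> L f [q]) < e"
  proof (intro exI[of _ n0] allI impI)
    fix n assume "n0 \<le> n"
    then show "norm (curve_current \<sigma> L f [p n] - curve_current \<sigma> L f [q]) < e"
      using n0[of n] R[OF p, of n] R[OF q] KM unfolding real_norm_def by linarith
  qed
qed

text \<open>On the open preimage of \<open>U\<close> the composition
  \<open>p \<circ> \<sigma>\<close> is constant, so its derivative vanishes wherever it exists and
  \<open>f\<close> is nonzero along the curve.\<close>

lemma curve_current_local:
  assumes f: "bounded_lipschitz f" and p: "lipschitz p" and U: "open U" "{x. f x \<noteq> 0} \<subseteq> U" "\<And>x. x \<in> U \<Longrightarrow> p x = c"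
  shows "curve_current \<sigma> L f [p] = 0"
proof -
  obtain q where q: "q \<in> borel_measurable borel" "\<And>x. \<bar>q x\<bar> \<le> Lip p"
    "\<And>a b. a \<le> b \<Longrightarrow> p (\<sigma> b) - p (\<sigma> a) = (LINT x:{a..b}|lborel. q x)"
    "AE x in lebesgue. (p \<circ> \<sigma> has_real_derivative q x) (at x)"
    "\<And>f L. f \<in> borel_measurable borel \<Longrightarrow> curve_current \<sigma> L f [p] = (LINT x:{0..L}|lborel. f (\<sigma> x) * q x)"
    by (rule curve_density[OF \<sigma> lipschitz_on_Lip[OF p]]) (rule that; assumption)
  have V: "open (\<sigma> -` U)"
    using U(1) lipschitz_continuous[OF lipschitzI[OF \<sigma>], of UNIV] by (simp add: open_vimage)
  have "AE x in lebesgue. indicator {0..L} x *\<^sub>R (f (\<sigma> x) * q x) = 0"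
    using q(4)
  proof eventually_elim
    fix x assume d: "(p \<circ> \<sigma> has_real_derivative q x) (at x)"
    show "indicator {0..L} x *\<^sub>R (f (\<sigma> x) * q x) = 0"
    proof (cases "f (\<sigma> x) = 0")
      case False
      then have "x \<in> \<sigma> -` U" using U(2) by auto
      then have "((\<lambda>_. c) has_real_derivative q x) (at x)"
        using has_field_derivative_transform_within_open[OF d V] U(3) by auto
      then have "q x = 0" using DERIV_const DERIV_unique by blast
      then show ?thesis by simp
    qed simp
  qed
  then have "(LINT x:{0..L}|lborel. f (\<sigma> x) * q x) = 0"
    unfolding set_lebesgue_integral_def AE_completion_iff by (rule integral_eq_zero_AE)
  then show ?thesis using q(5)[OF bounded_lipschitz_borel[OF f]] by simp
qed

lemma current_curve_current: "current 1 (curve_current \<sigma> L)"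
  unfolding current_def
proof (intro conjI)
  show "multilinear_functional 1 (curve_current \<sigma> L)"
    unfolding multilinear_functional_def
  proof (intro conjI allI impI)
    fix f g :: "'a \<Rightarrow> real" and \<pi> a b assume "(f, \<pi>) \<in> forms 1" "(g, \<pi>) \<in> forms 1"
    then show "curve_current \<sigma> L (\<lambda>x. a * f x + b * g x) \<pi> = a * curve_current \<sigma> L f \<pi> + b * curve_current \<sigma> L g \<pi>"
      using curve_current_linear1 by (auto simp: forms_iff length_1_iff)
  next
    fix f p q :: "'a \<Rightarrow> real" and \<pi> j a b assume "(f, \<pi>) \<in> forms 1" "j < (1::nat)" "lipschitz p" "lipschitz q"
    then show "curve_current \<sigma> L f (\<pi>[j := \<lambda>x. a * p x + b * q x]) = a * curve_current \<sigma> L f (\<pi>[j := p]) + b * curve_current \<sigma> L f (\<pi>[j := q])"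
      using curve_current_linear2 by (auto simp: forms_iff length_1_iff)
  qed
  show "continuous_functional 1 (curve_current \<sigma> L)"
    unfolding continuous_functional_def
  proof (intro allI impI)
    fix f \<pi> and \<rho> :: "nat \<Rightarrow> ('a \<Rightarrow> real) list" and C
    assume f: "(f, \<pi>) \<in> forms 1" and len: "\<forall>n. length (\<rho> n) = 1" and C: "\<forall>n. \<forall>j<1. C-lipschitz_on UNIV (\<rho> n ! j)"
      and lim: "\<forall>j<1. \<forall>x. (\<lambda>n. (\<rho> n ! j) x) \<longlonglongrightarrow> (\<pi> ! j) x"
    have "\<rho> n = [\<rho> n ! 0]" for n using len by (metis length_1_iff nth_Cons_0)
    moreover have "\<pi> = [\<pi> ! 0]" using f by (auto simp: forms_iff length_1_iff)
    moreover have "(\<lambda>n. curve_current \<sigma> L f [\<rho> n ! 0]) \<longlonglongrightarrow> curve_current \<sigma> L f [\<pi> ! 0]"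
      using f C lim by (intro curve_current_continuous) (auto simp: forms_iff)
    ultimately show "(\<lambda>n. curve_current \<sigma> L f (\<rho> n)) \<longlonglongrightarrow> curve_current \<sigma> L f \<pi>" by simp
  qed
  show "local_functional 1 (curve_current \<sigma> L)"
    unfolding local_functional_def using curve_current_local by (fastforce simp: forms_iff length_1_iff)
qed

lemma mass_bound_curve_current: "mass_bound 1 (curve_current \<sigma> L) (curve_measure \<sigma> L)"
proof -
  interpret M: finite_borel_measure "curve_measure \<sigma> L" by (rule finite_borel_curve_measure)
  have "\<bar>curve_current \<sigma> L f [p]\<bar> \<le> Lip p * (LINT x|curve_measure \<sigma> L. \<bar>f x\<bar>)"
    if f: "bounded_lipschitz f" and p: "lipschitz p" for f p
  proof -
    obtain q where q: "q \<in> borel_measurable borel" "\<And>x. \<bar>q x\<bar> \<le> Lip p"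
      "\<And>a b. a \<le> b \<Longrightarrow> p (\<sigma> b) - p (\<sigma> a) = (LINT x:{a..b}|lborel. q x)"
      "AE x in lebesgue. (p \<circ> \<sigma> has_real_derivative q x) (at x)"
      "\<And>f L. f \<in> borel_measurable borel \<Longrightarrow> curve_current \<sigma> L f [p] = (LINT x:{0..L}|lborel. f (\<sigma> x) * q x)"
      by (rule curve_density[OF \<sigma> lipschitz_on_Lip[OF p]]) (rule that; assumption)
    obtain A where A: "\<And>x. \<bar>f x\<bar> \<le> A" using bounded_lipschitzE[OF f] by blast
    have fm: "f \<in> borel_measurable borel" by (rule bounded_lipschitz_borel[OF f])
    show ?thesis unfolding q(5)[OF fm] by (rule curve_integral_bound(2)[OF q(1,2) fm A])
  qed
  moreover have "(\<Prod>j<1. Lip (\<pi> ! j)) = Lip (\<pi> ! 0)" for \<pi> :: "('a \<Rightarrow> real) list"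
    by (simp add: One_nat_def lessThan_Suc)
  ultimately show ?thesis
    unfolding mass_bound_def using M.sets_borel M.finite_measure_axioms
    by (auto simp: forms_iff length_1_iff)
qed

lemma metric_current1_curve_current: "metric_current1 (curve_current \<sigma> L)"
  using current_curve_current mass_bound_curve_current by unfold_locales (auto simp: finite_mass_def)

lemma boundary_curve_current: "lipschitz f \<Longrightarrow> boundary (curve_current \<sigma> L) f [] = f (\<sigma> L) - f (\<sigma> 0)"
proof -
  assume f: "lipschitz f"
  obtain q where q: "q \<in> borel_measurable borel" "\<And>x. \<bar>q x\<bar> \<le> Lip f"
    "\<And>a b. a \<le> b \<Longrightarrow> f (\<sigma> b) - f (\<sigma> a) = (LINT x:{a..b}|lborel. q x)"
    "AE x in lebesgue. (f \<circ> \<sigma> has_real_derivative q x) (at x)"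
    "\<And>h L. h \<in> borel_measurable borel \<Longrightarrow> curve_current \<sigma> L h [f] = (LINT x:{0..L}|lborel. h (\<sigma> x) * q x)"
    by (rule curve_density[OF \<sigma> lipschitz_on_Lip[OF f]]) (rule that; assumption)
  show ?thesis using q(3)[OF L] q(5)[of "\<lambda>_. 1" L] by (simp add: boundary_def)
qed

lemma mass_bound_boundary_curve_current:
  "mass_bound 0 (boundary (curve_current \<sigma> L)) (endpoint_measure \<sigma> L)"
proof -
  interpret M: finite_borel_measure "endpoint_measure \<sigma> L" by (rule finite_borel_endpoint_measure)
  have "\<bar>boundary (curve_current \<sigma> L) f []\<bar> \<le> (LINT x|endpoint_measure \<sigma> L. \<bar>f x\<bar>)" if f: "bounded_lipschitz f" for f
  proof -
    have "(\<lambda>x. \<bar>f x\<bar>) \<in> borel_measurable borel"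
      using bounded_lipschitz_borel[OF f] by measurable
    then show ?thesis
      using boundary_curve_current[OF bounded_lipschitz_lipschitz[OF f]] by (simp add: integral_endpoint_measure)
  qed
  then show ?thesis unfolding mass_bound_def using M.sets_borel M.finite_measure_axioms by (auto simp: forms_iff)
qed

lemma mass_boundary_curve_current: "mass 0 (boundary (curve_current \<sigma> L)) \<le> 2"
  using mass_le[OF metric_current1.multilinear_boundary[OF metric_current1_curve_current] mass_bound_boundary_curve_current]
  by (simp add: measure_endpoint_measure)

lemma mass_boundary_closed_curve:
  assumes "\<sigma> L = \<sigma> 0"
  shows "mass 0 (boundary (curve_current \<sigma> L)) = 0"
proof -
  have "mass_bound 0 (boundary (curve_current \<sigma> L)) (null_measure borel)"
    unfolding mass_bound_def using boundary_curve_current assms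
    by (auto simp: forms_iff bounded_lipschitz_lipschitz intro!: finite_measureI)
  from mass_le[OF metric_current1.multilinear_boundary[OF metric_current1_curve_current] this]
  show ?thesis using mass_nonneg[of 0 "boundary (curve_current \<sigma> L)"] by (simp add: measure_def)
qed

text \<open>The open set cuts the curve into countably many arcs. The arc over the parameters from
  \<open>a i\<close> to \<open>b i\<close> is pushed to the oriented interval from
  \<open>u (a i)\<close> to \<open>u (b i)\<close>, whatever it does in between, and these intervals
  have summable lengths because the parameter intervals do. The premise on the mass measure serves
  to evaluate the restriction, which is defined through L1 of that measure.\<close>

lemma curve_current_integer_pushforward:
  fixes \<phi> :: "'a \<Rightarrow> real"
  assumes mass: "mass_measure 1 (curve_current \<sigma> L) = curve_measure \<sigma> L" and \<phi>: "lipschitz \<phi>" and U: "open U"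
  obtains g :: "real \<Rightarrow> real" where "integrable lebesgue g" "range g \<subseteq> \<int>"
    "same_current 1 (pushforward \<phi> (restrict_current 1 (curve_current \<sigma> L) U)) (euclidean_current g)"
proof -
  interpret M: finite_borel_measure "curve_measure \<sigma> L" by (rule finite_borel_curve_measure)
  obtain K where K: "K-lipschitz_on UNIV \<phi>" using \<phi> by (auto simp: lipschitz_def)
  define u where "u = \<phi> \<circ> \<sigma>"
  have u: "K-lipschitz_on UNIV u" unfolding u_def using lipschitz_on_compose[OF \<sigma> lipschitz_on_subset[OF K]] by simp
  have [measurable]: "U \<in> sets borel" using U by simp
  note curve_borel [measurable]
  have [measurable]: "\<phi> \<in> borel_measurable borel" by (rule borel_measurable_lipschitz[OF \<phi>])
  have "open (\<sigma> -` U)"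
    using U lipschitz_continuous[OF lipschitzI[OF \<sigma>], of UNIV] by (simp add: open_vimage)
  \<comment> \<open>Leaving out the parameters 0 and \<open>L\<close> makes the set open on the line
    and changes it by a null set only.\<close>
  then have V: "open (\<sigma> -` U \<inter> {0<..<L})" by (intro open_Int) auto
  obtain a b :: "nat \<Rightarrow> real" where ab: "\<And>i. a i \<le> b i" "disjoint_family (\<lambda>i. {a i<..<b i})"
    "\<sigma> -` U \<inter> {0<..<L} = (\<Union>i. {a i<..<b i})"
    by (rule open_real_intervals[OF V bounded_subset[of "{0..L}"]]) (auto intro: that)
  have "(\<Sum>i. ennreal (b i - a i)) = (\<Sum>i. emeasure lborel {a i<..<b i})" using ab(1) by simp
  also have "\<dots> = emeasure lborel (\<sigma> -` U \<inter> {0<..<L})" unfolding ab(3) using ab(2) by (intro suminf_emeasure) auto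
  also have "\<dots> \<le> emeasure lborel {0<..<L}" by (intro emeasure_mono) auto
  also have "\<dots> < top" using L by simp
  finally have ab_sum: "summable (\<lambda>i. b i - a i)" using ab(1) by (intro summable_suminf_not_top) auto
  have sum_u: "summable (\<lambda>i. \<bar>u (b i) - u (a i)\<bar>)"
  proof (rule summable_comparison_test'[OF summable_mult[OF ab_sum, of K], of 0])
    show "norm \<bar>u (b i) - u (a i)\<bar> \<le> K * (b i - a i)" for i
      using lipschitz_realD[OF u, of "b i" "a i"] ab(1)[of i] by (simp add: dist_real_def)
  qed
  obtain g where g: "integrable lborel g" "g \<in> borel_measurable borel" "range g \<subseteq> \<int>"
    "\<And>(m :: real \<Rightarrow> real) B. m \<in> borel_measurable borel \<Longrightarrow> (\<And>x. \<bar>m x\<bar> \<le> B) \<Longrightarrow>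
      (LINT x|lborel. g x * m x) = (\<Sum>i. (LINT x:{u (a i)..u (b i)}|lborel. m x) - (LINT x:{u (b i)..u (a i)}|lborel. m x))"
    by (rule signed_intervals[OF sum_u]) (blast intro: that)
  show thesis
  proof (rule that[of g])
    show "integrable lebesgue g" using g(1,2) by (simp add: integrable_completion)
    have "pushforward \<phi> (restrict_current 1 (curve_current \<sigma> L) U) f [p] = euclidean_current g f [p]"
      if f: "bounded_lipschitz f" and p: "lipschitz p" for f p :: "real \<Rightarrow> real"
    proof -
      obtain A where A: "0 \<le> A" "A-lipschitz_on UNIV f" "\<And>x. \<bar>f x\<bar> \<le> A" using bounded_lipschitzE[OF f] by blast
      have fm [measurable]: "f \<in> borel_measurable borel" by (rule bounded_lipschitz_borel[OF f])
      obtain C where C: "C-lipschitz_on UNIV p" using p by (auto simp: lipschitz_def)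
      obtain r where r: "r \<in> borel_measurable borel" "\<And>x. \<bar>r x\<bar> \<le> C"
        "\<And>a b. a \<le> b \<Longrightarrow> p b - p a = (LINT x:{a..b}|lborel. r x)"
        "AE x in lebesgue. (p has_real_derivative r x) (at x)"
        using lipschitz_real_AE_derivative[OF C] by blast
      note r(1) [measurable]
      have p\<phi>: "(C * K)-lipschitz_on UNIV (p \<circ> \<phi>)" using lipschitz_on_compose[OF K lipschitz_on_subset[OF C]] by simp
      obtain q where q: "q \<in> borel_measurable borel" "\<And>x. \<bar>q x\<bar> \<le> C * K"
        "\<And>a b. a \<le> b \<Longrightarrow> (p \<circ> \<phi>) (\<sigma> b) - (p \<circ> \<phi>) (\<sigma> a) = (LINT x:{a..b}|lborel. q x)"
        "AE x in lebesgue. (p \<circ> \<phi> \<circ> \<sigma> has_real_derivative q x) (at x)"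
        "\<And>f L. f \<in> borel_measurable borel \<Longrightarrow> curve_current \<sigma> L f [p \<circ> \<phi>] = (LINT x:{0..L}|lborel. f (\<sigma> x) * q x)"
        by (rule curve_density[OF \<sigma> p\<phi>]) (rule that; assumption)
      note q(1) [measurable]
      let ?h = "\<lambda>x. (f \<circ> \<phi>) x * indicator U x"
      have hm: "?h \<in> borel_measurable borel" by measurable
      have hb: "\<bar>?h x\<bar> \<le> A" for x using A(1,3) by (simp add: indicator_def)
      have "restrict_current 1 (curve_current \<sigma> L) U (f \<circ> \<phi>) [p \<circ> \<phi>] = (LINT x:{0..L}|lborel. ?h (\<sigma> x) * q x)"
        unfolding restrict_current_def
      proof (rule extend_eqI[where C="C * K"], unfold mass)
        show "finite_borel_measure (curve_measure \<sigma> L)" by (rule finite_borel_curve_measure)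
        show "integrable (curve_measure \<sigma> L) ?h" by (rule M.integrable_bounded[OF hm hb])
        fix k :: "'a \<Rightarrow> real" assume k: "bounded_lipschitz k"
        obtain B where B: "\<And>x. \<bar>k x\<bar> \<le> B" using bounded_lipschitzE[OF k] by blast
        have km [measurable]: "k \<in> borel_measurable borel" by (rule bounded_lipschitz_borel[OF k])
        have "curve_current \<sigma> L k [p \<circ> \<phi>] - (LINT x:{0..L}|lborel. ?h (\<sigma> x) * q x) = (LINT x:{0..L}|lborel. (k (\<sigma> x) - ?h (\<sigma> x)) * q x)"
          unfolding q(5)[OF km] left_diff_distrib
          by (intro set_integral_diff(2)[symmetric] curve_integral_bound(1)[OF q(1,2) km B] curve_integral_bound(1)[OF q(1,2) hm hb])
        also have "\<bar>\<dots>\<bar> \<le> C * K * (LINT x|curve_measure \<sigma> L. \<bar>k x - ?h x\<bar>)"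
        proof (rule curve_integral_bound(2)[OF q(1,2), of "\<lambda>x. k x - ?h x" "B + A"])
          show "\<bar>k x - ?h x\<bar> \<le> B + A" for x using B[of x] hb[of x] by linarith
        qed measurable
        finally show "\<bar>curve_current \<sigma> L k [p \<circ> \<phi>] - (LINT x:{0..L}|lborel. ?h (\<sigma> x) * q x)\<bar> \<le> C * K * (LINT x|curve_measure \<sigma> L. \<bar>k x - ?h x\<bar>)" .
      qed
      also have "\<dots> = (LINT x:(\<Union>i. {a i<..<b i})|lborel. f (u x) * q x)"
        unfolding set_lebesgue_integral_def ab(3)[symmetric]
      proof (rule integral_cong_AE)
        show "AE x in lborel. indicator {0..L} x *\<^sub>R (?h (\<sigma> x) * q x) = indicator (\<sigma> -` U \<inter> {0<..<L}) x *\<^sub>R (f (u x) * q x)"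
          using AE_lborel_singleton[of 0] AE_lborel_singleton[of L]
          by eventually_elim (auto simp: indicator_def u_def)
        have "\<sigma> -` U \<inter> {0<..<L} \<in> sets borel" using V by simp
        then show "(\<lambda>x. indicator (\<sigma> -` U \<inter> {0<..<L}) x *\<^sub>R (f (u x) * q x)) \<in> borel_measurable lborel"
          unfolding u_def comp_def by measurable
      qed (unfold comp_def, measurable)
      also have "\<dots> = (\<Sum>i. LINT x:{a i<..<b i}|lborel. f (u x) * q x)"
      proof (rule lebesgue_integral_countable_add)
        show "{a i<..<b i} \<inter> {a j<..<b j} = {}" if "i \<noteq> j" for i j
          using ab(2) that by (auto simp: disjoint_family_on_def)
        have "set_integrable lborel {0..L} (\<lambda>x. (f \<circ> \<phi>) (\<sigma> x) * q x)"
          using A(3) by (intro curve_integral_bound(1)[OF q(1,2), of _ A]) (auto simp: comp_def)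
        then show "set_integrable lborel (\<Union>i. {a i<..<b i}) (\<lambda>x. f (u x) * q x)"
          unfolding ab(3)[symmetric] u_def comp_def by (rule set_integrable_subset) (use V in auto)
      qed simp
      also have "(\<lambda>i. LINT x:{a i<..<b i}|lborel. f (u x) * q x) =
          (\<lambda>i. (LINT x:{u (a i)..u (b i)}|lborel. f x * r x) - (LINT x:{u (b i)..u (a i)}|lborel. f x * r x))"
      proof
        fix i
        have "(LINT x:{a i<..<b i}|lborel. f (u x) * q x) = (LINT x:{a i..b i}|lborel. f (u x) * q x)"
          unfolding set_lebesgue_integral_def
        proof (rule integral_cong_AE)
          show "AE x in lborel. indicator {a i<..<b i} x *\<^sub>R (f (u x) * q x) = indicator {a i..b i} x *\<^sub>R (f (u x) * q x)"
            using AE_lborel_singleton[of "a i"] AE_lborel_singleton[of "b i"]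
            by eventually_elim (auto simp: indicator_def)
        qed (unfold u_def comp_def, measurable)
        also have "\<dots> = (LINT x:{u (a i)..u (b i)}|lborel. f x * r x) - (LINT x:{u (b i)..u (a i)}|lborel. f x * r x)"
          by (rule lipschitz_primitive_compose[OF u A(2,3) C r(1-3) q(1) q(4)[unfolded comp_assoc, folded u_def] ab(1)])
        finally show "(LINT x:{a i<..<b i}|lborel. f (u x) * q x) =
          (LINT x:{u (a i)..u (b i)}|lborel. f x * r x) - (LINT x:{u (b i)..u (a i)}|lborel. f x * r x)" .
      qed
      also have "suminf \<dots> = (LINT x|lborel. g x * (f x * r x))"
      proof (rule g(4)[symmetric, of _ "A * C"])
        show "\<bar>f x * r x\<bar> \<le> A * C" for x unfolding abs_mult using A r(2) by (intro mult_mono) auto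
      qed measurable
      also have "\<dots> = (LINT x|lebesgue. g x * f x * r x)"
        using g(2) by (subst integral_completion) (auto simp: mult.assoc)
      also have "\<dots> = euclidean_current g f [p]"
        using g(2) fm r(1) by (intro euclidean_current_real[symmetric] r(4)) (auto intro!: measurable_completion)
      finally show ?thesis by (simp only: pushforward_def list.map)
    qed
    then show "same_current 1 (pushforward \<phi> (restrict_current 1 (curve_current \<sigma> L) U)) (euclidean_current g)"
      by (auto simp: same_current_def forms_iff length_1_iff)
  qed (rule g(3))
qed

text \<open>Both premises will come from the additivity of mass: the second holds because the curve
  measure is then dominated by the mass measure of the given integral current.\<close>

lemma integral_current_curve_current:
  assumes mass: "mass_measure 1 (curve_current \<sigma> L) = curve_measure \<sigma> L"
    and null: "\<And>B. B \<in> sets borel \<Longrightarrow> hausdorff_measure 1 B = 0 \<Longrightarrow> emeasure (curve_measure \<sigma> L) B = 0"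
  shows "curve_current \<sigma> L \<in> integral_currents TYPE(real)"
proof -
  have "compact (\<sigma> ` {0..L})"
    by (intro compact_continuous_image lipschitz_continuous[OF lipschitzI[OF \<sigma>]]) simp
  then have "\<sigma> ` {0..L} \<in> sets borel" by (intro borel_closed compact_imp_closed)
  then have "AE x in curve_measure \<sigma> L. x \<in> \<sigma> ` {0..L}"
    unfolding curve_measure_def by (subst AE_distr_iff[OF curve_restrict]) (auto simp: space_restrict_space intro!: AE_I2)
  then have "integer_rectifiable TYPE(real) (curve_current \<sigma> L)"
    unfolding integer_rectifiable_def DIM_real mass
    using current_curve_current mass_bound_curve_current countably_rectifiable_curve[OF \<sigma>] null curve_current_integer_pushforward[OF mass]
    by (auto simp: finite_mass_def) metis+
  then show ?thesis
    using mass_bound_boundary_curve_current by (auto simp: integral_currents_def finite_mass_def)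
qed

end

section \<open>Additivity of mass\<close>

text \<open>Countable subadditivity of mass at the level of measures, for dimension 1 and, applied
  to boundaries, for dimension 0.\<close>

lemma mass_bound_sums:
  fixes S :: "nat \<Rightarrow> 'a::metric_space functional"
  assumes \<nu>: "\<And>i. mass_bound k (S i) (\<nu> i)" and sum: "summable (\<lambda>i. measure (\<nu> i) UNIV)"
    and T: "\<And>f \<pi>. (f, \<pi>) \<in> forms k \<Longrightarrow> (\<lambda>i. S i f \<pi>) sums T f \<pi>"
  shows "mass_bound k T (sum_measure \<nu>)" and "measure (sum_measure \<nu>) UNIV = (\<Sum>i. measure (\<nu> i) UNIV)"
proof -
  have M: "finite_borel_measure (\<nu> i)" for i by (rule mass_bound_finite_borel[OF \<nu>])
  have sets: "sets (\<nu> i) = sets borel" for i using \<nu> by (simp add: mass_bound_def)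
  have em: "emeasure (\<nu> i) UNIV = ennreal (measure (\<nu> i) UNIV)" for i
  proof -
    interpret finite_borel_measure "\<nu> i" by (rule M)
    show ?thesis by (rule emeasure_eq_measure)
  qed
  have e: "emeasure (sum_measure \<nu>) UNIV = ennreal (\<Sum>i. measure (\<nu> i) UNIV)"
    using sum by (simp add: emeasure_sum_measure[OF sets] em suminf_ennreal2)
  then show "measure (sum_measure \<nu>) UNIV = (\<Sum>i. measure (\<nu> i) UNIV)"
    by (simp only: measure_def[of "sum_measure \<nu>"] enn2real_ennreal suminf_nonneg[OF sum measure_nonneg])
  have fin: "finite_borel_measure (sum_measure \<nu>)" by (rule finite_borel_measureI) (simp_all add: e)
  have "\<bar>T f \<pi>\<bar> \<le> (\<Prod>j<k. Lip (\<pi> ! j)) * (LINT x|sum_measure \<nu>. \<bar>f x\<bar>)" if f: "(f, \<pi>) \<in> forms k" for f \<pi>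
  proof -
    have bl: "bounded_lipschitz f" using f by (simp add: forms_iff)
    obtain B where B: "\<And>x. \<bar>f x\<bar> \<le> B" using bounded_lipschitzE[OF bl] by blast
    have fm [measurable]: "f \<in> borel_measurable borel"
      by (rule bounded_lipschitz_borel[OF bl])
    have int: "ennreal (LINT x|N. \<bar>f x\<bar>) = (\<integral>\<^sup>+x. \<bar>f x\<bar> \<partial>N)" if "finite_borel_measure N" for N
      using B by (intro integral_ennreal[OF that]) auto
    have "(\<Sum>i. ennreal (LINT x|\<nu> i. \<bar>f x\<bar>)) = ennreal (LINT x|sum_measure \<nu>. \<bar>f x\<bar>)"
      unfolding int[OF fin] int[OF M] by (rule nn_integral_sum_measure[OF sets, symmetric]) measurable
    then have sums: "(\<lambda>i. LINT x|\<nu> i. \<bar>f x\<bar>) sums (LINT x|sum_measure \<nu>. \<bar>f x\<bar>)"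
      using summable_suminf_not_top[of "\<lambda>i. LINT x|\<nu> i. \<bar>f x\<bar>"] suminf_ennreal2[of "\<lambda>i. LINT x|\<nu> i. \<bar>f x\<bar>"]
      by (simp add: summable_sums_iff suminf_nonneg ennreal_inj)
    let ?P = "\<Prod>j<k. Lip (\<pi> ! j)"
    have le: "\<bar>S i f \<pi>\<bar> \<le> ?P * (LINT x|\<nu> i. \<bar>f x\<bar>)" for i using \<nu>[of i] f by (auto simp: mass_bound_def)
    have sums': "(\<lambda>i. ?P * (LINT x|\<nu> i. \<bar>f x\<bar>)) sums (?P * (LINT x|sum_measure \<nu>. \<bar>f x\<bar>))"
      by (rule sums_mult[OF sums])
    have "summable (\<lambda>i. \<bar>S i f \<pi>\<bar>)" by (rule summable_comparison_test'[OF sums_summable[OF sums'], of 0]) (simp add: le)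
    then have "\<bar>\<Sum>i. S i f \<pi>\<bar> \<le> (\<Sum>i. ?P * (LINT x|\<nu> i. \<bar>f x\<bar>))"
      by (intro order_trans[OF summable_rabs suminf_le] le sums_summable[OF sums'])
    then show ?thesis using sums_unique[OF T[OF f]] sums_unique[OF sums'] by simp
  qed
  then show "mass_bound k T (sum_measure \<nu>)"
    using fin by (auto simp: mass_bound_def finite_borel_measure_def)
qed

theorem theoremA2:
  fixes T :: "'a::complete_space functional"
  assumes "T \<in> integral_currents TYPE(real)"
  shows "\<exists>Ts :: nat \<Rightarrow> 'a functional.
    (\<forall>i. Ts i \<in> integral_currents TYPE(real)) \<and>
    (\<forall>(f, \<pi>)\<in>forms 1. (\<lambda>i. Ts i f \<pi>) sums T f \<pi>) \<and>
    (\<lambda>i. mass 1 (Ts i)) sums mass 1 T \<and>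
    (\<lambda>i. mass 0 (boundary (Ts i))) sums mass 0 (boundary T) \<and>
    (\<forall>i. \<exists>(L::real) (\<sigma> :: real \<Rightarrow> 'a). 0 \<le> L \<and> 1-lipschitz_on {0..L} \<sigma> \<and>
       same_current 1 (pushforward \<sigma> (euclidean_current (indicator {0..L}))) (Ts i))"
proof -
  have rect: "integer_rectifiable TYPE(real) T" and fin: "finite_mass 0 (boundary T)"
    using assms by (auto simp: integral_currents_def)
  interpret T: metric_current1 T by (rule integer_rectifiableD(1)[OF rect])
  define m where "m = mass 0 (boundary T)"
  \<comment> \<open>The largest integer with \<open>2 * k \<le> m\<close>. As
    \<open>m / 2 < k + 1\<close>, the decomposition has at most \<open>k\<close> curves that are not
    closed, and \<open>k\<close> boundaries of mass 2 do not exceed \<open>m\<close>.\<close>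
  define k where "k = nat \<lfloor>m / 2\<rfloor>"
  have "0 \<le> m / 2" by (simp add: m_def mass_nonneg)
  then have k: "real k \<le> m / 2" "m / 2 < real k + 1" unfolding k_def by linarith+
  obtain L and \<sigma> :: "nat \<Rightarrow> real \<Rightarrow> 'a" where L0: "\<And>i. 0 \<le> L i" and \<sigma>: "\<And>i. 1-lipschitz_on UNIV (\<sigma> i)"
    and closed: "\<And>i. k \<le> i \<Longrightarrow> \<sigma> i (L i) = \<sigma> i 0" and L_sum: "\<And>M. (\<Sum>i<M. L i) \<le> mass 1 T"
    and sums: "\<And>f p. bounded_lipschitz f \<Longrightarrow> lipschitz p \<Longrightarrow> (\<lambda>i. curve_current (\<sigma> i) (L i) f [p]) sums T f [p]"
    by (rule curve_decomposition[OF rect fin k(2)[unfolded m_def]]) (blast intro: that)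
  define S where "S i = curve_current (\<sigma> i) (L i)" for i
  have S1: "metric_current1 (S i)" for i unfolding S_def by (rule metric_current1_curve_current[OF \<sigma> L0])
  have S_sums: "(\<lambda>i. S i f \<pi>) sums T f \<pi>" if "(f, \<pi>) \<in> forms 1" for f \<pi>
    using that sums by (auto simp: S_def forms_iff length_1_iff)
  have S_bound: "mass_bound 1 (S i) (curve_measure (\<sigma> i) (L i))" for i
    unfolding S_def by (rule mass_bound_curve_current[OF \<sigma> L0])
  have S_meas: "measure (curve_measure (\<sigma> i) (L i)) UNIV = L i" for i by (rule measure_curve_measure[OF \<sigma> L0])
  have S_mass: "mass 1 (S i) \<le> L i" for i
    using mass_le[OF metric_current1.multilinear[OF S1] S_bound, of i] by (simp add: S_meas)
  have L_summable: "summable L" by (rule summableI_nonneg_bounded[OF L0 L_sum])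
  then have L_le: "suminf L \<le> mass 1 T" using L_sum by (rule suminf_le_const)
  have mass_summable: "summable (\<lambda>i. mass 1 (S i))"
    by (rule summable_comparison_test'[OF L_summable, of 0]) (simp add: S_mass mass_nonneg)
  have "mass_bound 1 T (sum_measure (\<lambda>i. mass_measure 1 (S i)))"
    and "measure (sum_measure (\<lambda>i. mass_measure 1 (S i))) UNIV = (\<Sum>i. mass 1 (S i))"
    using mass_bound_sums[OF metric_current1.mass_bound[OF S1], where T=T] mass_summable S_sums by (auto simp: mass_def)
  then have T_le: "mass 1 T \<le> (\<Sum>i. mass 1 (S i))" using mass_le[OF T.multilinear] by metis
  \<comment> \<open>The differences \<open>L i - mass 1 (S i)\<close> are nonnegative and have a sum
    of at most 0, so each of them vanishes.\<close>
  have mass_eq: "mass 1 (S i) = L i" for i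
  proof -
    have d: "summable (\<lambda>i. L i - mass 1 (S i))" by (rule summable_diff[OF L_summable mass_summable])
    have "(\<Sum>i. L i - mass 1 (S i)) \<le> 0"
      using suminf_diff[OF L_summable mass_summable] L_le T_le by simp
    moreover have "0 \<le> (\<Sum>i. L i - mass 1 (S i))" using S_mass by (intro suminf_nonneg[OF d]) simp
    ultimately have "\<forall>i. L i - mass 1 (S i) = 0" using suminf_eq_zero_iff[OF d] S_mass by simp
    then show ?thesis by simp
  qed
  have mm_S: "mass_measure 1 (S i) = curve_measure (\<sigma> i) (L i)" for i
    using mass_measure_eqI[OF metric_current1.multilinear[OF S1] S_bound] by (simp add: S_meas mass_eq)
  have T_bound: "mass_bound 1 T (sum_measure (\<lambda>i. curve_measure (\<sigma> i) (L i)))"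
    and T_meas: "measure (sum_measure (\<lambda>i. curve_measure (\<sigma> i) (L i))) UNIV = suminf L"
    using mass_bound_sums[OF S_bound, where T=T] L_summable S_sums by (auto simp: S_meas)
  \<comment> \<open>The sum of the curve measures bounds \<open>T\<close> and has total mass
    \<open>suminf L \<le> mass 1 T\<close>, so it is the least bound.\<close>
  have mm_T: "mass_measure 1 T = sum_measure (\<lambda>i. curve_measure (\<sigma> i) (L i))"
    using L_le by (intro mass_measure_eqI[OF T.multilinear T_bound]) (simp add: T_meas)
  have S_int: "S i \<in> integral_currents TYPE(real)" for i
    unfolding S_def
  proof (rule integral_current_curve_current[OF \<sigma> L0 mm_S[unfolded S_def]])
    fix B :: "'a set" assume B: "B \<in> sets borel" "hausdorff_measure 1 B = 0"
    then have "emeasure (mass_measure 1 T) B = 0" using rect unfolding integer_rectifiable_def DIM_real by blast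
    moreover have "emeasure (curve_measure (\<sigma> i) (L i)) B \<le> emeasure (mass_measure 1 T) B"
      unfolding mm_T by (rule emeasure_le_sum_measure[OF sets_curve_measure[OF \<sigma> L0] B(1)])
    ultimately show "emeasure (curve_measure (\<sigma> i) (L i)) B = 0" by simp
  qed
  have mass_sums: "(\<lambda>i. mass 1 (S i)) sums mass 1 T"
    using summable_sums[OF mass_summable] L_le T_le by (simp add: mass_eq)
  have boundary_sums: "(\<lambda>i. mass 0 (boundary (S i))) sums mass 0 (boundary T)"
  proof -
    have b2: "mass 0 (boundary (S i)) \<le> 2" for i unfolding S_def by (rule mass_boundary_curve_current[OF \<sigma> L0])
    have b0: "mass 0 (boundary (S i)) = 0" if "k \<le> i" for i
      unfolding S_def using closed[OF that] by (rule mass_boundary_closed_curve[OF \<sigma> L0])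
    have b_sums: "(\<lambda>i. mass 0 (boundary (S i))) sums (\<Sum>i<k. mass 0 (boundary (S i)))"
      by (rule sums_finite) (auto simp: b0)
    have b_fin: "finite_mass 0 (boundary (S i))" for i using S_int[of i] by (simp add: integral_currents_def)
    have "(\<lambda>i. boundary (S i) f \<pi>) sums boundary T f \<pi>" if "(f, \<pi>) \<in> forms 0" for f \<pi>
      using that by (auto simp: boundary_def forms_iff bounded_lipschitz_lipschitz intro!: S_sums)
    then have "mass_bound 0 (boundary T) (sum_measure (\<lambda>i. mass_measure 0 (boundary (S i))))"
      and "measure (sum_measure (\<lambda>i. mass_measure 0 (boundary (S i)))) UNIV = (\<Sum>i. mass 0 (boundary (S i)))"
      using mass_bound_sums[OF mass_bound_mass_measure[OF metric_current1.multilinear_boundary[OF S1] b_fin], where T="boundary T"]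
        sums_summable[OF b_sums] by (auto simp: mass_def)
    then have "m \<le> (\<Sum>i. mass 0 (boundary (S i)))" unfolding m_def using mass_le[OF T.multilinear_boundary] by metis
    moreover have "(\<Sum>i<k. mass 0 (boundary (S i))) \<le> (\<Sum>i<k. 2)" by (intro sum_mono b2)
    \<comment> \<open>The sum of the boundary masses is at least \<open>m\<close> by subadditivity
      and at most \<open>2 * k \<le> m\<close>.\<close>
    ultimately have "(\<Sum>i<k. mass 0 (boundary (S i))) = m" using k(1) sums_unique[OF b_sums] by simp
    then show ?thesis using b_sums by (simp add: m_def)
  qed
  show ?thesis
  proof (intro exI[of _ S] conjI allI)
    show "\<forall>(f, \<pi>)\<in>forms 1. (\<lambda>i. S i f \<pi>) sums T f \<pi>" using S_sums by blast
    fix i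
    have "1-lipschitz_on {0..L i} (\<sigma> i)" using \<sigma> by (rule lipschitz_on_subset) simp
    then show "\<exists>(L::real) (\<sigma> :: real \<Rightarrow> 'a). 0 \<le> L \<and> 1-lipschitz_on {0..L} \<sigma> \<and>
       same_current 1 (pushforward \<sigma> (euclidean_current (indicator {0..L}))) (S i)"
      using L0 by (intro exI[of _ "L i"] exI[of _ "\<sigma> i"]) (auto simp: same_current_def S_def curve_current_def)
  qed (rule S_int mass_sums boundary_sums)+
qed

end
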